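(* Let $A=A(\vec m,\simeq)$ be an arbitrary skew-gentle algebra, $H$ its normalization, and $Z$ a representation generator of $H\text{-mod}$ (i.e. $H\text{-mod}=\mathrm{add}(Z)$), viewed as an $A$-module. Then $D^b(A\text{-mod})=\langle Z\rangle_2$; that is, for any object $X^\bullet$ of $D^b(A\text{-mod})$ there exists an exact triangle $$X_1^\bullet\to X^\bullet\to X_2^\bullet\to X_1^\bullet[1]$$ in which $X_1^\bullet$ and $X_2^\bullet$ are direct sums of shifts of direct summands of the $A$-module $Z$. In particular, $\mathrm{der.dim}(A)\le 1$.
   Context: $k$ is an algebraically closed field; algebras are finite-dimensional associative $k$-algebras; modules are finite-dimensional left modules. Skew-gentle algebras. For $m\ge 2$ and $\Sigma\subseteq\{1,\dots,m\}$ put $d_i=2$ if $i\in\Sigma$ and $d_i=1$ otherwise; $T_{m,\Sigma}\subset \mathrm{Mat}_{m+|\Sigma|}(k)$ is the algebra of block lower triangular matrices $(X_{ij})_{1\le i,j\le m}$ with blocks $X_{ij}$ of size $d_i\times d_j$, arbitrary for $i\ge j$ and zero for $i<j$. A datum $(\vec m,\simeq)$ consists of $\vec m=(m_1,\dots,m_t)$ with all $m_i\ge2$, and a symmetric, not necessarily reflexive relation $\simeq$ on $\Omega=\{(i,j)\mid 1\le i\le t,\ 1\le j\le m_i\}$ such that for every $\gamma\in\Omega$ there is at most one $\delta\in\Omega$ with $\gamma\simeq\delta$. Put $\Sigma_i=\{1\le j\le m_i\mid (i,j)\simeq(i,j)\}$, $H_i=T_{m_i,\Sigma_i}$ and $H=H_1\times\dots\times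 H_t$ (the normalization). The skew-gentle algebra $A=A(\vec m,\simeq)\subseteq H$ consists of all $(X(1),\dots,X(t))\in H$ with $X(i)_{jj}=X(k)_{ll}$ whenever $(i,j)\simeq(k,l)$ and $(i,j)\neq(k,l)$, and with the $2\times2$ diagonal block $X(i)_{jj}$ diagonal whenever $(i,j)\simeq(i,j)$. Rouquier's notation: for an object $Y$ of a triangulated category, $\langle Y\rangle_1$ is the full subcategory of direct summands of finite direct sums of shifts of $Y$; $\langle Y\rangle_{n+1}$ consists of direct summands of objects $X$ for which there is a distinguished triangle $X_1\to X\to X_2\to X_1[1]$ with $X_1\in\langle Y\rangle_1$, $X_2\in\langle Y\rangle_n$. The Rouquier dimension of the category is the smallest $d$ such that it equals $\langle Y\rangle_{d+1}$ for some $Y$; $\mathrm{der.dim}(A)$ is that of $D^b(A\text{-mod})$. *)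

theory Defs
  imports
    "HOL-Computational_Algebra.Polynomial"
    "Jordan_Normal_Form.Matrix"
    "HOL-Library.Extended_Nat"
begin

section \<open>Categories with finite sums, and Rouquier's generation by layers\<close>

text \<open>Only the data needed to speak about summands and layers are recorded. The two instances
  below are the category of finite-dimensional modules and its bounded derived category.\<close>

record ('o, 'm) add_cat =
  Ob :: "'o set"
  Hom :: "'o \<Rightarrow> 'o \<Rightarrow> 'm set"
  Idn :: "'o \<Rightarrow> 'm"
  Cmp :: "'m \<Rightarrow> 'm \<Rightarrow> 'm"
  Zero :: "'o"
  DSum :: "'o \<Rightarrow> 'o \<Rightarrow> 'o"

record ('o, 'm) tri_cat = "('o, 'm) add_cat" +
  Shift :: "int \<Rightarrow> 'o \<Rightarrow> 'o"
  Tri :: "'o \<Rightarrow> 'o \<Rightarrow> 'o \<Rightarrow> 'm \<Rightarrow> 'm \<Rightarrow> 'm \<Rightarrow> bool"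

definition is_iso :: "('o, 'm, 'z) add_cat_scheme \<Rightarrow> 'o \<Rightarrow> 'o \<Rightarrow> 'm \<Rightarrow> bool" where
  "is_iso C X Y f \<longleftrightarrow>
     f \<in> Hom C X Y \<and> (\<exists>g \<in> Hom C Y X. Cmp C g f = Idn C X \<and> Cmp C f g = Idn C Y)"

definition isomorphic :: "('o, 'm, 'z) add_cat_scheme \<Rightarrow> 'o \<Rightarrow> 'o \<Rightarrow> bool" where
  "isomorphic C X Y \<longleftrightarrow> (\<exists>f. is_iso C X Y f)"

definition finsum_of :: "('o, 'm, 'z) add_cat_scheme \<Rightarrow> 'o list \<Rightarrow> 'o" where
  "finsum_of C Xs = foldr (DSum C) Xs (Zero C)"

definition summand_of :: "('o, 'm, 'z) add_cat_scheme \<Rightarrow> 'o \<Rightarrow> 'o \<Rightarrow> bool" where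
  "summand_of C X Y \<longleftrightarrow>
     X \<in> Ob C \<and> Y \<in> Ob C \<and> (\<exists>X' \<in> Ob C. isomorphic C (DSum C X X') Y)"

definition add_closure :: "('o, 'm, 'z) add_cat_scheme \<Rightarrow> 'o \<Rightarrow> 'o set" where
  "add_closure C Z = {X. \<exists>r. summand_of C X (finsum_of C (replicate r Z))}"

text \<open>\<open>layer T Y n\<close> is the object class of the full subcategory \<open>\<langle>Y\<rangle>\<close> with index \<open>n\<close>; as in
  Rouquier's paper, index 0 gives the zero objects.\<close>

fun layer :: "('o, 'm, 'z) tri_cat_scheme \<Rightarrow> 'o \<Rightarrow> nat \<Rightarrow> 'o set" where
  "layer T Y 0 = {X \<in> Ob T. isomorphic T X (Zero T)}"
| "layer T Y (Suc 0) =
     {X. \<exists>ns. summand_of T X (finsum_of T (map (\<lambda>n. Shift T n Y) ns))}"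
| "layer T Y (Suc (Suc n)) =
     {X. \<exists>W. summand_of T X W \<and>
        (\<exists>X1 \<in> layer T Y (Suc 0). \<exists>X2 \<in> layer T Y (Suc n). \<exists>u v w. Tri T X1 W X2 u v w)}"

text \<open>The infimum of the empty set of extended naturals is \<open>\<infinity>\<close>.\<close>

definition rouquier_dim :: "('o, 'm, 'z) tri_cat_scheme \<Rightarrow> enat" where
  "rouquier_dim T = Inf {enat d | d. \<exists>Y \<in> Ob T. Ob T = layer T Y (d + 1)}"


section \<open>Finite-dimensional modules\<close>

text \<open>A \<open>k\<close>-algebra is given by a HOL-Algebra record (carrier, ring operations, scalar
  multiplication). A finite-dimensional left module is a vector space \<open>k\<^sup>n\<close> of column vectors
  on which the algebra acts through a unital homomorphism into the \<open>n \<times> n\<close> matrices; up to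
  isomorphism this gives all finite-dimensional left modules. The action is only constrained on
  the carrier of the algebra, so that a module over an algebra is literally also a module over
  each of its unital subalgebras (restriction of scalars).\<close>

record ('a, 'k) fdmod =
  vdim :: nat
  act :: "'a \<Rightarrow> 'k mat"

definition is_module :: "('k :: field, 'a) module \<Rightarrow> ('a, 'k) fdmod \<Rightarrow> bool" where
  "is_module A M \<longleftrightarrow>
     (\<forall>x \<in> carrier A. act M x \<in> carrier_mat (vdim M) (vdim M)) \<and>
     (\<forall>x \<in> carrier A. \<forall>y \<in> carrier A. act M (x \<oplus>\<^bsub>A\<^esub> y) = act M x + act M y) \<and>
     (\<forall>c. \<forall>x \<in> carrier A. act M (c \<odot>\<^bsub>A\<^esub> x) = c \<cdot>\<^sub>m act M x) \<and>
     (\<forall>x \<in> carrier A. \<forall>y \<in> carrier A. act M (x \<otimes>\<^bsub>A\<^esub> y) = act M x * act M y) \<and>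
     act M \<one>\<^bsub>A\<^esub> = 1\<^sub>m (vdim M)"

definition mod_hom ::
  "('k :: field, 'a) module \<Rightarrow> ('a, 'k) fdmod \<Rightarrow> ('a, 'k) fdmod \<Rightarrow> 'k mat set" where
  "mod_hom A M N =
     {f \<in> carrier_mat (vdim N) (vdim M). \<forall>x \<in> carrier A. f * act M x = act N x * f}"

definition zero_mod :: "('a, 'k :: field) fdmod" where
  "zero_mod = \<lparr>vdim = 0, act = (\<lambda>_. 0\<^sub>m 0 0)\<rparr>"

definition diag_sum :: "'k :: field mat \<Rightarrow> 'k mat \<Rightarrow> 'k mat" where
  "diag_sum f g =
     four_block_mat f (0\<^sub>m (dim_row f) (dim_col g)) (0\<^sub>m (dim_row g) (dim_col f)) g"

definition mod_sum ::
  "('a, 'k :: field) fdmod \<Rightarrow> ('a, 'k) fdmod \<Rightarrow> ('a, 'k) fdmod" where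
  "mod_sum M N = \<lparr>vdim = vdim M + vdim N, act = (\<lambda>x. diag_sum (act M x) (act N x))\<rparr>"

definition mod_cat :: "('k :: field, 'a) module \<Rightarrow> (('a, 'k) fdmod, 'k mat) add_cat" where
  "mod_cat A =
     \<lparr>Ob = {M. is_module A M}, Hom = mod_hom A, Idn = (\<lambda>M. 1\<^sub>m (vdim M)), Cmp = (*),
      Zero = zero_mod, DSum = mod_sum\<rparr>"

definition rep_generator :: "('k :: field, 'a) module \<Rightarrow> ('a, 'k) fdmod \<Rightarrow> bool" where
  "rep_generator A Z \<longleftrightarrow>
     Z \<in> Ob (mod_cat A) \<and> Ob (mod_cat A) = add_closure (mod_cat A) Z"


section \<open>Bounded complexes (cohomological grading)\<close>

record ('a, 'k) cpx =
  cterm :: "int \<Rightarrow> ('a, 'k) fdmod"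
  cdiff :: "int \<Rightarrow> 'k mat"

abbreviation cdim :: "('a, 'k) cpx \<Rightarrow> int \<Rightarrow> nat" where
  "cdim X n \<equiv> vdim (cterm X n)"

definition bounded_cpx :: "('k :: field, 'a) module \<Rightarrow> ('a, 'k) cpx \<Rightarrow> bool" where
  "bounded_cpx A X \<longleftrightarrow>
     (\<forall>n. is_module A (cterm X n)) \<and>
     (\<forall>n. cdiff X n \<in> mod_hom A (cterm X n) (cterm X (n + 1))) \<and>
     (\<forall>n. cdiff X (n + 1) * cdiff X n = 0\<^sub>m (cdim X (n + 2)) (cdim X n)) \<and>
     (\<exists>b. \<forall>n. \<bar>n\<bar> > b \<longrightarrow> cdim X n = 0)"

definition chain_map ::
  "('k :: field, 'a) module \<Rightarrow> ('a, 'k) cpx \<Rightarrow> ('a, 'k) cpx \<Rightarrow> (int \<Rightarrow> 'k mat) \<Rightarrow> bool" where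
  "chain_map A X Y f \<longleftrightarrow>
     (\<forall>n. f n \<in> mod_hom A (cterm X n) (cterm Y n)) \<and>
     (\<forall>n. f (n + 1) * cdiff X n = cdiff Y n * f n)"

definition cid :: "('a, 'k :: field) cpx \<Rightarrow> int \<Rightarrow> 'k mat" where
  "cid X n = 1\<^sub>m (cdim X n)"

definition cocycles :: "('a, 'k :: field) cpx \<Rightarrow> int \<Rightarrow> 'k vec set" where
  "cocycles X n = {x \<in> carrier_vec (cdim X n). cdiff X n *\<^sub>v x = 0\<^sub>v (cdim X (n + 1))}"

definition coboundaries :: "('a, 'k :: field) cpx \<Rightarrow> int \<Rightarrow> 'k vec set" where
  "coboundaries X n = (\<lambda>y. cdiff X (n - 1) *\<^sub>v y) ` carrier_vec (cdim X (n - 1))"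

definition cohomologous :: "('a, 'k :: field) cpx \<Rightarrow> int \<Rightarrow> ('k vec \<times> 'k vec) set" where
  "cohomologous X n =
     {(x, y). x \<in> cocycles X n \<and> y \<in> cocycles X n \<and> x - y \<in> coboundaries X n}"

definition cohomology :: "('a, 'k :: field) cpx \<Rightarrow> int \<Rightarrow> 'k vec set set" where
  "cohomology X n = cocycles X n // cohomologous X n"

text \<open>The map induced on cohomology sends a class \<open>C\<close> to the class containing \<open>f\<^sup>n C\<close>.\<close>

definition quasi_iso ::
  "('k :: field, 'a) module \<Rightarrow> ('a, 'k) cpx \<Rightarrow> ('a, 'k) cpx \<Rightarrow> (int \<Rightarrow> 'k mat) \<Rightarrow> bool" where
  "quasi_iso A X Y f \<longleftrightarrow>
     chain_map A X Y f \<and>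
     (\<forall>n. bij_betw (\<lambda>C. cohomologous Y n `` ((\<lambda>x. f n *\<^sub>v x) ` C))
            (cohomology X n) (cohomology Y n))"

definition cpx_sum :: "('a, 'k :: field) cpx \<Rightarrow> ('a, 'k) cpx \<Rightarrow> ('a, 'k) cpx" where
  "cpx_sum X Y =
     \<lparr>cterm = (\<lambda>n. mod_sum (cterm X n) (cterm Y n)),
      cdiff = (\<lambda>n. diag_sum (cdiff X n) (cdiff Y n))\<rparr>"

text \<open>\<open>X[m]\<close> has terms \<open>X[m]\<^sup>n = X\<^sup>n\<^sup>+\<^sup>m\<close> and differential \<open>(-1)\<^sup>m d\<close>.\<close>

definition cpx_shift :: "int \<Rightarrow> ('a, 'k :: field) cpx \<Rightarrow> ('a, 'k) cpx" where
  "cpx_shift m X =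
     \<lparr>cterm = (\<lambda>n. cterm X (n + m)),
      cdiff = (\<lambda>n. if even m then cdiff X (n + m) else - cdiff X (n + m))\<rparr>"

definition stalk :: "('a, 'k :: field) fdmod \<Rightarrow> ('a, 'k) cpx" where
  "stalk M =
     (let t = (\<lambda>n :: int. if n = 0 then M else zero_mod)
      in \<lparr>cterm = t, cdiff = (\<lambda>n. 0\<^sub>m (vdim (t (n + 1))) (vdim (t n)))\<rparr>)"

definition zero_cpx :: "('a, 'k :: field) cpx" where
  "zero_cpx = stalk zero_mod"

text \<open>The cone of \<open>f : X \<rightarrow> Y\<close> has terms \<open>X\<^sup>n\<^sup>+\<^sup>1 \<oplus> Y\<^sup>n\<close> and differential
  \<open>(x, y) \<mapsto> (- d x, f x + d y)\<close>.\<close>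

definition cone ::
  "('a, 'k :: field) cpx \<Rightarrow> (int \<Rightarrow> 'k mat) \<Rightarrow> ('a, 'k) cpx \<Rightarrow> ('a, 'k) cpx" where
  "cone X f Y =
     \<lparr>cterm = (\<lambda>n. mod_sum (cterm X (n + 1)) (cterm Y n)),
      cdiff = (\<lambda>n. four_block_mat (- cdiff X (n + 1)) (0\<^sub>m (cdim X (n + 2)) (cdim Y n))
                     (f (n + 1)) (cdiff Y n))\<rparr>"

definition cone_in :: "('a, 'k :: field) cpx \<Rightarrow> ('a, 'k) cpx \<Rightarrow> int \<Rightarrow> 'k mat" where
  "cone_in X Y n =
     mat (cdim X (n + 1) + cdim Y n) (cdim Y n)
       (\<lambda>(i, j). if i = cdim X (n + 1) + j then 1 else 0)"

definition cone_out :: "('a, 'k :: field) cpx \<Rightarrow> ('a, 'k) cpx \<Rightarrow> int \<Rightarrow> 'k mat" where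
  "cone_out X Y n =
     mat (cdim X (n + 1)) (cdim X (n + 1) + cdim Y n) (\<lambda>(i, j). if i = j then 1 else 0)"


section \<open>The bounded derived category\<close>

text \<open>The bounded derived category is the localization of the category of bounded complexes at
  the quasi-isomorphisms. Morphisms are formal composites of chain maps and formal inverses of
  quasi-isomorphisms, modulo the congruence generated by functoriality of
  \<open>f \<mapsto> Fwd X f Y\<close> and by invertibility of the quasi-isomorphisms. (Homotopic chain maps become
  equal in this localization, since the cylinder of a bounded complex is bounded.)

  \<open>Inv X s Y\<close> is the formal inverse of \<open>s : X \<rightarrow> Y\<close>, hence a morphism from \<open>Y\<close> to \<open>X\<close>;
  \<open>After q p\<close> is \<open>q\<close> after \<open>p\<close>.\<close>

datatype ('a, 'k) zigzag =
    Fwd "('a, 'k) cpx" "int \<Rightarrow> 'k mat" "('a, 'k) cpx"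
  | Inv "('a, 'k) cpx" "int \<Rightarrow> 'k mat" "('a, 'k) cpx"
  | After "('a, 'k) zigzag" "('a, 'k) zigzag"

inductive zz_hom ::
  "('k :: field, 'a) module \<Rightarrow> ('a, 'k) zigzag \<Rightarrow> ('a, 'k) cpx \<Rightarrow> ('a, 'k) cpx \<Rightarrow> bool"
  for A where
  fwd: "bounded_cpx A X \<Longrightarrow> bounded_cpx A Y \<Longrightarrow> chain_map A X Y f \<Longrightarrow> zz_hom A (Fwd X f Y) X Y"
| inv: "bounded_cpx A X \<Longrightarrow> bounded_cpx A Y \<Longrightarrow> quasi_iso A X Y s \<Longrightarrow> zz_hom A (Inv X s Y) Y X"
| after: "zz_hom A p X Y \<Longrightarrow> zz_hom A q Y W \<Longrightarrow> zz_hom A (After q p) X W"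

inductive zz_eq :: "('k :: field, 'a) module \<Rightarrow> ('a, 'k) zigzag \<Rightarrow> ('a, 'k) zigzag \<Rightarrow> bool"
  for A where
  refl: "zz_hom A p X Y \<Longrightarrow> zz_eq A p p"
| sym: "zz_eq A p q \<Longrightarrow> zz_eq A q p"
| trans: "zz_eq A p q \<Longrightarrow> zz_eq A q r \<Longrightarrow> zz_eq A p r"
| cong: "zz_eq A p p' \<Longrightarrow> zz_eq A q q' \<Longrightarrow> zz_hom A (After q p) X Y \<Longrightarrow>
    zz_eq A (After q p) (After q' p')"
| assoc: "zz_hom A (After r (After q p)) X Y \<Longrightarrow>
    zz_eq A (After r (After q p)) (After (After r q) p)"
| id_left: "zz_hom A p X Y \<Longrightarrow> zz_eq A (After (Fwd Y (cid Y) Y) p) p"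
| id_right: "zz_hom A p X Y \<Longrightarrow> zz_eq A (After p (Fwd X (cid X) X)) p"
| fwd_comp: "zz_hom A (After (Fwd Y g W) (Fwd X f Y)) X W \<Longrightarrow>
    zz_eq A (After (Fwd Y g W) (Fwd X f Y)) (Fwd X (\<lambda>n. g n * f n) W)"
| inv_left: "zz_hom A (Inv X s Y) Y X \<Longrightarrow>
    zz_eq A (After (Inv X s Y) (Fwd X s Y)) (Fwd X (cid X) X)"
| inv_right: "zz_hom A (Inv X s Y) Y X \<Longrightarrow>
    zz_eq A (After (Fwd X s Y) (Inv X s Y)) (Fwd Y (cid Y) Y)"

definition zz_class :: "('k :: field, 'a) module \<Rightarrow> ('a, 'k) zigzag \<Rightarrow> ('a, 'k) zigzag set" where
  "zz_class A p = {q. zz_eq A p q}"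

primrec zz_shift :: "int \<Rightarrow> ('a, 'k :: field) zigzag \<Rightarrow> ('a, 'k) zigzag" where
  "zz_shift m (Fwd X f Y) = Fwd (cpx_shift m X) (\<lambda>n. f (n + m)) (cpx_shift m Y)"
| "zz_shift m (Inv X s Y) = Inv (cpx_shift m X) (\<lambda>n. s (n + m)) (cpx_shift m Y)"
| "zz_shift m (After q p) = After (zz_shift m q) (zz_shift m p)"

text \<open>Morphisms are equivalence classes; composition and shift are defined on representatives.\<close>

definition cls_shift ::
  "('k :: field, 'a) module \<Rightarrow> int \<Rightarrow> ('a, 'k) zigzag set \<Rightarrow> ('a, 'k) zigzag set" where
  "cls_shift A m P = (\<Union>p \<in> P. zz_class A (zz_shift m p))"

definition derived_add_cat ::
  "('k :: field, 'a) module \<Rightarrow> (('a, 'k) cpx, ('a, 'k) zigzag set) add_cat" where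
  "derived_add_cat A =
     \<lparr>Ob = {X. bounded_cpx A X},
      Hom = (\<lambda>X Y. {zz_class A p | p. zz_hom A p X Y}),
      Idn = (\<lambda>X. zz_class A (Fwd X (cid X) X)),
      Cmp = (\<lambda>Q P. \<Union>q \<in> Q. \<Union>p \<in> P. zz_class A (After q p)),
      Zero = zero_cpx,
      DSum = cpx_sum\<rparr>"

text \<open>A triangle is distinguished if it is isomorphic to the triangle
  \<open>X0 \<rightarrow> Y0 \<rightarrow> cone f \<rightarrow> X0[1]\<close> of a chain map \<open>f : X0 \<rightarrow> Y0\<close>.\<close>

definition derived_tri ::
  "('k :: field, 'a) module \<Rightarrow> ('a, 'k) cpx \<Rightarrow> ('a, 'k) cpx \<Rightarrow> ('a, 'k) cpx \<Rightarrow>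
   ('a, 'k) zigzag set \<Rightarrow> ('a, 'k) zigzag set \<Rightarrow> ('a, 'k) zigzag set \<Rightarrow> bool" where
  "derived_tri A X Y W u v w \<longleftrightarrow>
     (let D = derived_add_cat A in
      X \<in> Ob D \<and> Y \<in> Ob D \<and> W \<in> Ob D \<and>
      u \<in> Hom D X Y \<and> v \<in> Hom D Y W \<and> w \<in> Hom D W (cpx_shift 1 X) \<and>
      (\<exists>X0 Y0 f a b c.
         X0 \<in> Ob D \<and> Y0 \<in> Ob D \<and> chain_map A X0 Y0 f \<and>
         is_iso D X X0 a \<and> is_iso D Y Y0 b \<and> is_iso D W (cone X0 f Y0) c \<and>
         Cmp D b u = Cmp D (zz_class A (Fwd X0 f Y0)) a \<and>
         Cmp D c v = Cmp D (zz_class A (Fwd Y0 (cone_in X0 Y0) (cone X0 f Y0))) b \<and>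
         Cmp D (cls_shift A 1 a) w =
           Cmp D (zz_class A (Fwd (cone X0 f Y0) (cone_out X0 Y0) (cpx_shift 1 X0))) c))"

definition derived_cat ::
  "('k :: field, 'a) module \<Rightarrow> (('a, 'k) cpx, ('a, 'k) zigzag set) tri_cat" where
  "derived_cat A =
     (let D = derived_add_cat A in
      \<lparr>Ob = Ob D, Hom = Hom D, Idn = Idn D, Cmp = Cmp D, Zero = Zero D, DSum = DSum D,
       Shift = cpx_shift, Tri = derived_tri A\<rparr>)"

definition der_dim :: "('k :: field, 'a) module \<Rightarrow> enat" where
  "der_dim A = rouquier_dim (derived_cat A)"

definition sum_of_shifted_summands ::
  "('k :: field, 'a) module \<Rightarrow> ('a, 'k) fdmod \<Rightarrow> ('a, 'k) cpx \<Rightarrow> bool" where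
  "sum_of_shifted_summands A Z X \<longleftrightarrow>
     X \<in> Ob (derived_cat A) \<and>
     (\<exists>L. (\<forall>(M, n) \<in> set L. summand_of (mod_cat A) M Z) \<and>
          isomorphic (derived_cat A) X
            (finsum_of (derived_cat A) (map (\<lambda>(M, n). cpx_shift n (stalk M)) L)))"


section \<open>Skew-gentle algebras\<close>

definition positions :: "nat list \<Rightarrow> (nat \<times> nat) set" where
  "positions m = {(i, j). 1 \<le> i \<and> i \<le> length m \<and> 1 \<le> j \<and> j \<le> m ! (i - 1)}"

definition skew_gentle_datum :: "nat list \<Rightarrow> (nat \<times> nat) rel \<Rightarrow> bool" where
  "skew_gentle_datum m R \<longleftrightarrow>
     (\<forall>n \<in> set m. n \<ge> 2) \<and> R \<subseteq> positions m \<times> positions m \<and> sym R \<and>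
     (\<forall>\<gamma> \<delta> \<delta>'. (\<gamma>, \<delta>) \<in> R \<and> (\<gamma>, \<delta>') \<in> R \<longrightarrow> \<delta> = \<delta>')"

text \<open>Rows and columns of the matrices in \<open>T\<^sub>m\<^sub>,\<^sub>\<Sigma>\<close> are labelled by pairs \<open>(j, a)\<close>: the number \<open>j\<close>
  of the block, and the place \<open>a < d\<^sub>j\<close> within the block. Thus \<open>\<lambda>a b. X (j, a) (l, b)\<close> is the
  block \<open>X\<^sub>j\<^sub>l\<close>. Entries with labels out of range are 0.\<close>

type_synonym 'k bmat = "nat \<times> nat \<Rightarrow> nat \<times> nat \<Rightarrow> 'k"

definition block_size :: "nat set \<Rightarrow> nat \<Rightarrow> nat" where
  "block_size \<Sigma> j = (if j \<in> \<Sigma> then 2 else 1)"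

definition labels :: "nat \<Rightarrow> nat set \<Rightarrow> (nat \<times> nat) set" where
  "labels m \<Sigma> = {(j, a). 1 \<le> j \<and> j \<le> m \<and> a < block_size \<Sigma> j}"

definition lower_block :: "nat \<Rightarrow> nat set \<Rightarrow> 'k :: field bmat set" where
  "lower_block m \<Sigma> =
     {X. \<forall>p q. X p q \<noteq> 0 \<longrightarrow> p \<in> labels m \<Sigma> \<and> q \<in> labels m \<Sigma> \<and> fst p \<ge> fst q}"

definition Sig :: "(nat \<times> nat) rel \<Rightarrow> nat \<Rightarrow> nat set" where
  "Sig R i = {j. ((i, j), (i, j)) \<in> R}"

definition labels_at :: "nat list \<Rightarrow> (nat \<times> nat) rel \<Rightarrow> nat \<Rightarrow> (nat \<times> nat) set" where
  "labels_at m R i = labels (m ! (i - 1)) (Sig R i)"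

definition normalization ::
  "nat list \<Rightarrow> (nat \<times> nat) rel \<Rightarrow> ('k :: field, nat \<Rightarrow> 'k bmat) module" where
  "normalization m R =
     \<lparr>carrier = {X. \<forall>i. if 1 \<le> i \<and> i \<le> length m then X i \<in> lower_block (m ! (i - 1)) (Sig R i)
                        else X i = (\<lambda>p q. 0)},
      mult = (\<lambda>X Y i p q. \<Sum>r \<in> labels_at m R i. X i p r * Y i r q),
      one = (\<lambda>i p q. if 1 \<le> i \<and> i \<le> length m \<and> p = q \<and> p \<in> labels_at m R i then 1 else 0),
      zero = (\<lambda>i p q. 0),
      add = (\<lambda>X Y i p q. X i p q + Y i p q),
      module.smult = (\<lambda>c X i p q. c * X i p q)\<rparr>"

definition skew_gentle ::
  "nat list \<Rightarrow> (nat \<times> nat) rel \<Rightarrow> ('k :: field, nat \<Rightarrow> 'k bmat) module" where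
  "skew_gentle m R =
     normalization m R
       \<lparr>carrier := {X \<in> carrier (normalization m R).
          (\<forall>i j k l. ((i, j), (k, l)) \<in> R \<and> (i, j) \<noteq> (k, l) \<longrightarrow>
             (\<forall>a b. X i (j, a) (j, b) = X k (l, a) (l, b))) \<and>
          (\<forall>i j. ((i, j), (i, j)) \<in> R \<longrightarrow> (\<forall>a b. a \<noteq> b \<longrightarrow> X i (j, a) (j, b) = 0))}\<rparr>"

end

theory Submission
  imports Defs "HOL-Library.Function_Algebras"
begin

text \<open>Let \<open>\<mu>\<close> denote the multiplication map from the free module \<open>A \<otimes> M\<close> to \<open>M\<close>. A bounded complex
  \<open>X\<close> is quasi-isomorphic to the complex \<open>Y\<close> with terms \<open>{(P, Q). \<mu> P = d (\<mu> Q)}\<close> inside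
  \<open>(A \<otimes> X\<^sup>n\<^sup>+\<^sup>1) \<oplus> (A \<otimes> X\<^sup>n)\<close> and differential \<open>(P, Q) \<mapsto> (0, P)\<close>. Since \<open>A\<close> and \<open>H\<close> have the same
  radical and \<open>Y\<close> lies in free \<open>A\<close>-modules, \<open>rad Y\<close> is a complex of \<open>H\<close>-modules, and the triangle
  \<open>rad Y \<rightarrow> X \<rightarrow> Y / rad Y\<close> is the required one. A complex of \<open>H\<close>-submodules of free modules amounts
  to complexes of filtered vector spaces, one for each factor of \<open>H\<close>; such a complex splits into
  pieces with one or two basis vectors (the bars of persistent homology), so \<open>rad Y\<close> splits into shifts
  of interval modules over \<open>H\<close>. The same argument over the semisimple quotient of \<open>A\<close> splits
  \<open>Y / rad Y\<close> into shifts of simple modules, which are retracts of simple \<open>H\<close>-modules. Interval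
  modules have only scalar endomorphisms, and hence are direct summands of \<open>Z\<close>.\<close>

section \<open>Subquotients of function spaces in coordinates\<close>

text \<open>A projective resolution of \<open>X\<close> may be unbounded: \<open>A\<close> can have
  infinite global dimension, already for one factor \<open>T\<^sub>2\<close> with its two positions
  glued, where \<open>A\<close> is the algebra of dual numbers. The complex of pairs
  \<open>(P, Q)\<close> is bounded whenever \<open>X\<close> is, and asks only that its terms lie
  inside free modules. That inclusion is what gives the radical its \<open>H\<close>-structure.
  Inside the free \<open>H\<close>-module one has \<open>rad(A) Y = rad(H) H Y\<close>, because
  \<open>rad A = rad H\<close> is an ideal of \<open>H\<close>; an abstract \<open>A\<close>-module
  has no surrounding \<open>H\<close>-module in which \<open>H Y\<close> could be formed. The bound
  comes from cutting \<open>Y\<close> only once, into radical and semisimple top: two layers, hence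
  dimension at most 1. Modules and complexes are matrices here, which makes submodules and quotients
  awkward. They are therefore formed as subspaces of spaces of functions and turned into matrices by
  coordinate maps at the end; homomorphisms are likewise given by formulas on functions.\<close>

definition fscale :: "'k :: field \<Rightarrow> ('x \<Rightarrow> 'k) \<Rightarrow> 'x \<Rightarrow> 'k" where
  "fscale c f = (\<lambda>x. c * f x)"

lemma fscale_apply [simp]: "fscale c f x = c * f x"
  by (simp add: fscale_def)

interpretation fvs: vector_space fscale
  by unfold_locales (auto simp: fscale_def fun_eq_iff algebra_simps)

definition lin :: "(('x \<Rightarrow> 'k :: field) \<Rightarrow> ('y \<Rightarrow> 'k)) \<Rightarrow> bool" where
  "lin f \<longleftrightarrow> (\<forall>v w. f (v + w) = f v + f w) \<and> (\<forall>c v. f (fscale c v) = fscale c (f v))"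

definition functional :: "(('x \<Rightarrow> 'k :: field) \<Rightarrow> 'k) \<Rightarrow> bool" where
  "functional f \<longleftrightarrow> (\<forall>v w. f (v + w) = f v + f w) \<and> (\<forall>c v. f (fscale c v) = c * f v)"

text \<open>Linearity is asked only on the subspace \<open>S\<close>, because a coordinate map is
  built from a basis of \<open>S\<close> and carries no information off it.\<close>

definition lin_vec :: "('x \<Rightarrow> 'k :: field) set \<Rightarrow> nat \<Rightarrow> (('x \<Rightarrow> 'k) \<Rightarrow> 'k vec) \<Rightarrow> bool" where
  "lin_vec S n h \<longleftrightarrow> (\<forall>v\<in>S. h v \<in> carrier_vec n) \<and>
     (\<forall>v\<in>S. \<forall>w\<in>S. h (v + w) = h v + h w) \<and> (\<forall>c. \<forall>v\<in>S. h (fscale c v) = c \<cdot>\<^sub>v h v)"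

text \<open>A surjection from \<open>S\<close> onto a column space with kernel \<open>U\<close>,
  that is, coordinates on the subquotient \<open>S / U\<close>. It links subspaces of functions,
  where constructions are carried out, with the matrices that make up modules and complexes.\<close>

definition coords ::
  "('x \<Rightarrow> 'k :: field) set \<Rightarrow> ('x \<Rightarrow> 'k) set \<Rightarrow> nat \<Rightarrow> (('x \<Rightarrow> 'k) \<Rightarrow> 'k vec) \<Rightarrow> bool" where
  "coords S U n \<kappa> \<longleftrightarrow> fvs.subspace S \<and> fvs.subspace U \<and> U \<subseteq> S \<and> lin_vec S n \<kappa> \<and>
     (\<forall>x\<in>carrier_vec n. \<exists>v\<in>S. \<kappa> v = x) \<and> (\<forall>v\<in>S. \<kappa> v = 0\<^sub>v n \<longleftrightarrow> v \<in> U)"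

lemma linD:
  assumes "lin f"
  shows "f (v + w) = f v + f w" "f (fscale c v) = fscale c (f v)" "f 0 = 0"
    "f (v - w) = f v - f w" "f (- v) = - f v"
proof -
  show add: "f (v + w) = f v + f w" for v w using assms by (simp add: lin_def)
  show scale: "f (fscale c v) = fscale c (f v)" for c v using assms by (simp add: lin_def)
  show "f 0 = 0" using scale[of 0 0] by (simp add: fscale_def zero_fun_def)
  have neg: "f (- v) = - f v" for v
    using scale[of "-1" v] by (simp add: fscale_def fun_Compl_def)
  show "f (- v) = - f v" by (rule neg)
  show "f (v - w) = f v - f w" using add[of v "- w"] neg[of w] by simp
qed

lemma functionalD:
  assumes "functional f"
  shows "f (v + w) = f v + f w" "f (fscale c v) = c * f v" "f 0 = 0"
    "f (v - w) = f v - f w"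
proof -
  show add: "f (v + w) = f v + f w" for v w using assms by (simp add: functional_def)
  show scale: "f (fscale c v) = c * f v" for c v using assms by (simp add: functional_def)
  show "f 0 = 0" using scale[of 0 0] by (simp add: fscale_def zero_fun_def)
  have neg: "f (- v) = - f v" for v
    using scale[of "-1" v] by (simp add: fscale_def fun_Compl_def)
  show "f (v - w) = f v - f w" using add[of v "- w"] neg[of w] by simp
qed

lemma lin_vecD:
  assumes "lin_vec S n h"
  shows "v \<in> S \<Longrightarrow> h v \<in> carrier_vec n"
    "v \<in> S \<Longrightarrow> w \<in> S \<Longrightarrow> h (v + w) = h v + h w"
    "v \<in> S \<Longrightarrow> h (fscale c v) = c \<cdot>\<^sub>v h v"
  using assms by (auto simp: lin_vec_def)

lemma minus_eq_add_fscale: "v - w = v + fscale (-1) w" for v w :: "'x \<Rightarrow> 'k :: field"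
  by (auto simp: fscale_def)

lemma lin_vec_diff:
  assumes "lin_vec S n h" "fvs.subspace S" "v \<in> S" "w \<in> S"
  shows "h (v - w) = h v - h w"
proof -
  have c: "h v \<in> carrier_vec n" "h w \<in> carrier_vec n" using assms lin_vecD(1) by blast+
  have s: "fscale (-1) w \<in> S" using assms(2,4) by (rule fvs.subspace_scale)
  have "h (v - w) = h v + (-1) \<cdot>\<^sub>v h w"
    using lin_vecD(2)[OF assms(1,3) s] lin_vecD(3)[OF assms(1,4), of "-1"]
    unfolding minus_eq_add_fscale[of v w] by simp
  also have "\<dots> = h v - h w" using c by (intro eq_vecI) auto
  finally show ?thesis .
qed

lemma lin_vec_zero:
  assumes "lin_vec S n h" "fvs.subspace S"
  shows "h 0 = 0\<^sub>v n"
  using lin_vec_diff[OF assms, of 0 0] lin_vecD(1)[OF assms(1), of 0] fvs.subspace_0[OF assms(2)]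
  by simp

lemma coordsD:
  assumes "coords S U n \<kappa>"
  shows "fvs.subspace S" "fvs.subspace U" "U \<subseteq> S" "lin_vec S n \<kappa>"
    "x \<in> carrier_vec n \<Longrightarrow> \<exists>v\<in>S. \<kappa> v = x" "v \<in> S \<Longrightarrow> \<kappa> v = 0\<^sub>v n \<longleftrightarrow> v \<in> U"
  using assms by (auto simp: coords_def)

lemma coords_eq_iff:
  assumes "coords S U n \<kappa>" "v \<in> S" "w \<in> S"
  shows "\<kappa> v = \<kappa> w \<longleftrightarrow> v - w \<in> U"
proof -
  note c = coordsD[OF assms(1)]
  have k: "\<kappa> v \<in> carrier_vec n" "\<kappa> w \<in> carrier_vec n" using c(4) assms lin_vecD(1) by blast+
  have "v - w \<in> S" using assms c(1) by (simp add: fvs.subspace_diff)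
  then have "v - w \<in> U \<longleftrightarrow> \<kappa> v - \<kappa> w = 0\<^sub>v n"
    using c(6) lin_vec_diff[OF c(4,1) assms(2,3)] by metis
  also have "\<dots> \<longleftrightarrow> \<kappa> v = \<kappa> w"
  proof
    assume *: "\<kappa> v - \<kappa> w = 0\<^sub>v n"
    show "\<kappa> v = \<kappa> w"
    proof (intro eq_vecI)
      fix i assume i: "i < dim_vec (\<kappa> w)"
      have "(\<kappa> v - \<kappa> w) $ i = 0" using * i k by simp
      then show "\<kappa> v $ i = \<kappa> w $ i" using i k by simp
    qed (use k in auto)
  qed (use k in auto)
  finally show ?thesis by simp
qed

text \<open>A basis \<open>B\<close> of \<open>U\<close> is extended to a basis \<open>C\<close> of
  \<open>S\<close>; the coordinates along \<open>C - B\<close> vanish exactly on the span of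
  \<open>B\<close>. The finite set \<open>F\<close> makes \<open>C - B\<close> finite, so that it
  can be listed.\<close>

lemma coords_exist:
  fixes S U :: "('x \<Rightarrow> 'k :: field) set"
  assumes S: "fvs.subspace S" and U: "fvs.subspace U" and "U \<subseteq> S"
    and fin: "finite F" "S \<subseteq> fvs.span F"
  shows "\<exists>n \<kappa>. coords S U n \<kappa>"
proof -
  obtain B where B: "B \<subseteq> U" "fvs.independent B" "U \<subseteq> fvs.span B"
    using fvs.maximal_independent_subset[of U] by metis
  obtain C where C: "B \<subseteq> C" "C \<subseteq> S" "fvs.independent C" "S \<subseteq> fvs.span C"
    using fvs.maximal_independent_subset_extend[of B S] B \<open>U \<subseteq> S\<close> by (metis subset_trans)
  have "finite C" using fvs.independent_span_bound[OF fin(1) C(3)] C(2) fin(2) by auto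
  then obtain bs where bs: "set bs = C - B" "distinct bs"
    using finite_distinct_list[of "C - B"] by auto
  have SC: "fvs.span C = S" using C S by (simp add: fvs.span_subspace)
  have UB: "fvs.span B = U" using B U by (simp add: fvs.span_subspace)
  define n where "n = length bs"
  define \<kappa> where "\<kappa> v = vec n (\<lambda>k. fvs.representation C v (bs ! k))" for v
  have bsC: "k < n \<Longrightarrow> bs ! k \<in> C - B" for k using bs(1) n_def nth_mem by blast
  have lv: "lin_vec S n \<kappa>"
    unfolding lin_vec_def \<kappa>_def
    using C(3) SC by (auto intro!: eq_vecI simp: fvs.representation_add fvs.representation_scale)
  have "coords S U n \<kappa>"
    unfolding coords_def
  proof (intro conjI ballI S U \<open>U \<subseteq> S\<close> lv)
    fix x :: "'k vec" assume x: "x \<in> carrier_vec n"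
    define v where "v = (\<Sum>k<n. fscale (x $ k) (bs ! k))"
    have vS: "v \<in> S" unfolding v_def
      using bsC C(2) S by (intro fvs.subspace_sum fvs.subspace_scale) auto
    have sp: "bs ! k \<in> fvs.span C" if "k < n" for k using bsC[OF that] by (simp add: fvs.span_base)
    have "\<kappa> v = x"
    proof (intro eq_vecI)
      fix i assume "i < dim_vec x"
      then have i: "i < n" using x by simp
      have "fvs.representation C v (bs ! i)
          = (\<Sum>k<n. fvs.representation C (fscale (x $ k) (bs ! k)) (bs ! i))"
        unfolding v_def
        using fvs.representation_sum[OF C(3), of "{..<n}" "\<lambda>k. fscale (x $ k) (bs ! k)"] sp
        by (simp add: fvs.span_scale)
      also have "\<dots> = (\<Sum>k<n. (if k = i then x $ k else 0))"
      proof (rule sum.cong[OF HOL.refl])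
        fix k assume "k \<in> {..<n}"
        then have k: "k < n" by simp
        have "fvs.representation C (bs ! k) (bs ! i) = (if k = i then 1 else 0)"
          using fvs.representation_basis[OF C(3), of "bs ! k"] bsC[OF k] k i bs(2)
          by (auto simp: nth_eq_iff_index_eq n_def)
        then show "fvs.representation C (fscale (x $ k) (bs ! k)) (bs ! i)
            = (if k = i then x $ k else 0)"
          using fvs.representation_scale[OF C(3) sp[OF k]] by simp
      qed
      also have "\<dots> = x $ i" using i by simp
      finally show "\<kappa> v $ i = x $ i" using i by (simp add: \<kappa>_def)
    qed (use x in \<open>simp add: \<kappa>_def\<close>)
    then show "\<exists>v\<in>S. \<kappa> v = x" using vS by blast
  next
    fix v assume v: "v \<in> S"
    show "\<kappa> v = 0\<^sub>v n \<longleftrightarrow> v \<in> U"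
    proof
      assume "v \<in> U"
      then have "v \<in> fvs.span B" using UB by simp
      then have r: "fvs.representation C v = fvs.representation B v"
        using fvs.representation_extend[OF C(3) _ C(1)] by simp
      have "fvs.representation B v (bs ! k) = 0" if "k < n" for k
        using bsC[OF that] fvs.representation_ne_zero[of B v "bs ! k"] by blast
      then show "\<kappa> v = 0\<^sub>v n" by (auto simp: \<kappa>_def r intro!: eq_vecI)
    next
      assume z: "\<kappa> v = 0\<^sub>v n"
      have z': "fvs.representation C v b = 0" if "b \<in> C - B" for b
      proof -
        have "b \<in> set bs" using that bs(1) by simp
        then obtain k where k: "k < n" "bs ! k = b" unfolding n_def in_set_conv_nth by blast
        have "\<kappa> v $ k = 0" unfolding z using k(1) by simp
        then show ?thesis using k by (simp add: \<kappa>_def)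
      qed
      have spv: "v \<in> fvs.span C" using v SC by blast
      have "v = (\<Sum>b | fvs.representation C v b \<noteq> 0. fscale (fvs.representation C v b) b)"
        using fvs.sum_nonzero_representation_eq[OF C(3) spv] by (rule HOL.sym)
      also have "\<dots> \<in> U"
      proof (intro fvs.subspace_sum U fvs.subspace_scale)
        fix b assume "b \<in> {b. fvs.representation C v b \<noteq> 0}"
        then have "b \<in> C" "fvs.representation C v b \<noteq> 0"
          using fvs.representation_ne_zero by auto
        then have "b \<in> B" using z' by blast
        then show "b \<in> U" using B by blast
      qed
      finally show "v \<in> U" .
    qed
  qed
  then show ?thesis by blast
qed

lemma mult_mat_vec_zero:
  fixes F :: "'k :: field mat"
  assumes "F \<in> carrier_mat m n"
  shows "F *\<^sub>v 0\<^sub>v n = 0\<^sub>v m"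
  using mult_mat_vec[OF assms zero_carrier_vec, of 0] assms by (intro eq_vecI) auto

lemma mult_mat_unit_vec:
  fixes F :: "'k :: field mat"
  assumes "F \<in> carrier_mat m n" "j < n"
  shows "F *\<^sub>v unit_vec n j = col F j"
  using assms by (intro eq_vecI) (simp_all add: scalar_prod_right_unit)

text \<open>The universal property of \<open>S / U\<close> in matrix form: column \<open>j\<close>
  is the value of \<open>h\<close> at a preimage \<open>b j\<close> of the unit vector
  \<open>j\<close>.\<close>

lemma lin_vec_factor:
  assumes c: "coords S U n \<kappa>" and h: "lin_vec S m h" and z: "\<And>v. v \<in> U \<Longrightarrow> h v = 0\<^sub>v m"
  shows "\<exists>F\<in>carrier_mat m n. \<forall>v\<in>S. F *\<^sub>v \<kappa> v = h v"
proof -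
  note cD = coordsD[OF c]
  have "\<exists>b. b \<in> S \<and> \<kappa> b = unit_vec n j" for j using cD(5)[of "unit_vec n j"] by auto
  then obtain b where b: "\<And>j. b j \<in> S" "\<And>j. \<kappa> (b j) = unit_vec n j" by metis
  define F where "F = mat m n (\<lambda>(i,j). h (b j) $ i)"
  have F: "F \<in> carrier_mat m n" by (simp add: F_def)
  have Fb: "F *\<^sub>v \<kappa> (b j) = h (b j)" if "j < n" for j
    using mult_mat_unit_vec[OF F that] that lin_vecD(1)[OF h b(1)[of j]]
    by (auto simp: b(2) F_def intro!: eq_vecI)
  \<comment> \<open>Induction on the number \<open>k\<close> of leading coordinates that may be
    nonzero: subtracting a multiple of \<open>b k\<close> removes the last of them, and for
    \<open>k = 0\<close> the vector lies in \<open>U\<close>.\<close>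
  have "\<forall>v\<in>S. (\<forall>j. k \<le> j \<longrightarrow> j < n \<longrightarrow> \<kappa> v $ j = 0) \<longrightarrow> F *\<^sub>v \<kappa> v = h v" if "k \<le> n" for k
    using that
  proof (induction k)
    case 0
    show ?case
    proof (intro ballI impI)
      fix v assume v: "v \<in> S" and "\<forall>j. 0 \<le> j \<longrightarrow> j < n \<longrightarrow> \<kappa> v $ j = 0"
      then have k0: "\<kappa> v = 0\<^sub>v n" using lin_vecD(1)[OF cD(4) v] by (intro eq_vecI) auto
      then have "h v = 0\<^sub>v m" using cD(6) v z by blast
      then show "F *\<^sub>v \<kappa> v = h v" using k0 F by (simp add: mult_mat_vec_zero)
    qed
  next
    case (Suc k)
    show ?case
    proof (intro ballI impI)
      fix v assume v: "v \<in> S" and v0: "\<forall>j. Suc k \<le> j \<longrightarrow> j < n \<longrightarrow> \<kappa> v $ j = 0"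
      have k: "k < n" using Suc.prems by simp
      define c where "c = \<kappa> v $ k"
      define w where "w = v - fscale c (b k)"
      have bs: "fscale c (b k) \<in> S" using b(1) cD(1) by (simp add: fvs.subspace_scale)
      have w: "w \<in> S" unfolding w_def using v bs cD(1) by (simp add: fvs.subspace_diff)
      have kv: "\<kappa> v \<in> carrier_vec n" "\<kappa> w \<in> carrier_vec n" using lin_vecD(1)[OF cD(4)] v w by auto
      have kb: "\<kappa> (fscale c (b k)) = c \<cdot>\<^sub>v unit_vec n k"
        using lin_vecD(3)[OF cD(4) b(1)] b(2) by simp
      have kw: "\<kappa> w = \<kappa> v - c \<cdot>\<^sub>v unit_vec n k"
        unfolding w_def using lin_vec_diff[OF cD(4,1) v bs] kb by simp
      have "\<kappa> w $ j = 0" if "k \<le> j" "j < n" for j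
        using that v0 kv by (cases "j = k") (auto simp: kw c_def)
      then have Fw: "F *\<^sub>v \<kappa> w = h w" using Suc w by simp
      have vw: "v = w + fscale c (b k)" by (simp add: w_def)
      have "F *\<^sub>v \<kappa> v = F *\<^sub>v (\<kappa> w + \<kappa> (fscale c (b k)))"
        using lin_vecD(2)[OF cD(4) w bs] vw by simp
      also have "\<dots> = F *\<^sub>v \<kappa> w + c \<cdot>\<^sub>v (F *\<^sub>v \<kappa> (b k))"
        using mult_add_distrib_mat_vec[OF F kv(2), of "c \<cdot>\<^sub>v unit_vec n k"]
          mult_mat_vec[OF F, of "unit_vec n k" c] kb b(2) by simp
      also have "\<dots> = h w + h (fscale c (b k))"
        using Fw Fb[OF k] lin_vecD(3)[OF h b(1)] by simp
      also have "\<dots> = h v" using lin_vecD(2)[OF h w bs] vw by simp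
      finally show "F *\<^sub>v \<kappa> v = h v" .
    qed
  qed
  from this[of n] show ?thesis using F by auto
qed

lemma mat_eqI_vec:
  fixes F G :: "'k :: field mat"
  assumes F: "F \<in> carrier_mat m n" and G: "G \<in> carrier_mat m n"
    and eq: "\<And>v. v \<in> carrier_vec n \<Longrightarrow> F *\<^sub>v v = G *\<^sub>v v"
  shows "F = G"
proof (rule eq_matI)
  fix i j assume "i < dim_row G" "j < dim_col G"
  then have ij: "i < m" "j < n" using G by auto
  have "col F j = col G j"
    using eq[of "unit_vec n j"] mult_mat_unit_vec[OF F ij(2)] mult_mat_unit_vec[OF G ij(2)] by simp
  then have "col F j $ i = col G j $ i" by simp
  then show "F $$ (i, j) = G $$ (i, j)" using ij F G by simp
qed (use F G in auto)

lemma mat_eqI_coords: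
  assumes "coords S U n \<kappa>" "F \<in> carrier_mat m n" "G \<in> carrier_mat m n"
    and "\<And>v. v \<in> S \<Longrightarrow> F *\<^sub>v \<kappa> v = G *\<^sub>v \<kappa> v"
  shows "F = G"
proof (rule mat_eqI_vec[OF assms(2,3)])
  fix x :: "'b vec" assume "x \<in> carrier_vec n"
  then obtain v where "v \<in> S" "\<kappa> v = x" using coordsD(5)[OF assms(1)] by blast
  then show "F *\<^sub>v x = G *\<^sub>v x" using assms(4) by blast
qed

text \<open>\<open>y\<close> together with a basis of \<open>V\<close> extends to a basis of the
  whole function space, whatever its dimension; the functional is the coordinate along
  \<open>y\<close>. It will mark the level of a filtration at which a vector first appears.\<close>

lemma functional_exists:
  fixes V :: "('x \<Rightarrow> 'k :: field) set"
  assumes V: "fvs.subspace V" and y: "y \<notin> V"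
  shows "\<exists>\<phi>. functional \<phi> \<and> \<phi> y = 1 \<and> (\<forall>v\<in>V. \<phi> v = 0)"
proof -
  obtain B where B: "B \<subseteq> V" "fvs.independent B" "V \<subseteq> fvs.span B"
    using fvs.maximal_independent_subset[of V] by metis
  have sB: "fvs.span B = V" using B V by (simp add: fvs.span_subspace)
  have ind: "fvs.independent (insert y B)"
    using B y sB by (simp add: fvs.independent_insert)
  define C where "C = fvs.extend_basis (insert y B)"
  have C: "fvs.independent C" "insert y B \<subseteq> C" "fvs.span C = UNIV"
    unfolding C_def using ind
    by (simp_all add: fvs.independent_extend_basis fvs.extend_basis_superset del: insert_subset)
  have "fvs.representation C v y = 0" if "v \<in> V" for v
  proof -
    have "fvs.representation C v = fvs.representation B v"
      using fvs.representation_extend[OF C(1), of v B] that sB C(2) by auto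
    moreover have "y \<notin> B" using B(1) y by blast
    ultimately show ?thesis using fvs.representation_ne_zero[of B v y] by metis
  qed
  then show ?thesis
    using C(2) fvs.representation_basis[OF C(1), of y]
    by (intro exI[of _ "\<lambda>v. fvs.representation C v y"])
      (auto simp: functional_def fvs.representation_add[OF C(1)]
        fvs.representation_scale[OF C(1)] C(3))
qed

text \<open>Supplies the strict decrease in the induction that splits off one bar at a time. The
  finite set \<open>F\<close> keeps dimensions finite inside a function space that may be
  infinite-dimensional.\<close>

lemma dim_psubset:
  fixes V W :: "('x \<Rightarrow> 'k :: field) set"
  assumes "fvs.subspace V" "V \<subset> W" "W \<subseteq> fvs.span F" "finite F"
  shows "fvs.dim V < fvs.dim W"
proof -
  obtain B where B: "B \<subseteq> V" "fvs.independent B" "V \<subseteq> fvs.span B" "card B = fvs.dim V"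
    using fvs.basis_exists[of V] by metis
  obtain C where C: "B \<subseteq> C" "C \<subseteq> W" "fvs.independent C" "W \<subseteq> fvs.span C"
    using fvs.maximal_independent_subset_extend[of B W] B assms(2) by (metis psubsetE subset_trans)
  have fC: "finite C" using fvs.independent_span_bound[OF assms(4) C(3)] C(2) assms(3) by auto
  have "B \<noteq> C"
    using assms(1,2) B(1) C(4) fvs.span_minimal[of B V] by auto
  then have "card B < card C" using C(1) fC by (simp add: psubset_card_mono)
  moreover have "card C = fvs.dim W" using C by (simp add: fvs.basis_card_eq_dim)
  ultimately show ?thesis using B by simp
qed

section \<open>Complexes of modules and quasi-isomorphisms\<close>

lemma cdiff_carrier:
  assumes "bounded_cpx A X"
  shows "cdiff X n \<in> carrier_mat (cdim X (n + 1)) (cdim X n)"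
  using assms by (auto simp: bounded_cpx_def mod_hom_def)

lemma cdiff_prev_carrier:
  assumes "bounded_cpx A X"
  shows "cdiff X (n - 1) \<in> carrier_mat (cdim X n) (cdim X (n - 1))"
  using cdiff_carrier[OF assms, of "n - 1"] by simp

lemma cdiff_cdiff:
  assumes X: "bounded_cpx A X" and x: "x \<in> carrier_vec (cdim X n)"
  shows "cdiff X (n + 1) *\<^sub>v (cdiff X n *\<^sub>v x) = 0\<^sub>v (cdim X (n + 2))"
proof -
  have c: "cdiff X (n + 1) \<in> carrier_mat (cdim X (n + 2)) (cdim X (n + 1))"
    using cdiff_carrier[OF X, of "n + 1"] by (simp add: add.assoc)
  have "cdiff X (n + 1) *\<^sub>v (cdiff X n *\<^sub>v x) = (cdiff X (n + 1) * cdiff X n) *\<^sub>v x"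
    using assoc_mult_mat_vec[OF c cdiff_carrier[OF X] x] by simp
  also have "\<dots> = 0\<^sub>v (cdim X (n + 2))"
    using X x by (auto simp: bounded_cpx_def intro!: eq_vecI)
  finally show ?thesis .
qed

lemma chain_map_carrier:
  assumes "chain_map A X Y f"
  shows "f n \<in> carrier_mat (cdim Y n) (cdim X n)"
  using assms by (auto simp: chain_map_def mod_hom_def)

lemma chain_map_vec:
  assumes f: "chain_map A X Y f" and X: "bounded_cpx A X" and Y: "bounded_cpx A Y"
    and x: "x \<in> carrier_vec (cdim X n)"
  shows "f (n + 1) *\<^sub>v (cdiff X n *\<^sub>v x) = cdiff Y n *\<^sub>v (f n *\<^sub>v x)"
  using assoc_mult_mat_vec[OF chain_map_carrier[OF f] cdiff_carrier[OF X] x]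
    assoc_mult_mat_vec[OF cdiff_carrier[OF Y] chain_map_carrier[OF f] x] f
  by (simp add: chain_map_def)

lemma coboundariesI:
  "a \<in> carrier_vec (cdim X (n - 1)) \<Longrightarrow> cdiff X (n - 1) *\<^sub>v a \<in> coboundaries X n"
  by (simp add: coboundaries_def)

lemma coboundaries_carrier:
  assumes "bounded_cpx A X" "x \<in> coboundaries X n"
  shows "x \<in> carrier_vec (cdim X n)"
  using cdiff_prev_carrier[OF assms(1), of n] assms(2) by (auto simp: coboundaries_def)

lemma coboundaries_diff:
  assumes X: "bounded_cpx A X" and xy: "x \<in> coboundaries X n" "y \<in> coboundaries X n"
  shows "x - y \<in> coboundaries X n"
proof -
  obtain a b where ab: "a \<in> carrier_vec (cdim X (n - 1))" "b \<in> carrier_vec (cdim X (n - 1))"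
      "x = cdiff X (n - 1) *\<^sub>v a" "y = cdiff X (n - 1) *\<^sub>v b"
    using xy by (auto simp: coboundaries_def)
  have "x - y = cdiff X (n - 1) *\<^sub>v (a - b)"
    unfolding ab(3,4) by (rule mult_minus_distrib_mat_vec[OF cdiff_prev_carrier[OF X] ab(1,2), symmetric])
  then show ?thesis using ab(1,2) by (simp add: coboundariesI)
qed

lemma zero_coboundaries:
  assumes X: "bounded_cpx A X"
  shows "0\<^sub>v (cdim X n) \<in> coboundaries X n"
  using coboundariesI[of "0\<^sub>v (cdim X (n - 1))" X n] mult_mat_vec_zero[OF cdiff_prev_carrier[OF X, of n]]
  by simp

lemma coboundaries_minus_commute:
  assumes X: "bounded_cpx A X" and "x - y \<in> coboundaries X n"
    and "x \<in> carrier_vec (cdim X n)" "y \<in> carrier_vec (cdim X n)"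
  shows "y - x \<in> coboundaries X n"
proof -
  have "y - x = 0\<^sub>v (cdim X n) - (x - y)" using assms(3,4) by (intro eq_vecI) auto
  then show ?thesis using coboundaries_diff[OF X zero_coboundaries[OF X] assms(2)] by simp
qed

lemma coboundaries_diff_trans:
  assumes X: "bounded_cpx A X" and "x - y \<in> coboundaries X n" "y - z \<in> coboundaries X n"
    and c: "x \<in> carrier_vec (cdim X n)" "y \<in> carrier_vec (cdim X n)" "z \<in> carrier_vec (cdim X n)"
  shows "x - z \<in> coboundaries X n"
proof -
  have "x - z = (x - y) - (z - y)" using c by (intro eq_vecI) auto
  then show ?thesis
    using coboundaries_diff[OF X assms(2) coboundaries_minus_commute[OF X assms(3) c(2,3)]] by simp
qed

lemma cocyclesD: "x \<in> cocycles X n \<Longrightarrow> x \<in> carrier_vec (cdim X n)"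
  by (simp add: cocycles_def)

lemma cocycles_diff:
  assumes X: "bounded_cpx A X" and "x \<in> cocycles X n" "y \<in> cocycles X n"
  shows "x - y \<in> cocycles X n"
  using assms mult_minus_distrib_mat_vec[OF cdiff_carrier[OF X]] by (simp add: cocycles_def)

lemma zero_cocycles:
  assumes X: "bounded_cpx A X"
  shows "0\<^sub>v (cdim X n) \<in> cocycles X n"
  using mult_mat_vec_zero[OF cdiff_carrier[OF X, of n]] by (simp add: cocycles_def)

lemma cohomologous_equiv:
  assumes X: "bounded_cpx A X"
  shows "equiv (cocycles X n) (cohomologous X n)"
proof (rule equivI)
  show "cohomologous X n \<subseteq> cocycles X n \<times> cocycles X n" by (auto simp: cohomologous_def)
  have "x - x \<in> coboundaries X n" if "x \<in> carrier_vec (cdim X n)" for x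
    using zero_coboundaries[OF X, of n] that by simp
  then show "refl_on (cocycles X n) (cohomologous X n)"
    by (auto simp: refl_on_def cohomologous_def dest: cocyclesD)
  show "Relation.sym (cohomologous X n)"
    using coboundaries_minus_commute[OF X]
    by (auto simp: Relation.sym_def cohomologous_def dest: cocyclesD)
  show "Relation.trans (cohomologous X n)"
    unfolding Relation.trans_def cohomologous_def
    using coboundaries_diff_trans[OF X _ _ cocyclesD cocyclesD cocyclesD] by blast
qed

lemma chain_map_cocycles:
  assumes f: "chain_map A X Y f" and X: "bounded_cpx A X" and Y: "bounded_cpx A Y"
    and x: "x \<in> cocycles X n"
  shows "f n *\<^sub>v x \<in> cocycles Y n"
proof -
  have c: "x \<in> carrier_vec (cdim X n)" using x cocyclesD by blast
  have "cdiff Y n *\<^sub>v (f n *\<^sub>v x) = f (n + 1) *\<^sub>v 0\<^sub>v (cdim X (n + 1))"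
    using chain_map_vec[OF f X Y c] x by (simp add: cocycles_def)
  then show ?thesis
    using mult_mat_vec_zero[OF chain_map_carrier[OF f, of "n + 1"]] chain_map_carrier[OF f, of n] c
    by (simp add: cocycles_def)
qed

lemma chain_map_coboundaries:
  assumes f: "chain_map A X Y f" and X: "bounded_cpx A X" and Y: "bounded_cpx A Y"
    and x: "x \<in> coboundaries X n"
  shows "f n *\<^sub>v x \<in> coboundaries Y n"
proof -
  obtain a where a: "a \<in> carrier_vec (cdim X (n - 1))" "x = cdiff X (n - 1) *\<^sub>v a"
    using x by (auto simp: coboundaries_def)
  have "f n *\<^sub>v x = cdiff Y (n - 1) *\<^sub>v (f (n - 1) *\<^sub>v a)"
    using chain_map_vec[OF f X Y a(1)] a(2) by simp
  moreover have "f (n - 1) *\<^sub>v a \<in> carrier_vec (cdim Y (n - 1))"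
    using chain_map_carrier[OF f, of "n - 1"] a(1) by simp
  ultimately show ?thesis by (simp add: coboundariesI)
qed

definition cohom_inj :: "('a, 'k :: field) cpx \<Rightarrow> ('a, 'k) cpx \<Rightarrow> (int \<Rightarrow> 'k mat) \<Rightarrow> bool" where
  "cohom_inj X Y f \<longleftrightarrow>
     (\<forall>n. \<forall>x\<in>cocycles X n. f n *\<^sub>v x \<in> coboundaries Y n \<longrightarrow> x \<in> coboundaries X n)"

definition cohom_surj :: "('a, 'k :: field) cpx \<Rightarrow> ('a, 'k) cpx \<Rightarrow> (int \<Rightarrow> 'k mat) \<Rightarrow> bool" where
  "cohom_surj X Y f \<longleftrightarrow>
     (\<forall>n. \<forall>y\<in>cocycles Y n. \<exists>x\<in>cocycles X n. f n *\<^sub>v x - y \<in> coboundaries Y n)"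

text \<open>The image of a class under \<open>f n\<close> meets only one class, so the induced map,
  which is defined through images of sets, can be computed on a representative.\<close>

lemma class_image:
  assumes f: "chain_map A X Y f" and X: "bounded_cpx A X" and Y: "bounded_cpx A Y"
    and x: "x \<in> cocycles X n"
  shows "cohomologous Y n `` ((\<lambda>x. f n *\<^sub>v x) ` (cohomologous X n `` {x}))
       = cohomologous Y n `` {f n *\<^sub>v x}"
proof -
  note eX = cohomologous_equiv[OF X, of n] and eY = cohomologous_equiv[OF Y, of n]
  have "(f n *\<^sub>v x, f n *\<^sub>v x') \<in> cohomologous Y n" if "(x, x') \<in> cohomologous X n" for x'
  proof -
    have *: "x' \<in> cocycles X n" "x - x' \<in> coboundaries X n" using that by (auto simp: cohomologous_def)
    have "f n *\<^sub>v (x - x') \<in> coboundaries Y n"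
      using chain_map_coboundaries[OF f X Y *(2)] .
    moreover have "f n *\<^sub>v (x - x') = f n *\<^sub>v x - f n *\<^sub>v x'"
      using mult_minus_distrib_mat_vec[OF chain_map_carrier[OF f]] x *(1) cocyclesD by blast
    ultimately show ?thesis
      using chain_map_cocycles[OF f X Y] x *(1) by (simp add: cohomologous_def)
  qed
  moreover have "(x, x) \<in> cohomologous X n" using eX x by (meson equivE refl_onD)
  ultimately show ?thesis
    using eY unfolding equiv_def Relation.trans_def by blast
qed

text \<open>Trades cohomology classes for cocycles once and for all: injectivity becomes triviality
  of the kernel, and surjectivity is tested on representatives. Later quasi-isomorphisms are
  verified in this form.\<close>

lemma quasi_iso_iff:
  assumes X: "bounded_cpx A X" and Y: "bounded_cpx A Y"
  shows "quasi_iso A X Y f \<longleftrightarrow> chain_map A X Y f \<and> cohom_inj X Y f \<and> cohom_surj X Y f"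
proof (cases "chain_map A X Y f")
  case f: True
  note eX = cohomologous_equiv[OF X] and eY = cohomologous_equiv[OF Y]
  define F where "F n C = cohomologous Y n `` ((\<lambda>x. f n *\<^sub>v x) ` C)" for n C
  have F: "F n (cohomologous X n `` {x}) = cohomologous Y n `` {f n *\<^sub>v x}"
    if "x \<in> cocycles X n" for n x
    unfolding F_def by (rule class_image[OF f X Y that])
  have inj: "inj_on (F n) (cohomology X n) \<longleftrightarrow>
      (\<forall>x\<in>cocycles X n. f n *\<^sub>v x \<in> coboundaries Y n \<longrightarrow> x \<in> coboundaries X n)" for n
  proof
    assume inj: "inj_on (F n) (cohomology X n)"
    show "\<forall>x\<in>cocycles X n. f n *\<^sub>v x \<in> coboundaries Y n \<longrightarrow> x \<in> coboundaries X n"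
    proof (intro ballI impI)
      fix x assume x: "x \<in> cocycles X n" and fx: "f n *\<^sub>v x \<in> coboundaries Y n"
      note z = zero_cocycles[OF X, of n]
      have xc: "x \<in> carrier_vec (cdim X n)" using x cocyclesD by blast
      have fc: "f n *\<^sub>v x \<in> carrier_vec (cdim Y n)" using coboundaries_carrier[OF Y fx] .
      have f0: "f n *\<^sub>v 0\<^sub>v (cdim X n) = 0\<^sub>v (cdim Y n)"
        using mult_mat_vec_zero[OF chain_map_carrier[OF f]] .
      have "(f n *\<^sub>v x, f n *\<^sub>v 0\<^sub>v (cdim X n)) \<in> cohomologous Y n"
        using chain_map_cocycles[OF f X Y x] zero_cocycles[OF Y, of n] fx fc
        by (simp add: cohomologous_def f0)
      then have "F n (cohomologous X n `` {x}) = F n (cohomologous X n `` {0\<^sub>v (cdim X n)})"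
        using F[OF x] F[OF z] equiv_class_eq[OF eY] by simp
      then have "cohomologous X n `` {x} = cohomologous X n `` {0\<^sub>v (cdim X n)}"
        using inj x z unfolding cohomology_def
        by (meson inj_onD quotientI)
      then have "(x, 0\<^sub>v (cdim X n)) \<in> cohomologous X n"
        using eq_equiv_class[OF _ eX z] by simp
      then show "x \<in> coboundaries X n" using xc by (simp add: cohomologous_def)
    qed
  next
    assume i: "\<forall>x\<in>cocycles X n. f n *\<^sub>v x \<in> coboundaries Y n \<longrightarrow> x \<in> coboundaries X n"
    show "inj_on (F n) (cohomology X n)"
    proof (rule inj_onI)
      fix C D assume "C \<in> cohomology X n" "D \<in> cohomology X n" and FF: "F n C = F n D"
      then obtain x y where x: "x \<in> cocycles X n" "C = cohomologous X n `` {x}"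
          and y: "y \<in> cocycles X n" "D = cohomologous X n `` {y}"
        unfolding cohomology_def by (auto elim!: quotientE)
      have "(f n *\<^sub>v x, f n *\<^sub>v y) \<in> cohomologous Y n"
        using FF F[OF x(1)] F[OF y(1)] x y eq_equiv_class[OF _ eY chain_map_cocycles[OF f X Y y(1)]]
        by simp
      then have "f n *\<^sub>v (x - y) \<in> coboundaries Y n"
        using mult_minus_distrib_mat_vec[OF chain_map_carrier[OF f] cocyclesD[OF x(1)] cocyclesD[OF y(1)]]
        by (simp add: cohomologous_def)
      then have "x - y \<in> coboundaries X n" using i cocycles_diff[OF X x(1) y(1)] by blast
      then have "(x, y) \<in> cohomologous X n" using x(1) y(1) by (simp add: cohomologous_def)
      then show "C = D" using x y equiv_class_eq[OF eX] by simp
    qed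
  qed
  have surj: "F n ` cohomology X n = cohomology Y n \<longleftrightarrow>
      (\<forall>y\<in>cocycles Y n. \<exists>x\<in>cocycles X n. f n *\<^sub>v x - y \<in> coboundaries Y n)" for n
  proof
    assume s: "F n ` cohomology X n = cohomology Y n"
    show "\<forall>y\<in>cocycles Y n. \<exists>x\<in>cocycles X n. f n *\<^sub>v x - y \<in> coboundaries Y n"
    proof
      fix y assume y: "y \<in> cocycles Y n"
      then have "cohomologous Y n `` {y} \<in> F n ` cohomology X n"
        unfolding s unfolding cohomology_def by (rule quotientI)
      then obtain x where x: "x \<in> cocycles X n"
          "cohomologous Y n `` {y} = F n (cohomologous X n `` {x})"
        unfolding cohomology_def by (auto elim!: quotientE)
      then have "(f n *\<^sub>v x, y) \<in> cohomologous Y n"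
        using F[OF x(1)] eq_equiv_class[OF _ eY y] by simp
      then show "\<exists>x\<in>cocycles X n. f n *\<^sub>v x - y \<in> coboundaries Y n"
        using x(1) by (auto simp: cohomologous_def)
    qed
  next
    assume s: "\<forall>y\<in>cocycles Y n. \<exists>x\<in>cocycles X n. f n *\<^sub>v x - y \<in> coboundaries Y n"
    show "F n ` cohomology X n = cohomology Y n"
    proof
      show "F n ` cohomology X n \<subseteq> cohomology Y n"
        using F chain_map_cocycles[OF f X Y] unfolding cohomology_def
        by (auto elim!: quotientE intro!: quotientI)
      show "cohomology Y n \<subseteq> F n ` cohomology X n"
      proof
        fix D assume "D \<in> cohomology Y n"
        then obtain y where y: "y \<in> cocycles Y n" "D = cohomologous Y n `` {y}"
          unfolding cohomology_def by (auto elim!: quotientE)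
        then obtain x where x: "x \<in> cocycles X n" "f n *\<^sub>v x - y \<in> coboundaries Y n"
          using s by blast
        then have "(f n *\<^sub>v x, y) \<in> cohomologous Y n"
          using y(1) chain_map_cocycles[OF f X Y x(1)] by (simp add: cohomologous_def)
        then have "D = F n (cohomologous X n `` {x})"
          using F[OF x(1)] y(2) equiv_class_eq[OF eY] by simp
        then show "D \<in> F n ` cohomology X n"
          using x(1) unfolding cohomology_def by (auto intro: quotientI)
      qed
    qed
  qed
  show ?thesis
    using f inj surj by (auto simp: quasi_iso_def cohom_inj_def cohom_surj_def bij_betw_def F_def[abs_def])
qed (simp add: quasi_iso_def)

lemma quasi_isoI:
  assumes "bounded_cpx A X" "bounded_cpx A Y" "chain_map A X Y f"
    and "\<And>n x. x \<in> cocycles X n \<Longrightarrow> f n *\<^sub>v x \<in> coboundaries Y n \<Longrightarrow> x \<in> coboundaries X n"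
    and "\<And>n y. y \<in> cocycles Y n \<Longrightarrow> \<exists>x\<in>cocycles X n. f n *\<^sub>v x - y \<in> coboundaries Y n"
  shows "quasi_iso A X Y f"
  using assms quasi_iso_iff[OF assms(1,2)] by (simp add: cohom_inj_def cohom_surj_def)

text \<open>Degreewise bijectivity lets cocycles and primitives be pulled back one vector at a time,
  so no inverse matrices have to be constructed.\<close>

lemma chain_map_bij_quasi_iso:
  assumes X: "bounded_cpx A X" and Y: "bounded_cpx A Y" and f: "chain_map A X Y f"
    and bij: "\<And>n. bij_betw (\<lambda>x. f n *\<^sub>v x) (carrier_vec (cdim X n)) (carrier_vec (cdim Y n))"
  shows "quasi_iso A X Y f"
proof (rule quasi_isoI[OF X Y f])
  have inj: "x = x'" if "f n *\<^sub>v x = f n *\<^sub>v x'" "x \<in> carrier_vec (cdim X n)" "x' \<in> carrier_vec (cdim X n)"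
    for n x x' using bij[of n] that unfolding bij_betw_def by (meson inj_onD)
  have surj: "\<exists>x\<in>carrier_vec (cdim X n). f n *\<^sub>v x = y" if "y \<in> carrier_vec (cdim Y n)" for n y
    using bij[of n] that unfolding bij_betw_def by (metis imageE)
  {
    fix n x assume x: "x \<in> cocycles X n" "f n *\<^sub>v x \<in> coboundaries Y n"
    then obtain b where b: "b \<in> carrier_vec (cdim Y (n - 1))" "f n *\<^sub>v x = cdiff Y (n - 1) *\<^sub>v b"
      by (auto simp: coboundaries_def)
    then obtain a where a: "a \<in> carrier_vec (cdim X (n - 1))" "f (n - 1) *\<^sub>v a = b"
      using surj by blast
    have "f n *\<^sub>v x = f n *\<^sub>v (cdiff X (n - 1) *\<^sub>v a)"
      using chain_map_vec[OF f X Y a(1)] a b by simp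
    then have xa: "x = cdiff X (n - 1) *\<^sub>v a"
      using inj cocyclesD[OF x(1)] cdiff_prev_carrier[OF X, of n] a(1) by (meson mult_mat_vec_carrier)
    show "x \<in> coboundaries X n" unfolding xa by (rule coboundariesI[OF a(1)])
  next
    fix n y assume y: "y \<in> cocycles Y n"
    then obtain x where x: "x \<in> carrier_vec (cdim X n)" "f n *\<^sub>v x = y"
      using surj cocyclesD by blast
    have "f (n + 1) *\<^sub>v (cdiff X n *\<^sub>v x) = f (n + 1) *\<^sub>v 0\<^sub>v (cdim X (n + 1))"
      using chain_map_vec[OF f X Y x(1)] x(2) y mult_mat_vec_zero[OF chain_map_carrier[OF f, of "n + 1"]]
      by (simp add: cocycles_def)
    then have "cdiff X n *\<^sub>v x = 0\<^sub>v (cdim X (n + 1))"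
      by (rule inj) (use cdiff_carrier[OF X, of n] x(1) in auto)
    then have "x \<in> cocycles X n" using x(1) by (simp add: cocycles_def)
    moreover have "f n *\<^sub>v x - y \<in> coboundaries Y n"
      using x(2) zero_coboundaries[OF Y, of n] cocyclesD[OF y] by simp
    ultimately show "\<exists>x\<in>cocycles X n. f n *\<^sub>v x - y \<in> coboundaries Y n" by blast
  }
qed

lemma chain_map_id:
  assumes X: "bounded_cpx A X"
  shows "chain_map A X X (cid X)"
proof -
  have "act (cterm X n) a \<in> carrier_mat (cdim X n) (cdim X n)" if "a \<in> carrier A" for a n
    using X that by (auto simp: bounded_cpx_def is_module_def)
  from left_mult_one_mat[OF this] right_mult_one_mat[OF this] show ?thesis
    using cdiff_carrier[OF X] left_mult_one_mat[OF cdiff_carrier[OF X]]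
      right_mult_one_mat[OF cdiff_carrier[OF X]]
    by (simp add: chain_map_def cid_def mod_hom_def)
qed

lemma mod_hom_comp:
  assumes f: "f \<in> mod_hom A L M" and g: "g \<in> mod_hom A M N"
    and m: "is_module A L" "is_module A M" "is_module A N"
  shows "g * f \<in> mod_hom A L N"
proof -
  have fc: "f \<in> carrier_mat (vdim M) (vdim L)" and gc: "g \<in> carrier_mat (vdim N) (vdim M)"
    using f g by (auto simp: mod_hom_def)
  have "(g * f) * act L a = act N a * (g * f)" if a: "a \<in> carrier A" for a
  proof -
    have c: "act L a \<in> carrier_mat (vdim L) (vdim L)" "act M a \<in> carrier_mat (vdim M) (vdim M)"
      "act N a \<in> carrier_mat (vdim N) (vdim N)" using m a by (auto simp: is_module_def)
    have "(g * f) * act L a = g * (act M a * f)"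
      using assoc_mult_mat[OF gc fc c(1)] f a by (simp add: mod_hom_def)
    also have "\<dots> = (act N a * g) * f"
      using assoc_mult_mat[OF gc c(2) fc] g a by (simp add: mod_hom_def)
    finally show ?thesis using assoc_mult_mat[OF c(3) gc fc] by simp
  qed
  then show ?thesis using fc gc by (simp add: mod_hom_def)
qed

lemma cterm_module: "bounded_cpx A X \<Longrightarrow> is_module A (cterm X n)"
  by (simp add: bounded_cpx_def)

section \<open>Direct sums, shifts and cones\<close>

lemma diag_sum_carrier [simp]:
  "f \<in> carrier_mat a b \<Longrightarrow> g \<in> carrier_mat c d \<Longrightarrow> diag_sum f g \<in> carrier_mat (a + c) (b + d)"
  by (auto simp: diag_sum_def)

lemma diag_sum_dim [simp]:
  "dim_row (diag_sum f g) = dim_row f + dim_row g" "dim_col (diag_sum f g) = dim_col f + dim_col g"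
  by (auto simp: diag_sum_def)

lemma diag_sum_index:
  assumes "i < dim_row f + dim_row g" "j < dim_col f + dim_col g"
  shows "diag_sum f g $$ (i, j) =
    (if i < dim_row f then if j < dim_col f then f $$ (i, j) else 0
     else if j < dim_col f then 0 else g $$ (i - dim_row f, j - dim_col f))"
  using assms by (auto simp: diag_sum_def)

text \<open>Block sums are associative on the nose, and with them sums of modules and of complexes;
  rebracketing below is plain rewriting. The entries are compared block by block.\<close>

lemma diag_sum_assoc: "diag_sum (diag_sum f g) h = diag_sum f (diag_sum g h)"
proof (rule eq_matI)
  fix i j assume "i < dim_row (diag_sum f (diag_sum g h))" "j < dim_col (diag_sum f (diag_sum g h))"
  then have ij: "i < dim_row f + (dim_row g + dim_row h)" "j < dim_col f + (dim_col g + dim_col h)"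
    by simp_all
  have b: "a < r + s \<longleftrightarrow> a < r \<or> a - r < s" "a < r + (s + t) \<Longrightarrow> \<not> a < r \<Longrightarrow> a - r < s + t"
    "a < r + (s + t) \<longleftrightarrow> a < (r + s) + t"
    for a r s t :: nat by auto
  show "diag_sum (diag_sum f g) h $$ (i, j) = diag_sum f (diag_sum g h) $$ (i, j)"
    using ij b(2)[OF ij(1)] b(2)[OF ij(2)]
    by (cases "i < dim_row f"; cases "j < dim_col f"; cases "i - dim_row f < dim_row g";
        cases "j - dim_col f < dim_col g")
      (simp_all add: diag_sum_index b(1)[of i "dim_row f" "dim_row g"] b(1)[of j "dim_col f" "dim_col g"]
        b(3) diff_diff_left)
qed simp_all

lemma diag_sum_zero_left [simp]: "diag_sum (0\<^sub>m 0 0) g = g"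
  by (rule eq_matI) (auto simp: diag_sum_index)

lemma diag_sum_zero [simp]: "diag_sum (0\<^sub>m a b) (0\<^sub>m c d) = 0\<^sub>m (a + c) (b + d)"
  by (rule eq_matI) (auto simp: diag_sum_index)

lemma diag_sum_uminus: "- diag_sum f g = diag_sum (- f) (- g)"
  by (rule eq_matI) (auto simp: diag_sum_index)

lemma diag_sum_one: "diag_sum (1\<^sub>m a) (1\<^sub>m b) = 1\<^sub>m (a + b)"
  by (rule eq_matI) (auto simp: diag_sum_index)

lemma diag_sum_add:
  "a \<in> carrier_mat m n \<Longrightarrow> b \<in> carrier_mat m n \<Longrightarrow> c \<in> carrier_mat p q \<Longrightarrow> d \<in> carrier_mat p q \<Longrightarrow>
   diag_sum (a + b) (c + d) = diag_sum a c + diag_sum b d"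
  by (rule eq_matI) (auto simp: diag_sum_index)

lemma diag_sum_smult: "diag_sum (c \<cdot>\<^sub>m a) (c \<cdot>\<^sub>m b) = c \<cdot>\<^sub>m diag_sum a b"
  by (rule eq_matI) (auto simp: diag_sum_index)

lemma diag_sum_mult_vec:
  assumes "f \<in> carrier_mat a b" "g \<in> carrier_mat c d" "x \<in> carrier_vec b" "y \<in> carrier_vec d"
  shows "diag_sum f g *\<^sub>v (x @\<^sub>v y) = (f *\<^sub>v x) @\<^sub>v (g *\<^sub>v y)"
proof -
  have "f *\<^sub>v x + 0\<^sub>m a d *\<^sub>v y = f *\<^sub>v x" "0\<^sub>m c b *\<^sub>v x + g *\<^sub>v y = g *\<^sub>v y"
    using assms by (auto intro!: eq_vecI)
  then show ?thesis
    using four_block_mat_mult_vec[OF assms(1) zero_carrier_mat zero_carrier_mat assms(2-4)] assms(1,2)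
    by (simp add: diag_sum_def)
qed

lemma vec_append_cases:
  assumes "x \<in> carrier_vec (a + b)"
  obtains y z where "y \<in> carrier_vec a" "z \<in> carrier_vec b" "x = y @\<^sub>v z"
  using assms vec_first_last_append[of x a b] vec_first_carrier vec_last_carrier by metis

lemma mat_eqI_append:
  fixes F G :: "'k :: field mat"
  assumes "F \<in> carrier_mat m (a + b)" "G \<in> carrier_mat m (a + b)"
    and "\<And>x y. x \<in> carrier_vec a \<Longrightarrow> y \<in> carrier_vec b \<Longrightarrow> F *\<^sub>v (x @\<^sub>v y) = G *\<^sub>v (x @\<^sub>v y)"
  shows "F = G"
  by (rule mat_eqI_vec[OF assms(1,2)]) (metis assms(3) vec_append_cases)

lemma diag_sum_mult:
  fixes f g f' g' :: "'k :: field mat"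
  assumes "f \<in> carrier_mat a b" "g \<in> carrier_mat c d" "f' \<in> carrier_mat b p" "g' \<in> carrier_mat d q"
  shows "diag_sum f g * diag_sum f' g' = diag_sum (f * f') (g * g')"
proof (rule mat_eqI_append)
  have c: "diag_sum f g \<in> carrier_mat (a + c) (b + d)" "diag_sum f' g' \<in> carrier_mat (b + d) (p + q)"
    using assms by auto
  show "diag_sum f g * diag_sum f' g' \<in> carrier_mat (a + c) (p + q)" using c by simp
  show "diag_sum (f * f') (g * g') \<in> carrier_mat (a + c) (p + q)" using assms by simp
  fix x y :: "'k vec" assume xy: "x \<in> carrier_vec p" "y \<in> carrier_vec q"
  have "diag_sum f g * diag_sum f' g' *\<^sub>v (x @\<^sub>v y) = (f *\<^sub>v (f' *\<^sub>v x)) @\<^sub>v (g *\<^sub>v (g' *\<^sub>v y))"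
    using assms xy
    by (simp add: assoc_mult_mat_vec[OF c] diag_sum_mult_vec[OF assms(3,4)] diag_sum_mult_vec[OF assms(1,2)])
  also have "\<dots> = diag_sum (f * f') (g * g') *\<^sub>v (x @\<^sub>v y)"
    using assms xy
    by (simp add: diag_sum_mult_vec[OF mult_carrier_mat[OF assms(1,3)] mult_carrier_mat[OF assms(2,4)]])
  finally show "diag_sum f g * diag_sum f' g' *\<^sub>v (x @\<^sub>v y) = diag_sum (f * f') (g * g') *\<^sub>v (x @\<^sub>v y)" .
qed

lemma mod_sum_simps [simp]:
  "vdim (mod_sum M N) = vdim M + vdim N" "act (mod_sum M N) a = diag_sum (act M a) (act N a)"
  by (simp_all add: mod_sum_def)

lemma is_moduleD:
  assumes "is_module A M" "x \<in> carrier A"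
  shows "act M x \<in> carrier_mat (vdim M) (vdim M)"
    "y \<in> carrier A \<Longrightarrow> act M (x \<oplus>\<^bsub>A\<^esub> y) = act M x + act M y"
    "act M (c \<odot>\<^bsub>A\<^esub> x) = c \<cdot>\<^sub>m act M x"
    "y \<in> carrier A \<Longrightarrow> act M (x \<otimes>\<^bsub>A\<^esub> y) = act M x * act M y"
    "act M \<one>\<^bsub>A\<^esub> = 1\<^sub>m (vdim M)"
  using assms by (auto simp: is_module_def)

lemma is_module_mod_sum:
  assumes M: "is_module A M" and N: "is_module A N"
  shows "is_module A (mod_sum M N)"
  unfolding is_module_def mod_sum_simps
proof (intro conjI ballI allI)
  fix x y assume x: "x \<in> carrier A" and y: "y \<in> carrier A"
  show "diag_sum (act M (x \<oplus>\<^bsub>A\<^esub> y)) (act N (x \<oplus>\<^bsub>A\<^esub> y))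
      = diag_sum (act M x) (act N x) + diag_sum (act M y) (act N y)"
    using is_moduleD(2)[OF M x y] is_moduleD(2)[OF N x y]
      diag_sum_add[OF is_moduleD(1)[OF M x] is_moduleD(1)[OF M y] is_moduleD(1)[OF N x] is_moduleD(1)[OF N y]]
    by simp
  show "diag_sum (act M (x \<otimes>\<^bsub>A\<^esub> y)) (act N (x \<otimes>\<^bsub>A\<^esub> y))
      = diag_sum (act M x) (act N x) * diag_sum (act M y) (act N y)"
    using is_moduleD(4)[OF M x y] is_moduleD(4)[OF N x y]
      diag_sum_mult[OF is_moduleD(1)[OF M x] is_moduleD(1)[OF N x] is_moduleD(1)[OF M y] is_moduleD(1)[OF N y]]
    by simp
qed (use M N in \<open>auto simp: is_module_def diag_sum_smult diag_sum_one\<close>)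

lemma is_module_zero: "is_module A zero_mod"
  by (auto simp: is_module_def zero_mod_def intro!: eq_matI)

lemma vdim_zero_mod [simp]: "vdim zero_mod = 0"
  by (simp add: zero_mod_def)

lemma mod_hom_diag_sum:
  assumes f: "f \<in> mod_hom A M M'" and g: "g \<in> mod_hom A N N'"
    and m: "is_module A M" "is_module A M'" "is_module A N" "is_module A N'"
  shows "diag_sum f g \<in> mod_hom A (mod_sum M N) (mod_sum M' N')"
proof -
  have c: "f \<in> carrier_mat (vdim M') (vdim M)" "g \<in> carrier_mat (vdim N') (vdim N)"
    using f g by (auto simp: mod_hom_def)
  have "diag_sum f g * diag_sum (act M a) (act N a) = diag_sum (act M' a) (act N' a) * diag_sum f g"
    if a: "a \<in> carrier A" for a
    using diag_sum_mult[OF c is_moduleD(1)[OF m(1) a] is_moduleD(1)[OF m(3) a]]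
      diag_sum_mult[OF is_moduleD(1)[OF m(2) a] is_moduleD(1)[OF m(4) a] c] f g a
    by (simp add: mod_hom_def)
  then show ?thesis using c by (simp add: mod_hom_def)
qed

lemma mod_sum_assoc: "mod_sum (mod_sum L M) N = mod_sum L (mod_sum M N)"
  by (simp add: mod_sum_def diag_sum_assoc)

lemma mod_sum_zero_left [simp]: "mod_sum zero_mod M = M"
  by (simp add: mod_sum_def zero_mod_def)

lemma cpx_sum_simps [simp]:
  "cterm (cpx_sum X Y) n = mod_sum (cterm X n) (cterm Y n)"
  "cdiff (cpx_sum X Y) n = diag_sum (cdiff X n) (cdiff Y n)"
  by (simp_all add: cpx_sum_def)

lemma cpx_sum_assoc: "cpx_sum (cpx_sum X Y) Z = cpx_sum X (cpx_sum Y Z)"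
  by (simp add: cpx_sum_def diag_sum_assoc mod_sum_assoc)

lemma zero_cpx_simps [simp]: "cterm zero_cpx n = zero_mod" "cdiff zero_cpx n = 0\<^sub>m 0 0"
  by (simp_all add: zero_cpx_def stalk_def Let_def)

lemma cpx_sum_zero_left [simp]: "cpx_sum zero_cpx X = X"
  by (simp add: cpx_sum_def)

lemma bounded_cpx_sum:
  assumes X: "bounded_cpx A X" and Y: "bounded_cpx A Y"
  shows "bounded_cpx A (cpx_sum X Y)"
  unfolding bounded_cpx_def cpx_sum_simps
proof (intro conjI allI)
  fix n
  show "is_module A (mod_sum (cterm X n) (cterm Y n))"
    using X Y by (simp add: cterm_module is_module_mod_sum)
  show "diag_sum (cdiff X n) (cdiff Y n)
      \<in> mod_hom A (mod_sum (cterm X n) (cterm Y n)) (mod_sum (cterm X (n + 1)) (cterm Y (n + 1)))"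
    by (rule mod_hom_diag_sum) (use X Y in \<open>auto simp: bounded_cpx_def\<close>)
  have c: "cdiff W (n + 1) \<in> carrier_mat (cdim W (n + 2)) (cdim W (n + 1))"
    if "bounded_cpx A W" for W
    using cdiff_carrier[OF that, of "n + 1"] by (simp add: add.assoc)
  show "diag_sum (cdiff X (n + 1)) (cdiff Y (n + 1)) * diag_sum (cdiff X n) (cdiff Y n)
      = 0\<^sub>m (vdim (mod_sum (cterm X (n + 2)) (cterm Y (n + 2)))) (vdim (mod_sum (cterm X n) (cterm Y n)))"
    using diag_sum_mult[OF c[OF X] c[OF Y] cdiff_carrier[OF X] cdiff_carrier[OF Y]] X Y
    by (simp add: bounded_cpx_def)
next
  obtain b c where "\<forall>n. \<bar>n\<bar> > b \<longrightarrow> cdim X n = 0" "\<forall>n. \<bar>n\<bar> > c \<longrightarrow> cdim Y n = 0"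
    using X Y by (auto simp: bounded_cpx_def)
  then show "\<exists>b. \<forall>n. \<bar>n\<bar> > b \<longrightarrow> vdim (mod_sum (cterm X n) (cterm Y n)) = 0"
    by (intro exI[of _ "max b c"]) auto
qed

lemma chain_map_cpx_sum:
  assumes f: "chain_map A X X' f" and g: "chain_map A Y Y' g"
    and b: "bounded_cpx A X" "bounded_cpx A X'" "bounded_cpx A Y" "bounded_cpx A Y'"
  shows "chain_map A (cpx_sum X Y) (cpx_sum X' Y') (\<lambda>n. diag_sum (f n) (g n))"
  unfolding chain_map_def cpx_sum_simps
proof (intro conjI allI)
  fix n
  show "diag_sum (f n) (g n) \<in> mod_hom A (mod_sum (cterm X n) (cterm Y n)) (mod_sum (cterm X' n) (cterm Y' n))"
    by (rule mod_hom_diag_sum) (use f g b in \<open>auto simp: chain_map_def cterm_module\<close>)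
  show "diag_sum (f (n + 1)) (g (n + 1)) * diag_sum (cdiff X n) (cdiff Y n)
      = diag_sum (cdiff X' n) (cdiff Y' n) * diag_sum (f n) (g n)"
    using diag_sum_mult[OF chain_map_carrier[OF f] chain_map_carrier[OF g] cdiff_carrier[OF b(1)] cdiff_carrier[OF b(3)]]
      diag_sum_mult[OF cdiff_carrier[OF b(2)] cdiff_carrier[OF b(4)] chain_map_carrier[OF f] chain_map_carrier[OF g]]
      f g by (simp add: chain_map_def)
qed

lemma append_vec_zero: "0\<^sub>v a @\<^sub>v 0\<^sub>v b = 0\<^sub>v (a + b)"
  by (intro eq_vecI) auto

lemma append_vec_diff:
  assumes "v \<in> carrier_vec n" "v' \<in> carrier_vec n" "w \<in> carrier_vec m" "w' \<in> carrier_vec m"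
  shows "(v @\<^sub>v w) - (v' @\<^sub>v w') = (v - v') @\<^sub>v (w - w')"
  using assms by (intro eq_vecI) auto

lemma cocycles_cpx_sum:
  assumes "bounded_cpx A X" "bounded_cpx A Y" "x \<in> carrier_vec (cdim X n)" "y \<in> carrier_vec (cdim Y n)"
  shows "x @\<^sub>v y \<in> cocycles (cpx_sum X Y) n \<longleftrightarrow> x \<in> cocycles X n \<and> y \<in> cocycles Y n"
proof -
  have c: "cdiff X n *\<^sub>v x \<in> carrier_vec (cdim X (n + 1))"
    using cdiff_carrier[OF assms(1), of n] assms(3) by simp
  have "diag_sum (cdiff X n) (cdiff Y n) *\<^sub>v (x @\<^sub>v y) = (cdiff X n *\<^sub>v x) @\<^sub>v (cdiff Y n *\<^sub>v y)"
    by (rule diag_sum_mult_vec[OF cdiff_carrier[OF assms(1)] cdiff_carrier[OF assms(2)] assms(3,4)])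
  then show ?thesis
    using assms append_vec_eq[OF c zero_carrier_vec]
    by (simp add: cocycles_def append_vec_zero[symmetric])
qed

lemma coboundaries_cpx_sum:
  assumes X: "bounded_cpx A X" and Y: "bounded_cpx A Y"
    and xy: "x \<in> carrier_vec (cdim X n)" "y \<in> carrier_vec (cdim Y n)"
  shows "x @\<^sub>v y \<in> coboundaries (cpx_sum X Y) n \<longleftrightarrow> x \<in> coboundaries X n \<and> y \<in> coboundaries Y n"
proof -
  have m: "diag_sum (cdiff X (n - 1)) (cdiff Y (n - 1)) *\<^sub>v (a @\<^sub>v b)
      = (cdiff X (n - 1) *\<^sub>v a) @\<^sub>v (cdiff Y (n - 1) *\<^sub>v b)"
    if "a \<in> carrier_vec (cdim X (n - 1))" "b \<in> carrier_vec (cdim Y (n - 1))" for a b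
    by (rule diag_sum_mult_vec[OF cdiff_carrier[OF X] cdiff_carrier[OF Y] that])
  show ?thesis
  proof
    assume "x @\<^sub>v y \<in> coboundaries (cpx_sum X Y) n"
    then obtain v where v: "v \<in> carrier_vec (cdim X (n - 1) + cdim Y (n - 1))"
        "x @\<^sub>v y = diag_sum (cdiff X (n - 1)) (cdiff Y (n - 1)) *\<^sub>v v"
      by (auto simp: coboundaries_def)
    from v(1) obtain a b where ab: "a \<in> carrier_vec (cdim X (n - 1))" "b \<in> carrier_vec (cdim Y (n - 1))"
        "v = a @\<^sub>v b" by (rule vec_append_cases)
    have "x @\<^sub>v y = (cdiff X (n - 1) *\<^sub>v a) @\<^sub>v (cdiff Y (n - 1) *\<^sub>v b)"
      using v(2) m[OF ab(1,2)] ab(3) by simp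
    moreover have "cdiff X (n - 1) *\<^sub>v a \<in> carrier_vec (cdim X n)"
      using cdiff_prev_carrier[OF X, of n] ab(1) by simp
    ultimately have "x = cdiff X (n - 1) *\<^sub>v a" "y = cdiff Y (n - 1) *\<^sub>v b"
      using append_vec_eq[OF xy(1)] by auto
    then show "x \<in> coboundaries X n \<and> y \<in> coboundaries Y n"
      using coboundariesI[OF ab(1)] coboundariesI[OF ab(2)] by simp
  next
    assume "x \<in> coboundaries X n \<and> y \<in> coboundaries Y n"
    then obtain a b where ab: "a \<in> carrier_vec (cdim X (n - 1))" "b \<in> carrier_vec (cdim Y (n - 1))"
        "x = cdiff X (n - 1) *\<^sub>v a" "y = cdiff Y (n - 1) *\<^sub>v b" by (auto simp: coboundaries_def)
    have "a @\<^sub>v b \<in> carrier_vec (cdim (cpx_sum X Y) (n - 1))" using ab(1,2) by simp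
    from coboundariesI[OF this] show "x @\<^sub>v y \<in> coboundaries (cpx_sum X Y) n"
      using m[OF ab(1,2)] ab(3,4) by simp
  qed
qed

lemma quasi_iso_cpx_sum:
  assumes f: "quasi_iso A X X' f" and g: "quasi_iso A Y Y' g"
    and b: "bounded_cpx A X" "bounded_cpx A X'" "bounded_cpx A Y" "bounded_cpx A Y'"
  shows "quasi_iso A (cpx_sum X Y) (cpx_sum X' Y') (\<lambda>n. diag_sum (f n) (g n))"
proof (rule quasi_isoI)
  have fc: "chain_map A X X' f" and fi: "cohom_inj X X' f" and fs: "cohom_surj X X' f"
    using f quasi_iso_iff[OF b(1,2)] by auto
  have gc: "chain_map A Y Y' g" and gi: "cohom_inj Y Y' g" and gs: "cohom_surj Y Y' g"
    using g quasi_iso_iff[OF b(3,4)] by auto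
  show "bounded_cpx A (cpx_sum X Y)" "bounded_cpx A (cpx_sum X' Y')"
    using b bounded_cpx_sum by auto
  show "chain_map A (cpx_sum X Y) (cpx_sum X' Y') (\<lambda>n. diag_sum (f n) (g n))"
    by (rule chain_map_cpx_sum[OF fc gc b])
  have m: "diag_sum (f n) (g n) *\<^sub>v (x @\<^sub>v y) = (f n *\<^sub>v x) @\<^sub>v (g n *\<^sub>v y)"
    if "x \<in> carrier_vec (cdim X n)" "y \<in> carrier_vec (cdim Y n)" for x y n
    by (rule diag_sum_mult_vec[OF chain_map_carrier[OF fc] chain_map_carrier[OF gc] that])
  have fm: "f n *\<^sub>v x \<in> carrier_vec (cdim X' n)" if "x \<in> carrier_vec (cdim X n)" for n x
    using chain_map_carrier[OF fc] that by (rule mult_mat_vec_carrier)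
  have gm: "g n *\<^sub>v x \<in> carrier_vec (cdim Y' n)" if "x \<in> carrier_vec (cdim Y n)" for n x
    using chain_map_carrier[OF gc] that by (rule mult_mat_vec_carrier)
  {
    fix n v
    assume v: "v \<in> cocycles (cpx_sum X Y) n" and fv: "diag_sum (f n) (g n) *\<^sub>v v \<in> coboundaries (cpx_sum X' Y') n"
    from cocyclesD[OF v] obtain x y where xy: "x \<in> carrier_vec (cdim X n)" "y \<in> carrier_vec (cdim Y n)"
        "v = x @\<^sub>v y" by (auto elim: vec_append_cases)
    show "v \<in> coboundaries (cpx_sum X Y) n"
      using v fv fi gi unfolding xy(3) m[OF xy(1,2)] cohom_inj_def
        coboundaries_cpx_sum[OF b(2,4) fm[OF xy(1)] gm[OF xy(2)]] coboundaries_cpx_sum[OF b(1,3) xy(1,2)]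
        cocycles_cpx_sum[OF b(1,3) xy(1,2)] by blast
  next
    fix n v
    assume v: "v \<in> cocycles (cpx_sum X' Y') n"
    from cocyclesD[OF v] obtain x' y' where xy': "x' \<in> carrier_vec (cdim X' n)" "y' \<in> carrier_vec (cdim Y' n)"
        "v = x' @\<^sub>v y'" by (auto elim: vec_append_cases)
    have "x' \<in> cocycles X' n" "y' \<in> cocycles Y' n"
      using v unfolding xy'(3) cocycles_cpx_sum[OF b(2,4) xy'(1,2)] by auto
    then obtain x y where xy: "x \<in> cocycles X n" "f n *\<^sub>v x - x' \<in> coboundaries X' n"
        "y \<in> cocycles Y n" "g n *\<^sub>v y - y' \<in> coboundaries Y' n"
      using fs gs unfolding cohom_surj_def by metis
    note c = cocyclesD[OF xy(1)] cocyclesD[OF xy(3)]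
    have "x @\<^sub>v y \<in> cocycles (cpx_sum X Y) n"
      using cocycles_cpx_sum[OF b(1,3) c] xy(1,3) by simp
    moreover have "(f n *\<^sub>v x - x') @\<^sub>v (g n *\<^sub>v y - y') \<in> coboundaries (cpx_sum X' Y') n"
      using coboundaries_cpx_sum[OF b(2,4), of "f n *\<^sub>v x - x'" n "g n *\<^sub>v y - y'"]
        xy(2,4) xy'(1,2) fm[OF c(1)] gm[OF c(2)] by simp
    ultimately show "\<exists>v'\<in>cocycles (cpx_sum X Y) n. diag_sum (f n) (g n) *\<^sub>v v' - v \<in> coboundaries (cpx_sum X' Y') n"
      using m[OF c] append_vec_diff[OF fm[OF c(1)] xy'(1) gm[OF c(2)] xy'(2)] xy'(3) by metis
  }
qed

section \<open>Commutativity of direct sums\<close>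

definition swap_mat :: "nat \<Rightarrow> nat \<Rightarrow> 'k :: field mat" where
  "swap_mat a b = four_block_mat (0\<^sub>m b a) (1\<^sub>m b) (1\<^sub>m a) (0\<^sub>m a b)"

lemma swap_mat_carrier [simp]: "swap_mat a b \<in> carrier_mat (b + a) (a + b)"
  unfolding swap_mat_def by (rule four_block_carrier_mat) auto

lemma swap_mat_mult_vec:
  fixes x y :: "'k :: field vec"
  assumes "x \<in> carrier_vec a" "y \<in> carrier_vec b"
  shows "swap_mat a b *\<^sub>v (x @\<^sub>v y) = y @\<^sub>v x"
proof -
  have "0\<^sub>m b a *\<^sub>v x + 1\<^sub>m b *\<^sub>v y = y" "1\<^sub>m a *\<^sub>v x + 0\<^sub>m a b *\<^sub>v y = x"
    using assms by (auto intro!: eq_vecI)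
  then show ?thesis
    using four_block_mat_mult_vec[OF zero_carrier_mat one_carrier_mat one_carrier_mat zero_carrier_mat assms]
    by (simp add: swap_mat_def)
qed

text \<open>Applied to differentials this makes the exchange of summands a chain map, applied to
  actions a module homomorphism.\<close>

lemma swap_mat_diag_sum:
  fixes f g :: "'k :: field mat"
  assumes f: "f \<in> carrier_mat a b" and g: "g \<in> carrier_mat c d"
  shows "swap_mat a c * diag_sum f g = diag_sum g f * swap_mat b d"
proof (rule mat_eqI_append)
  have fg: "diag_sum f g \<in> carrier_mat (a + c) (b + d)" "diag_sum g f \<in> carrier_mat (c + a) (d + b)"
    using f g by auto
  show "swap_mat a c * diag_sum f g \<in> carrier_mat (c + a) (b + d)"
    by (rule mult_carrier_mat[OF swap_mat_carrier fg(1)])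
  show "diag_sum g f * swap_mat b d \<in> carrier_mat (c + a) (b + d)"
    by (rule mult_carrier_mat[OF fg(2) swap_mat_carrier])
  fix x y :: "'k vec" assume xy: "x \<in> carrier_vec b" "y \<in> carrier_vec d"
  have xy': "x @\<^sub>v y \<in> carrier_vec (b + d)" using xy by simp
  have c: "f *\<^sub>v x \<in> carrier_vec a" "g *\<^sub>v y \<in> carrier_vec c" using f g xy by auto
  show "swap_mat a c * diag_sum f g *\<^sub>v (x @\<^sub>v y) = diag_sum g f * swap_mat b d *\<^sub>v (x @\<^sub>v y)"
    unfolding assoc_mult_mat_vec[OF swap_mat_carrier fg(1) xy'] assoc_mult_mat_vec[OF fg(2) swap_mat_carrier xy']
      diag_sum_mult_vec[OF f g xy] swap_mat_mult_vec[OF xy] swap_mat_mult_vec[OF c]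
      diag_sum_mult_vec[OF g f xy(2,1)] ..
qed

lemma bij_betw_swap_mat:
  "bij_betw (\<lambda>x. swap_mat a b *\<^sub>v x) (carrier_vec (a + b)) (carrier_vec (b + a) :: 'k :: field vec set)"
proof (rule bij_betwI[where g = "\<lambda>x. swap_mat b a *\<^sub>v x"])
  fix x :: "'k vec"
  show "swap_mat b a *\<^sub>v (swap_mat a b *\<^sub>v x) = x" if "x \<in> carrier_vec (a + b)"
    using that by (auto elim!: vec_append_cases simp: swap_mat_mult_vec)
  show "swap_mat a b *\<^sub>v (swap_mat b a *\<^sub>v x) = x" if "x \<in> carrier_vec (b + a)"
    using that by (auto elim!: vec_append_cases simp: swap_mat_mult_vec)
qed (auto intro: mult_mat_vec_carrier[OF swap_mat_carrier])

lemma quasi_iso_swap: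
  assumes X: "bounded_cpx A X" and Y: "bounded_cpx A Y"
  shows "quasi_iso A (cpx_sum X Y) (cpx_sum Y X) (\<lambda>n. swap_mat (cdim X n) (cdim Y n))"
proof (rule chain_map_bij_quasi_iso[OF bounded_cpx_sum[OF X Y] bounded_cpx_sum[OF Y X]])
  show "chain_map A (cpx_sum X Y) (cpx_sum Y X) (\<lambda>n. swap_mat (cdim X n) (cdim Y n))"
    using swap_mat_diag_sum[OF cdiff_carrier[OF X] cdiff_carrier[OF Y]]
      swap_mat_diag_sum[OF is_moduleD(1)[OF cterm_module[OF X]] is_moduleD(1)[OF cterm_module[OF Y]]]
    by (simp add: chain_map_def mod_hom_def)
qed (simp add: bij_betw_swap_mat)

section \<open>Shifts\<close>

lemma cpx_shift_simps [simp]: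
  "cterm (cpx_shift m X) n = cterm X (n + m)"
  "cdiff (cpx_shift m X) n = (if even m then cdiff X (n + m) else - cdiff X (n + m))"
  by (simp_all add: cpx_shift_def)

lemma uminus_mult_vec_zero_iff:
  fixes F :: "'k :: field mat"
  assumes "F \<in> carrier_mat m n" "x \<in> carrier_vec n"
  shows "(- F) *\<^sub>v x = 0\<^sub>v m \<longleftrightarrow> F *\<^sub>v x = 0\<^sub>v m"
proof -
  have "(- F) *\<^sub>v x = - (F *\<^sub>v x)" using assms by simp
  moreover have "- (F *\<^sub>v x) = 0\<^sub>v m \<longleftrightarrow> F *\<^sub>v x = 0\<^sub>v m"
    using uminus_uminus_vec[of "F *\<^sub>v x"] by (metis uminus_zero_vec)
  ultimately show ?thesis by simp
qed

text \<open>The sign in the differential of a shift changes neither its kernel nor its image.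
  Cocycles and coboundaries are therefore equal as sets, and cohomological conditions transfer
  without computation.\<close>

lemma cocycles_shift:
  assumes X: "bounded_cpx A X"
  shows "cocycles (cpx_shift m X) n = cocycles X (n + m)"
proof -
  have e: "n + 1 + m = n + m + 1" by simp
  show ?thesis
    unfolding cocycles_def cpx_shift_simps e
    using uminus_mult_vec_zero_iff[OF cdiff_carrier[OF X, of "n + m"]] by auto
qed

lemma coboundaries_shift:
  assumes X: "bounded_cpx A X"
  shows "coboundaries (cpx_shift m X) n = coboundaries X (n + m)"
proof -
  have e: "n - 1 + m = n + m - 1" by simp
  let ?d = "cdiff X (n + m - 1)" and ?C = "carrier_vec (cdim X (n + m - 1))"
  have u: "(- ?d) *\<^sub>v x = ?d *\<^sub>v (- x)" if "x \<in> ?C" for x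
    using that cdiff_prev_carrier[OF X, of "n + m"] by (intro eq_vecI) auto
  have "(\<lambda>y. (- ?d) *\<^sub>v y) ` ?C = (\<lambda>y. ?d *\<^sub>v y) ` ?C"
  proof (intro equalityI image_subsetI)
    fix x :: "'b vec" assume x: "x \<in> ?C"
    show "(- ?d) *\<^sub>v x \<in> (\<lambda>y. ?d *\<^sub>v y) ` ?C"
      unfolding u[OF x] using x by (intro imageI) simp
    have "?d *\<^sub>v x = (- ?d) *\<^sub>v (- x)" using u[of "- x"] x by simp
    then show "?d *\<^sub>v x \<in> (\<lambda>y. (- ?d) *\<^sub>v y) ` ?C"
      using x by (metis (no_types, lifting) image_eqI uminus_carrier_vec)
  qed
  then show ?thesis
    unfolding coboundaries_def cpx_shift_simps e by simp
qed

lemma bounded_cpx_shift: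
  assumes X: "bounded_cpx A X"
  shows "bounded_cpx A (cpx_shift m X)"
  unfolding bounded_cpx_def cpx_shift_simps
proof (intro conjI allI)
  fix n
  have e: "n + 1 + m = n + m + 1" "n + 2 + m = n + m + 2" by auto
  let ?d = "cdiff X (n + m)" and ?d' = "cdiff X (n + m + 1)"
  have c: "?d \<in> carrier_mat (cdim X (n + m + 1)) (cdim X (n + m))"
    "?d' \<in> carrier_mat (cdim X (n + m + 2)) (cdim X (n + m + 1))"
    using cdiff_carrier[OF X, of "n + m"] cdiff_carrier[OF X, of "n + m + 1"]
    by (simp_all add: add.assoc)
  show "is_module A (cterm X (n + m))" using cterm_module[OF X] .
  have dm: "?d * act (cterm X (n + m)) a = act (cterm X (n + m + 1)) a * ?d" if "a \<in> carrier A" for a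
    using X that by (simp add: bounded_cpx_def mod_hom_def)
  have "(- ?d) * act (cterm X (n + m)) a = act (cterm X (n + m + 1)) a * (- ?d)"
    if a: "a \<in> carrier A" for a
    using is_moduleD(1)[OF cterm_module[OF X] a, of "n + m"]
      is_moduleD(1)[OF cterm_module[OF X] a, of "n + m + 1"] c dm[OF a]
    by simp
  then have "- ?d \<in> mod_hom A (cterm X (n + m)) (cterm X (n + m + 1))"
    using c by (simp add: mod_hom_def)
  then show "(if even m then cdiff X (n + m) else - cdiff X (n + m))
      \<in> mod_hom A (cterm X (n + m)) (cterm X (n + 1 + m))"
    using X unfolding e by (simp add: bounded_cpx_def)
  have z: "?d' * ?d = 0\<^sub>m (cdim X (n + m + 2)) (cdim X (n + m))"
    using X unfolding bounded_cpx_def by blast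
  have "(- ?d') * (- ?d) = ?d' * ?d" using c by simp
  then show "(if even m then cdiff X (n + 1 + m) else - cdiff X (n + 1 + m)) *
      (if even m then cdiff X (n + m) else - cdiff X (n + m)) = 0\<^sub>m (cdim X (n + 2 + m)) (cdim X (n + m))"
    unfolding e using z by simp
next
  obtain b where "\<forall>n. \<bar>n\<bar> > b \<longrightarrow> cdim X n = 0" using X by (auto simp: bounded_cpx_def)
  then show "\<exists>b. \<forall>n. \<bar>n\<bar> > b \<longrightarrow> cdim X (n + m) = 0"
    by (intro exI[of _ "b + \<bar>m\<bar>"]) auto
qed

lemma chain_map_shift:
  assumes f: "chain_map A X Y f" and X: "bounded_cpx A X" and Y: "bounded_cpx A Y"
  shows "chain_map A (cpx_shift m X) (cpx_shift m Y) (\<lambda>n. f (n + m))"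
  unfolding chain_map_def cpx_shift_simps
proof (intro conjI allI)
  fix n
  have e: "n + 1 + m = n + m + 1" by simp
  show "f (n + m) \<in> mod_hom A (cterm X (n + m)) (cterm Y (n + m))"
    using f by (simp add: chain_map_def)
  have "f (n + m + 1) * cdiff X (n + m) = cdiff Y (n + m) * f (n + m)"
    using f by (simp add: chain_map_def)
  then show "f (n + 1 + m) * (if even m then cdiff X (n + m) else - cdiff X (n + m)) =
      (if even m then cdiff Y (n + m) else - cdiff Y (n + m)) * f (n + m)"
    using chain_map_carrier[OF f, of "n + m"] chain_map_carrier[OF f, of "n + m + 1"]
      cdiff_carrier[OF X, of "n + m"] cdiff_carrier[OF Y, of "n + m"]
    unfolding e by simp
qed

lemma quasi_iso_shift:
  assumes f: "quasi_iso A X Y f" and X: "bounded_cpx A X" and Y: "bounded_cpx A Y"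
  shows "quasi_iso A (cpx_shift m X) (cpx_shift m Y) (\<lambda>n. f (n + m))"
  using f chain_map_shift[of A X Y f m, OF _ X Y]
  unfolding quasi_iso_iff[OF X Y] quasi_iso_iff[OF bounded_cpx_shift[OF X] bounded_cpx_shift[OF Y]]
    cohom_inj_def cohom_surj_def cocycles_shift[OF X] cocycles_shift[OF Y]
    coboundaries_shift[OF X] coboundaries_shift[OF Y]
  by blast

section \<open>Stalk complexes\<close>

lemma stalk_simps:
  "cterm (stalk M) n = (if n = 0 then M else zero_mod)"
  "cdiff (stalk M) n = 0\<^sub>m (cdim (stalk M) (n + 1)) (cdim (stalk M) n)"
  by (simp_all add: stalk_def Let_def)

lemma bounded_stalk:
  assumes "is_module A M"
  shows "bounded_cpx A (stalk M)"
proof -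
  have m: "is_module A (cterm (stalk M) n)" for n
    using assms by (simp add: stalk_simps is_module_zero)
  have "0\<^sub>m (cdim (stalk M) (n + 1)) (cdim (stalk M) n) \<in> mod_hom A (cterm (stalk M) n) (cterm (stalk M) (n + 1))" for n
    using is_moduleD(1)[OF m, of _ n] is_moduleD(1)[OF m, of _ "n + 1"]
    by (simp add: mod_hom_def left_mult_zero_mat[OF is_moduleD(1)[OF m]] right_mult_zero_mat[OF is_moduleD(1)[OF m]])
  then show ?thesis
    using m by (auto simp: bounded_cpx_def stalk_simps(2) add.assoc) (auto simp: stalk_simps intro: exI[of _ 0])
qed

lemma bounded_zero_cpx: "bounded_cpx A zero_cpx"
  unfolding zero_cpx_def by (rule bounded_stalk[OF is_module_zero])

lemma cpx_sum_shift_stalk: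
  "cpx_sum (cpx_shift n (stalk M)) (cpx_shift n (stalk N)) = cpx_shift n (stalk (mod_sum M N))"
proof -
  have "cterm (cpx_sum (cpx_shift n (stalk M)) (cpx_shift n (stalk N))) k
      = cterm (cpx_shift n (stalk (mod_sum M N))) k" for k
    by (simp add: stalk_simps)
  moreover have "cdiff (cpx_sum (cpx_shift n (stalk M)) (cpx_shift n (stalk N))) k
      = cdiff (cpx_shift n (stalk (mod_sum M N))) k" for k
    by (simp add: stalk_simps diag_sum_uminus[symmetric])
  ultimately show ?thesis by (intro cpx.equality) auto
qed

section \<open>Mapping cones\<close>

lemma cone_simps [simp]:
  "cterm (cone X f Y) n = mod_sum (cterm X (n + 1)) (cterm Y n)"
  "cdiff (cone X f Y) n = four_block_mat (- cdiff X (n + 1)) (0\<^sub>m (cdim X (n + 2)) (cdim Y n)) (f (n + 1)) (cdiff Y n)"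
  by (simp_all add: cone_def)

lemma cone_diff_mult_vec:
  assumes X: "bounded_cpx A X" and Y: "bounded_cpx A Y" and f: "chain_map A X Y f"
    and x: "x \<in> carrier_vec (cdim X (n + 1))" and y: "y \<in> carrier_vec (cdim Y n)"
  shows "cdiff (cone X f Y) n *\<^sub>v (x @\<^sub>v y)
    = - (cdiff X (n + 1) *\<^sub>v x) @\<^sub>v (f (n + 1) *\<^sub>v x + cdiff Y n *\<^sub>v y)"
proof -
  have d: "cdiff X (n + 1) \<in> carrier_mat (cdim X (n + 2)) (cdim X (n + 1))"
    using cdiff_carrier[OF X, of "n + 1"] by (simp add: add.assoc)
  have "(- cdiff X (n + 1)) *\<^sub>v x + 0\<^sub>m (cdim X (n + 2)) (cdim Y n) *\<^sub>v y = - (cdiff X (n + 1) *\<^sub>v x)"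
    using d x y by (intro eq_vecI) auto
  then show ?thesis
    using four_block_mat_mult_vec[OF uminus_carrier_mat[OF d] zero_carrier_mat
      chain_map_carrier[OF f] cdiff_carrier[OF Y] x y] by simp
qed

lemma cone_diff_carrier:
  assumes X: "bounded_cpx A X" and Y: "bounded_cpx A Y" and f: "chain_map A X Y f"
  shows "cdiff (cone X f Y) n \<in> carrier_mat (cdim (cone X f Y) (n + 1)) (cdim (cone X f Y) n)"
proof -
  have d: "cdiff X (n + 1) \<in> carrier_mat (cdim X (n + 2)) (cdim X (n + 1))"
    using cdiff_carrier[OF X, of "n + 1"] by (simp add: add.assoc)
  show ?thesis
    using four_block_carrier_mat[OF uminus_carrier_mat[OF d] cdiff_carrier[OF Y]]
    by (simp add: add.assoc)
qed

lemma uminus_mult_vec: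
  fixes F :: "'k :: field mat"
  assumes "F \<in> carrier_mat m n" "x \<in> carrier_vec n"
  shows "F *\<^sub>v (- x) = - (F *\<^sub>v x)"
  using assms by (intro eq_vecI) auto

lemma mod_hom_vec:
  assumes "f \<in> mod_hom A M N" "is_module A M" "is_module A N" "a \<in> carrier A" "x \<in> carrier_vec (vdim M)"
  shows "f *\<^sub>v (act M a *\<^sub>v x) = act N a *\<^sub>v (f *\<^sub>v x)"
proof -
  have f: "f \<in> carrier_mat (vdim N) (vdim M)" "f * act M a = act N a * f"
    using assms by (auto simp: mod_hom_def)
  show ?thesis
    using assoc_mult_mat_vec[OF f(1) is_moduleD(1)[OF assms(2,4)] assms(5)]
      assoc_mult_mat_vec[OF is_moduleD(1)[OF assms(3,4)] f(1) assms(5)] f(2) by simp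
qed

lemma mod_homI:
  fixes f :: "'k :: field mat"
  assumes "f \<in> carrier_mat (vdim N) (vdim M)" "is_module A M" "is_module A N"
    and "\<And>a x. a \<in> carrier A \<Longrightarrow> x \<in> carrier_vec (vdim M) \<Longrightarrow> f *\<^sub>v (act M a *\<^sub>v x) = act N a *\<^sub>v (f *\<^sub>v x)"
  shows "f \<in> mod_hom A M N"
proof -
  have "f * act M a = act N a * f" if a: "a \<in> carrier A" for a
  proof (rule mat_eqI_vec)
    note m = is_moduleD(1)[OF assms(2) a] is_moduleD(1)[OF assms(3) a]
    show "f * act M a \<in> carrier_mat (vdim N) (vdim M)" using assms(1) m(1) by (rule mult_carrier_mat)
    show "act N a * f \<in> carrier_mat (vdim N) (vdim M)" using m(2) assms(1) by (rule mult_carrier_mat)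
    show "f * act M a *\<^sub>v x = act N a * f *\<^sub>v x" if "x \<in> carrier_vec (vdim M)" for x
      using assoc_mult_mat_vec[OF assms(1) m(1) that] assoc_mult_mat_vec[OF m(2) assms(1) that]
        assms(4)[OF a that] by simp
  qed
  then show ?thesis using assms(1) by (simp add: mod_hom_def)
qed

lemma chain_mapI:
  assumes X: "bounded_cpx A X" and Y: "bounded_cpx A Y"
    and f: "\<And>n. f n \<in> mod_hom A (cterm X n) (cterm Y n)"
    and "\<And>n x. x \<in> carrier_vec (cdim X n) \<Longrightarrow> f (n + 1) *\<^sub>v (cdiff X n *\<^sub>v x) = cdiff Y n *\<^sub>v (f n *\<^sub>v x)"
  shows "chain_map A X Y f"
proof -
  have fc: "f n \<in> carrier_mat (cdim Y n) (cdim X n)" for n using f[of n] by (auto simp: mod_hom_def)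
  have "f (n + 1) * cdiff X n = cdiff Y n * f n" for n
  proof (rule mat_eqI_vec)
    show "f (n + 1) * cdiff X n \<in> carrier_mat (cdim Y (n + 1)) (cdim X n)"
      using fc cdiff_carrier[OF X] by (rule mult_carrier_mat)
    show "cdiff Y n * f n \<in> carrier_mat (cdim Y (n + 1)) (cdim X n)"
      using cdiff_carrier[OF Y] fc by (rule mult_carrier_mat)
    show "f (n + 1) * cdiff X n *\<^sub>v x = cdiff Y n * f n *\<^sub>v x" if "x \<in> carrier_vec (cdim X n)" for x
      using assoc_mult_mat_vec[OF fc cdiff_carrier[OF X] that]
        assoc_mult_mat_vec[OF cdiff_carrier[OF Y] fc that] assms(4)[OF that] by simp
  qed
  then show ?thesis using f by (simp add: chain_map_def)
qed

lemma bounded_cone: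
  fixes X Y :: "('a, 'k :: field) cpx"
  assumes X: "bounded_cpx A X" and Y: "bounded_cpx A Y" and f: "chain_map A X Y f"
  shows "bounded_cpx A (cone X f Y)"
  unfolding bounded_cpx_def
proof (intro conjI allI)
  fix n
  let ?C = "cone X f Y"
  have mod: "is_module A (cterm ?C n)" for n
    using X Y by (simp add: cterm_module is_module_mod_sum)
  show "is_module A (cterm ?C n)" by (rule mod)
  have dx: "cdiff X k *\<^sub>v x \<in> carrier_vec (cdim X (k + 1))" if "x \<in> carrier_vec (cdim X k)" for k x
    using cdiff_carrier[OF X] that by (rule mult_mat_vec_carrier)
  have dy: "cdiff Y k *\<^sub>v x \<in> carrier_vec (cdim Y (k + 1))" if "x \<in> carrier_vec (cdim Y k)" for k x
    using cdiff_carrier[OF Y] that by (rule mult_mat_vec_carrier)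
  have fx: "f k *\<^sub>v x \<in> carrier_vec (cdim Y k)" if "x \<in> carrier_vec (cdim X k)" for k x
    using chain_map_carrier[OF f] that by (rule mult_mat_vec_carrier)
  have e: "n + 1 + 1 = n + 2" by simp
  show "cdiff ?C n \<in> mod_hom A (cterm ?C n) (cterm ?C (n + 1))"
  proof (rule mod_homI[OF cone_diff_carrier[OF X Y f] mod mod])
    fix a and v :: "'k vec" assume a: "a \<in> carrier A" and "v \<in> carrier_vec (cdim ?C n)"
    then have "v \<in> carrier_vec (cdim X (n + 1) + cdim Y n)" by simp
    then obtain x y where v: "x \<in> carrier_vec (cdim X (n + 1))" "y \<in> carrier_vec (cdim Y n)" "v = x @\<^sub>v y"
      by (rule vec_append_cases)
    note mX = is_moduleD(1)[OF cterm_module[OF X] a] and mY = is_moduleD(1)[OF cterm_module[OF Y] a]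
    have ax: "act (cterm X (n + 1)) a *\<^sub>v x \<in> carrier_vec (cdim X (n + 1))"
      using mX v(1) by (rule mult_mat_vec_carrier)
    have ay: "act (cterm Y n) a *\<^sub>v y \<in> carrier_vec (cdim Y n)"
      using mY v(2) by (rule mult_mat_vec_carrier)
    have hX: "cdiff X (n + 1) *\<^sub>v (act (cterm X (n + 1)) a *\<^sub>v x)
        = act (cterm X (n + 2)) a *\<^sub>v (cdiff X (n + 1) *\<^sub>v x)"
      using mod_hom_vec[of "cdiff X (n + 1)" A "cterm X (n + 1)" "cterm X (n + 2)" a x] X a v(1)
      unfolding bounded_cpx_def e[symmetric] by blast
    have hY: "cdiff Y n *\<^sub>v (act (cterm Y n) a *\<^sub>v y) = act (cterm Y (n + 1)) a *\<^sub>v (cdiff Y n *\<^sub>v y)"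
      using mod_hom_vec[of "cdiff Y n" A "cterm Y n" "cterm Y (n + 1)" a y] Y a v(2)
      unfolding bounded_cpx_def by blast
    have hf: "f (n + 1) *\<^sub>v (act (cterm X (n + 1)) a *\<^sub>v x) = act (cterm Y (n + 1)) a *\<^sub>v (f (n + 1) *\<^sub>v x)"
      using mod_hom_vec[of "f (n + 1)" A "cterm X (n + 1)" "cterm Y (n + 1)" a x] X Y f a v(1)
      unfolding bounded_cpx_def chain_map_def by blast
    have d2: "cdiff X (n + 1) *\<^sub>v x \<in> carrier_vec (cdim X (n + 2))" using dx[OF v(1)] unfolding e .
    have "cdiff ?C n *\<^sub>v (act (cterm ?C n) a *\<^sub>v v)
        = cdiff ?C n *\<^sub>v ((act (cterm X (n + 1)) a *\<^sub>v x) @\<^sub>v (act (cterm Y n) a *\<^sub>v y))"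
      using diag_sum_mult_vec[OF mX mY v(1,2)] v(3) by simp
    also have "\<dots> = - (act (cterm X (n + 2)) a *\<^sub>v (cdiff X (n + 1) *\<^sub>v x)) @\<^sub>v
        (act (cterm Y (n + 1)) a *\<^sub>v (f (n + 1) *\<^sub>v x) + act (cterm Y (n + 1)) a *\<^sub>v (cdiff Y n *\<^sub>v y))"
      using cone_diff_mult_vec[OF X Y f ax ay] hX hY hf by simp
    also have "\<dots> = (act (cterm X (n + 2)) a *\<^sub>v (- (cdiff X (n + 1) *\<^sub>v x))) @\<^sub>v
        (act (cterm Y (n + 1)) a *\<^sub>v (f (n + 1) *\<^sub>v x + cdiff Y n *\<^sub>v y))"
      using uminus_mult_vec[OF mX d2] mult_add_distrib_mat_vec[OF mY fx[OF v(1)] dy[OF v(2)]] by simp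
    also have "\<dots> = act (cterm ?C (n + 1)) a *\<^sub>v (cdiff ?C n *\<^sub>v v)"
      using diag_sum_mult_vec[OF mX[of "n + 2"] mY[of "n + 1"], of "- (cdiff X (n + 1) *\<^sub>v x)"
          "f (n + 1) *\<^sub>v x + cdiff Y n *\<^sub>v y"] cone_diff_mult_vec[OF X Y f v(1,2)] v(3) d2 fx[OF v(1)] dy[OF v(2)]
      by (simp add: add.assoc)
    finally show "cdiff ?C n *\<^sub>v (act (cterm ?C n) a *\<^sub>v v) = act (cterm ?C (n + 1)) a *\<^sub>v (cdiff ?C n *\<^sub>v v)" .
  qed
  show "cdiff ?C (n + 1) * cdiff ?C n = 0\<^sub>m (cdim ?C (n + 2)) (cdim ?C n)"
  proof (rule mat_eqI_append[where a = "cdim X (n + 1)" and b = "cdim Y n"])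
    have c: "cdiff ?C (n + 1) \<in> carrier_mat (cdim ?C (n + 2)) (cdim ?C (n + 1))"
      using cone_diff_carrier[OF X Y f, of "n + 1"] unfolding e .
    show "cdiff ?C (n + 1) * cdiff ?C n \<in> carrier_mat (cdim ?C (n + 2)) (cdim X (n + 1) + cdim Y n)"
      using mult_carrier_mat[OF c cone_diff_carrier[OF X Y f]] by simp
    show "0\<^sub>m (cdim ?C (n + 2)) (cdim ?C n) \<in> carrier_mat (cdim ?C (n + 2)) (cdim X (n + 1) + cdim Y n)"
      by simp
    fix x y :: "'k vec" assume x: "x \<in> carrier_vec (cdim X (n + 1))" and y: "y \<in> carrier_vec (cdim Y n)"
    have d2: "cdiff X (n + 1) *\<^sub>v x \<in> carrier_vec (cdim X (n + 1 + 1))" by (rule dx[OF x])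
    have m: "- (cdiff X (n + 1) *\<^sub>v x) \<in> carrier_vec (cdim X (n + 1 + 1))" using d2 by simp
    have s: "f (n + 1) *\<^sub>v x + cdiff Y n *\<^sub>v y \<in> carrier_vec (cdim Y (n + 1))"
      using fx[OF x] dy[OF y] by simp
    have "cdiff ?C (n + 1) *\<^sub>v (cdiff ?C n *\<^sub>v (x @\<^sub>v y)) =
       - (cdiff X (n + 1 + 1) *\<^sub>v (- (cdiff X (n + 1) *\<^sub>v x))) @\<^sub>v
        (f (n + 1 + 1) *\<^sub>v (- (cdiff X (n + 1) *\<^sub>v x)) + cdiff Y (n + 1) *\<^sub>v (f (n + 1) *\<^sub>v x + cdiff Y n *\<^sub>v y))"
      unfolding cone_diff_mult_vec[OF X Y f x y] cone_diff_mult_vec[OF X Y f m s] ..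
    also have "cdiff X (n + 1 + 1) *\<^sub>v (- (cdiff X (n + 1) *\<^sub>v x)) = 0\<^sub>v (cdim X (n + 3))"
      using uminus_mult_vec[OF cdiff_carrier[OF X] d2] cdiff_cdiff[OF X x] by (simp add: add.assoc)
    also have "f (n + 1 + 1) *\<^sub>v (- (cdiff X (n + 1) *\<^sub>v x)) = - (cdiff Y (n + 1) *\<^sub>v (f (n + 1) *\<^sub>v x))"
      using uminus_mult_vec[OF chain_map_carrier[OF f] d2] chain_map_vec[OF f X Y x] by simp
    also have "cdiff Y (n + 1) *\<^sub>v (f (n + 1) *\<^sub>v x + cdiff Y n *\<^sub>v y) = cdiff Y (n + 1) *\<^sub>v (f (n + 1) *\<^sub>v x)"
      using mult_add_distrib_mat_vec[OF cdiff_carrier[OF Y] fx[OF x] dy[OF y]] cdiff_cdiff[OF Y y]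
        dy[OF fx[OF x]] by (simp add: add.assoc)
    also have "- (cdiff Y (n + 1) *\<^sub>v (f (n + 1) *\<^sub>v x)) + cdiff Y (n + 1) *\<^sub>v (f (n + 1) *\<^sub>v x)
        = 0\<^sub>v (cdim Y (n + 2))"
      using dy[OF fx[OF x]] by (simp add: add.assoc)
    also have "- (0\<^sub>v (cdim X (n + 3)) :: 'k vec) @\<^sub>v 0\<^sub>v (cdim Y (n + 2)) = 0\<^sub>v (cdim ?C (n + 2))"
      by (simp add: append_vec_zero add.assoc uminus_zero_vec)
    finally have z: "cdiff ?C (n + 1) *\<^sub>v (cdiff ?C n *\<^sub>v (x @\<^sub>v y)) = 0\<^sub>v (cdim ?C (n + 2))" .
    have xy: "x @\<^sub>v y \<in> carrier_vec (cdim ?C n)" using x y by simp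
    show "cdiff ?C (n + 1) * cdiff ?C n *\<^sub>v (x @\<^sub>v y) = 0\<^sub>m (cdim ?C (n + 2)) (cdim ?C n) *\<^sub>v (x @\<^sub>v y)"
      unfolding assoc_mult_mat_vec[OF c cone_diff_carrier[OF X Y f] xy] z
      using xy by (intro eq_vecI) simp_all
  qed
next
  obtain b c where "\<forall>n. \<bar>n\<bar> > b \<longrightarrow> cdim X n = 0" "\<forall>n. \<bar>n\<bar> > c \<longrightarrow> cdim Y n = 0"
    using X Y by (auto simp: bounded_cpx_def)
  then show "\<exists>b. \<forall>n. \<bar>n\<bar> > b \<longrightarrow> cdim (cone X f Y) n = 0"
    by (intro exI[of _ "max b c + 1"]) auto
qed

lemma cone_in_mult_vec:
  fixes X Y :: "('a, 'k :: field) cpx"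
  assumes "y \<in> carrier_vec (cdim Y n)"
  shows "cone_in X Y n *\<^sub>v y = 0\<^sub>v (cdim X (n + 1)) @\<^sub>v y"
proof (rule eq_vecI)
  fix i assume "i < dim_vec (0\<^sub>v (cdim X (n + 1)) @\<^sub>v y)"
  then have i: "i < cdim X (n + 1) + cdim Y n" using assms by simp
  have "(cone_in X Y n *\<^sub>v y) $ i = (\<Sum>j = 0..<cdim Y n. (if i = cdim X (n + 1) + j then 1 else 0) * y $ j)"
    using i assms by (simp add: cone_in_def scalar_prod_def)
  also have "\<dots> = (\<Sum>j = 0..<cdim Y n. if j = i - cdim X (n + 1) \<and> cdim X (n + 1) \<le> i then y $ j else 0)"
    by (intro sum.cong) auto
  also have "\<dots> = (0\<^sub>v (cdim X (n + 1)) @\<^sub>v y) $ i"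
    using i assms by (cases "cdim X (n + 1) \<le> i") auto
  finally show "(cone_in X Y n *\<^sub>v y) $ i = (0\<^sub>v (cdim X (n + 1)) @\<^sub>v y) $ i" .
qed (use assms in \<open>simp add: cone_in_def\<close>)

lemma cone_out_mult_vec:
  fixes X Y :: "('a, 'k :: field) cpx"
  assumes "x \<in> carrier_vec (cdim X (n + 1))" "y \<in> carrier_vec (cdim Y n)"
  shows "cone_out X Y n *\<^sub>v (x @\<^sub>v y) = x"
proof (rule eq_vecI)
  fix i assume "i < dim_vec x"
  then have i: "i < cdim X (n + 1)" using assms by simp
  have "(cone_out X Y n *\<^sub>v (x @\<^sub>v y)) $ i
      = (\<Sum>j = 0..<cdim X (n + 1) + cdim Y n. (if i = j then 1 else 0) * (x @\<^sub>v y) $ j)"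
    using i assms by (simp add: cone_out_def scalar_prod_def)
  also have "\<dots> = (\<Sum>j = 0..<cdim X (n + 1) + cdim Y n. if j = i then (x @\<^sub>v y) $ j else 0)"
    by (intro sum.cong) auto
  also have "\<dots> = x $ i" using i assms by simp
  finally show "(cone_out X Y n *\<^sub>v (x @\<^sub>v y)) $ i = x $ i" .
qed (use assms in \<open>simp add: cone_out_def\<close>)

lemma cone_in_chain_map:
  fixes X Y :: "('a, 'k :: field) cpx"
  assumes X: "bounded_cpx A X" and Y: "bounded_cpx A Y" and f: "chain_map A X Y f"
  shows "chain_map A Y (cone X f Y) (cone_in X Y)"
proof (rule chain_mapI[OF Y bounded_cone[OF X Y f]])
  have c: "cone_in X Y n \<in> carrier_mat (cdim (cone X f Y) n) (cdim Y n)" for n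
    by (simp add: cone_in_def)
  show "cone_in X Y n \<in> mod_hom A (cterm Y n) (cterm (cone X f Y) n)" for n
  proof (rule mod_homI[OF c cterm_module[OF Y] cterm_module[OF bounded_cone[OF X Y f]]])
    fix a and y :: "'k vec" assume a: "a \<in> carrier A" and y: "y \<in> carrier_vec (cdim Y n)"
    note mX = is_moduleD(1)[OF cterm_module[OF X] a] and mY = is_moduleD(1)[OF cterm_module[OF Y] a]
    have ay: "act (cterm Y n) a *\<^sub>v y \<in> carrier_vec (cdim Y n)"
      using mY y by (rule mult_mat_vec_carrier)
    show "cone_in X Y n *\<^sub>v (act (cterm Y n) a *\<^sub>v y) = act (cterm (cone X f Y) n) a *\<^sub>v (cone_in X Y n *\<^sub>v y)"
      using diag_sum_mult_vec[OF mX mY zero_carrier_vec y] mult_mat_vec_zero[OF mX]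
      by (simp add: cone_in_mult_vec[OF y] cone_in_mult_vec[OF ay])
  qed
  fix n and y :: "'k vec" assume y: "y \<in> carrier_vec (cdim Y n)"
  have dy: "cdiff Y n *\<^sub>v y \<in> carrier_vec (cdim Y (n + 1))"
    using cdiff_carrier[OF Y] y by (rule mult_mat_vec_carrier)
  show "cone_in X Y (n + 1) *\<^sub>v (cdiff Y n *\<^sub>v y) = cdiff (cone X f Y) n *\<^sub>v (cone_in X Y n *\<^sub>v y)"
    unfolding cone_in_mult_vec[OF y] cone_in_mult_vec[OF dy] cone_diff_mult_vec[OF X Y f zero_carrier_vec y]
    using mult_mat_vec_zero[OF cdiff_carrier[OF X], of "n + 1"]
      mult_mat_vec_zero[OF chain_map_carrier[OF f], of "n + 1"] dy by simp
qed

lemma cone_out_chain_map: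
  fixes X Y :: "('a, 'k :: field) cpx"
  assumes X: "bounded_cpx A X" and Y: "bounded_cpx A Y" and f: "chain_map A X Y f"
  shows "chain_map A (cone X f Y) (cpx_shift 1 X) (cone_out X Y)"
proof (rule chain_mapI[OF bounded_cone[OF X Y f] bounded_cpx_shift[OF X]])
  have c: "cone_out X Y n \<in> carrier_mat (cdim (cpx_shift 1 X) n) (cdim (cone X f Y) n)" for n
    by (simp add: cone_out_def)
  show "cone_out X Y n \<in> mod_hom A (cterm (cone X f Y) n) (cterm (cpx_shift 1 X) n)" for n
  proof (rule mod_homI[OF c cterm_module[OF bounded_cone[OF X Y f]] cterm_module[OF bounded_cpx_shift[OF X]]])
    fix a and v :: "'k vec" assume a: "a \<in> carrier A" and "v \<in> carrier_vec (cdim (cone X f Y) n)"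
    then have "v \<in> carrier_vec (cdim X (n + 1) + cdim Y n)" by simp
    then obtain x y where v: "x \<in> carrier_vec (cdim X (n + 1))" "y \<in> carrier_vec (cdim Y n)" "v = x @\<^sub>v y"
      by (rule vec_append_cases)
    note mX = is_moduleD(1)[OF cterm_module[OF X] a] and mY = is_moduleD(1)[OF cterm_module[OF Y] a]
    have ax: "act (cterm X (n + 1)) a *\<^sub>v x \<in> carrier_vec (cdim X (n + 1))"
      using mX v(1) by (rule mult_mat_vec_carrier)
    have ay: "act (cterm Y n) a *\<^sub>v y \<in> carrier_vec (cdim Y n)"
      using mY v(2) by (rule mult_mat_vec_carrier)
    show "cone_out X Y n *\<^sub>v (act (cterm (cone X f Y) n) a *\<^sub>v v) = act (cterm (cpx_shift 1 X) n) a *\<^sub>v (cone_out X Y n *\<^sub>v v)"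
      using diag_sum_mult_vec[OF mX mY v(1,2)]
      by (simp add: v(3) cone_out_mult_vec[where n = n, OF v(1,2)] cone_out_mult_vec[where n = n, OF ax ay])
  qed
  fix n and v :: "'k vec" assume "v \<in> carrier_vec (cdim (cone X f Y) n)"
  then have "v \<in> carrier_vec (cdim X (n + 1) + cdim Y n)" by simp
  then obtain x y where v: "x \<in> carrier_vec (cdim X (n + 1))" "y \<in> carrier_vec (cdim Y n)" "v = x @\<^sub>v y"
    by (rule vec_append_cases)
  have dx: "- (cdiff X (n + 1) *\<^sub>v x) \<in> carrier_vec (cdim X (n + 1 + 1))"
    using mult_mat_vec_carrier[OF cdiff_carrier[OF X] v(1)] by simp
  have s: "f (n + 1) *\<^sub>v x + cdiff Y n *\<^sub>v y \<in> carrier_vec (cdim Y (n + 1))"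
    using mult_mat_vec_carrier[OF cdiff_carrier[OF Y] v(2)] mult_mat_vec_carrier[OF chain_map_carrier[OF f] v(1)]
    by simp
  show "cone_out X Y (n + 1) *\<^sub>v (cdiff (cone X f Y) n *\<^sub>v v) = cdiff (cpx_shift 1 X) n *\<^sub>v (cone_out X Y n *\<^sub>v v)"
    unfolding v(3) cone_diff_mult_vec[OF X Y f v(1,2)] cone_out_mult_vec[where n = n, OF v(1,2)]
      cone_out_mult_vec[where n = "n + 1", OF dx s]
    using v(1) cdiff_carrier[OF X, of "n + 1"] by simp
qed

text \<open>The block row \<open>(0, F)\<close>, given two empty lower blocks so that the product
  rule for four-block matrices applies.\<close>

definition drop_mat :: "nat \<Rightarrow> 'k :: field mat \<Rightarrow> 'k mat" where
  "drop_mat a F = four_block_mat (0\<^sub>m (dim_row F) a) F (0\<^sub>m 0 a) (0\<^sub>m 0 (dim_col F))"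

lemma vec_diff_add:
  fixes x y :: "'k :: field vec"
  assumes "x \<in> carrier_vec n" "y \<in> carrier_vec n"
  shows "x - y + y = x"
  using assms by (intro eq_vecI) auto

lemma drop_mat_carrier: "F \<in> carrier_mat m b \<Longrightarrow> drop_mat a F \<in> carrier_mat m (a + b)"
  by (auto simp: drop_mat_def)

lemma drop_mat_mult_vec:
  fixes F :: "'k :: field mat"
  assumes F: "F \<in> carrier_mat m b" and x: "x \<in> carrier_vec a" and y: "y \<in> carrier_vec b"
  shows "drop_mat a F *\<^sub>v (x @\<^sub>v y) = F *\<^sub>v y"
proof -
  have "drop_mat a F *\<^sub>v (x @\<^sub>v y) = (0\<^sub>m m a *\<^sub>v x + F *\<^sub>v y) @\<^sub>v (0\<^sub>m 0 a *\<^sub>v x + 0\<^sub>m 0 b *\<^sub>v y)"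
    using four_block_mat_mult_vec[OF zero_carrier_mat F zero_carrier_mat zero_carrier_mat x y] F
    by (simp add: drop_mat_def)
  also have "\<dots> = F *\<^sub>v y"
    using assms by (intro eq_vecI) auto
  finally show ?thesis .
qed

text \<open>For a degreewise short exact sequence \<open>0 -> X -> Y -> S -> 0\<close>, forgetting
  the component in \<open>X\<close> and applying \<open>q\<close> identifies the cone of
  \<open>f\<close> with \<open>S\<close>. This turns exact sequences of complexes into
  triangles.\<close>

lemma cone_exact_quasi_iso:
  fixes X Y S :: "('a, 'k :: field) cpx"
  assumes X: "bounded_cpx A X" and Y: "bounded_cpx A Y" and S: "bounded_cpx A S"
    and f: "chain_map A X Y f" and q: "chain_map A Y S q"
    and inj: "\<And>n x x'. x \<in> carrier_vec (cdim X n) \<Longrightarrow> x' \<in> carrier_vec (cdim X n) \<Longrightarrow>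
      f n *\<^sub>v x = f n *\<^sub>v x' \<Longrightarrow> x = x'"
    and surj: "\<And>n s. s \<in> carrier_vec (cdim S n) \<Longrightarrow> \<exists>y\<in>carrier_vec (cdim Y n). q n *\<^sub>v y = s"
    and qf: "\<And>n x. x \<in> carrier_vec (cdim X n) \<Longrightarrow> q n *\<^sub>v (f n *\<^sub>v x) = 0\<^sub>v (cdim S n)"
    and ex: "\<And>n y. y \<in> carrier_vec (cdim Y n) \<Longrightarrow> q n *\<^sub>v y = 0\<^sub>v (cdim S n) \<Longrightarrow>
      \<exists>x\<in>carrier_vec (cdim X n). f n *\<^sub>v x = y"
  shows "quasi_iso A (cone X f Y) S (\<lambda>n. drop_mat (cdim X (n + 1)) (q n))"
proof -
  let ?C = "cone X f Y" and ?g = "\<lambda>n. drop_mat (cdim X (n + 1)) (q n)"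
  note bC = bounded_cone[OF X Y f]
  note qc = chain_map_carrier[OF q] and fc = chain_map_carrier[OF f]
  note dXc = mult_mat_vec_carrier[OF cdiff_carrier[OF X]]
  note dYc = mult_mat_vec_carrier[OF cdiff_carrier[OF Y]]
  note dSc = mult_mat_vec_carrier[OF cdiff_carrier[OF S]]
  note fvc = mult_mat_vec_carrier[OF fc] and qvc = mult_mat_vec_carrier[OF qc]
  have split: "\<exists>x y. x \<in> carrier_vec (cdim X (n + 1)) \<and> y \<in> carrier_vec (cdim Y n) \<and> v = x @\<^sub>v y"
    if "v \<in> carrier_vec (cdim ?C n)" for n v
  proof -
    from that have "v \<in> carrier_vec (cdim X (n + 1) + cdim Y n)" by simp
    then show ?thesis by (rule vec_append_cases) blast
  qed
  have g: "?g n *\<^sub>v (x @\<^sub>v y) = q n *\<^sub>v y" if "x \<in> carrier_vec (cdim X (n + 1))" "y \<in> carrier_vec (cdim Y n)"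
    for n x y by (rule drop_mat_mult_vec[OF qc that])
  have gc: "?g n \<in> carrier_mat (cdim S n) (cdim ?C n)" for n
    using drop_mat_carrier[OF qc] by simp
  have gch: "chain_map A ?C S ?g"
  proof (rule chain_mapI[OF bC S])
    show "?g n \<in> mod_hom A (cterm ?C n) (cterm S n)" for n
    proof (rule mod_homI[OF gc cterm_module[OF bC] cterm_module[OF S]])
      fix a and v :: "'k vec" assume a: "a \<in> carrier A" and "v \<in> carrier_vec (cdim ?C n)"
      then obtain x y where v: "x \<in> carrier_vec (cdim X (n + 1))" "y \<in> carrier_vec (cdim Y n)" "v = x @\<^sub>v y"
        using split by blast
      note mX = is_moduleD(1)[OF cterm_module[OF X] a] and mY = is_moduleD(1)[OF cterm_module[OF Y] a]
      have "q n \<in> mod_hom A (cterm Y n) (cterm S n)" using q by (simp add: chain_map_def)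
      from mod_hom_vec[OF this cterm_module[OF Y] cterm_module[OF S] a v(2)]
      show "?g n *\<^sub>v (act (cterm ?C n) a *\<^sub>v v) = act (cterm S n) a *\<^sub>v (?g n *\<^sub>v v)"
        using diag_sum_mult_vec[OF mX mY v(1,2)] g[OF v(1,2)]
          g[OF mult_mat_vec_carrier[OF mX v(1)] mult_mat_vec_carrier[OF mY v(2)]] v(3) by simp
    qed
    fix n and v :: "'k vec" assume "v \<in> carrier_vec (cdim ?C n)"
    then obtain x y where v: "x \<in> carrier_vec (cdim X (n + 1))" "y \<in> carrier_vec (cdim Y n)" "v = x @\<^sub>v y"
      using split by blast
    have dx: "- (cdiff X (n + 1) *\<^sub>v x) \<in> carrier_vec (cdim X (n + 1 + 1))" using dXc[OF v(1)] by simp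
    have s: "f (n + 1) *\<^sub>v x + cdiff Y n *\<^sub>v y \<in> carrier_vec (cdim Y (n + 1))"
      using fvc[OF v(1)] dYc[OF v(2)] by simp
    have "?g (n + 1) *\<^sub>v (cdiff ?C n *\<^sub>v v) = q (n + 1) *\<^sub>v (f (n + 1) *\<^sub>v x + cdiff Y n *\<^sub>v y)"
      unfolding v(3) cone_diff_mult_vec[OF X Y f v(1,2)] g[OF dx s] ..
    also have "\<dots> = 0\<^sub>v (cdim S (n + 1)) + cdiff S n *\<^sub>v (q n *\<^sub>v y)"
      using mult_add_distrib_mat_vec[OF qc fvc[OF v(1)] dYc[OF v(2)]] qf[OF v(1)] chain_map_vec[OF q Y S v(2)]
      by simp
    also have "\<dots> = cdiff S n *\<^sub>v (?g n *\<^sub>v v)"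
      using g[OF v(1,2)] v(3) dSc[OF qvc[OF v(2)]] by simp
    finally show "?g (n + 1) *\<^sub>v (cdiff ?C n *\<^sub>v v) = cdiff S n *\<^sub>v (?g n *\<^sub>v v)" .
  qed
  show ?thesis
  proof (rule quasi_isoI[OF bC S gch])
    fix n and v :: "'k vec" assume v: "v \<in> cocycles ?C n" and gv: "?g n *\<^sub>v v \<in> coboundaries S n"
    from split[OF cocyclesD[OF v]] obtain x y where xy: "x \<in> carrier_vec (cdim X (n + 1))"
        "y \<in> carrier_vec (cdim Y n)" "v = x @\<^sub>v y" by blast
    have "- (cdiff X (n + 1) *\<^sub>v x) @\<^sub>v (f (n + 1) *\<^sub>v x + cdiff Y n *\<^sub>v y)
        = 0\<^sub>v (cdim X (n + 1 + 1)) @\<^sub>v 0\<^sub>v (cdim Y (n + 1))"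
      using v unfolding cocycles_def xy(3) by (simp add: cone_diff_mult_vec[OF X Y f xy(1,2)] append_vec_zero del: cone_simps(2))
    then have fd: "f (n + 1) *\<^sub>v x + cdiff Y n *\<^sub>v y = 0\<^sub>v (cdim Y (n + 1))"
      using append_vec_eq[of "- (cdiff X (n + 1) *\<^sub>v x)" "cdim X (n + 1 + 1)"] dXc[OF xy(1)] by simp
    from gv obtain s' where s': "s' \<in> carrier_vec (cdim S (n - 1))" "q n *\<^sub>v y = cdiff S (n - 1) *\<^sub>v s'"
      unfolding xy(3) g[OF xy(1,2)] by (auto simp: coboundaries_def)
    \<comment> \<open>Lifting the primitive \<open>s'\<close> of \<open>q y\<close> to
      \<open>y'\<close> moves \<open>y - d y'\<close> into the kernel of \<open>q\<close>, so it
      equals \<open>f x'\<close>; then \<open>(x', y')\<close> is the primitive sought.\<close>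
    obtain y' where y': "y' \<in> carrier_vec (cdim Y (n - 1))" "q (n - 1) *\<^sub>v y' = s'" using surj[OF s'(1)] by blast
    have dy': "cdiff Y (n - 1) *\<^sub>v y' \<in> carrier_vec (cdim Y n)" using dYc[OF y'(1)] by simp
    have "q n *\<^sub>v (cdiff Y (n - 1) *\<^sub>v y') = q n *\<^sub>v y"
      using chain_map_vec[OF q Y S y'(1)] y'(2) s'(2) by simp
    then have "q n *\<^sub>v (y - cdiff Y (n - 1) *\<^sub>v y') = 0\<^sub>v (cdim S n)"
      using mult_minus_distrib_mat_vec[OF qc xy(2) dy'] qvc[OF xy(2)] by simp
    moreover have yy: "y - cdiff Y (n - 1) *\<^sub>v y' \<in> carrier_vec (cdim Y n)" using xy(2) dy' by simp
    ultimately obtain x' where x': "x' \<in> carrier_vec (cdim X n)" "f n *\<^sub>v x' = y - cdiff Y (n - 1) *\<^sub>v y'"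
      using ex by blast
    have x'': "x' \<in> carrier_vec (cdim X (n - 1 + 1))" using x'(1) by simp
    have "f (n + 1) *\<^sub>v (cdiff X n *\<^sub>v x') = cdiff Y n *\<^sub>v y - cdiff Y n *\<^sub>v (cdiff Y (n - 1) *\<^sub>v y')"
      using chain_map_vec[OF f X Y x'(1)] x'(2) mult_minus_distrib_mat_vec[OF cdiff_carrier[OF Y] xy(2) dy'] by simp
    also have "cdiff Y n *\<^sub>v (cdiff Y (n - 1) *\<^sub>v y') = 0\<^sub>v (cdim Y (n + 1))"
      using cdiff_cdiff[OF Y y'(1)] by (simp add: add.commute)
    finally have fdx: "f (n + 1) *\<^sub>v (cdiff X n *\<^sub>v x') = cdiff Y n *\<^sub>v y" using dYc[OF xy(2)] by simp
    \<comment> \<open>The cocycle condition gives \<open>f x = - d y\<close>, while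
      \<open>f (d x') = d y\<close>; injectivity of \<open>f\<close> then forces
      \<open>x = - d x'\<close>.\<close>
    have "f (n + 1) *\<^sub>v (- (cdiff X n *\<^sub>v x')) = f (n + 1) *\<^sub>v x"
    proof -
      have "f (n + 1) *\<^sub>v (- (cdiff X n *\<^sub>v x')) = - (cdiff Y n *\<^sub>v y)"
        using uminus_mult_vec[OF fc dXc[OF x'(1)]] fdx by simp
      also have "\<dots> = f (n + 1) *\<^sub>v x"
      proof (rule eq_vecI)
        fix i assume i: "i < dim_vec (f (n + 1) *\<^sub>v x)"
        have "(f (n + 1) *\<^sub>v x + cdiff Y n *\<^sub>v y) $ i = 0" unfolding fd using i carrier_vecD[OF fvc[OF xy(1)]] by simp
        then show "(- (cdiff Y n *\<^sub>v y)) $ i = (f (n + 1) *\<^sub>v x) $ i"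
          using i carrier_vecD[OF fvc[OF xy(1)]] carrier_vecD[OF dYc[OF xy(2)]]
            by (simp add: neg_eq_iff_add_eq_0 add.commute del: index_mult_mat_vec dim_mult_mat_vec)
      qed (use carrier_vecD[OF fvc[OF xy(1)]] carrier_vecD[OF dYc[OF xy(2)]] in \<open>simp del: dim_mult_mat_vec\<close>)
      finally show ?thesis .
    qed
    then have xe: "x = - (cdiff X n *\<^sub>v x')"
      using inj[OF xy(1), of "- (cdiff X n *\<^sub>v x')"] dXc[OF x'(1)] by simp
    have "cdiff ?C (n - 1) *\<^sub>v (x' @\<^sub>v y') = - (cdiff X n *\<^sub>v x') @\<^sub>v (f n *\<^sub>v x' + cdiff Y (n - 1) *\<^sub>v y')"
      using cone_diff_mult_vec[OF X Y f x'' y'(1)] by simp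
    also have "\<dots> = v"
      unfolding xy(3) xe[symmetric] x'(2) vec_diff_add[OF xy(2) dy'] ..
    finally show "v \<in> coboundaries ?C n"
      using coboundariesI[of "x' @\<^sub>v y'" ?C n] x'(1) y'(1) by (simp del: cone_simps(2))
  next
    fix n and s :: "'k vec" assume s: "s \<in> cocycles S n"
    obtain y where y: "y \<in> carrier_vec (cdim Y n)" "q n *\<^sub>v y = s" using surj[OF cocyclesD[OF s]] by blast
    have "q (n + 1) *\<^sub>v (cdiff Y n *\<^sub>v y) = 0\<^sub>v (cdim S (n + 1))"
      using chain_map_vec[OF q Y S y(1)] y(2) s by (simp add: cocycles_def)
    \<comment> \<open>The preimage \<open>x'\<close> of \<open>d y\<close> completes
      \<open>y\<close> to the cone cocycle \<open>(- x', y)\<close>, which still maps to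
      \<open>s\<close>.\<close>
    then obtain x' where x': "x' \<in> carrier_vec (cdim X (n + 1))" "f (n + 1) *\<^sub>v x' = cdiff Y n *\<^sub>v y"
      using ex[OF dYc[OF y(1)]] by blast
    have mx: "- x' \<in> carrier_vec (cdim X (n + 1))" using x' by simp
    have "f (n + 1 + 1) *\<^sub>v (cdiff X (n + 1) *\<^sub>v x') = cdiff Y (n + 1) *\<^sub>v (cdiff Y n *\<^sub>v y)"
      using chain_map_vec[OF f X Y x'(1)] x'(2) by simp
    also have "\<dots> = f (n + 1 + 1) *\<^sub>v 0\<^sub>v (cdim X (n + 1 + 1))"
      using cdiff_cdiff[OF Y y(1)] mult_mat_vec_zero[OF fc, of "n + 1 + 1"] by (simp add: add.assoc)
    finally have dx: "cdiff X (n + 1) *\<^sub>v x' = 0\<^sub>v (cdim X (n + 1 + 1))"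
      by (rule inj[rotated 2]) (use dXc[OF x'(1)] in auto)
    have "cdiff ?C n *\<^sub>v (- x' @\<^sub>v y) = - (- 0\<^sub>v (cdim X (n + 1 + 1))) @\<^sub>v (- (cdiff Y n *\<^sub>v y) + cdiff Y n *\<^sub>v y)"
      unfolding cone_diff_mult_vec[OF X Y f mx y(1)] uminus_mult_vec[OF cdiff_carrier[OF X] x'(1)]
        uminus_mult_vec[OF fc x'(1)] dx x'(2) ..
    also have "\<dots> = 0\<^sub>v (cdim ?C (n + 1))"
      using dYc[OF y(1)] by (simp add: append_vec_zero)
    finally have "- x' @\<^sub>v y \<in> cocycles ?C n"
      using x'(1) y(1) by (simp add: cocycles_def del: cone_simps(2))
    moreover have "?g n *\<^sub>v (- x' @\<^sub>v y) - s \<in> coboundaries S n"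
      unfolding g[OF mx y(1)] y(2) using zero_coboundaries[OF S, of n] cocyclesD[OF s] by simp
    ultimately show "\<exists>v\<in>cocycles ?C n. ?g n *\<^sub>v v - s \<in> coboundaries S n" by blast
  qed
qed

section \<open>Isomorphisms and triangles in the derived category\<close>

lemma zz_hom_id: "bounded_cpx A X \<Longrightarrow> zz_hom A (Fwd X (cid X) X) X X"
  by (simp add: zz_hom.fwd chain_map_id)

lemma zz_class_eq: "zz_eq A p q \<Longrightarrow> zz_class A p = zz_class A q"
  unfolding zz_class_def by (auto intro: zz_eq.sym zz_eq.trans)

lemma zz_eq_After:
  assumes "zz_eq A p p'" "zz_eq A q q'" "zz_hom A p X Y" "zz_hom A q Y W"
  shows "zz_eq A (After q p) (After q' p')"
  using zz_eq.cong[OF assms(1,2) zz_hom.after[OF assms(3,4)]] .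

lemma UN_const_eq: "x \<in> S \<Longrightarrow> (\<And>y. y \<in> S \<Longrightarrow> f y = c) \<Longrightarrow> (\<Union>y\<in>S. f y) = c"
  by blast

text \<open>Composition is a union over all representatives; by the congruence rule the classes in
  that union coincide, so it is the class of one composite.\<close>

lemma Cmp_zz_class:
  assumes p: "zz_hom A p X Y" and q: "zz_hom A q Y W"
  shows "Cmp (derived_add_cat A) (zz_class A q) (zz_class A p) = zz_class A (After q p)"
proof -
  have "zz_class A (After q' p') = zz_class A (After q p)"
    if "p' \<in> zz_class A p" "q' \<in> zz_class A q" for p' q'
  proof -
    have "zz_eq A p p'" "zz_eq A q q'" using that by (simp_all add: zz_class_def)
    then show ?thesis using zz_class_eq[OF zz_eq_After[OF _ _ p q]] by simp
  qed
  moreover have "p \<in> zz_class A p" "q \<in> zz_class A q"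
    using zz_eq.refl[OF p] zz_eq.refl[OF q] by (auto simp: zz_class_def)
  ultimately show ?thesis unfolding derived_add_cat_def add_cat.simps by (intro UN_const_eq)
qed

lemma derived_cat_simps [simp]:
  "Ob (derived_cat A) = {X. bounded_cpx A X}"
  "Hom (derived_cat A) = Hom (derived_add_cat A)"
  "Idn (derived_cat A) = Idn (derived_add_cat A)"
  "Cmp (derived_cat A) = Cmp (derived_add_cat A)"
  "Zero (derived_cat A) = zero_cpx" "DSum (derived_cat A) = cpx_sum"
  "Shift (derived_cat A) = cpx_shift" "Tri (derived_cat A) = derived_tri A"
  by (simp_all add: derived_cat_def derived_add_cat_def Let_def)

lemma derived_add_cat_simps:
  "Ob (derived_add_cat A) = {X. bounded_cpx A X}"
  "Hom (derived_add_cat A) X Y = {zz_class A p | p. zz_hom A p X Y}"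
  "Idn (derived_add_cat A) X = zz_class A (Fwd X (cid X) X)"
  by (simp_all add: derived_add_cat_def)

lemma isomorphic_derived_cat: "isomorphic (derived_cat A) X Y \<longleftrightarrow> isomorphic (derived_add_cat A) X Y"
  by (simp add: isomorphic_def is_iso_def)

lemma zz_iso_is_iso:
  assumes "zz_hom A p X Y" "zz_hom A q Y X"
    "zz_eq A (After q p) (Fwd X (cid X) X)" "zz_eq A (After p q) (Fwd Y (cid Y) Y)"
  shows "is_iso (derived_add_cat A) X Y (zz_class A p)"
  unfolding is_iso_def derived_add_cat_simps
  using assms Cmp_zz_class[OF assms(1,2)] Cmp_zz_class[OF assms(2,1)] zz_class_eq by blast

text \<open>Mutually inverse morphisms at the level of representatives, where associativity and
  cancellation apply as rules; classes are formed only at the end.\<close>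

definition zz_inverse ::
  "('k :: field, 'a) module \<Rightarrow> ('a, 'k) cpx \<Rightarrow> ('a, 'k) cpx \<Rightarrow> ('a, 'k) zigzag \<Rightarrow> ('a, 'k) zigzag \<Rightarrow> bool"
  where "zz_inverse A X Y p q \<longleftrightarrow> zz_hom A p X Y \<and> zz_hom A q Y X \<and>
    zz_eq A (After q p) (Fwd X (cid X) X) \<and> zz_eq A (After p q) (Fwd Y (cid Y) Y)"

lemma zz_inverse_sym: "zz_inverse A X Y p q \<Longrightarrow> zz_inverse A Y X q p"
  by (simp add: zz_inverse_def)

lemma zz_inverse_quasi_iso:
  assumes "bounded_cpx A X" "bounded_cpx A Y" "quasi_iso A X Y s"
  shows "zz_inverse A X Y (Fwd X s Y) (Inv X s Y)"
proof -
  have "zz_hom A (Inv X s Y) Y X" using assms by (simp add: zz_hom.inv)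
  moreover have "zz_hom A (Fwd X s Y) X Y" using assms by (simp add: zz_hom.fwd quasi_iso_def)
  ultimately show ?thesis by (simp add: zz_inverse_def zz_eq.inv_left zz_eq.inv_right)
qed

lemma zz_inverse_id: "bounded_cpx A X \<Longrightarrow> zz_inverse A X X (Fwd X (cid X) X) (Fwd X (cid X) X)"
  using zz_hom_id zz_eq.id_left by (metis zz_inverse_def)

lemma zz_cancel:
  assumes p: "zz_hom A p X Y" and q: "zz_hom A q Y X" and e: "zz_eq A (After q p) (Fwd X (cid X) X)"
    and r: "zz_hom A r W X"
  shows "zz_eq A (After q (After p r)) r"
proof -
  note zz_eq.trans [trans]
  have "zz_eq A (After q (After p r)) (After (After q p) r)"
    by (rule zz_eq.assoc[OF zz_hom.after[OF zz_hom.after[OF r p] q]])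
  also have "zz_eq A (After (After q p) r) (After (Fwd X (cid X) X) r)"
    by (rule zz_eq_After[OF zz_eq.refl[OF r] e r zz_hom.after[OF p q]])
  also have "zz_eq A (After (Fwd X (cid X) X) r) r"
    by (rule zz_eq.id_left[OF r])
  finally show ?thesis .
qed

lemma zz_inverse_comp_half:
  assumes p: "zz_inverse A X Y p p'" and q: "zz_inverse A Y W q q'"
  shows "zz_eq A (After (After p' q') (After q p)) (Fwd X (cid X) X)"
proof -
  note p' = p[unfolded zz_inverse_def] and q' = q[unfolded zz_inverse_def]
  have h: "zz_hom A p X Y" "zz_hom A q Y W" "zz_hom A p' Y X" "zz_hom A q' W Y" using p' q' by auto
  note zz_eq.trans [trans]
  have "zz_eq A (After (After p' q') (After q p)) (After p' (After q' (After q p)))"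
    by (rule zz_eq.sym[OF zz_eq.assoc[OF zz_hom.after[OF zz_hom.after[OF zz_hom.after[OF h(1,2)] h(4)] h(3)]]])
  also have "zz_eq A (After p' (After q' (After q p))) (After p' p)"
    by (rule zz_eq_After[OF zz_cancel[OF h(2,4) _ h(1)] zz_eq.refl[OF h(3)]
          zz_hom.after[OF zz_hom.after[OF h(1,2)] h(4)] h(3)]) (use q' in blast)
  also have "zz_eq A (After p' p) (Fwd X (cid X) X)" using p' by blast
  finally show ?thesis .
qed

lemma zz_inverse_comp:
  assumes p: "zz_inverse A X Y p p'" and q: "zz_inverse A Y W q q'"
  shows "zz_inverse A X W (After q p) (After p' q')"
  using zz_inverse_comp_half[OF p q] zz_inverse_comp_half[OF zz_inverse_sym[OF q] zz_inverse_sym[OF p]] p q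
  by (auto simp: zz_inverse_def intro: zz_hom.after)

text \<open>The equivalence relation generated by quasi-isomorphisms. It implies isomorphism in the
  derived category, and it is visibly compatible with direct sums: a chain of quasi-isomorphisms can
  be summed with a fixed complex link by link.\<close>

inductive qeq :: "('k :: field, 'a) module \<Rightarrow> ('a, 'k) cpx \<Rightarrow> ('a, 'k) cpx \<Rightarrow> bool" for A where
  qeq_refl: "bounded_cpx A X \<Longrightarrow> qeq A X X"
| qeq_step: "qeq A X Y \<Longrightarrow> bounded_cpx A W \<Longrightarrow> quasi_iso A Y W f \<Longrightarrow> qeq A X W"
| qeq_back: "qeq A X Y \<Longrightarrow> bounded_cpx A W \<Longrightarrow> quasi_iso A W Y f \<Longrightarrow> qeq A X W"

lemma qeq_bounded: "qeq A X Y \<Longrightarrow> bounded_cpx A X \<and> bounded_cpx A Y"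
  by (induction rule: qeq.induct) auto

lemma qeq_trans: 
  assumes "qeq A Y W" "qeq A X Y"
  shows "qeq A X W"
  using assms by (induction rule: qeq.induct) (auto intro: qeq_step qeq_back)

lemma qeq_quasi_iso: "bounded_cpx A X \<Longrightarrow> bounded_cpx A Y \<Longrightarrow> quasi_iso A X Y f \<Longrightarrow> qeq A X Y"
  by (rule qeq_step[OF qeq_refl])

lemma qeq_sum_left:
  assumes "qeq A X X'" "bounded_cpx A Y"
  shows "qeq A (cpx_sum X Y) (cpx_sum X' Y)"
  using assms
proof (induction rule: qeq.induct)
  case (qeq_refl X) then show ?case by (simp add: qeq.qeq_refl bounded_cpx_sum)
next
  have id: "quasi_iso A Y Y (cid Y)"
  proof (rule chain_map_bij_quasi_iso[OF assms(2,2) chain_map_id[OF assms(2)]])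
    fix n
    have "(\<lambda>x. cid Y n *\<^sub>v x) ` carrier_vec (cdim Y n) = carrier_vec (cdim Y n)"
      by (force simp: cid_def)
    then show "bij_betw (\<lambda>x. cid Y n *\<^sub>v x) (carrier_vec (cdim Y n)) (carrier_vec (cdim Y n))"
      by (auto simp: bij_betw_def inj_on_def cid_def)
  qed
  {
    case (qeq_step X X' W f)
    then show ?case
      using quasi_iso_cpx_sum[OF qeq_step(3) id] qeq_bounded bounded_cpx_sum qeq.qeq_step by metis
  next
    case (qeq_back X X' W f)
    then show ?case
      using quasi_iso_cpx_sum[OF qeq_back(3) id] qeq_bounded bounded_cpx_sum qeq.qeq_back by metis
  }
qed

lemma qeq_swap:
  assumes "bounded_cpx A X" "bounded_cpx A Y"
  shows "qeq A (cpx_sum X Y) (cpx_sum Y X)"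
  using qeq_quasi_iso[OF _ _ quasi_iso_swap[OF assms]] bounded_cpx_sum assms by blast

text \<open>The second summand is treated like the first after conjugation with the exchange of
  summands.\<close>

lemma qeq_sum:
  assumes "qeq A X X'" "qeq A Y Y'"
  shows "qeq A (cpx_sum X Y) (cpx_sum X' Y')"
proof -
  note b = qeq_bounded[OF assms(1)] qeq_bounded[OF assms(2)]
  have "qeq A (cpx_sum X' Y) (cpx_sum Y X')" using qeq_swap b by blast
  moreover have "qeq A (cpx_sum Y X') (cpx_sum Y' X')" using qeq_sum_left[OF assms(2)] b by blast
  moreover have "qeq A (cpx_sum Y' X') (cpx_sum X' Y')" using qeq_swap b by blast
  ultimately show ?thesis using qeq_sum_left[OF assms(1)] b qeq_trans by metis
qed

lemma qeq_isomorphic: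
  assumes "qeq A X Y"
  shows "isomorphic (derived_cat A) X Y"
proof -
  from assms have "\<exists>p q. zz_inverse A X Y p q"
  proof (induction rule: qeq.induct)
    case (qeq_refl X) then show ?case using zz_inverse_id by blast
  next
    case (qeq_step X Y W f)
    then show ?case using zz_inverse_comp zz_inverse_quasi_iso qeq_bounded by metis
  next
    case (qeq_back X Y W f)
    then show ?case using zz_inverse_comp zz_inverse_sym zz_inverse_quasi_iso qeq_bounded by metis
  qed
  then show ?thesis
    unfolding isomorphic_derived_cat unfolding isomorphic_def zz_inverse_def using zz_iso_is_iso by metis
qed

section \<open>The shift on zigzags, and triangles\<close>

lemma zz_hom_shift: "zz_hom A p X Y \<Longrightarrow> zz_hom A (zz_shift m p) (cpx_shift m X) (cpx_shift m Y)"
proof (induction rule: zz_hom.induct)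
  case (fwd X Y f) then show ?case by (simp add: zz_hom.fwd bounded_cpx_shift chain_map_shift)
next
  case (inv X Y s) then show ?case by (simp add: zz_hom.inv bounded_cpx_shift quasi_iso_shift)
next
  case (after p X Y q W) then show ?case by (simp add: zz_hom.after)
qed

lemma cid_shift: "(\<lambda>n. cid X (n + m)) = cid (cpx_shift m X)"
  by (simp add: cid_def fun_eq_iff)

text \<open>Each generating relation is sent to a relation of the same kind. Hence the shift of a
  class of morphisms, defined as a union, is a single class.\<close>

lemma zz_eq_shift: "zz_eq A p q \<Longrightarrow> zz_eq A (zz_shift m p) (zz_shift m q)"
proof (induction rule: zz_eq.induct)
  case (refl p X Y) then show ?case by (rule zz_eq.refl[OF zz_hom_shift])
next
  case (sym p q) from sym.IH show ?case by (rule zz_eq.sym)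
next
  case (trans p q r) then show ?case by (metis zz_eq.trans)
next
  case (cong p p' q q' X Y)
  then show ?case using zz_eq.cong zz_hom_shift[OF cong.hyps(3), of m] by simp
next
  case (assoc r q p X Y)
  then show ?case using zz_eq.assoc zz_hom_shift[OF assoc, of m] by simp
next
  case (id_left p X Y)
  then show ?case using zz_eq.id_left zz_hom_shift[OF id_left, of m] by (simp add: cid_shift)
next
  case (id_right p X Y)
  then show ?case using zz_eq.id_right zz_hom_shift[OF id_right, of m] by (simp add: cid_shift)
next
  case (fwd_comp Y g W X f)
  have "zz_hom A (After (Fwd (cpx_shift m Y) (\<lambda>n. g (n + m)) (cpx_shift m W))
      (Fwd (cpx_shift m X) (\<lambda>n. f (n + m)) (cpx_shift m Y))) (cpx_shift m X) (cpx_shift m W)"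
    using zz_hom_shift[OF fwd_comp, of m] by simp
  from zz_eq.fwd_comp[OF this] show ?case by simp
next
  case (inv_left X s Y)
  then show ?case using zz_eq.inv_left zz_hom_shift[OF inv_left, of m] by (simp add: cid_shift)
next
  case (inv_right X s Y)
  then show ?case using zz_eq.inv_right zz_hom_shift[OF inv_right, of m] by (simp add: cid_shift)
qed

lemma cls_shift_zz_class:
  assumes "zz_hom A p X Y"
  shows "cls_shift A m (zz_class A p) = zz_class A (zz_shift m p)"
proof -
  have "zz_class A (zz_shift m p') = zz_class A (zz_shift m p)" if "p' \<in> zz_class A p" for p'
  proof -
    have "zz_eq A p p'" using that by (simp add: zz_class_def)
    then show ?thesis using zz_class_eq[OF zz_eq_shift] by metis
  qed
  moreover have "p \<in> zz_class A p" using zz_eq.refl[OF assms] by (simp add: zz_class_def)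
  ultimately show ?thesis unfolding cls_shift_def by (intro UN_const_eq)
qed

text \<open>The cone triangle of \<open>f : X -> Y\<close> with its middle object replaced along
  \<open>e : Y -> W\<close>. The comparison with the standard triangle is the identity at both ends
  and the formal inverse of \<open>e\<close> in the middle, so only the first square needs a
  cancellation.\<close>

lemma derived_tri_cone:
  assumes X: "bounded_cpx A X" and Y: "bounded_cpx A Y" and W: "bounded_cpx A W"
    and f: "chain_map A X Y f" and e: "quasi_iso A Y W e"
  shows "\<exists>u v w. derived_tri A X W (cone X f Y) u v w"
proof -
  let ?D = "derived_add_cat A" and ?C = "cone X f Y"
  note C = bounded_cone[OF X Y f]
  have iso: "zz_inverse A Y W (Fwd Y e W) (Inv Y e W)" by (rule zz_inverse_quasi_iso[OF Y W e])
  have hI: "zz_hom A (Inv Y e W) W Y" and hE: "zz_hom A (Fwd Y e W) Y W"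
    using iso by (auto simp: zz_inverse_def)
  have hf: "zz_hom A (Fwd X f Y) X Y" using X Y f by (rule zz_hom.fwd)
  have hin: "zz_hom A (Fwd Y (cone_in X Y) ?C) Y ?C"
    by (rule zz_hom.fwd[OF Y C cone_in_chain_map[OF X Y f]])
  have hout: "zz_hom A (Fwd ?C (cone_out X Y) (cpx_shift 1 X)) ?C (cpx_shift 1 X)"
    by (rule zz_hom.fwd[OF C bounded_cpx_shift[OF X] cone_out_chain_map[OF X Y f]])
  note idX = zz_hom_id[OF X] and idC = zz_hom_id[OF C]
  have isoid: "is_iso ?D V V (zz_class A (Fwd V (cid V) V))" if "bounded_cpx A V" for V
    using zz_inverse_id[OF that] unfolding zz_inverse_def by (blast intro: zz_iso_is_iso)
  have isob: "is_iso ?D W Y (zz_class A (Inv Y e W))"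
    using zz_inverse_sym[OF iso] unfolding zz_inverse_def by (blast intro: zz_iso_is_iso)
  let ?u = "After (Fwd Y e W) (Fwd X f Y)" and ?v = "After (Fwd Y (cone_in X Y) ?C) (Inv Y e W)"
  have hu: "zz_hom A ?u X W" by (rule zz_hom.after[OF hf hE])
  have hv: "zz_hom A ?v W ?C" by (rule zz_hom.after[OF hI hin])
  have 1: "Cmp ?D (zz_class A (Inv Y e W)) (zz_class A ?u)
      = Cmp ?D (zz_class A (Fwd X f Y)) (zz_class A (Fwd X (cid X) X))"
  proof -
    have "zz_eq A (After (Inv Y e W) ?u) (Fwd X f Y)"
      by (rule zz_cancel[OF hE hI _ hf]) (use iso in \<open>simp add: zz_inverse_def\<close>)
    then show ?thesis
      unfolding Cmp_zz_class[OF hu hI] Cmp_zz_class[OF idX hf]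
      using zz_class_eq[OF zz_eq.id_right[OF hf]] zz_class_eq by metis
  qed
  have 2: "Cmp ?D (zz_class A (Fwd ?C (cid ?C) ?C)) (zz_class A ?v)
      = Cmp ?D (zz_class A (Fwd Y (cone_in X Y) ?C)) (zz_class A (Inv Y e W))"
    unfolding Cmp_zz_class[OF hv idC] Cmp_zz_class[OF hI hin] by (rule zz_class_eq[OF zz_eq.id_left[OF hv]])
  have sh: "cls_shift A 1 (zz_class A (Fwd X (cid X) X)) = zz_class A (Fwd (cpx_shift 1 X) (cid (cpx_shift 1 X)) (cpx_shift 1 X))"
    unfolding cls_shift_zz_class[OF idX] by (simp add: cid_shift)
  have 3: "Cmp ?D (cls_shift A 1 (zz_class A (Fwd X (cid X) X))) (zz_class A (Fwd ?C (cone_out X Y) (cpx_shift 1 X)))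
      = Cmp ?D (zz_class A (Fwd ?C (cone_out X Y) (cpx_shift 1 X))) (zz_class A (Fwd ?C (cid ?C) ?C))"
    unfolding sh Cmp_zz_class[OF hout zz_hom_id[OF bounded_cpx_shift[OF X]]] Cmp_zz_class[OF idC hout]
    using zz_class_eq[OF zz_eq.id_left[OF hout]] zz_class_eq[OF zz_eq.id_right[OF hout]] by simp
  have ob: "X \<in> Ob ?D" "Y \<in> Ob ?D" "W \<in> Ob ?D" "?C \<in> Ob ?D"
    using X Y W C by (simp_all add: derived_add_cat_simps)
  have hm: "zz_class A ?u \<in> Hom ?D X W" "zz_class A ?v \<in> Hom ?D W ?C"
    "zz_class A (Fwd ?C (cone_out X Y) (cpx_shift 1 X)) \<in> Hom ?D ?C (cpx_shift 1 X)"
    using hu hv hout by (auto simp: derived_add_cat_simps)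
  have "derived_tri A X W ?C (zz_class A ?u) (zz_class A ?v) (zz_class A (Fwd ?C (cone_out X Y) (cpx_shift 1 X)))"
    unfolding derived_tri_def Let_def
    using ob hm f isoid[OF X] isob isoid[OF C] 1 2 3 by blast
  then show ?thesis by blast
qed

section \<open>Sums of shifted summands\<close>

lemma finsum_of_derived_cat: "finsum_of (derived_cat A) Xs = foldr cpx_sum Xs zero_cpx"
  by (simp add: finsum_of_def)

lemma bounded_finsum: "(\<And>X. X \<in> set Xs \<Longrightarrow> bounded_cpx A X) \<Longrightarrow> bounded_cpx A (foldr cpx_sum Xs zero_cpx)"
  by (induction Xs) (auto simp: bounded_zero_cpx bounded_cpx_sum)

lemma finsum_append:
  "foldr cpx_sum (Xs @ Ys) zero_cpx = cpx_sum (foldr cpx_sum Xs zero_cpx) (foldr cpx_sum Ys zero_cpx)"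
  by (induction Xs) (simp_all add: cpx_sum_assoc)

lemma mod_cat_simps [simp]:
  "Ob (mod_cat A) = {M. is_module A M}" "Hom (mod_cat A) = mod_hom A" "Idn (mod_cat A) M = 1\<^sub>m (vdim M)"
  "Cmp (mod_cat A) = (*)" "Zero (mod_cat A) = zero_mod" "DSum (mod_cat A) = mod_sum"
  by (simp_all add: mod_cat_def)

text \<open>\<open>sum_of_shifted_summands\<close> with \<open>qeq\<close> in place of isomorphism.
  In this form the property passes easily to direct sums and along quasi-isomorphisms.\<close>

definition shifted_sum :: "('k :: field, 'a) module \<Rightarrow> ('a, 'k) fdmod \<Rightarrow> ('a, 'k) cpx \<Rightarrow> bool" where
  "shifted_sum A Z X \<longleftrightarrow> (\<exists>L. (\<forall>(M, n) \<in> set L. summand_of (mod_cat A) M Z) \<and>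
     qeq A X (foldr cpx_sum (map (\<lambda>(M, n). cpx_shift n (stalk M)) L) zero_cpx))"

lemma shifted_sum_qeq: "shifted_sum A Z X \<Longrightarrow> qeq A Y X \<Longrightarrow> shifted_sum A Z Y"
  unfolding shifted_sum_def by (meson qeq_trans)

lemma shifted_sum_zero: "shifted_sum A Z zero_cpx"
  unfolding shifted_sum_def by (rule exI[of _ "[]"]) (simp add: qeq_refl bounded_zero_cpx)

lemma shifted_sum_sum:
  assumes "shifted_sum A Z X" "shifted_sum A Z Y"
  shows "shifted_sum A Z (cpx_sum X Y)"
proof -
  let ?F = "\<lambda>L. foldr cpx_sum (map (\<lambda>(M, n). cpx_shift n (stalk M)) L) zero_cpx"
  obtain K L where "\<forall>(M, n) \<in> set K. summand_of (mod_cat A) M Z" "qeq A X (?F K)"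
      "\<forall>(M, n) \<in> set L. summand_of (mod_cat A) M Z" "qeq A Y (?F L)"
    using assms by (auto simp: shifted_sum_def)
  then show ?thesis
    unfolding shifted_sum_def using qeq_sum[of A X "?F K" Y "?F L"]
    by (intro exI[of _ "K @ L"]) (auto simp: finsum_append simp del: foldr_append)
qed

lemma shifted_sum_stalk:
  assumes "summand_of (mod_cat A) M Z"
  shows "shifted_sum A Z (cpx_shift n (stalk M))"
proof -
  have "is_module A M" using assms by (simp add: summand_of_def)
  then have b: "bounded_cpx A (cpx_shift n (stalk M))" by (simp add: bounded_stalk bounded_cpx_shift)
  have "qeq A (cpx_shift n (stalk M)) (cpx_sum (cpx_shift n (stalk M)) zero_cpx)"
    using qeq_swap[OF bounded_zero_cpx b] by simp
  then show ?thesis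
    unfolding shifted_sum_def using assms by (intro exI[of _ "[(M, n)]"]) simp
qed

lemma shifted_sum_sum_of_shifted_summands:
  assumes "shifted_sum A Z X"
  shows "sum_of_shifted_summands A Z X"
  using assms qeq_isomorphic qeq_bounded
  unfolding shifted_sum_def sum_of_shifted_summands_def finsum_of_derived_cat derived_cat_simps by blast

lemma zero_mat_mult_vec: "v \<in> carrier_vec n \<Longrightarrow> 0\<^sub>m m n *\<^sub>v v = (0\<^sub>v m :: 'k :: field vec)"
  by (intro eq_vecI) auto

lemma bij_betw_zero_mat:
  "bij_betw (\<lambda>x. 0\<^sub>m 0 0 *\<^sub>v x) (carrier_vec 0) (carrier_vec 0 :: 'k :: field vec set)"
proof -
  have "x = 0\<^sub>v 0" if "x \<in> carrier_vec 0" for x :: "'k vec" using that by (intro eq_vecI) auto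
  then have "carrier_vec 0 = {0\<^sub>v 0 :: 'k vec}" by auto
  then show ?thesis by (simp add: bij_betw_def zero_mat_mult_vec)
qed

lemma shift_stalk_cdiff:
  fixes N :: "('a, 'k :: field) fdmod"
  assumes "x \<in> carrier_vec (cdim (cpx_shift n (stalk N)) k)"
  shows "cdiff (cpx_shift n (stalk N)) k *\<^sub>v x = 0\<^sub>v (cdim (cpx_shift n (stalk N)) (k + 1))"
proof -
  have e: "k + 1 + n = k + n + 1" by simp
  have x: "x \<in> carrier_vec (cdim (stalk N) (k + n))" using assms by simp
  show ?thesis
    using zero_mat_mult_vec[OF x, of "cdim (stalk N) (k + n + 1)"] x
    unfolding cpx_shift_simps e stalk_simps(2) by simp
qed

lemma mod_iso_quasi_iso:
  fixes M N :: "('a, 'b :: field) fdmod"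
  assumes M: "is_module A M" and N: "is_module A N" and f: "is_iso (mod_cat A) M N f"
  shows "qeq A (cpx_shift n (stalk M)) (cpx_shift n (stalk N))"
proof -
  obtain g where g: "f \<in> mod_hom A M N" "g \<in> mod_hom A N M" "g * f = 1\<^sub>m (vdim M)" "f * g = 1\<^sub>m (vdim N)"
    using f by (auto simp: is_iso_def)
  have fc: "f \<in> carrier_mat (vdim N) (vdim M)" and gc: "g \<in> carrier_mat (vdim M) (vdim N)"
    using g by (auto simp: mod_hom_def)
  let ?X = "cpx_shift n (stalk M)" and ?Y = "cpx_shift n (stalk N)"
  have b: "bounded_cpx A ?X" "bounded_cpx A ?Y" using M N by (simp_all add: bounded_stalk bounded_cpx_shift)
  define F where "F k = (if k + n = 0 then f else 0\<^sub>m 0 0)" for k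
  have Fh: "F k \<in> mod_hom A (cterm ?X k) (cterm ?Y k)" for k
    using g(1) by (auto simp: F_def stalk_simps mod_hom_def zero_mod_def)
  have Fc: "F k \<in> carrier_mat (cdim ?Y k) (cdim ?X k)" for k using Fh[of k] by (simp add: mod_hom_def)
  have "chain_map A ?X ?Y F"
  proof (rule chain_mapI[OF b Fh])
    fix k and x :: "'b vec" assume x: "x \<in> carrier_vec (cdim ?X k)"
    show "F (k + 1) *\<^sub>v (cdiff ?X k *\<^sub>v x) = cdiff ?Y k *\<^sub>v (F k *\<^sub>v x)"
      unfolding shift_stalk_cdiff[OF x] shift_stalk_cdiff[OF mult_mat_vec_carrier[OF Fc x]]
      by (rule mult_mat_vec_zero[OF Fc])
  qed
  moreover have "bij_betw (\<lambda>x. F k *\<^sub>v x) (carrier_vec (cdim ?X k)) (carrier_vec (cdim ?Y k))" for k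
  proof (cases "k + n = 0")
    case True
    have "bij_betw (\<lambda>x. f *\<^sub>v x) (carrier_vec (vdim M)) (carrier_vec (vdim N))"
      using g(3,4) assoc_mult_mat_vec[OF fc gc] assoc_mult_mat_vec[OF gc fc] fc gc
      by (intro bij_betwI[where g = "\<lambda>x. g *\<^sub>v x"]) auto
    then show ?thesis using True by (simp add: F_def stalk_simps)
  next
    case False
    have "bij_betw (\<lambda>x. 0\<^sub>m 0 0 *\<^sub>v x) (carrier_vec 0) (carrier_vec 0 :: 'b vec set)"
      by (rule bij_betw_zero_mat)
    then show ?thesis using False by (simp add: F_def stalk_simps)
  qed
  ultimately show ?thesis using chain_map_bij_quasi_iso[OF b] qeq_quasi_iso[OF b] by blast
qed

text \<open>The first layer asks for one complement of the whole sum inside a sum of shifts of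
  \<open>Z\<close>. It is assembled from the complements of the individual summands, shifted
  alongside them, by induction on the list.\<close>

lemma shifted_sum_layer:
  assumes X: "shifted_sum A Z X" and Z: "is_module A Z"
  shows "X \<in> layer (derived_cat A) (stalk Z) 1"
proof -
  let ?F = "\<lambda>L. foldr cpx_sum (map (\<lambda>(M, n). cpx_shift n (stalk M)) L) zero_cpx"
  obtain L where L: "\<forall>(M, n) \<in> set L. summand_of (mod_cat A) M Z" and q: "qeq A X (?F L)"
    using X by (auto simp: shifted_sum_def)
  have bZ: "bounded_cpx A (foldr cpx_sum (map (\<lambda>n. cpx_shift n (stalk Z)) ns) zero_cpx)" for ns
    using Z by (intro bounded_finsum) (auto simp: bounded_stalk bounded_cpx_shift)
  have "\<exists>X'. bounded_cpx A X' \<and> qeq A (cpx_sum (?F L) X') (foldr cpx_sum (map (\<lambda>n. cpx_shift n (stalk Z)) (map snd L)) zero_cpx)"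
    using L
  proof (induction L)
    case Nil
    then show ?case by (intro exI[of _ zero_cpx]) (simp add: bounded_zero_cpx qeq_refl)
  next
    case (Cons Mn L)
    obtain M n where Mn: "Mn = (M, n)" by fastforce
    from Cons obtain X' where X': "bounded_cpx A X'"
        "qeq A (cpx_sum (?F L) X') (foldr cpx_sum (map (\<lambda>n. cpx_shift n (stalk Z)) (map snd L)) zero_cpx)"
      by auto
    have "summand_of (mod_cat A) M Z" using Cons.prems Mn by simp
    then obtain M' f where M': "is_module A M" "is_module A M'" "is_iso (mod_cat A) (mod_sum M M') Z f"
      by (auto simp: summand_of_def isomorphic_def)
    let ?S = "\<lambda>M. cpx_shift n (stalk M)"
    have b: "bounded_cpx A (?S M)" "bounded_cpx A (?S M')"
      using M' by (simp_all add: bounded_stalk bounded_cpx_shift)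
    have "\<forall>(M, n) \<in> set L. is_module A M" using Cons.prems by (auto simp: summand_of_def)
    then have bL: "bounded_cpx A (?F L)"
      by (intro bounded_finsum) (auto simp: bounded_stalk bounded_cpx_shift)
    have 1: "qeq A (cpx_sum (?S M) (?S M')) (?S Z)"
      using mod_iso_quasi_iso[OF is_module_mod_sum[OF M'(1,2)] Z M'(3)] by (simp add: cpx_sum_shift_stalk)
    \<comment> \<open>Exchanging the middle two of four summands pairs each summand with its own
      complement.\<close>
    have "qeq A (cpx_sum (?F L) (?S M')) (cpx_sum (?S M') (?F L))" by (rule qeq_swap[OF bL b(2)])
    from qeq_sum[OF qeq_refl[OF b(1)] qeq_sum[OF this qeq_refl[OF X'(1)]]]
    have "qeq A (cpx_sum (cpx_sum (?S M) (?F L)) (cpx_sum (?S M') X'))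
        (cpx_sum (cpx_sum (?S M) (?S M')) (cpx_sum (?F L) X'))"
      by (simp add: cpx_sum_assoc)
    with qeq_sum[OF 1 X'(2)]
    have "qeq A (cpx_sum (cpx_sum (?S M) (?F L)) (cpx_sum (?S M') X'))
        (cpx_sum (?S Z) (foldr cpx_sum (map (\<lambda>n. cpx_shift n (stalk Z)) (map snd L)) zero_cpx))"
      by (rule qeq_trans)
    then show ?case
      using bounded_cpx_sum[OF b(2) X'(1)] unfolding Mn by (intro exI[of _ "cpx_sum (?S M') X'"]) simp
  qed
  then obtain X' where X': "bounded_cpx A X'"
      "qeq A (cpx_sum (?F L) X') (foldr cpx_sum (map (\<lambda>n. cpx_shift n (stalk Z)) (map snd L)) zero_cpx)" by blast
  have "qeq A (cpx_sum X X') (foldr cpx_sum (map (\<lambda>n. cpx_shift n (stalk Z)) (map snd L)) zero_cpx)"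
    using qeq_trans[OF X'(2) qeq_sum_left[OF q X'(1)]] .
  then have "summand_of (derived_cat A) X (finsum_of (derived_cat A) (map (\<lambda>n. Shift (derived_cat A) n (stalk Z)) (map snd L)))"
    unfolding summand_of_def finsum_of_derived_cat derived_cat_simps
    using qeq_isomorphic X'(1) qeq_bounded[OF q] bZ by blast
  then show ?thesis unfolding One_nat_def layer.simps(2) mem_Collect_eq by (rule exI)
qed

lemma layer_subset_Ob: "layer (derived_cat A) Y (Suc n) \<subseteq> Ob (derived_cat A)"
  by (cases n) (auto simp: summand_of_def)

lemma tri_layer2:
  assumes X: "bounded_cpx A X" and t: "derived_tri A X1 X X2 u v w"
    and "shifted_sum A Z X1" "shifted_sum A Z X2" "is_module A Z"
  shows "X \<in> layer (derived_cat A) (stalk Z) 2"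
proof -
  have "qeq A (cpx_sum X zero_cpx) X"
    using qeq_swap[OF X bounded_zero_cpx] by simp
  then have "summand_of (derived_cat A) X X"
    unfolding summand_of_def derived_cat_simps using X bounded_zero_cpx qeq_isomorphic by blast
  moreover have "X1 \<in> layer (derived_cat A) (stalk Z) (Suc 0)" "X2 \<in> layer (derived_cat A) (stalk Z) (Suc 0)"
    using shifted_sum_layer[of A Z] assms by auto
  ultimately show ?thesis
    using t unfolding numeral_2_eq_2 layer.simps(3) derived_cat_simps by blast
qed

section \<open>Modules and complexes given by subquotients of function spaces\<close>

text \<open>The laws are imposed only on \<open>S\<close>: the actions used below annihilate rows
  outside the index set, so the unit acts as the identity only on functions supported there.\<close>

definition lin_action ::
  "('k :: field, 'a) module \<Rightarrow> ('a \<Rightarrow> ('x \<Rightarrow> 'k) \<Rightarrow> 'x \<Rightarrow> 'k) \<Rightarrow> ('x \<Rightarrow> 'k) set \<Rightarrow> bool" where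
  "lin_action A \<rho> S \<longleftrightarrow> \<one>\<^bsub>A\<^esub> \<in> carrier A \<and> (\<forall>v\<in>S. \<rho> \<one>\<^bsub>A\<^esub> v = v) \<and>
     (\<forall>a\<in>carrier A. lin (\<rho> a) \<and> (\<forall>v\<in>S. \<rho> a v \<in> S) \<and>
       (\<forall>c. c \<odot>\<^bsub>A\<^esub> a \<in> carrier A \<and> (\<forall>v\<in>S. \<rho> (c \<odot>\<^bsub>A\<^esub> a) v = fscale c (\<rho> a v))) \<and>
       (\<forall>b\<in>carrier A. a \<oplus>\<^bsub>A\<^esub> b \<in> carrier A \<and> a \<otimes>\<^bsub>A\<^esub> b \<in> carrier A \<and>
         (\<forall>v\<in>S. \<rho> (a \<oplus>\<^bsub>A\<^esub> b) v = \<rho> a v + \<rho> b v \<and> \<rho> (a \<otimes>\<^bsub>A\<^esub> b) v = \<rho> a (\<rho> b v))))"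

text \<open>\<open>M\<close> is the subquotient \<open>S / U\<close> with the action induced by
  \<open>\<rho>\<close>, written in the coordinates \<open>\<kappa>\<close>. Keeping
  \<open>\<kappa>\<close> in the statement makes it possible to prescribe homomorphisms by formulas
  on functions.\<close>

definition mod_real ::
  "('k :: field, 'a) module \<Rightarrow> ('a \<Rightarrow> ('x \<Rightarrow> 'k) \<Rightarrow> 'x \<Rightarrow> 'k) \<Rightarrow> ('x \<Rightarrow> 'k) set \<Rightarrow>
   ('x \<Rightarrow> 'k) set \<Rightarrow> ('a, 'k) fdmod \<Rightarrow> (('x \<Rightarrow> 'k) \<Rightarrow> 'k vec) \<Rightarrow> bool" where
  "mod_real A \<rho> S U M \<kappa> \<longleftrightarrow> is_module A M \<and> coords S U (vdim M) \<kappa> \<and>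
     (\<forall>a\<in>carrier A. \<forall>v\<in>S. \<rho> a v \<in> S \<and> \<kappa> (\<rho> a v) = act M a *\<^sub>v \<kappa> v)"

text \<open>The action and the differential are the same maps of one ambient function space in all
  degrees; the degree enters only through the subspaces \<open>S n\<close> and
  \<open>U n\<close>.\<close>

definition cpx_real ::
  "('k :: field, 'a) module \<Rightarrow> ('a \<Rightarrow> ('x \<Rightarrow> 'k) \<Rightarrow> 'x \<Rightarrow> 'k) \<Rightarrow> (('x \<Rightarrow> 'k) \<Rightarrow> 'x \<Rightarrow> 'k) \<Rightarrow>
   (int \<Rightarrow> ('x \<Rightarrow> 'k) set) \<Rightarrow> (int \<Rightarrow> ('x \<Rightarrow> 'k) set) \<Rightarrow> ('a, 'k) cpx \<Rightarrow>
   (int \<Rightarrow> ('x \<Rightarrow> 'k) \<Rightarrow> 'k vec) \<Rightarrow> bool" where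
  "cpx_real A \<rho> d S U X \<kappa> \<longleftrightarrow> bounded_cpx A X \<and>
     (\<forall>n. mod_real A \<rho> (S n) (U n) (cterm X n) (\<kappa> n)) \<and>
     (\<forall>n. \<forall>v\<in>S n. d v \<in> S (n + 1) \<and> \<kappa> (n + 1) (d v) = cdiff X n *\<^sub>v \<kappa> n v)"

lemma lin_actionD:
  assumes "lin_action A \<rho> S"
  shows "\<one>\<^bsub>A\<^esub> \<in> carrier A" "v \<in> S \<Longrightarrow> \<rho> \<one>\<^bsub>A\<^esub> v = v"
    "a \<in> carrier A \<Longrightarrow> lin (\<rho> a)" "a \<in> carrier A \<Longrightarrow> v \<in> S \<Longrightarrow> \<rho> a v \<in> S"
    "a \<in> carrier A \<Longrightarrow> c \<odot>\<^bsub>A\<^esub> a \<in> carrier A"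
    "a \<in> carrier A \<Longrightarrow> v \<in> S \<Longrightarrow> \<rho> (c \<odot>\<^bsub>A\<^esub> a) v = fscale c (\<rho> a v)"
    "a \<in> carrier A \<Longrightarrow> b \<in> carrier A \<Longrightarrow> a \<oplus>\<^bsub>A\<^esub> b \<in> carrier A"
    "a \<in> carrier A \<Longrightarrow> b \<in> carrier A \<Longrightarrow> a \<otimes>\<^bsub>A\<^esub> b \<in> carrier A"
    "a \<in> carrier A \<Longrightarrow> b \<in> carrier A \<Longrightarrow> v \<in> S \<Longrightarrow> \<rho> (a \<oplus>\<^bsub>A\<^esub> b) v = \<rho> a v + \<rho> b v"
    "a \<in> carrier A \<Longrightarrow> b \<in> carrier A \<Longrightarrow> v \<in> S \<Longrightarrow> \<rho> (a \<otimes>\<^bsub>A\<^esub> b) v = \<rho> a (\<rho> b v)"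
  using assms by (auto simp: lin_action_def)

lemma mod_realD:
  assumes "mod_real A \<rho> S U M \<kappa>"
  shows "is_module A M" "coords S U (vdim M) \<kappa>"
    "a \<in> carrier A \<Longrightarrow> v \<in> S \<Longrightarrow> \<rho> a v \<in> S"
    "a \<in> carrier A \<Longrightarrow> v \<in> S \<Longrightarrow> \<kappa> (\<rho> a v) = act M a *\<^sub>v \<kappa> v"
  using assms by (auto simp: mod_real_def)

lemma cpx_realD:
  assumes "cpx_real A \<rho> d S U X \<kappa>"
  shows "bounded_cpx A X" "mod_real A \<rho> (S n) (U n) (cterm X n) (\<kappa> n)"
    "coords (S n) (U n) (cdim X n) (\<kappa> n)"
    "v \<in> S n \<Longrightarrow> d v \<in> S (n + 1)" "v \<in> S n \<Longrightarrow> \<kappa> (n + 1) (d v) = cdiff X n *\<^sub>v \<kappa> n v"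
  using assms by (auto simp: cpx_real_def mod_real_def)

lemma lin_vec_comp_lin:
  assumes "lin_vec S' m h" "lin f" "\<And>v. v \<in> S \<Longrightarrow> f v \<in> S'"
  shows "lin_vec S m (\<lambda>v. h (f v))"
  unfolding lin_vec_def linD(1,2)[OF assms(2)]
  using lin_vecD[OF assms(1)] assms(3) by blast

lemma mod_real_exists:
  assumes S: "fvs.subspace S" and U: "fvs.subspace U" and US: "U \<subseteq> S"
    and fin: "finite F" "S \<subseteq> fvs.span F" and act: "lin_action A \<rho> S"
    and actU: "\<And>a v. a \<in> carrier A \<Longrightarrow> v \<in> U \<Longrightarrow> \<rho> a v \<in> U"
  shows "\<exists>M \<kappa>. mod_real A \<rho> S U M \<kappa>"
proof -
  obtain n \<kappa> where \<kappa>: "coords S U n \<kappa>" using coords_exist[OF S U US fin] by blast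
  note c = coordsD[OF \<kappa>] and a = lin_actionD[OF act]
  have "\<exists>F\<in>carrier_mat n n. \<forall>v\<in>S. F *\<^sub>v \<kappa> v = \<kappa> (\<rho> x v)" if x: "x \<in> carrier A" for x
  proof (rule lin_vec_factor[OF \<kappa>])
    show "lin_vec S n (\<lambda>v. \<kappa> (\<rho> x v))" by (rule lin_vec_comp_lin[OF c(4) a(3)[OF x] a(4)[OF x]])
    show "\<kappa> (\<rho> x v) = 0\<^sub>v n" if "v \<in> U" for v using c(3,6) actU[OF x that] by blast
  qed
  then obtain F where F: "\<And>x. x \<in> carrier A \<Longrightarrow> F x \<in> carrier_mat n n"
      "\<And>x v. x \<in> carrier A \<Longrightarrow> v \<in> S \<Longrightarrow> F x *\<^sub>v \<kappa> v = \<kappa> (\<rho> x v)" by metis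
  let ?M = "\<lparr>vdim = n, act = F\<rparr>"
  have \<kappa>c: "\<kappa> v \<in> carrier_vec n" if "v \<in> S" for v using lin_vecD(1)[OF c(4) that] .
  have "is_module A ?M"
    unfolding is_module_def fdmod.simps
  proof (intro conjI ballI allI F(1))
    fix x y assume x: "x \<in> carrier A" and y: "y \<in> carrier A"
    show "F (x \<oplus>\<^bsub>A\<^esub> y) = F x + F y"
    proof (rule mat_eqI_coords[OF \<kappa> F(1)[OF a(7)[OF x y]]])
      show "F x + F y \<in> carrier_mat n n" using F(1)[OF x] F(1)[OF y] by simp
      fix v assume v: "v \<in> S"
      show "F (x \<oplus>\<^bsub>A\<^esub> y) *\<^sub>v \<kappa> v = (F x + F y) *\<^sub>v \<kappa> v"
        using F(2)[OF a(7)[OF x y] v] F(2)[OF x v] F(2)[OF y v] a(9)[OF x y v]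
          lin_vecD(2)[OF c(4) a(4)[OF x v] a(4)[OF y v]]
          add_mult_distrib_mat_vec[OF F(1)[OF x] F(1)[OF y] \<kappa>c[OF v]] by simp
    qed
    show "F (x \<otimes>\<^bsub>A\<^esub> y) = F x * F y"
    proof (rule mat_eqI_coords[OF \<kappa> F(1)[OF a(8)[OF x y]]])
      show "F x * F y \<in> carrier_mat n n" using F(1)[OF x] F(1)[OF y] by simp
      fix v assume v: "v \<in> S"
      show "F (x \<otimes>\<^bsub>A\<^esub> y) *\<^sub>v \<kappa> v = (F x * F y) *\<^sub>v \<kappa> v"
        using F(2)[OF a(8)[OF x y] v] F(2)[OF x a(4)[OF y v]] F(2)[OF y v] a(10)[OF x y v]
          assoc_mult_mat_vec[OF F(1)[OF x] F(1)[OF y] \<kappa>c[OF v]] by simp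
    qed
  next
    fix k x assume x: "x \<in> carrier A"
    show "F (k \<odot>\<^bsub>A\<^esub> x) = k \<cdot>\<^sub>m F x"
    proof (rule mat_eqI_coords[OF \<kappa> F(1)[OF a(5)[OF x]]])
      show "k \<cdot>\<^sub>m F x \<in> carrier_mat n n" using F(1)[OF x] by simp
      fix v assume v: "v \<in> S"
      have "(k \<cdot>\<^sub>m F x) *\<^sub>v \<kappa> v = k \<cdot>\<^sub>v (F x *\<^sub>v \<kappa> v)"
        using F(1)[OF x] \<kappa>c[OF v] by (intro eq_vecI) auto
      then show "F (k \<odot>\<^bsub>A\<^esub> x) *\<^sub>v \<kappa> v = (k \<cdot>\<^sub>m F x) *\<^sub>v \<kappa> v"
        using F(2)[OF a(5)[OF x] v] F(2)[OF x v] a(6)[OF x v] lin_vecD(3)[OF c(4) a(4)[OF x v]] by simp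
    qed
  next
    show "F \<one>\<^bsub>A\<^esub> = 1\<^sub>m n"
    proof (rule mat_eqI_coords[OF \<kappa> F(1)[OF a(1)] one_carrier_mat])
      fix v assume v: "v \<in> S"
      show "F \<one>\<^bsub>A\<^esub> *\<^sub>v \<kappa> v = 1\<^sub>m n *\<^sub>v \<kappa> v" using F(2)[OF a(1) v] a(2)[OF v] \<kappa>c[OF v] by simp
    qed
  qed
  then have "mod_real A \<rho> S U ?M \<kappa>"
    using \<kappa> F(2) a(4) by (simp add: mod_real_def)
  then show ?thesis by blast
qed

lemma mod_real_hom:
  fixes h :: "('x \<Rightarrow> 'k :: field) \<Rightarrow> 'k vec"
  assumes r: "mod_real A \<rho> S U M \<kappa>" and N: "is_module A N" and h: "lin_vec S (vdim N) h"
    and z: "\<And>v. v \<in> U \<Longrightarrow> h v = 0\<^sub>v (vdim N)"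
    and eq: "\<And>a v. a \<in> carrier A \<Longrightarrow> v \<in> S \<Longrightarrow> h (\<rho> a v) = act N a *\<^sub>v h v"
  shows "\<exists>F\<in>mod_hom A M N. \<forall>v\<in>S. F *\<^sub>v \<kappa> v = h v"
proof -
  note c = mod_realD(2)[OF r]
  obtain F where F: "F \<in> carrier_mat (vdim N) (vdim M)" "\<And>v. v \<in> S \<Longrightarrow> F *\<^sub>v \<kappa> v = h v"
    using lin_vec_factor[OF c h z] by blast
  have "F \<in> mod_hom A M N"
  proof (rule mod_homI[OF F(1) mod_realD(1)[OF r] N])
    fix a and x :: "'k vec" assume a: "a \<in> carrier A" and "x \<in> carrier_vec (vdim M)"
    then obtain v where v: "v \<in> S" "\<kappa> v = x" using coordsD(5)[OF c] by blast
    show "F *\<^sub>v (act M a *\<^sub>v x) = act N a *\<^sub>v (F *\<^sub>v x)"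
      using mod_realD(4)[OF r a v(1)] v F(2)[OF v(1)] F(2)[OF mod_realD(3)[OF r a v(1)]] eq[OF a v(1)]
      by simp
  qed
  then show ?thesis using F(2) by blast
qed

lemma coords_trivial:
  fixes S :: "('x \<Rightarrow> 'k :: field) set"
  assumes "coords S S n \<kappa>"
  shows "n = 0"
proof (rule ccontr)
  assume "n \<noteq> 0"
  have "unit_vec n 0 = (0\<^sub>v n :: 'k vec)"
    using coordsD(5)[OF assms, of "unit_vec n 0"] coordsD(6)[OF assms] by (metis unit_vec_carrier)
  then have "unit_vec n 0 $ 0 = (0 :: 'k)" using \<open>n \<noteq> 0\<close> by simp
  then show False using \<open>n \<noteq> 0\<close> by simp
qed

text \<open>The differentials come from the factorization of equivariant maps through
  \<open>S n / U n\<close>. A degree with \<open>S n = U n\<close> yields a zero term, which gives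
  boundedness.\<close>

lemma cpx_real_exists:
  assumes S: "\<And>n. fvs.subspace (S n)" and U: "\<And>n. fvs.subspace (U n)" and US: "\<And>n. U n \<subseteq> S n"
    and fin: "\<And>n. \<exists>F. finite F \<and> S n \<subseteq> fvs.span F" and act: "\<And>n. lin_action A \<rho> (S n)"
    and actU: "\<And>n a v. a \<in> carrier A \<Longrightarrow> v \<in> U n \<Longrightarrow> \<rho> a v \<in> U n"
    and d: "lin d" "\<And>v n. v \<in> S n \<Longrightarrow> d v \<in> S (n + 1)" "\<And>v n. v \<in> U n \<Longrightarrow> d v \<in> U (n + 1)"
      "\<And>v n. v \<in> S n \<Longrightarrow> d (d v) \<in> U (n + 2)"
    and da: "\<And>a v n. a \<in> carrier A \<Longrightarrow> v \<in> S n \<Longrightarrow> d (\<rho> a v) = \<rho> a (d v)"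
    and bd: "\<And>n. \<bar>n\<bar> > b \<Longrightarrow> S n = U n"
  shows "\<exists>X \<kappa>. cpx_real A \<rho> d S U X \<kappa>"
proof -
  have "\<exists>M \<kappa>. mod_real A \<rho> (S n) (U n) M \<kappa>" for n
    using fin[of n] mod_real_exists[OF S U US _ _ act actU] by metis
  then obtain M \<kappa> where r: "\<And>n. mod_real A \<rho> (S n) (U n) (M n) (\<kappa> n)" by metis
  note c = mod_realD(2)[OF r] and m = mod_realD(1)[OF r]
  have "\<exists>F\<in>mod_hom A (M n) (M (n + 1)). \<forall>v\<in>S n. F *\<^sub>v \<kappa> n v = \<kappa> (n + 1) (d v)" for n
  proof (rule mod_real_hom[OF r m])
    show "lin_vec (S n) (vdim (M (n + 1))) (\<lambda>v. \<kappa> (n + 1) (d v))"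
      by (rule lin_vec_comp_lin[OF coordsD(4)[OF c] d(1,2)])
    show "\<kappa> (n + 1) (d v) = 0\<^sub>v (vdim (M (n + 1)))" if "v \<in> U n" for v
      using coordsD(3,6)[OF c] d(3)[OF that] by blast
    show "\<kappa> (n + 1) (d (\<rho> a v)) = act (M (n + 1)) a *\<^sub>v \<kappa> (n + 1) (d v)"
      if "a \<in> carrier A" "v \<in> S n" for a v
      using da[OF that] mod_realD(4)[OF r that(1) d(2)[OF that(2)]] by simp
  qed
  then obtain D where D: "\<And>n. D n \<in> mod_hom A (M n) (M (n + 1))"
      "\<And>n v. v \<in> S n \<Longrightarrow> D n *\<^sub>v \<kappa> n v = \<kappa> (n + 1) (d v)" by metis
  let ?X = "\<lparr>cterm = M, cdiff = D\<rparr>"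
  have Dc: "D n \<in> carrier_mat (vdim (M (n + 1))) (vdim (M n))" for n using D(1)[of n] by (simp add: mod_hom_def)
  have Dc': "D (n + 1) \<in> carrier_mat (vdim (M (n + 2))) (vdim (M (n + 1)))" for n
    using Dc[of "n + 1"] by (simp add: add.assoc)
  have "D (n + 1) * D n = 0\<^sub>m (vdim (M (n + 2))) (vdim (M n))" for n
  proof (rule mat_eqI_coords[OF c[of n] mult_carrier_mat[OF Dc' Dc] zero_carrier_mat])
    fix v assume v: "v \<in> S n"
    have k: "\<kappa> n v \<in> carrier_vec (vdim (M n))" using lin_vecD(1)[OF coordsD(4)[OF c] v] .
    have s: "d (d v) \<in> S (n + 2)" using US d(4)[OF v] by blast
    have "D (n + 1) * D n *\<^sub>v \<kappa> n v = \<kappa> (n + 2) (d (d v))"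
      using assoc_mult_mat_vec[OF Dc' Dc k] D(2)[OF v] D(2)[OF d(2)[OF v]] by (simp add: add.assoc)
    also have "\<dots> = 0\<^sub>v (vdim (M (n + 2)))" using coordsD(6)[OF c s] d(4)[OF v] by blast
    finally show "D (n + 1) * D n *\<^sub>v \<kappa> n v = 0\<^sub>m (vdim (M (n + 2))) (vdim (M n)) *\<^sub>v \<kappa> n v"
      using zero_mat_mult_vec[OF k] by simp
  qed
  moreover have "\<forall>n. \<bar>n\<bar> > b \<longrightarrow> vdim (M n) = 0"
    using bd c coords_trivial by metis
  ultimately have "bounded_cpx A ?X"
    unfolding bounded_cpx_def using m D(1) by auto
  then have "cpx_real A \<rho> d S U ?X \<kappa>"
    using r D(2) d(2) by (simp add: cpx_real_def)
  then show ?thesis by blast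
qed

text \<open>The way to build chain maps out of a subquotient complex: a formula \<open>h\<close>,
  checked on functions, replaces matrix identities.\<close>

lemma cpx_real_map:
  fixes h :: "int \<Rightarrow> ('x \<Rightarrow> 'k :: field) \<Rightarrow> 'k vec"
  assumes r: "cpx_real A \<rho> d S U X \<kappa>" and Y: "bounded_cpx A Y"
    and h: "\<And>n. lin_vec (S n) (cdim Y n) (h n)"
    and z: "\<And>n v. v \<in> U n \<Longrightarrow> h n v = 0\<^sub>v (cdim Y n)"
    and eq: "\<And>n a v. a \<in> carrier A \<Longrightarrow> v \<in> S n \<Longrightarrow> h n (\<rho> a v) = act (cterm Y n) a *\<^sub>v h n v"
    and hd: "\<And>n v. v \<in> S n \<Longrightarrow> h (n + 1) (d v) = cdiff Y n *\<^sub>v h n v"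
  shows "\<exists>F. chain_map A X Y F \<and> (\<forall>n. \<forall>v\<in>S n. F n *\<^sub>v \<kappa> n v = h n v)"
proof -
  have "\<exists>F\<in>mod_hom A (cterm X n) (cterm Y n). \<forall>v\<in>S n. F *\<^sub>v \<kappa> n v = h n v" for n
    by (rule mod_real_hom[OF cpx_realD(2)[OF r] cterm_module[OF Y] h z eq])
  then obtain F where F: "\<And>n. F n \<in> mod_hom A (cterm X n) (cterm Y n)"
      "\<And>n v. v \<in> S n \<Longrightarrow> F n *\<^sub>v \<kappa> n v = h n v" by metis
  have "chain_map A X Y F"
  proof (rule chain_mapI[OF cpx_realD(1)[OF r] Y F(1)])
    fix n and x :: "'k vec" assume "x \<in> carrier_vec (cdim X n)"
    then obtain v where v: "v \<in> S n" "\<kappa> n v = x" using coordsD(5)[OF cpx_realD(3)[OF r]] by blast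
    show "F (n + 1) *\<^sub>v (cdiff X n *\<^sub>v x) = cdiff Y n *\<^sub>v (F n *\<^sub>v x)"
      using cpx_realD(5)[OF r v(1)] v F(2)[OF v(1)] F(2)[OF cpx_realD(4)[OF r v(1)]] hd[OF v(1)] by simp
  qed
  then show ?thesis using F(2) by blast
qed

lemma cpx_real_carrier:
  assumes r: "cpx_real A \<rho> d S U X \<kappa>" and v: "v \<in> S n"
  shows "\<kappa> n v \<in> carrier_vec (cdim X n)"
  using lin_vecD(1)[OF coordsD(4)[OF cpx_realD(3)[OF r]] v] .

lemma cpx_real_surj:
  assumes r: "cpx_real A \<rho> d S U X \<kappa>" and "x \<in> carrier_vec (cdim X n)"
  obtains v where "v \<in> S n" "\<kappa> n v = x"
  using coordsD(5)[OF cpx_realD(3)[OF r] assms(2)] by blast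

lemma cpx_real_cocycles:
  assumes r: "cpx_real A \<rho> d S U X \<kappa>" and v: "v \<in> S n"
  shows "\<kappa> n v \<in> cocycles X n \<longleftrightarrow> d v \<in> U (n + 1)"
  using coordsD(6)[OF cpx_realD(3)[OF r] cpx_realD(4)[OF r v]] cpx_realD(5)[OF r v]
    cpx_real_carrier[OF r v] by (simp add: cocycles_def)

lemma cpx_real_coboundaries:
  assumes r: "cpx_real A \<rho> d S U X \<kappa>" and v: "v \<in> S n"
  shows "\<kappa> n v \<in> coboundaries X n \<longleftrightarrow> (\<exists>w\<in>S (n - 1). v - d w \<in> U n)"
proof -
  note c = cpx_realD(3)[OF r]
  have eq: "cdiff X (n - 1) *\<^sub>v \<kappa> (n - 1) w = \<kappa> n v \<longleftrightarrow> v - d w \<in> U n" if w: "w \<in> S (n - 1)" for w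
  proof -
    have dw: "d w \<in> S n" using cpx_realD(4)[OF r w] by simp
    have "cdiff X (n - 1) *\<^sub>v \<kappa> (n - 1) w = \<kappa> n (d w)" using cpx_realD(5)[OF r w] by simp
    then show ?thesis using coords_eq_iff[OF c v dw] by auto
  qed
  show ?thesis
  proof
    assume "\<kappa> n v \<in> coboundaries X n"
    then obtain y where y: "y \<in> carrier_vec (cdim X (n - 1))" "\<kappa> n v = cdiff X (n - 1) *\<^sub>v y"
      by (auto simp: coboundaries_def)
    then show "\<exists>w\<in>S (n - 1). v - d w \<in> U n" using eq by (metis cpx_real_surj[OF r])
  next
    assume "\<exists>w\<in>S (n - 1). v - d w \<in> U n"
    then obtain w where w: "w \<in> S (n - 1)" "v - d w \<in> U n" by blast
    have "\<kappa> n v = cdiff X (n - 1) *\<^sub>v \<kappa> (n - 1) w" using eq[OF w(1)] w(2) by metis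
    then show "\<kappa> n v \<in> coboundaries X n"
      using coboundariesI[OF cpx_real_carrier[OF r w(1)]] by simp
  qed
qed

lemma zero_dim_qeq:
  fixes X :: "('a, 'k :: field) cpx"
  assumes X: "bounded_cpx A X" and z: "\<And>n. cdim X n = 0"
  shows "qeq A X zero_cpx"
proof -
  have c: "(0\<^sub>m 0 0 :: 'k mat) \<in> mod_hom A (cterm X n) (cterm zero_cpx n)" for n
    using z carrier_matD[OF is_moduleD(1)[OF cterm_module[OF X]], of _ n]
    by (auto simp: mod_hom_def zero_mod_def intro!: eq_matI)
  have "chain_map A X zero_cpx (\<lambda>n. 0\<^sub>m 0 0)"
    by (rule chain_mapI[OF X bounded_zero_cpx c]) (auto intro!: eq_vecI)
  moreover have "bij_betw (\<lambda>x. 0\<^sub>m 0 0 *\<^sub>v x) (carrier_vec 0) (carrier_vec 0 :: 'k vec set)"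
    by (rule bij_betw_zero_mat)
  ultimately have "quasi_iso A X zero_cpx (\<lambda>n. 0\<^sub>m 0 0)"
    using z by (intro chain_map_bij_quasi_iso[OF X bounded_zero_cpx]) auto
  then show ?thesis by (rule qeq_quasi_iso[OF X bounded_zero_cpx])
qed

section \<open>Decomposition of filtered complexes\<close>

lemma lin_sum:
  assumes "lin f"
  shows "f (sum h X) = (\<Sum>i\<in>X. f (h i))"
proof (induction X rule: infinite_finite_induct)
  case (insert x F)
  show ?case unfolding sum.insert[OF insert.hyps] linD(1)[OF assms] insert.IH ..
qed (simp_all only: sum.infinite sum.empty linD(3)[OF assms] not_False_eq_True)

lemma sum_fun_apply: "(sum h X) x = (\<Sum>i\<in>X. h i x)"
  by (induction X rule: infinite_finite_induct) simp_all

text \<open>A function on pairs is read as a family of functions on \<open>'x\<close>, one for each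
  row index. Below, \<open>ract\<close> mixes the rows and \<open>rowop\<close> works inside each of
  them.\<close>

definition row :: "('l \<times> 'x \<Rightarrow> 'k) \<Rightarrow> 'l \<Rightarrow> 'x \<Rightarrow> 'k" where
  "row g p = (\<lambda>x. g (p, x))"

lemma row_simps [simp]:
  "row (g + h) p = row g p + row h p" "row (g - h') p = row g p - row h' p"
  "row (fscale c f) p = fscale c (row f p)" "row 0 p = 0"
  by (auto simp: row_def fun_eq_iff)

lemma row_sum: "row (sum h X) p = (\<Sum>i\<in>X. row (h i) p)"
  by (auto simp: row_def fun_eq_iff sum_fun_apply)

lemma row_eqI: "(\<And>p. row g p = row h p) \<Longrightarrow> g = h"
  by (auto simp: row_def fun_eq_iff)

text \<open>A matrix representation \<open>\<tau>\<close> with rows indexed by \<open>L\<close>,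
  block diagonal for the components \<open>cmp\<close> and lower triangular for the levels
  \<open>lev\<close>. It is instantiated for the rows of the normalization, over \<open>H\<close>
  and over \<open>A\<close>, and for the characters of \<open>A\<close>, where every character is a
  component of height 1. One decomposition theorem thus serves both ends of the triangle.\<close>

locale tri_rep =
  fixes A :: "('k :: field, 'a) module" and L :: "'l set" and cmp :: "'l \<Rightarrow> 'c" and lev :: "'l \<Rightarrow> nat"
    and hgt :: "'c \<Rightarrow> nat" and \<tau> :: "'a \<Rightarrow> 'l \<Rightarrow> 'l \<Rightarrow> 'k"
  assumes finL: "finite L"
    and lev: "p \<in> L \<Longrightarrow> 1 \<le> lev p" "p \<in> L \<Longrightarrow> lev p \<le> hgt (cmp p)"
    and closed: "\<one>\<^bsub>A\<^esub> \<in> carrier A" "a \<in> carrier A \<Longrightarrow> s \<odot>\<^bsub>A\<^esub> a \<in> carrier A"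
      "a \<in> carrier A \<Longrightarrow> b \<in> carrier A \<Longrightarrow> a \<oplus>\<^bsub>A\<^esub> b \<in> carrier A"
      "a \<in> carrier A \<Longrightarrow> b \<in> carrier A \<Longrightarrow> a \<otimes>\<^bsub>A\<^esub> b \<in> carrier A"
    and \<tau>_one: "p \<in> L \<Longrightarrow> q \<in> L \<Longrightarrow> \<tau> \<one>\<^bsub>A\<^esub> p q = (if p = q then 1 else 0)"
    and \<tau>_smult: "a \<in> carrier A \<Longrightarrow> p \<in> L \<Longrightarrow> q \<in> L \<Longrightarrow> \<tau> (s \<odot>\<^bsub>A\<^esub> a) p q = s * \<tau> a p q"
    and \<tau>_add: "a \<in> carrier A \<Longrightarrow> b \<in> carrier A \<Longrightarrow> p \<in> L \<Longrightarrow> q \<in> L \<Longrightarrow>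
      \<tau> (a \<oplus>\<^bsub>A\<^esub> b) p q = \<tau> a p q + \<tau> b p q"
    and \<tau>_mult: "a \<in> carrier A \<Longrightarrow> b \<in> carrier A \<Longrightarrow> p \<in> L \<Longrightarrow> q \<in> L \<Longrightarrow>
      \<tau> (a \<otimes>\<^bsub>A\<^esub> b) p q = (\<Sum>r\<in>L. \<tau> a p r * \<tau> b r q)"
    and \<tau>_tri: "a \<in> carrier A \<Longrightarrow> p \<in> L \<Longrightarrow> q \<in> L \<Longrightarrow> \<tau> a p q \<noteq> 0 \<Longrightarrow>
      cmp q = cmp p \<and> lev q \<le> lev p"
begin

definition ract :: "'a \<Rightarrow> ('l \<times> 'x \<Rightarrow> 'k) \<Rightarrow> 'l \<times> 'x \<Rightarrow> 'k" where
  "ract a g = (\<lambda>(p, x). if p \<in> L then \<Sum>q\<in>L. \<tau> a p q * g (q, x) else 0)"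

definition rowop :: "('c \<Rightarrow> ('x \<Rightarrow> 'k) \<Rightarrow> 'y \<Rightarrow> 'k) \<Rightarrow> ('l \<times> 'x \<Rightarrow> 'k) \<Rightarrow> 'l \<times> 'y \<Rightarrow> 'k" where
  "rowop T g = (\<lambda>(p, x). if p \<in> L then T (cmp p) (row g p) x else 0)"

definition Qs :: "('c \<Rightarrow> nat \<Rightarrow> ('x \<Rightarrow> 'k) set) \<Rightarrow> ('l \<times> 'x \<Rightarrow> 'k) set" where
  "Qs V = {g. (\<forall>p\<in>L. row g p \<in> V (cmp p) (lev p)) \<and> (\<forall>p. p \<notin> L \<longrightarrow> row g p = 0)}"

lemma row_ract:
  "row (ract a g) p = (if p \<in> L then \<Sum>q\<in>L. fscale (\<tau> a p q) (row g q) else 0)"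
  by (auto simp: row_def ract_def fun_eq_iff sum_fun_apply)

lemma row_rowop: "row (rowop T g) p = (if p \<in> L then T (cmp p) (row g p) else 0)"
  by (auto simp: row_def rowop_def fun_eq_iff)

lemma QsD:
  assumes "g \<in> Qs V"
  shows "p \<in> L \<Longrightarrow> row g p \<in> V (cmp p) (lev p)" "p \<notin> L \<Longrightarrow> row g p = 0"
  using assms by (auto simp: Qs_def)

lemma QsI:
  assumes "\<And>p. p \<in> L \<Longrightarrow> row g p \<in> V (cmp p) (lev p)" "\<And>p. p \<notin> L \<Longrightarrow> row g p = 0"
  shows "g \<in> Qs V"
  using assms by (auto simp: Qs_def)

lemma lin_ract: "lin (ract a)"
  unfolding lin_def
  by (auto simp: ract_def fun_eq_iff sum.distrib sum_distrib_left algebra_simps)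

lemma lin_rowop:
  assumes "\<And>c. lin (T c)"
  shows "lin (rowop T)"
  unfolding lin_def
proof (intro conjI allI)
  show "rowop T (v + w) = rowop T v + rowop T w" for v w
    by (rule row_eqI) (simp only: row_simps row_rowop linD(1)[OF assms] split: if_split, simp)
  show "rowop T (fscale s v) = fscale s (rowop T v)" for s v
    by (rule row_eqI) (simp only: row_simps row_rowop linD(2)[OF assms] split: if_split, simp)
qed

text \<open>The operator may depend on the component, since a nonzero entry of \<open>\<tau>\<close>
  joins only rows of one component.\<close>

lemma rowop_ract:
  assumes T: "\<And>c. lin (T c)" and a: "a \<in> carrier A"
  shows "rowop T (ract a g) = ract a (rowop T g)"
proof (rule row_eqI)
  fix p
  show "row (rowop T (ract a g)) p = row (ract a (rowop T g)) p"
  proof (cases "p \<in> L")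
    case True
    have "T (cmp p) (\<Sum>q\<in>L. fscale (\<tau> a p q) (row g q)) = (\<Sum>q\<in>L. fscale (\<tau> a p q) (T (cmp p) (row g q)))"
      unfolding lin_sum[OF T] linD(2)[OF T] ..
    also have "\<dots> = (\<Sum>q\<in>L. fscale (\<tau> a p q) (row (rowop T g) q))"
    proof (rule sum.cong[OF HOL.refl])
      fix q assume q: "q \<in> L"
      show "fscale (\<tau> a p q) (T (cmp p) (row g q)) = fscale (\<tau> a p q) (row (rowop T g) q)"
        using \<tau>_tri[OF a True q] q by (cases "\<tau> a p q = 0") (auto simp: row_rowop)
    qed
    finally show ?thesis using True by (simp add: row_rowop row_ract)
  qed (simp add: row_rowop row_ract)
qed

lemma subspace_Qs:
  assumes "\<And>c r. fvs.subspace (V c r)"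
  shows "fvs.subspace (Qs V)"
  using assms
  by (auto simp: fvs.subspace_def Qs_def)

text \<open>Row \<open>p\<close> of the result combines rows of its own component and of level at
  most \<open>lev p\<close>; these lie in \<open>V (cmp p) (lev p)\<close> because \<open>V\<close>
  increases. Triangularity of \<open>\<tau>\<close> is what turns a filtered space into a
  module.\<close>

lemma Qs_ract:
  assumes V: "\<And>c r. fvs.subspace (V c r)" and mono: "\<And>c r r'. r \<le> r' \<Longrightarrow> V c r \<subseteq> V c r'"
    and a: "a \<in> carrier A" and g: "g \<in> Qs V"
  shows "ract a g \<in> Qs V"
proof (rule QsI)
  fix p assume p: "p \<in> L"
  have "(\<Sum>q\<in>L. fscale (\<tau> a p q) (row g q)) \<in> V (cmp p) (lev p)"
  proof (rule fvs.subspace_sum[OF V])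
    fix q assume q: "q \<in> L"
    show "fscale (\<tau> a p q) (row g q) \<in> V (cmp p) (lev p)"
    proof (cases "\<tau> a p q = 0")
      case True
      then have "fscale (\<tau> a p q) (row g q) = 0" by (auto simp: fun_eq_iff)
      then show ?thesis using fvs.subspace_0[OF V] by metis
    next
      case False
      then have "row g q \<in> V (cmp p) (lev p)"
        using \<tau>_tri[OF a p q] QsD(1)[OF g q] mono[of "lev q" "lev p" "cmp p"] by auto
      then show ?thesis by (rule fvs.subspace_scale[OF V])
    qed
  qed
  then show "row (ract a g) p \<in> V (cmp p) (lev p)" using p by (simp add: row_ract)
qed (simp add: row_ract)

lemma lin_action_ract:
  assumes S: "\<And>a g. a \<in> carrier A \<Longrightarrow> g \<in> S \<Longrightarrow> ract a g \<in> S"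
    and supp: "\<And>g p. g \<in> S \<Longrightarrow> p \<notin> L \<Longrightarrow> row g p = 0"
  shows "lin_action A ract S"
  unfolding lin_action_def
proof (intro conjI ballI allI)
  fix g assume g: "g \<in> S"
  show "ract \<one>\<^bsub>A\<^esub> g = g"
  proof (rule ext, clarify)
    fix p x
    have "(\<Sum>q\<in>L. \<tau> \<one>\<^bsub>A\<^esub> p q * g (q, x)) = (\<Sum>q\<in>L. if q = p then g (q, x) else 0)" if "p \<in> L"
      using that by (intro sum.cong) (auto simp: \<tau>_one)
    then show "ract \<one>\<^bsub>A\<^esub> g (p, x) = g (p, x)"
      using finL supp[OF g, of p] by (auto simp: ract_def row_def fun_eq_iff)
  qed
  {
    fix a c assume "a \<in> carrier A"
    then show "ract (c \<odot>\<^bsub>A\<^esub> a) g = fscale c (ract a g)"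
      by (auto simp: ract_def fun_eq_iff \<tau>_smult sum_distrib_left mult.assoc)
  next
    fix a b assume a: "a \<in> carrier A" and b: "b \<in> carrier A"
    show "ract (a \<oplus>\<^bsub>A\<^esub> b) g = ract a g + ract b g"
      using a b by (auto simp: ract_def fun_eq_iff \<tau>_add sum.distrib distrib_right)
    have "(\<Sum>q\<in>L. \<tau> (a \<otimes>\<^bsub>A\<^esub> b) p q * g (q, x)) = (\<Sum>r\<in>L. \<tau> a p r * (\<Sum>q\<in>L. \<tau> b r q * g (q, x)))"
      if "p \<in> L" for p x
    proof -
      have "(\<Sum>q\<in>L. \<tau> (a \<otimes>\<^bsub>A\<^esub> b) p q * g (q, x)) = (\<Sum>q\<in>L. \<Sum>r\<in>L. \<tau> a p r * \<tau> b r q * g (q, x))"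
        using a b that by (intro sum.cong) (auto simp: \<tau>_mult sum_distrib_right)
      also have "\<dots> = (\<Sum>r\<in>L. \<Sum>q\<in>L. \<tau> a p r * \<tau> b r q * g (q, x))" by (rule sum.swap)
      finally show ?thesis by (simp add: sum_distrib_left mult.assoc)
    qed
    then show "ract (a \<otimes>\<^bsub>A\<^esub> b) g = ract a (ract b g)"
      by (auto simp: ract_def fun_eq_iff intro!: sum.cong)
  }
qed (simp_all add: closed S lin_ract)

lemma Qs_finite_span:
  fixes F :: "('x \<Rightarrow> 'k) set"
  assumes F: "finite F" and V: "\<And>c r. V c r \<subseteq> fvs.span F"
  shows "\<exists>F'. finite F' \<and> Qs V \<subseteq> fvs.span F'"
proof -
  define sg :: "'l \<Rightarrow> ('x \<Rightarrow> 'k) \<Rightarrow> 'l \<times> 'x \<Rightarrow> 'k" where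
    "sg p w = (\<lambda>(q, x). if q = p then w x else 0)" for p w
  let ?F = "(\<Union>p\<in>L. sg p ` F)"
  have sp: "sg p w \<in> fvs.span ?F" if p: "p \<in> L" and w: "w \<in> fvs.span F" for p w
    using w
  proof (induction rule: fvs.span_induct_alt)
    case base
    have "sg p 0 = 0" by (auto simp: sg_def fun_eq_iff)
    then show ?case by (metis fvs.span_zero)
  next
    case (step s f w)
    have e: "sg p (fscale s f + w) = fscale s (sg p f) + sg p w" by (auto simp: sg_def fun_eq_iff)
    have "sg p f \<in> fvs.span ?F" using p step.hyps by (intro fvs.span_base) blast
    then show ?case unfolding e using step.IH by (intro fvs.span_add fvs.span_scale)
  qed
  have "g \<in> fvs.span ?F" if g: "g \<in> Qs V" for g
  proof -
    have "g = (\<Sum>p\<in>L. sg p (row g p))"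
    proof (rule ext, clarify)
      fix p x
      have "(\<Sum>q\<in>L. sg q (row g q) (p, x)) = (\<Sum>q\<in>L. if q = p then g (p, x) else 0)"
        by (intro sum.cong) (auto simp: sg_def row_def)
      then show "g (p, x) = (\<Sum>p\<in>L. sg p (row g p)) (p, x)"
        using finL QsD(2)[OF g, of p] by (auto simp: sum_fun_apply row_def fun_eq_iff)
    qed
    moreover have "(\<Sum>p\<in>L. sg p (row g p)) \<in> fvs.span ?F"
      by (intro fvs.span_sum sp) (use QsD(1)[OF g] V in blast)+
    ultimately show ?thesis by simp
  qed
  moreover have "finite ?F" using F finL by simp
  ultimately show ?thesis by blast
qed

text \<open>\<open>ival c l / ival c j\<close> is the interval module with support at the levels \<open>l \<le> r < j\<close>.\<close>

definition ival :: "'c \<Rightarrow> nat \<Rightarrow> ('l \<times> unit \<Rightarrow> 'k) set" where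
  "ival c l = Qs (\<lambda>c' r. if c' = c \<and> l \<le> r then UNIV else {0})"

text \<open>\<open>V c r n\<close> is the part of level \<open>r\<close> of a filtered space in component \<open>c\<close> and degree \<open>n\<close>.
  The row \<open>p\<close> of the complex of modules that it defines is \<open>V (cmp p) (lev p) n / V (cmp p) 0 n\<close>.\<close>

definition filt ::
  "('c \<Rightarrow> nat \<Rightarrow> int \<Rightarrow> ('x \<Rightarrow> 'k) set) \<Rightarrow> (('x \<Rightarrow> 'k) \<Rightarrow> 'x \<Rightarrow> 'k) \<Rightarrow> ('x \<Rightarrow> 'k) set \<Rightarrow> int \<Rightarrow> bool" where
  "filt V d F b \<longleftrightarrow> lin d \<and> (\<forall>v. d (d v) = 0) \<and> finite F \<and>
     (\<forall>c r n. fvs.subspace (V c r n) \<and> V c r n \<subseteq> fvs.span F \<and> (\<forall>v\<in>V c r n. d v \<in> V c r (n + 1))) \<and>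
     (\<forall>c r r' n. r \<le> r' \<longrightarrow> V c r n \<subseteq> V c r' n) \<and>
     (\<forall>c n. b < \<bar>n\<bar> \<longrightarrow> V c (hgt c) n = V c 0 n)"

lemma filtD:
  assumes "filt V d F b"
  shows "lin d" "d (d v) = 0" "finite F" "fvs.subspace (V c r n)" "V c r n \<subseteq> fvs.span F"
    "v \<in> V c r n \<Longrightarrow> d v \<in> V c r (n + 1)" "r \<le> r' \<Longrightarrow> v \<in> V c r n \<Longrightarrow> v \<in> V c r' n"
    "b < \<bar>n\<bar> \<Longrightarrow> V c (hgt c) n = V c 0 n"
  using assms unfolding filt_def by blast+

definition fcpx ::
  "('c \<Rightarrow> nat \<Rightarrow> int \<Rightarrow> ('x \<Rightarrow> 'k) set) \<Rightarrow> (('x \<Rightarrow> 'k) \<Rightarrow> 'x \<Rightarrow> 'k) \<Rightarrow> ('a, 'k) cpx \<Rightarrow>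
   (int \<Rightarrow> ('l \<times> 'x \<Rightarrow> 'k) \<Rightarrow> 'k vec) \<Rightarrow> bool" where
  "fcpx V d C \<kappa> \<longleftrightarrow>
     cpx_real A ract (rowop (\<lambda>_. d)) (\<lambda>n. Qs (\<lambda>c r. V c r n)) (\<lambda>n. Qs (\<lambda>c r. V c 0 n)) C \<kappa>"

lemma Qs_mono:
  assumes "\<And>p. p \<in> L \<Longrightarrow> V (cmp p) (lev p) \<subseteq> V' (cmp p) (lev p)"
  shows "Qs V \<subseteq> Qs V'"
  using assms by (fastforce simp: Qs_def)

lemma fcpx_exists:
  assumes f: "filt V d F b"
  shows "\<exists>C \<kappa>. fcpx V d C \<kappa>"
  unfolding fcpx_def
proof (rule cpx_real_exists)
  note fD = filtD[OF f]
  fix n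
  show "fvs.subspace (Qs (\<lambda>c r. V c r n))" "fvs.subspace (Qs (\<lambda>c r. V c 0 n))"
    by (intro subspace_Qs fD(4))+
  show US: "Qs (\<lambda>c r. V c 0 n) \<subseteq> Qs (\<lambda>c r. V c r n)"
    by (rule Qs_mono) (use fD(7) in blast)
  show "\<exists>F'. finite F' \<and> Qs (\<lambda>c r. V c r n) \<subseteq> fvs.span F'"
    by (rule Qs_finite_span[OF fD(3,5)])
  show "lin_action A ract (Qs (\<lambda>c r. V c r n))"
    by (rule lin_action_ract[OF Qs_ract[OF fD(4)]]) (use fD(7) QsD(2) in blast)+
  show "ract a g \<in> Qs (\<lambda>c r. V c 0 n)" if "a \<in> carrier A" "g \<in> Qs (\<lambda>c r. V c 0 n)" for a g
    by (rule Qs_ract[OF fD(4) _ that]) simp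
  show "lin (rowop (\<lambda>_. d))" by (rule lin_rowop[OF fD(1)])
  show "rowop (\<lambda>_. d) g \<in> Qs (\<lambda>c r. V c r (n + 1))" if "g \<in> Qs (\<lambda>c r. V c r n)" for g
    by (rule QsI) (use QsD(1)[OF that] fD(6) in \<open>auto simp: row_rowop\<close>)
  show "rowop (\<lambda>_. d) g \<in> Qs (\<lambda>c r. V c 0 (n + 1))" if "g \<in> Qs (\<lambda>c r. V c 0 n)" for g
    by (rule QsI) (use QsD(1)[OF that] fD(6) in \<open>auto simp: row_rowop\<close>)
  show "rowop (\<lambda>_. d) (rowop (\<lambda>_. d) g) \<in> Qs (\<lambda>c r. V c 0 (n + 2))" for g
    by (rule QsI) (auto simp: row_rowop fD(2) fvs.subspace_0[OF fD(4)])
  show "rowop (\<lambda>_. d) (ract a g) = ract a (rowop (\<lambda>_. d) g)" if "a \<in> carrier A" for a g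
    by (rule rowop_ract[OF fD(1) that])
  show "Qs (\<lambda>c r. V c r n) = Qs (\<lambda>c r. V c 0 n)" if "b < \<bar>n\<bar>"
  proof
    \<comment> \<open>The levels of rows lie between 0 and the height, so equality of the two
      extreme spaces collapses all rows.\<close>
    have "V (cmp p) (lev p) n \<subseteq> V (cmp p) 0 n" if "p \<in> L" for p
      using fD(7)[OF lev(2)[OF that]] fD(8)[OF \<open>b < \<bar>n\<bar>\<close>] by blast
    then show "Qs (\<lambda>c r. V c r n) \<subseteq> Qs (\<lambda>c r. V c 0 n)" by (rule Qs_mono)
  qed (rule US)
qed

end

lemma lin_vec_append:
  assumes h: "lin_vec S a h" and k: "lin_vec S b k"
  shows "lin_vec S (a + b) (\<lambda>v. h v @\<^sub>v k v)"
  unfolding lin_vec_def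
proof (intro conjI ballI allI)
  fix v w assume v: "v \<in> S" and w: "w \<in> S"
  show "h (v + w) @\<^sub>v k (v + w) = (h v @\<^sub>v k v) + (h w @\<^sub>v k w)"
    unfolding lin_vecD(2)[OF h v w] lin_vecD(2)[OF k v w]
    by (rule append_vec_add[symmetric]) (use lin_vecD(1)[OF h] lin_vecD(1)[OF k] v w in auto)
next
  fix c v assume v: "v \<in> S"
  show "h (fscale c v) @\<^sub>v k (fscale c v) = c \<cdot>\<^sub>v (h v @\<^sub>v k v)"
    unfolding lin_vecD(3)[OF h v] lin_vecD(3)[OF k v] by (intro eq_vecI) auto
qed (use lin_vecD(1)[OF h] lin_vecD(1)[OF k] in auto)

lemma lin_id: "lin (\<lambda>v. v)"
  by (simp add: lin_def)

lemma lin_minus_rank_one: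
  assumes "functional \<psi>"
  shows "lin (\<lambda>v. v - fscale (\<psi> v) z)"
  unfolding lin_def functionalD(1,2)[OF assms] by (auto simp: fun_eq_iff algebra_simps)

lemma lin_zero: "lin (\<lambda>v. 0)"
  by (auto simp: lin_def fun_eq_iff)

lemma functional_comp_lin: "functional \<phi> \<Longrightarrow> lin d \<Longrightarrow> functional (\<lambda>v. \<phi> (d v))"
  unfolding functional_def lin_def by metis

lemma functional_zero: "functional (\<lambda>v. 0)"
  by (simp add: functional_def)

lemma fscale_zero: "fscale 0 z = 0"
  by (auto simp: fun_eq_iff)

context tri_rep
begin

lemma ival_module_exists:
  assumes "l \<le> j"
  shows "\<exists>N \<kappa>. mod_real A ract (ival c l) (ival c j) N \<kappa>"
proof -
  have sub: "fvs.subspace (ival c l)" for l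
    unfolding ival_def by (intro subspace_Qs) (simp add: fvs.subspace_0 fvs.subspace_def)
  have V: "fvs.subspace (if c' = c \<and> l \<le> r then UNIV else {0 :: unit \<Rightarrow> 'k})" for c' r l
    by (simp add: fvs.subspace_def)
  have act: "ract a g \<in> ival c l" if "a \<in> carrier A" "g \<in> ival c l" for a g l
    using that unfolding ival_def by (intro Qs_ract V) (auto split: if_splits)
  have sp: "w \<in> fvs.span {\<lambda>_. 1}" for w :: "unit \<Rightarrow> 'k"
  proof -
    have "w = fscale (w ()) (\<lambda>_. 1)" by (auto simp: fun_eq_iff)
    moreover have "fscale (w ()) (\<lambda>_. 1) \<in> fvs.span {\<lambda>_ :: unit. 1 :: 'k}"
      by (intro fvs.span_scale fvs.span_base) simp
    ultimately show ?thesis by metis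
  qed
  have "\<exists>F'. finite F' \<and> ival c l \<subseteq> fvs.span F'"
    unfolding ival_def by (rule Qs_finite_span[of "{\<lambda>_. 1}"]) (use sp in blast)+
  then obtain F' where F': "finite F'" "ival c l \<subseteq> fvs.span F'" by blast
  have "lin_action A ract (ival c l)"
    by (rule lin_action_ract[OF act]) (use QsD(2) in \<open>unfold ival_def, blast\<close>)
  then show ?thesis
    using assms by (intro mod_real_exists[OF sub sub _ F' _ act]) (auto simp: ival_def Qs_def)
qed

text \<open>Splitting off one bar: \<open>y\<close> of level \<open>l\<close> is a class that becomes the boundary of \<open>x\<close> at level
  \<open>j\<close>, or never if \<open>j\<close> exceeds the height. The remainder is cut out by \<open>\<phi>\<close> and \<open>\<phi> \<circ> d\<close>.\<close>

lemma bar_split: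
  fixes V :: "'c \<Rightarrow> nat \<Rightarrow> int \<Rightarrow> ('x \<Rightarrow> 'k) set" and n :: int
  assumes f: "filt V d F b" and C: "fcpx V d C \<kappa>"
    and l: "1 \<le> l" "l \<le> hgt c" "l \<le> j" and \<phi>: "functional \<phi>"
    and y: "y \<in> V c l (n + 1)" "\<phi> y = 1" and \<phi>l: "\<And>v. v \<in> V c (l - 1) (n + 1) \<Longrightarrow> \<phi> v = 0"
    and x: "j \<le> hgt c \<Longrightarrow> x \<in> V c j n" "j \<le> hgt c \<Longrightarrow> d x = y"
    and \<phi>j: "\<And>r v. r < j \<Longrightarrow> r \<le> hgt c \<Longrightarrow> v \<in> V c r n \<Longrightarrow> \<phi> (d v) = 0"
    and dy: "d y \<in> V c 0 (n + 2)"
    and N: "mod_real A ract (ival c l) (ival c j) N \<kappa>N"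
  defines "V' \<equiv> (\<lambda>c' r k. {v \<in> V c' r k. c' = c \<longrightarrow> (k = n + 1 \<longrightarrow> \<phi> v = 0) \<and> (k = n \<longrightarrow> \<phi> (d v) = 0)})"
  shows "filt V' d F b" and "\<exists>C' \<kappa>'. fcpx V' d C' \<kappa>' \<and> qeq A C (cpx_sum C' (cpx_shift (- (n + 1)) (stalk N)))"
proof -
  note fD = filtD[OF f]
  \<comment> \<open>\<open>\<psi> k\<close> vanishes on the remainder in degree \<open>k\<close>,
    and \<open>z k\<close> spans the piece split off: \<open>y\<close> in degree
    \<open>n + 1\<close>, \<open>x\<close> in degree \<open>n\<close>. If \<open>j\<close> exceeds
    the height, \<open>x\<close> is a dummy, but then \<open>\<psi> n\<close> vanishes on all levels
    up to the height.\<close>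
  define \<psi> where "\<psi> k v = (if k = n + 1 then \<phi> v else if k = n then \<phi> (d v) else 0)" for k v
  define z where "z k = (if k = n + 1 then y else if k = n then x else 0)" for k
  have V': "V' = (\<lambda>c' r k. {v \<in> V c' r k. c' = c \<longrightarrow> \<psi> k v = 0})"
    by (auto simp: V'_def \<psi>_def fun_eq_iff)
  have \<psi>: "functional (\<psi> k)" for k
    using \<phi> functional_comp_lin[OF \<phi> fD(1)] functional_zero
    unfolding \<psi>_def by (cases "k = n + 1"; cases "k = n") simp_all
  note \<psi>D = functionalD[OF \<psi>]
  have \<phi>0: "\<phi> 0 = 0" by (rule functionalD(3)[OF \<phi>])
  \<comment> \<open>The spaces at level 0 remain unchanged, so both complexes are quotients by the
    same \<open>?U\<close>. In degree \<open>n\<close> this uses \<open>0 < j\<close>, from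
    \<open>1 \<le> l\<close> and \<open>l \<le> j\<close>.\<close>
  have V0: "\<psi> k v = 0" if v: "v \<in> V c 0 k" for k v
  proof -
    have "\<phi> v = 0" if "k = n + 1" using fD(7)[of 0 "l - 1" v c k] v that \<phi>l by simp
    moreover have "\<phi> (d v) = 0" if "k = n" using \<phi>j[of 0 v] v l that by simp
    ultimately show ?thesis by (simp add: \<psi>_def)
  qed
  have \<psi>d: "\<psi> (k + 1) (d v) = (if k = n then \<phi> (d v) else 0)" for k v
    by (auto simp: \<psi>_def fD(2) \<phi>0)
  have lvl: "j \<le> r" if "v \<in> V c r n" "r \<le> hgt c" "\<phi> (d v) \<noteq> 0" for v r
    using \<phi>j[of r v] that by (cases "r < j") auto
  have lvl': "l \<le> r" if "v \<in> V c r (n + 1)" "\<phi> v \<noteq> 0" for v r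
  proof (rule ccontr)
    assume "\<not> l \<le> r"
    then have "v \<in> V c (l - 1) (n + 1)" using fD(7)[of r "l - 1" v] that(1) by simp
    then show False using \<phi>l that(2) by blast
  qed
  \<comment> \<open>A level that contains a vector with \<open>\<psi> k v \<noteq> 0\<close> already
    contains \<open>z k\<close>. Hence the projection along \<open>z k\<close> respects the
    filtration.\<close>
  have zV: "z k \<in> V c r k" "\<psi> k (z k) = 1" if h: "v \<in> V c r k" "r \<le> hgt c" "\<psi> k v \<noteq> 0" for k r v
  proof -
    consider "k = n + 1" "\<phi> v \<noteq> 0" | "k = n" "\<phi> (d v) \<noteq> 0"
      using h(3) by (auto simp: \<psi>_def split: if_splits)
    then have "z k \<in> V c r k \<and> \<psi> k (z k) = 1"
    proof cases
      case 1
      then show ?thesis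
        using lvl'[of v r] h(1) fD(7)[of l r y c k] y by (simp add: z_def \<psi>_def)
    next
      case 2
      then have "j \<le> r" using lvl h by blast
      then show ?thesis
        using 2 h(2) x fD(7)[of j r x c n] y(2) by (simp add: z_def \<psi>_def)
    qed
    then show "z k \<in> V c r k" "\<psi> k (z k) = 1" by auto
  qed
  have V'sub: "fvs.subspace (V' c' r k)" for c' r k
    unfolding V' using fD(4)[of c' r k]
    by (auto simp: fvs.subspace_def \<psi>D(1,2)) (metis \<psi>D(3))
  have V'd: "d v \<in> V' c' r (k + 1)" if "v \<in> V' c' r k" for v c' r k
    using that fD(6)[of v c' r k] \<psi>d[of k v] unfolding V' by (auto simp: \<psi>_def)
  have V'0: "V' c' 0 k = V c' 0 k" for c' k using V0 unfolding V' by auto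
  show f': "filt V' d F b"
    unfolding filt_def
  proof (intro conjI allI impI ballI fD(1,2,3) V'sub V'd)
    show "V' c' r k \<subseteq> fvs.span F" for c' r k using fD(5)[of c' r k] unfolding V' by blast
    show "V' c' r k \<subseteq> V' c' r' k" if "r \<le> r'" for c' r r' k
      using fD(7)[OF that, of _ c' k] unfolding V' by blast
    show "V' c' (hgt c') k = V' c' 0 k" if "b < \<bar>k\<bar>" for c' k
      using fD(8)[OF that, of c'] V'0[of c' k] unfolding V' by blast
  qed
  obtain C' \<kappa>' where C': "fcpx V' d C' \<kappa>'" using fcpx_exists[OF f'] by blast
  note r = C[unfolded fcpx_def] and r' = C'[unfolded fcpx_def]
  let ?S = "\<lambda>k. Qs (\<lambda>c r. V c r k)" and ?U = "\<lambda>k. Qs (\<lambda>c r. V c 0 k)"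
  let ?S' = "\<lambda>k. Qs (\<lambda>c r. V' c r k)" and ?dd = "rowop (\<lambda>_. d)"
  have U': "Qs (\<lambda>c r. V' c 0 k) = ?U k" for k by (simp add: V'0)
  note rc = cpx_realD(3)[OF r] and rc' = cpx_realD(3)[OF r', unfolded U']
  note cN = mod_realD(2)[OF N]
  define D where "D = cpx_shift (- (n + 1)) (stalk N)"
  have Dt: "cterm D k = (if k = n + 1 then N else zero_mod)" for k by (auto simp: D_def stalk_simps)
  have bD: "bounded_cpx A D" unfolding D_def
    by (intro bounded_cpx_shift bounded_stalk mod_realD(1)[OF N])
  have dD: "cdiff D k *\<^sub>v v = 0\<^sub>v (cdim D (k + 1))" if "v \<in> carrier_vec (cdim D k)" for v k
    using that unfolding D_def by (rule shift_stalk_cdiff)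
  have bC: "bounded_cpx A C" and bC': "bounded_cpx A C'"
    using cpx_realD(1)[OF r] cpx_realD(1)[OF r'] by auto
  note bS = bounded_cpx_sum[OF bC' bD]
  \<comment> \<open>\<open>T\<close> projects onto the remainder along \<open>z\<close>,
    \<open>E\<close> reads off the coefficient of \<open>y\<close>, \<open>G\<close> puts multiples
    of \<open>y\<close> back, and \<open>X\<close> supplies the multiples of \<open>x\<close> that
    bound them.\<close>
  define T where "T k c' v = (if c' = c then v - fscale (\<psi> k v) (z k) else v)" for k c' v
  define E where "E c' v = (if c' = c then (\<lambda>_ :: unit. \<phi> v) else 0)" for c' and v :: "'x \<Rightarrow> 'k"
  define G where "G c' w = (if c' = c then fscale (w ()) y else 0)" for c' and w :: "unit \<Rightarrow> 'k"
  define X where "X c' v = (if c' = c then fscale (\<phi> v) x else 0)" for c' and v :: "'x \<Rightarrow> 'k"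
  have linT: "lin (T k c')" for k c'
    using lin_minus_rank_one[OF \<psi>, of k "z k"] lin_id unfolding T_def by (cases "c' = c") simp_all
  have linE: "lin (E c')" for c'
    using lin_zero unfolding E_def
    by (cases "c' = c") (auto simp: lin_def functionalD(1,2)[OF \<phi>] fun_eq_iff)
  let ?p = "\<lambda>k. rowop (T k)" and ?e = "rowop E"
  have Tmem: "T k (cmp q) (row g q) \<in> V' (cmp q) (lev q) k" if g: "g \<in> ?S k" and q: "q \<in> L" for g q k
  proof (cases "cmp q = c \<and> \<psi> k (row g q) \<noteq> 0")
    case True
    let ?v = "row g q"
    have v: "?v \<in> V c (lev q) k" using QsD(1)[OF g q] True by simp
    have zz: "z k \<in> V c (lev q) k" "\<psi> k (z k) = 1" using zV[OF v] lev(2)[OF q] True by auto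
    have "?v - fscale (\<psi> k ?v) (z k) \<in> V c (lev q) k"
      using v zz(1) fD(4) by (intro fvs.subspace_diff fvs.subspace_scale)
    moreover have "\<psi> k (?v - fscale (\<psi> k ?v) (z k)) = 0"
      unfolding \<psi>D(4) \<psi>D(2) zz(2) by simp
    ultimately show ?thesis using True unfolding T_def V' by simp
  next
    case False
    have "T k (cmp q) (row g q) = row g q"
      using False by (cases "cmp q = c") (auto simp: T_def fun_eq_iff)
    then show ?thesis using QsD(1)[OF g q] False unfolding V' by auto
  qed
  have pmem: "?p k g \<in> ?S' k" if "g \<in> ?S k" for g k
    by (rule QsI) (use Tmem[OF that] in \<open>auto simp: row_rowop\<close>)
  have pid: "?p k g = g" if "\<And>q. q \<in> L \<Longrightarrow> cmp q = c \<Longrightarrow> \<psi> k (row g q) = 0" "\<And>q. q \<notin> L \<Longrightarrow> row g q = 0"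
    for g k
  proof (rule row_eqI)
    fix q show "row (?p k g) q = row g q"
      using that(1)[of q] that(2)[of q]
      by (cases "q \<in> L"; cases "cmp q = c") (simp_all add: row_rowop T_def fscale_zero del: fscale_apply)
  qed
  have pid': "?p k g = g" if g: "g \<in> ?S' k" for g k
    by (rule pid) (use QsD[OF g] in \<open>auto simp: V'\<close>)
  have pU: "?p k g = g" if g: "g \<in> ?U k" for g k
  proof (rule pid)
    fix q assume "q \<in> L" "cmp q = c"
    then show "\<psi> k (row g q) = 0" using QsD(1)[OF g, of q] V0 by simp
  qed (rule QsD(2)[OF g])
  have S'S: "?S' k \<subseteq> ?S k" for k by (rule Qs_mono) (auto simp: V')
  have Ssub: "fvs.subspace (?S k)" for k by (intro subspace_Qs fD(4))
  have emem: "?e g \<in> ival c l" if g: "g \<in> ?S (n + 1)" for g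
    unfolding ival_def
  proof (rule QsI)
    fix q assume q: "q \<in> L"
    have "\<phi> (row g q) = 0" if "cmp q = c" "\<not> l \<le> lev q"
      using lvl'[of "row g q" "lev q"] QsD(1)[OF g q] that by auto
    then show "row (?e g) q \<in> (if cmp q = c \<and> l \<le> lev q then UNIV else {0})"
      using q by (auto simp: row_rowop E_def fun_eq_iff)
  qed (simp add: row_rowop)
  have emem': "?e g \<in> ival c j \<longleftrightarrow> (\<forall>q\<in>L. cmp q = c \<longrightarrow> \<phi> (row g q) \<noteq> 0 \<longrightarrow> j \<le> lev q)" for g
    by (auto simp: ival_def Qs_def row_rowop E_def fun_eq_iff split: if_splits)
  \<comment> \<open>The projections commute with the differential only modulo level 0, because
    \<open>d y\<close> lies in \<open>V c 0\<close> but need not vanish.\<close>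
  have dd: "?p (k + 1) (?dd g) - ?dd (?p k g) \<in> ?U (k + 1)" if g: "g \<in> ?S k" for g k
  proof (rule QsI)
    fix q assume q: "q \<in> L"
    let ?v = "row g q"
    have v: "?v \<in> V (cmp q) (lev q) k" using QsD(1)[OF g q] .
    have "T (k + 1) (cmp q) (d ?v) - d (T k (cmp q) ?v) \<in> V (cmp q) 0 (k + 1)"
    proof (cases "cmp q = c")
      case True
      have e: "T (k + 1) (cmp q) (d ?v) - d (T k (cmp q) ?v)
          = fscale (\<psi> k ?v) (d (z k)) - fscale (\<psi> (k + 1) (d ?v)) (z (k + 1))"
        unfolding T_def if_P[OF True] linD(4)[OF fD(1)] linD(2)[OF fD(1)] by (auto simp: fun_eq_iff)
      consider "k = n" | "k = n + 1" | "k \<noteq> n" "k \<noteq> n + 1" by blast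
      then show ?thesis
      proof cases
        case 1
        have "fscale (\<phi> (d ?v)) (d x) = fscale (\<phi> (d ?v)) y"
        proof (cases "\<phi> (d ?v) = 0")
          case False
          then have "j \<le> lev q" using lvl[of ?v "lev q"] v True lev(2)[OF q] 1 by simp
          then have "j \<le> hgt c" using lev(2)[OF q] True by simp
          then show ?thesis using x(2) by simp
        qed (simp add: fscale_zero del: fscale_apply)
        then have "T (k + 1) (cmp q) (d ?v) - d (T k (cmp q) ?v) = 0"
          unfolding e \<psi>d using 1 by (simp add: \<psi>_def z_def)
        then show ?thesis using fvs.subspace_0[OF fD(4)] by metis
      next
        case 2
        have "T (k + 1) (cmp q) (d ?v) - d (T k (cmp q) ?v) = fscale (\<phi> ?v) (d y)"
          unfolding e \<psi>d using 2 by (auto simp: \<psi>_def z_def fun_eq_iff)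
        moreover have "fscale (\<phi> ?v) (d y) \<in> V c 0 (k + 1)"
          using 2 dy fD(4) by (intro fvs.subspace_scale) (auto simp: add.assoc)
        ultimately show ?thesis using True by metis
      next
        case 3
        have "T (k + 1) (cmp q) (d ?v) - d (T k (cmp q) ?v) = 0"
          unfolding e \<psi>d using 3 by (auto simp: \<psi>_def fun_eq_iff)
        then show ?thesis using fvs.subspace_0[OF fD(4)] by metis
      qed
    next
      case False
      then have "T (k + 1) (cmp q) (d ?v) - d (T k (cmp q) ?v) = 0" by (simp add: T_def)
      then show ?thesis using fvs.subspace_0[OF fD(4)] by metis
    qed
    then show "row (?p (k + 1) (?dd g) - ?dd (?p k g)) q \<in> V (cmp q) 0 (k + 1)"
      using q by (simp add: row_rowop)
  qed (simp add: row_rowop)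
  have ddS: "?dd g \<in> ?S (k + 1)" if "g \<in> ?S k" for g k by (rule cpx_realD(4)[OF r that])
  \<comment> \<open>Boundaries carry a multiple of \<open>y\<close> only from level \<open>j\<close>
    on, hence are zero in \<open>N\<close>. So the map to the stalk complex of \<open>N\<close> is
    compatible with its zero differential.\<close>
  have ed: "?e (?dd g) \<in> ival c j" if g: "g \<in> ?S n" for g
    unfolding emem'
  proof (intro ballI impI)
    fix q assume q: "q \<in> L" "cmp q = c" "\<phi> (row (?dd g) q) \<noteq> 0"
    then show "j \<le> lev q" using lvl[of "row g q" "lev q"] QsD(1)[OF g q(1)] lev(2)[OF q(1)] by (simp add: row_rowop)
  qed
  define hN where "hN k g = (if k = n + 1 then \<kappa>N (?e g) else 0\<^sub>v 0)" for k g
  define h where "h k g = \<kappa>' k (?p k g) @\<^sub>v hN k g" for k g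
  have \<kappa>'c: "\<kappa>' k g \<in> carrier_vec (cdim C' k)" if "g \<in> ?S' k" for g k
    by (rule cpx_real_carrier[OF r' that])
  have \<kappa>Nc: "\<kappa>N g \<in> carrier_vec (vdim N)" if "g \<in> ival c l" for g
    using lin_vecD(1)[OF coordsD(4)[OF cN] that] .
  have linhN: "lin_vec (?S k) (cdim D k) (hN k)" for k
  proof (cases "k = n + 1")
    case True
    have "lin_vec (?S k) (vdim N) (\<lambda>g. \<kappa>N (?e g))"
      using emem True by (intro lin_vec_comp_lin[OF coordsD(4)[OF cN] lin_rowop[OF linE]]) simp
    then show ?thesis using True by (simp add: hN_def[abs_def] Dt)
  qed (auto simp: hN_def Dt lin_vec_def)
  note hNc = lin_vecD(1)[OF linhN]
  have linp: "lin_vec (?S k) (cdim C' k) (\<lambda>g. \<kappa>' k (?p k g))" for k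
    by (rule lin_vec_comp_lin[OF coordsD(4)[OF rc'] lin_rowop[OF linT] pmem])
  have hlin: "lin_vec (?S k) (cdim (cpx_sum C' D) k) (h k)" for k
    using lin_vec_append[OF linp linhN] by (simp add: h_def[abs_def])
  have "\<exists>Fm. chain_map A C (cpx_sum C' D) Fm \<and> (\<forall>k. \<forall>g\<in>?S k. Fm k *\<^sub>v \<kappa> k g = h k g)"
  proof (rule cpx_real_map[OF r bS hlin])
    fix k g assume g: "g \<in> ?U k"
    have "?e g \<in> ival c j" if "k = n + 1"
      unfolding emem' using V0[of _ k] QsD(1)[OF g] that by (auto simp: \<psi>_def)
    then have "hN k g = 0\<^sub>v (cdim D k)"
      using coordsD(3,6)[OF cN] by (auto simp: hN_def Dt)
    moreover have "\<kappa>' k (?p k g) = 0\<^sub>v (cdim C' k)"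
      unfolding pU[OF g] using coordsD(3,6)[OF rc'] g by blast
    ultimately show "h k g = 0\<^sub>v (cdim (cpx_sum C' D) k)" by (simp add: h_def append_vec_zero)
  next
    fix k a g assume a: "a \<in> carrier A" and g: "g \<in> ?S k"
    have 1: "\<kappa>' k (?p k (ract a g)) = act (cterm C' k) a *\<^sub>v \<kappa>' k (?p k g)"
      unfolding rowop_ract[OF linT a] by (rule mod_realD(4)[OF cpx_realD(2)[OF r'] a pmem[OF g]])
    have 2: "hN k (ract a g) = act (cterm D k) a *\<^sub>v hN k g"
    proof (cases "k = n + 1")
      case True
      then show ?thesis
        unfolding hN_def Dt rowop_ract[OF linE a] using mod_realD(4)[OF N a emem] g by simp
    qed (auto simp: hN_def Dt zero_mod_def intro!: eq_vecI)
    show "h k (ract a g) = act (cterm (cpx_sum C' D) k) a *\<^sub>v h k g"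
      unfolding h_def 1 2 cpx_sum_simps mod_sum_simps
      by (rule diag_sum_mult_vec[symmetric, OF is_moduleD(1)[OF cterm_module[OF bC'] a]
            is_moduleD(1)[OF cterm_module[OF bD] a] \<kappa>'c[OF pmem[OF g]] hNc[OF g]])
  next
    fix k g assume g: "g \<in> ?S k"
    have 1: "\<kappa>' (k + 1) (?p (k + 1) (?dd g)) = cdiff C' k *\<^sub>v \<kappa>' k (?p k g)"
    proof -
      have m: "?p (k + 1) (?dd g) \<in> ?S' (k + 1)" "?dd (?p k g) \<in> ?S' (k + 1)"
        using pmem[OF ddS[OF g]] cpx_realD(4)[OF r' pmem[OF g]] by auto
      have "\<kappa>' (k + 1) (?p (k + 1) (?dd g)) = \<kappa>' (k + 1) (?dd (?p k g))"
        using coords_eq_iff[OF rc' m] dd[OF g] by blast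
      then show ?thesis using cpx_realD(5)[OF r' pmem[OF g]] by simp
    qed
    have "hN (k + 1) (?dd g) = 0\<^sub>v (cdim D (k + 1))"
    proof (cases "k = n")
      case True
      then show ?thesis using coordsD(3,6)[OF cN] ed[of g] g by (auto simp: hN_def Dt)
    qed (auto simp: hN_def Dt)
    then have 2: "hN (k + 1) (?dd g) = cdiff D k *\<^sub>v hN k g" using dD[OF hNc[OF g]] by simp
    show "h (k + 1) (?dd g) = cdiff (cpx_sum C' D) k *\<^sub>v h k g"
      unfolding h_def 1 2 cpx_sum_simps
      by (rule diag_sum_mult_vec[symmetric, OF cdiff_carrier[OF bC'] cdiff_carrier[OF bD]
            \<kappa>'c[OF pmem[OF g]] hNc[OF g]])
  qed
  then obtain Fm where Fm: "chain_map A C (cpx_sum C' D) Fm" "\<And>k g. g \<in> ?S k \<Longrightarrow> Fm k *\<^sub>v \<kappa> k g = h k g"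
    by blast
  have "quasi_iso A C (cpx_sum C' D) Fm"
  proof (rule quasi_isoI[OF bC bS Fm(1)])
    fix k v assume v: "v \<in> cocycles C k" and Fv: "Fm k *\<^sub>v v \<in> coboundaries (cpx_sum C' D) k"
    obtain g where g: "g \<in> ?S k" "\<kappa> k g = v" by (rule cpx_real_surj[OF r cocyclesD[OF v]])
    have dg: "?dd g \<in> ?U (k + 1)" using cpx_real_cocycles[OF r g(1)] g(2) v by simp
    have cb: "\<kappa>' k (?p k g) \<in> coboundaries C' k" "hN k g \<in> coboundaries D k"
      using Fv unfolding g(2)[symmetric] Fm(2)[OF g(1)] h_def
        coboundaries_cpx_sum[OF bC' bD \<kappa>'c[OF pmem[OF g(1)]] hNc[OF g(1)]] by auto
    obtain w' where w': "w' \<in> ?S' (k - 1)" "?p k g - ?dd w' \<in> ?U k"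
      using cb(1) unfolding cpx_real_coboundaries[OF r' pmem[OF g(1)]] U' by blast
    have w: "w' \<in> ?S (k - 1)" using w'(1) S'S by blast
    have "\<exists>w\<in>?S (k - 1). g - ?dd w \<in> ?U k"
    proof (cases "k = n + 1")
      case True
      have "hN k g = 0\<^sub>v (cdim D k)"
      proof -
        obtain u where "u \<in> carrier_vec (cdim D (k - 1))" "hN k g = cdiff D (k - 1) *\<^sub>v u"
          using cb(2) by (auto simp: coboundaries_def)
        then show ?thesis using dD[of u "k - 1"] by simp
      qed
      then have "?e g \<in> ival c j"
        using coordsD(6)[OF cN emem] g(1) True by (simp add: hN_def Dt)
      \<comment> \<open>From level \<open>j\<close> on \<open>y = d x\<close>, so a multiple of
        \<open>y\<close> there is a boundary; adding the same multiple of \<open>x\<close> to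
        \<open>w'\<close> gives a primitive of \<open>g\<close> itself.\<close>
      then have jl: "j \<le> lev q" if "q \<in> L" "cmp q = c" "\<phi> (row g q) \<noteq> 0" for q
        unfolding emem' using that by blast
      let ?w = "w' + rowop X g"
      have "rowop X g \<in> ?S (k - 1)"
      proof (rule QsI)
        fix q assume q: "q \<in> L"
        show "row (rowop X g) q \<in> V (cmp q) (lev q) (k - 1)"
        proof (cases "cmp q = c \<and> \<phi> (row g q) \<noteq> 0")
          case c: True
          then have "j \<le> lev q" "lev q \<le> hgt c" using jl q lev(2)[OF q] by auto
          then have "x \<in> V c (lev q) (k - 1)" using x(1) fD(7)[of j "lev q" x c n] True by simp
          then have "fscale (\<phi> (row g q)) x \<in> V c (lev q) (k - 1)" by (rule fvs.subspace_scale[OF fD(4)])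
          then show ?thesis using q c by (simp add: row_rowop X_def)
        next
          case False
          then have "row (rowop X g) q = 0" using q by (auto simp: row_rowop X_def fun_eq_iff)
          then show ?thesis using fvs.subspace_0[OF fD(4)] by metis
        qed
      qed (simp add: row_rowop)
      then have wS: "?w \<in> ?S (k - 1)" using w fvs.subspace_add[OF Ssub] by blast
      have "?p k g - ?dd w' = g - ?dd ?w"
      proof (rule row_eqI)
        fix q
        have "d (fscale (\<phi> (row g q)) x) = fscale (\<phi> (row g q)) y" if q: "q \<in> L" "cmp q = c"
        proof (cases "\<phi> (row g q) = 0")
          case False
          then have "j \<le> hgt c" using jl[OF q] lev(2)[OF q(1)] q(2) by simp
          then show ?thesis using x(2) linD(2)[OF fD(1)] by simp
        next
          case z: True
          show ?thesis unfolding z fscale_zero by (rule linD(3)[OF fD(1)])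
        qed
        then show "row (?p k g - ?dd w') q = row (g - ?dd ?w) q"
          using True QsD(2)[OF g(1), of q]
          by (cases "q \<in> L"; cases "cmp q = c")
            (simp_all add: row_rowop T_def X_def \<psi>_def z_def linD(1)[OF fD(1)] linD(3)[OF fD(1)] del: fscale_apply)
      qed
      then show ?thesis using w'(2) wS by metis
    next
      case False
      \<comment> \<open>In degree \<open>n\<close> the differential of \<open>g\<close> lies in
        level 0, where \<open>\<phi>\<close> vanishes, so \<open>g\<close> has no component along
        \<open>x\<close>; in the remaining degrees \<open>\<psi>\<close> is zero.\<close>
      have "?p k g = g"
      proof (rule pid)
        fix q assume q: "q \<in> L" "cmp q = c"
        have "d (row g q) \<in> V c 0 (k + 1)" using QsD(1)[OF dg q(1)] q by (simp add: row_rowop)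
        then have "\<psi> (k + 1) (d (row g q)) = 0" by (rule V0)
        then show "\<psi> k (row g q) = 0" using False by (auto simp: \<psi>_def split: if_splits)
      qed (rule QsD(2)[OF g(1)])
      then show ?thesis using w'(2) w by metis
    qed
    then show "v \<in> coboundaries C k"
      unfolding g(2)[symmetric] cpx_real_coboundaries[OF r g(1)] .
  next
    fix k u assume u: "u \<in> cocycles (cpx_sum C' D) k"
    have "u \<in> carrier_vec (cdim C' k + cdim D k)" using cocyclesD[OF u] by simp
    then obtain a e where ae: "a \<in> carrier_vec (cdim C' k)" "e \<in> carrier_vec (cdim D k)" "u = a @\<^sub>v e"
      by (rule vec_append_cases)
    have ac: "a \<in> cocycles C' k" using u unfolding ae(3) cocycles_cpx_sum[OF bC' bD ae(1,2)] by blast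
    obtain g' where g': "g' \<in> ?S' k" "\<kappa>' k g' = a" by (rule cpx_real_surj[OF r' ae(1)])
    have dg': "?dd g' \<in> ?U (k + 1)" using cpx_real_cocycles[OF r' g'(1)] g'(2) ac U' by simp
    have "\<exists>g\<in>?S k. ?dd g \<in> ?U (k + 1) \<and> ?p k g = g' \<and> hN k g = e"
    proof (cases "k = n + 1")
      case True
      then have "e \<in> carrier_vec (vdim N)" using ae(2) by (simp add: Dt)
      then obtain \<beta> where \<beta>: "\<beta> \<in> ival c l" "\<kappa>N \<beta> = e" using coordsD(5)[OF cN] by blast
      have \<beta>D: "row \<beta> q = 0" if "\<not> (q \<in> L \<and> cmp q = c \<and> l \<le> lev q)" for q
        using QsD[OF \<beta>(1)[unfolded ival_def], of q] that by (cases "q \<in> L") (auto split: if_splits)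
      \<comment> \<open>The multiples of \<open>y\<close> prescribed by \<open>\<beta>\<close> are
        added to \<open>g'\<close>. The sum is still a cocycle because \<open>d y\<close> lies in
        level 0, and \<open>T\<close> removes them again.\<close>
      let ?g = "g' + rowop G \<beta>"
      have GV: "fscale (row \<beta> q ()) y \<in> V c (lev q) k" for q
      proof (cases "l \<le> lev q")
        case l: True
        then have "y \<in> V c (lev q) k" using fD(7)[OF l y(1)] True by simp
        then show ?thesis by (rule fvs.subspace_scale[OF fD(4)])
      next
        case False
        then have "fscale (row \<beta> q ()) y = 0" using \<beta>D[of q] by (auto simp: fun_eq_iff)
        then show ?thesis using fvs.subspace_0[OF fD(4)] by metis
      qed
      have "rowop G \<beta> \<in> ?S k"
        by (rule QsI) (use GV fvs.subspace_0[OF fD(4)] in \<open>auto simp: row_rowop G_def\<close>)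
      then have gS: "?g \<in> ?S k" using g'(1) S'S fvs.subspace_add[OF Ssub] by blast
      have \<phi>g: "\<phi> (row ?g q) = row \<beta> q ()" if q: "q \<in> L" "cmp q = c" for q
      proof -
        have "\<phi> (row g' q) = 0" using QsD(1)[OF g'(1) q(1)] q(2) True unfolding V' by (simp add: \<psi>_def)
        then show ?thesis
          using q y(2) by (simp add: row_rowop G_def functionalD(1,2)[OF \<phi>] del: fscale_apply)
      qed
      have "?p k ?g = g'"
      proof (rule row_eqI)
        fix q
        show "row (?p k ?g) q = row g' q"
          using \<phi>g[of q] True QsD(2)[OF g'(1), of q]
          by (cases "q \<in> L"; cases "cmp q = c")
            (simp_all add: row_rowop T_def \<psi>_def z_def G_def del: fscale_apply)
      qed
      moreover have "?e ?g = \<beta>"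
      proof (rule row_eqI)
        fix q
        show "row (?e ?g) q = row \<beta> q"
          using \<phi>g[of q] \<beta>D[of q]
          by (cases "q \<in> L"; cases "cmp q = c") (auto simp: row_rowop E_def fun_eq_iff)
      qed
      moreover have "?dd ?g \<in> ?U (k + 1)"
      proof (rule QsI)
        fix q assume q: "q \<in> L"
        have 1: "d (row g' q) \<in> V (cmp q) 0 (k + 1)" using QsD(1)[OF dg' q] q by (simp add: row_rowop)
        have "d (row ?g q) \<in> V (cmp q) 0 (k + 1)"
        proof (cases "cmp q = c")
          case c: True
          have "d (fscale (row \<beta> q ()) y) \<in> V c 0 (k + 1)"
            unfolding linD(2)[OF fD(1)]
            using dy True by (intro fvs.subspace_scale[OF fD(4)]) (simp add: add.assoc)
          then have "d (row g' q) + d (fscale (row \<beta> q ()) y) \<in> V c 0 (k + 1)"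
            using 1 c by (intro fvs.subspace_add[OF fD(4)]) auto
          then show ?thesis using q c by (simp add: row_rowop G_def linD(1)[OF fD(1)])
        next
          case False
          have "row ?g q = row g' q" using False q by (auto simp: row_rowop G_def fun_eq_iff)
          then show ?thesis using 1 by simp
        qed
        then show "row (?dd ?g) q \<in> V (cmp q) 0 (k + 1)" using q by (simp add: row_rowop)
      qed (simp add: row_rowop)
      ultimately show ?thesis using gS \<beta>(2) True by (intro bexI[of _ ?g]) (auto simp: hN_def)
    next
      case False
      have "e = 0\<^sub>v 0" using ae(2) False by (auto simp: Dt)
      then show ?thesis
        using g'(1) S'S dg' pid'[OF g'(1)] False by (intro bexI[of _ g']) (auto simp: hN_def)
    qed
    then obtain g where g: "g \<in> ?S k" "?dd g \<in> ?U (k + 1)" "?p k g = g'" "hN k g = e" by blast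
    have "\<kappa> k g \<in> cocycles C k" using cpx_real_cocycles[OF r g(1)] g(2) by simp
    moreover have "Fm k *\<^sub>v \<kappa> k g = u" unfolding Fm(2)[OF g(1)] h_def g(3,4) g'(2) ae(3) ..
    moreover have "u - u \<in> coboundaries (cpx_sum C' D) k"
      using zero_coboundaries[OF bS, of k] cocyclesD[OF u] by simp
    ultimately show "\<exists>v\<in>cocycles C k. Fm k *\<^sub>v v - u \<in> coboundaries (cpx_sum C' D) k" by metis
  qed
  then have "qeq A C (cpx_sum C' D)" by (rule qeq_quasi_iso[OF bC bS])
  then show "\<exists>C' \<kappa>'. fcpx V' d C' \<kappa>' \<and> qeq A C (cpx_sum C' (cpx_shift (- (n + 1)) (stalk N)))"
    using C' unfolding D_def by blast
qed

end

context tri_rep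
begin

text \<open>As long as some filtered space exceeds its level 0, a bar is split off by means of
  functionals, and the total dimension at top level, over the finitely many relevant degrees, drops.
  A bar with \<open>l = j\<close> contributes the zero module: its two vectors form a contractible
  piece.\<close>

lemma filtered_cpx_shifted_sum:
  fixes V :: "'c \<Rightarrow> nat \<Rightarrow> int \<Rightarrow> ('x \<Rightarrow> 'k) set"
  assumes ivals: "\<And>c l j. c \<in> cmp ` L \<Longrightarrow> 1 \<le> l \<Longrightarrow> l \<le> hgt c \<Longrightarrow> l \<le> j \<Longrightarrow> j \<le> Suc (hgt c) \<Longrightarrow>
      \<exists>N \<kappa>N. mod_real A ract (ival c l) (ival c j) N \<kappa>N \<and> summand_of (mod_cat A) N Z"
    and "filt V d F b" and "fcpx V d C \<kappa>"
  shows "shifted_sum A Z C"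
  using assms(2,3)
proof (induction "\<Sum>c\<in>cmp ` L. \<Sum>n\<in>{-b..b}. fvs.dim (V c (hgt c) n)" arbitrary: V C \<kappa> rule: less_induct)
  case less
  note f = less.prems(1) and C = less.prems(2)
  note fD = filtD[OF f]
  show ?case
  proof (cases "\<forall>c\<in>cmp ` L. \<forall>n. V c (hgt c) n = V c 0 n")
    case True
    have SU: "Qs (\<lambda>c r. V c r n) = Qs (\<lambda>c r. V c 0 n)" for n
    proof
      show "Qs (\<lambda>c r. V c 0 n) \<subseteq> Qs (\<lambda>c r. V c r n)" by (rule Qs_mono) (use fD(7) in blast)
      have "V (cmp p) (lev p) n \<subseteq> V (cmp p) 0 n" if "p \<in> L" for p
        using fD(7)[OF lev(2)[OF that]] True that by blast
      then show "Qs (\<lambda>c r. V c r n) \<subseteq> Qs (\<lambda>c r. V c 0 n)" by (rule Qs_mono)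
    qed
    note r = C[unfolded fcpx_def SU]
    have "cdim C n = 0" for n using cpx_realD(3)[OF r] by (rule coords_trivial)
    then show ?thesis
      using shifted_sum_qeq[OF shifted_sum_zero zero_dim_qeq[OF cpx_realD(1)[OF r]]] by blast
  next
    case False
    have "\<exists>c l j n x y \<phi>. c \<in> cmp ` L \<and> 1 \<le> l \<and> l \<le> hgt c \<and> l \<le> j \<and> j \<le> Suc (hgt c) \<and> functional \<phi> \<and>
      y \<in> V c l (n + 1) \<and> \<phi> y = 1 \<and> (\<forall>v\<in>V c (l - 1) (n + 1). \<phi> v = 0) \<and>
      (j \<le> hgt c \<longrightarrow> x \<in> V c j n \<and> d x = y) \<and>
      (\<forall>r v. r < j \<longrightarrow> r \<le> hgt c \<longrightarrow> v \<in> V c r n \<longrightarrow> \<phi> (d v) = 0) \<and> d y \<in> V c 0 (n + 2)"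
    \<comment> \<open>If the differential is nonzero modulo level 0, a bar with both ends is taken;
      otherwise one that never dies.\<close>
    proof (cases "\<exists>c\<in>cmp ` L. \<exists>r\<le>hgt c. \<exists>n. \<exists>v\<in>V c r n. d v \<notin> V c 0 (n + 1)")
      case True
      then obtain c r0 where c: "c \<in> cmp ` L" and r0: "r0 \<le> hgt c" "\<exists>n. \<exists>v\<in>V c r0 n. d v \<notin> V c 0 (n + 1)"
        by blast
      \<comment> \<open>\<open>j\<close> is the least level from which the differential is nonzero
        modulo level 0, over all degrees. By minimality \<open>\<phi> (d v)\<close> vanishes for
        every \<open>v\<close> below level \<open>j\<close>, so splitting off \<open>x\<close>
        leaves lower levels undisturbed.\<close>
      define j where "j = (LEAST r. \<exists>n. \<exists>v\<in>V c r n. d v \<notin> V c 0 (n + 1))"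
      have "\<exists>n. \<exists>v\<in>V c j n. d v \<notin> V c 0 (n + 1)" unfolding j_def
        by (rule LeastI[of "\<lambda>r. \<exists>n. \<exists>v\<in>V c r n. d v \<notin> V c 0 (n + 1)", OF r0(2)])
      then obtain n x where x: "x \<in> V c j n" "d x \<notin> V c 0 (n + 1)" by blast
      have jh: "j \<le> hgt c" using Least_le[of "\<lambda>r. \<exists>n. \<exists>v\<in>V c r n. d v \<notin> V c 0 (n + 1)", OF r0(2)] r0(1)
        unfolding j_def by simp
      have low: "d v \<in> V c 0 (n + 1)" if "r < j" "v \<in> V c r n" for r v n
        using not_less_Least[of r "\<lambda>r. \<exists>n. \<exists>v\<in>V c r n. d v \<notin> V c 0 (n + 1)"] that unfolding j_def by blast
      \<comment> \<open>The level at which \<open>d x\<close> first appears; it is at least 1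
        because \<open>d x\<close> is nonzero modulo level 0.\<close>
      define l where "l = (LEAST l. d x \<in> V c l (n + 1))"
      have yj: "d x \<in> V c j (n + 1)" using fD(6)[OF x(1)] .
      have yl: "d x \<in> V c l (n + 1)" unfolding l_def by (rule LeastI[of "\<lambda>l. d x \<in> V c l (n + 1)", OF yj])
      have lj: "l \<le> j" unfolding l_def by (rule Least_le[of "\<lambda>l. d x \<in> V c l (n + 1)", OF yj])
      have l1: "1 \<le> l" using yl x(2) by (cases l) auto
      have "d x \<notin> V c (l - 1) (n + 1)"
        using not_less_Least[of "l - 1" "\<lambda>l. d x \<in> V c l (n + 1)"] l1 unfolding l_def by simp
      then obtain \<phi> where \<phi>: "functional \<phi>" "\<phi> (d x) = 1" "\<forall>v\<in>V c (l - 1) (n + 1). \<phi> v = 0"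
        using functional_exists[OF fD(4)] by blast
      have "\<phi> (d v) = 0" if "r < j" "v \<in> V c r n" for r v
        using \<phi>(3) fD(7)[OF _ low[OF that], of "l - 1"] by simp
      moreover have "d (d x) \<in> V c 0 (n + 2)" using fD(2) fvs.subspace_0[OF fD(4)] by metis
      ultimately show ?thesis using c l1 lj jh yl x \<phi>
        by (intro exI[of _ c] exI[of _ l] exI[of _ j] exI[of _ n] exI[of _ x] exI[of _ "d x"] exI[of _ \<phi>]) auto
    next
      case no: False
      from False obtain c k where c: "c \<in> cmp ` L" and k: "V c (hgt c) k \<noteq> V c 0 k" by blast
      then obtain y where y: "y \<in> V c (hgt c) k" "y \<notin> V c 0 k" using fD(7)[of 0 "hgt c" _ c k] by blast
      define l where "l = (LEAST l. y \<in> V c l k)"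
      have yl: "y \<in> V c l k" unfolding l_def by (rule LeastI[of "\<lambda>l. y \<in> V c l k", OF y(1)])
      have lh: "l \<le> hgt c" unfolding l_def by (rule Least_le[of "\<lambda>l. y \<in> V c l k", OF y(1)])
      have l1: "1 \<le> l" using yl y(2) by (cases l) auto
      have "y \<notin> V c (l - 1) k"
        using not_less_Least[of "l - 1" "\<lambda>l. y \<in> V c l k"] l1 unfolding l_def by simp
      then obtain \<phi> where \<phi>: "functional \<phi>" "\<phi> y = 1" "\<forall>v\<in>V c (l - 1) k. \<phi> v = 0"
        using functional_exists[OF fD(4)] by blast
      \<comment> \<open>\<open>bar_split\<close> places \<open>y\<close> in degree
        \<open>n + 1\<close>.\<close>
      define n where "n = k - 1"
      have k: "k = n + 1" by (simp add: n_def)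
      have \<phi>d: "\<phi> (d v) = 0" if "r \<le> hgt c" "v \<in> V c r n" for r v
      proof -
        have "d v \<in> V c 0 k" using no c that unfolding k by blast
        then show ?thesis using \<phi>(3) fD(7)[of 0 "l - 1" "d v" c k] by simp
      qed
      have dy: "d y \<in> V c 0 (n + 2)"
      proof -
        have "d y \<in> V c 0 (k + 1)" using no c lh yl by blast
        moreover have "k + 1 = n + 2" by (simp add: k)
        ultimately show ?thesis by metis
      qed
      note facts = c l1 lh yl[unfolded k] \<phi>[unfolded k] \<phi>d dy
      \<comment> \<open>The end \<open>Suc (hgt c)\<close> stands for a class that never becomes a
        boundary. The conditions on \<open>x\<close> are then void, and \<open>y\<close> fills its
        place.\<close>
      have "c \<in> cmp ` L \<and> 1 \<le> l \<and> l \<le> hgt c \<and> l \<le> Suc (hgt c) \<and> Suc (hgt c) \<le> Suc (hgt c) \<and> functional \<phi> \<and>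
        y \<in> V c l (n + 1) \<and> \<phi> y = 1 \<and> (\<forall>v\<in>V c (l - 1) (n + 1). \<phi> v = 0) \<and>
        (Suc (hgt c) \<le> hgt c \<longrightarrow> y \<in> V c (Suc (hgt c)) n \<and> d y = y) \<and>
        (\<forall>r v. r < Suc (hgt c) \<longrightarrow> r \<le> hgt c \<longrightarrow> v \<in> V c r n \<longrightarrow> \<phi> (d v) = 0) \<and> d y \<in> V c 0 (n + 2)"
      proof (intro conjI)
        show "l \<le> Suc (hgt c)" using lh by simp
        show "\<forall>r v. r < Suc (hgt c) \<longrightarrow> r \<le> hgt c \<longrightarrow> v \<in> V c r n \<longrightarrow> \<phi> (d v) = 0"
          using \<phi>d by blast
      qed (use facts in \<open>simp_all\<close>)
      then show ?thesis by blast
    qed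
    then obtain c l j n x y \<phi> where c: "c \<in> cmp ` L" and l: "1 \<le> l" "l \<le> hgt c" "l \<le> j"
        and jh: "j \<le> Suc (hgt c)" and \<phi>: "functional \<phi>"
        and y: "y \<in> V c l (n + 1)" "\<phi> y = 1" and \<phi>l: "\<And>v. v \<in> V c (l - 1) (n + 1) \<Longrightarrow> \<phi> v = 0"
        and x: "j \<le> hgt c \<Longrightarrow> x \<in> V c j n" "j \<le> hgt c \<Longrightarrow> d x = y"
        and \<phi>j: "\<And>r v. r < j \<Longrightarrow> r \<le> hgt c \<Longrightarrow> v \<in> V c r n \<Longrightarrow> \<phi> (d v) = 0"
        and dy: "d y \<in> V c 0 (n + 2)" by blast
    obtain N \<kappa>N where N: "mod_real A ract (ival c l) (ival c j) N \<kappa>N" "summand_of (mod_cat A) N Z"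
      using ivals[OF c l jh] by blast
    define V' where "V' = (\<lambda>c' r k. {v \<in> V c' r k. c' = c \<longrightarrow> (k = n + 1 \<longrightarrow> \<phi> v = 0) \<and> (k = n \<longrightarrow> \<phi> (d v) = 0)})"
    have sp: "filt V' d F b"
      unfolding V'_def by (rule bar_split(1)[OF f C l \<phi> y _ _ _ _ dy N(1)]) (fact \<phi>l x \<phi>j)+
    have "\<exists>C' \<kappa>'. fcpx V' d C' \<kappa>' \<and> qeq A C (cpx_sum C' (cpx_shift (- (n + 1)) (stalk N)))"
      unfolding V'_def by (rule bar_split(2)[OF f C l \<phi> y _ _ _ _ dy N(1)]) (fact \<phi>l x \<phi>j)+
    then obtain C' \<kappa>' where C': "fcpx V' d C' \<kappa>'" "qeq A C (cpx_sum C' (cpx_shift (- (n + 1)) (stalk N)))"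
      by blast
    have le: "fvs.dim (V' c' r k) \<le> fvs.dim (V c' r k)" for c' r k
    proof (cases "V' c' r k = V c' r k")
      case False
      then have "V' c' r k \<subset> V c' r k" unfolding V'_def by blast
      then show ?thesis using dim_psubset[OF filtD(4)[OF sp] _ fD(5) fD(3)] by (metis less_imp_le)
    qed simp
    have yh: "y \<in> V c (hgt c) (n + 1)" using fD(7)[OF l(2) y(1)] .
    have lt: "fvs.dim (V' c (hgt c) (n + 1)) < fvs.dim (V c (hgt c) (n + 1))"
    proof (rule dim_psubset[OF filtD(4)[OF sp] _ fD(5) fD(3)])
      have "y \<notin> V' c (hgt c) (n + 1)" using y(2) by (simp add: V'_def)
      then show "V' c (hgt c) (n + 1) \<subset> V c (hgt c) (n + 1)" using yh unfolding V'_def by blast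
    qed
    have "\<phi> v = 0" if "v \<in> V c 0 (n + 1)" for v using \<phi>l fD(7)[OF _ that, of "l - 1"] by simp
    then have "y \<notin> V c 0 (n + 1)" using y(2) by force
    \<comment> \<open>\<open>y\<close> separates the top level from level 0 in degree
      \<open>n + 1\<close>. Outside \<open>{-b..b}\<close> these levels coincide, so the drop in
      dimension is visible in the sum.\<close>
    then have nb: "n + 1 \<in> {-b..b}" using fD(8)[of "n + 1" c] yh by fastforce
    have "(\<Sum>c\<in>cmp ` L. \<Sum>n\<in>{-b..b}. fvs.dim (V' c (hgt c) n)) < (\<Sum>c\<in>cmp ` L. \<Sum>n\<in>{-b..b}. fvs.dim (V c (hgt c) n))"
    proof (rule sum_strict_mono_ex1)
      show "finite (cmp ` L)" using finL by simp
      show "\<forall>c\<in>cmp ` L. (\<Sum>n\<in>{-b..b}. fvs.dim (V' c (hgt c) n)) \<le> (\<Sum>n\<in>{-b..b}. fvs.dim (V c (hgt c) n))"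
        using le by (intro ballI sum_mono) blast
      have "(\<Sum>n\<in>{-b..b}. fvs.dim (V' c (hgt c) n)) < (\<Sum>n\<in>{-b..b}. fvs.dim (V c (hgt c) n))"
        by (rule sum_strict_mono_ex1) (use le lt nb in blast)+
      then show "\<exists>c\<in>cmp ` L. (\<Sum>n\<in>{-b..b}. fvs.dim (V' c (hgt c) n)) < (\<Sum>n\<in>{-b..b}. fvs.dim (V c (hgt c) n))"
        using c by blast
    qed
    then have "shifted_sum A Z C'" using less.hyps sp C'(1) by blast
    then show ?thesis
      using shifted_sum_qeq[OF shifted_sum_sum[OF _ shifted_sum_stalk[OF N(2)]] C'(2)] by blast
  qed
qed

end

section \<open>Direct summands as retracts\<close>

text \<open>A retract carries no choice of complement, so it composes easily and restricts from
  \<open>H\<close> to \<open>A\<close> at once; complements are produced only at the end.\<close>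

definition retract_of ::
  "('k :: field, 'a) module \<Rightarrow> ('a, 'k) fdmod \<Rightarrow> ('a, 'k) fdmod \<Rightarrow> bool" where
  "retract_of A M N \<longleftrightarrow> (\<exists>i\<in>mod_hom A M N. \<exists>p\<in>mod_hom A N M. p * i = 1\<^sub>m (vdim M))"

lemma mod_hom_carrier: "f \<in> mod_hom A M N \<Longrightarrow> f \<in> carrier_mat (vdim N) (vdim M)"
  by (simp add: mod_hom_def)

lemma retract_of_trans:
  assumes m: "is_module A L" "is_module A M" "is_module A N"
    and "retract_of A L M" "retract_of A M N"
  shows "retract_of A L N"
proof -
  obtain i p where 1: "i \<in> mod_hom A L M" "p \<in> mod_hom A M L" "p * i = 1\<^sub>m (vdim L)"
    using assms by (auto simp: retract_of_def)
  obtain j q where 2: "j \<in> mod_hom A M N" "q \<in> mod_hom A N M" "q * j = 1\<^sub>m (vdim M)"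
    using assms by (auto simp: retract_of_def)
  note c = mod_hom_carrier[OF 1(1)] mod_hom_carrier[OF 1(2)] mod_hom_carrier[OF 2(1)] mod_hom_carrier[OF 2(2)]
  have "(p * q) * (j * i) = p * (q * (j * i))"
    by (rule assoc_mult_mat[OF c(2,4) mult_carrier_mat[OF c(3,1)]])
  also have "q * (j * i) = i"
    using assoc_mult_mat[OF c(4,3,1)] 2(3) c(1) by simp
  finally have "(p * q) * (j * i) = 1\<^sub>m (vdim L)" using 1(3) by simp
  then show ?thesis
    unfolding retract_of_def
    using mod_hom_comp[OF 1(1) 2(1) m] mod_hom_comp[OF 2(2) 1(2) m(3,2,1)] by blast
qed

text \<open>\<open>B\<close> and \<open>P\<close> are the inclusion of the image of \<open>e\<close>
  and the projection onto it, with the image represented as the quotient by the kernel. Column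
  vectors are replaced by functions on \<open>nat\<close> supported below \<open>n\<close>, so that
  \<open>coords_exist\<close> applies.\<close>

lemma split_idempotent:
  fixes e :: "'k :: field mat"
  assumes e: "e \<in> carrier_mat n n" and ee: "e * e = e"
  obtains r B P where "B \<in> carrier_mat n r" "P \<in> carrier_mat r n" "B * P = e" "P * B = 1\<^sub>m r"
proof -
  define V where "V f = vec n f" for f :: "nat \<Rightarrow> 'k"
  define S where "S = {f :: nat \<Rightarrow> 'k. \<forall>i. n \<le> i \<longrightarrow> f i = 0}"
  define U where "U = {f \<in> S. e *\<^sub>v V f = 0\<^sub>v n}"
  have Vl: "V (f + g) = V f + V g" "V (fscale c f) = c \<cdot>\<^sub>v V f" "V f \<in> carrier_vec n" for f g c
    by (auto simp: V_def intro!: eq_vecI)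
  have eV: "e *\<^sub>v V (f + g) = e *\<^sub>v V f + e *\<^sub>v V g" "e *\<^sub>v V (fscale c f) = c \<cdot>\<^sub>v (e *\<^sub>v V f)" for f g c
    using mult_add_distrib_mat_vec[OF e Vl(3) Vl(3)] mult_mat_vec[OF e Vl(3)] by (simp_all add: Vl)
  have V0: "V 0 = 0\<^sub>v n" by (auto simp: V_def)
  have subS: "fvs.subspace S" by (auto simp: fvs.subspace_def S_def)
  have subU: "fvs.subspace U"
    unfolding fvs.subspace_def
  proof (intro conjI ballI allI)
    show "0 \<in> U" using V0 mult_mat_vec_zero[OF e] fvs.subspace_0[OF subS] unfolding U_def mem_Collect_eq by metis
  qed (use fvs.subspace_add[OF subS] fvs.subspace_scale[OF subS] in \<open>auto simp: U_def eV\<close>)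
  define \<delta> :: "nat \<Rightarrow> nat \<Rightarrow> 'k" where "\<delta> i = (\<lambda>j. if j = i then 1 else 0)" for i
  have "f \<in> fvs.span (\<delta> ` {..<n})" if f: "f \<in> S" for f
  proof -
    have "f = (\<Sum>i<n. fscale (f i) (\<delta> i))"
    proof
      fix j
      have "(\<Sum>i<n. fscale (f i) (\<delta> i)) j = (\<Sum>i<n. if i = j then f i else 0)"
        unfolding sum_fun_apply by (intro sum.cong) (auto simp: \<delta>_def)
      then show "f j = (\<Sum>i<n. fscale (f i) (\<delta> i)) j"
        using f by (simp add: S_def not_less)
    qed
    moreover have "(\<Sum>i<n. fscale (f i) (\<delta> i)) \<in> fvs.span (\<delta> ` {..<n})"
      by (intro fvs.span_sum fvs.span_scale fvs.span_base) auto
    ultimately show ?thesis by metis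
  qed
  then have fin: "S \<subseteq> fvs.span (\<delta> ` {..<n})" by blast
  obtain r \<kappa> where \<kappa>: "coords S U r \<kappa>"
    using coords_exist[OF subS subU _ _ fin] by (auto simp: U_def)
  note c = coordsD[OF \<kappa>]
  have lV: "lin_vec S n V" unfolding lin_vec_def using Vl by blast
  have lB: "lin_vec S n (\<lambda>f. e *\<^sub>v V f)"
    unfolding lin_vec_def eV using mult_mat_vec_carrier[OF e Vl(3)] by blast
  have "\<exists>B\<in>carrier_mat n r. \<forall>f\<in>S. B *\<^sub>v \<kappa> f = e *\<^sub>v V f"
    by (rule lin_vec_factor[OF \<kappa> lB]) (simp add: U_def)
  then obtain B where B: "B \<in> carrier_mat n r" "\<And>f. f \<in> S \<Longrightarrow> B *\<^sub>v \<kappa> f = e *\<^sub>v V f"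
    by blast
  define W where "W v = (\<lambda>i. if i < n then v $ i else 0)" for v :: "'k vec"
  have W: "W v \<in> S" "v \<in> carrier_vec n \<Longrightarrow> V (W v) = v" for v by (auto simp: W_def S_def V_def)
  have WV: "W (V f) = f" if "f \<in> S" for f using that by (auto simp: W_def S_def V_def fun_eq_iff)
  have triv: "coords S {0} n V"
    unfolding coords_def
  proof (intro conjI ballI subS)
    show "fvs.subspace {0 :: nat \<Rightarrow> 'k}" by (rule fvs.subspace_single_0)
    show "{0} \<subseteq> S" using fvs.subspace_0[OF subS] by blast
    show "lin_vec S n V" by (rule lV)
    show "\<exists>f\<in>S. V f = x" if "x \<in> carrier_vec n" for x using W that by blast
    show "V f = 0\<^sub>v n \<longleftrightarrow> f \<in> {0}" if "f \<in> S" for f using WV[OF that] WV[of 0] V0 fvs.subspace_0[OF subS] by (metis singletonD singletonI)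
  qed
  have "\<exists>P\<in>carrier_mat r n. \<forall>f\<in>S. P *\<^sub>v V f = \<kappa> f"
    by (rule lin_vec_factor[OF triv c(4)]) (use lin_vec_zero[OF c(4,1)] in blast)
  then obtain P where P: "P \<in> carrier_mat r n" "\<And>f. f \<in> S \<Longrightarrow> P *\<^sub>v V f = \<kappa> f" by blast
  have BP: "B * P = e"
  proof (rule mat_eqI_coords[OF triv mult_carrier_mat[OF B(1) P(1)] e])
    show "B * P *\<^sub>v V f = e *\<^sub>v V f" if "f \<in> S" for f
      using assoc_mult_mat_vec[OF B(1) P(1) Vl(3)] P(2)[OF that] B(2)[OF that] by simp
  qed
  have "P * B = 1\<^sub>m r"
  proof (rule mat_eqI_coords[OF \<kappa> mult_carrier_mat[OF P(1) B(1)] one_carrier_mat])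
    fix f assume f: "f \<in> S"
    have kc: "\<kappa> f \<in> carrier_vec r" using lin_vecD(1)[OF c(4) f] .
    let ?g = "W (e *\<^sub>v V f)"
    have Vg: "V ?g = e *\<^sub>v V f" using W(2) e Vl(3) by simp
    have "P * B *\<^sub>v \<kappa> f = P *\<^sub>v V ?g"
      using assoc_mult_mat_vec[OF P(1) B(1) kc] B(2)[OF f] Vg by simp
    also have "\<dots> = \<kappa> ?g" using P(2)[OF W(1)] .
    also have "\<dots> = \<kappa> f"
    proof -
      have s: "?g - f \<in> S" using W(1) f fvs.subspace_diff[OF subS] by blast
      have "V (?g - f) = V ?g - V f" by (auto simp: V_def)
      then have "e *\<^sub>v V (?g - f) = e *\<^sub>v (e *\<^sub>v V f) - e *\<^sub>v V f"
        using mult_minus_distrib_mat_vec[OF e mult_mat_vec_carrier[OF e Vl(3)] Vl(3)] Vg by simp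
      also have "e *\<^sub>v (e *\<^sub>v V f) = e *\<^sub>v V f"
        using assoc_mult_mat_vec[OF e e Vl(3)] ee by simp
      also have "e *\<^sub>v V f - e *\<^sub>v V f = 0\<^sub>v n" using e Vl(3) by simp
      finally have "?g - f \<in> U" using s unfolding U_def mem_Collect_eq by blast
      then show ?thesis using coords_eq_iff[OF \<kappa> W(1) f] by blast
    qed
    finally show "P * B *\<^sub>v \<kappa> f = 1\<^sub>m r *\<^sub>v \<kappa> f" using kc by simp
  qed
  then show ?thesis using that B(1) P(1) BP by blast
qed

definition hstack :: "'k :: field mat \<Rightarrow> 'k mat \<Rightarrow> 'k mat" where
  "hstack F G = four_block_mat F G (0\<^sub>m 0 (dim_col F)) (0\<^sub>m 0 (dim_col G))"

definition vstack :: "'k :: field mat \<Rightarrow> 'k mat \<Rightarrow> 'k mat" where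
  "vstack F G = four_block_mat F (0\<^sub>m (dim_row F) 0) G (0\<^sub>m (dim_row G) 0)"

lemma append_vec_empty: "y \<in> carrier_vec 0 \<Longrightarrow> x @\<^sub>v y = x"
  by (intro eq_vecI) auto

lemma hstack_carrier: "F \<in> carrier_mat m a \<Longrightarrow> G \<in> carrier_mat m b \<Longrightarrow> hstack F G \<in> carrier_mat m (a + b)"
  by (auto simp: hstack_def)

lemma vstack_carrier: "F \<in> carrier_mat a n \<Longrightarrow> G \<in> carrier_mat b n \<Longrightarrow> vstack F G \<in> carrier_mat (a + b) n"
  by (auto simp: vstack_def)

lemma hstack_mult_vec:
  fixes F G :: "'k :: field mat"
  assumes F: "F \<in> carrier_mat m a" and G: "G \<in> carrier_mat m b" and x: "x \<in> carrier_vec a" and y: "y \<in> carrier_vec b"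
  shows "hstack F G *\<^sub>v (x @\<^sub>v y) = F *\<^sub>v x + G *\<^sub>v y"
proof -
  have "hstack F G *\<^sub>v (x @\<^sub>v y) = (F *\<^sub>v x + G *\<^sub>v y) @\<^sub>v (0\<^sub>m 0 a *\<^sub>v x + 0\<^sub>m 0 b *\<^sub>v y)"
    using four_block_mat_mult_vec[OF F G zero_carrier_mat zero_carrier_mat x y] F G by (simp add: hstack_def)
  moreover have "0\<^sub>m 0 a *\<^sub>v x + 0\<^sub>m 0 b *\<^sub>v y \<in> carrier_vec 0"
    by (simp add: zero_mat_mult_vec[OF x] zero_mat_mult_vec[OF y])
  ultimately show ?thesis by (simp only: append_vec_empty)
qed

lemma vstack_mult_vec:
  fixes F G :: "'k :: field mat"
  assumes F: "F \<in> carrier_mat a n" and G: "G \<in> carrier_mat b n" and v: "v \<in> carrier_vec n"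
  shows "vstack F G *\<^sub>v v = (F *\<^sub>v v) @\<^sub>v (G *\<^sub>v v)"
proof -
  have z: "0\<^sub>v 0 \<in> carrier_vec 0" by simp
  have "vstack F G *\<^sub>v (v @\<^sub>v 0\<^sub>v 0) = (F *\<^sub>v v + 0\<^sub>m a 0 *\<^sub>v 0\<^sub>v 0) @\<^sub>v (G *\<^sub>v v + 0\<^sub>m b 0 *\<^sub>v 0\<^sub>v 0)"
    using four_block_mat_mult_vec[OF F zero_carrier_mat G zero_carrier_mat v z] F G by (simp add: vstack_def)
  moreover have "F *\<^sub>v v \<in> carrier_vec a" "G *\<^sub>v v \<in> carrier_vec b" using F G v by auto
  ultimately show ?thesis unfolding append_vec_empty[OF z] zero_mat_mult_vec[OF z] by simp
qed

text \<open>The complement of \<open>M\<close> is the image of the idempotent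
  \<open>1 - i * p\<close>, which commutes with the action of \<open>Z\<close>.\<close>

lemma retract_of_summand:
  fixes M Z :: "('a, 'k :: field) fdmod"
  assumes M: "is_module A M" and Z: "is_module A Z" and r: "retract_of A M Z"
    and cl: "\<one>\<^bsub>A\<^esub> \<in> carrier A" "\<And>a c. a \<in> carrier A \<Longrightarrow> c \<odot>\<^bsub>A\<^esub> a \<in> carrier A"
      "\<And>a b. a \<in> carrier A \<Longrightarrow> b \<in> carrier A \<Longrightarrow> a \<oplus>\<^bsub>A\<^esub> b \<in> carrier A"
      "\<And>a b. a \<in> carrier A \<Longrightarrow> b \<in> carrier A \<Longrightarrow> a \<otimes>\<^bsub>A\<^esub> b \<in> carrier A"
  shows "summand_of (mod_cat A) M Z"
proof -
  obtain i p where ip: "i \<in> mod_hom A M Z" "p \<in> mod_hom A Z M" "p * i = 1\<^sub>m (vdim M)"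
    using r by (auto simp: retract_of_def)
  let ?n = "vdim Z" and ?m = "vdim M"
  have i: "i \<in> carrier_mat ?n ?m" and p: "p \<in> carrier_mat ?m ?n" using ip mod_hom_carrier by auto
  define e where "e = 1\<^sub>m ?n - i * p"
  have ipc: "i * p \<in> carrier_mat ?n ?n" using i p by simp
  have ec: "e \<in> carrier_mat ?n ?n" unfolding e_def by (rule minus_carrier_mat[OF ipc])
  have ev: "e *\<^sub>v v = v - i *\<^sub>v (p *\<^sub>v v)" if "v \<in> carrier_vec ?n" for v
    using minus_mult_distrib_mat_vec[OF one_carrier_mat ipc that] assoc_mult_mat_vec[OF i p that] that
    by (simp add: e_def)
  have pi: "p *\<^sub>v (i *\<^sub>v v) = v" if "v \<in> carrier_vec ?m" for v
    using assoc_mult_mat_vec[OF p i that] ip(3) that by simp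
  have pv: "p *\<^sub>v v \<in> carrier_vec ?m" if "v \<in> carrier_vec ?n" for v using p that by simp
  have iv: "i *\<^sub>v v \<in> carrier_vec ?n" if "v \<in> carrier_vec ?m" for v using i that by simp
  have pe: "p *\<^sub>v (e *\<^sub>v v) = 0\<^sub>v ?m" if "v \<in> carrier_vec ?n" for v
    using mult_minus_distrib_mat_vec[OF p that iv[OF pv[OF that]]] pi[OF pv[OF that]] pv[OF that] ev[OF that]
    by simp
  have ecv: "e *\<^sub>v v \<in> carrier_vec ?n" if "v \<in> carrier_vec ?n" for v using ec that by simp
  have "e * e = e"
  proof (rule mat_eqI_vec[OF mult_carrier_mat[OF ec ec] ec])
    fix v :: "'k vec" assume v: "v \<in> carrier_vec ?n"
    have "e * e *\<^sub>v v = e *\<^sub>v v - i *\<^sub>v (p *\<^sub>v (e *\<^sub>v v))"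
      using assoc_mult_mat_vec[OF ec ec v] ev[OF ecv[OF v]] by simp
    then show "e * e *\<^sub>v v = e *\<^sub>v v"
      using pe[OF v] mult_mat_vec_zero[OF i] ecv[OF v] by simp
  qed
  then obtain r B P where BP: "B \<in> carrier_mat ?n r" "P \<in> carrier_mat r ?n" "B * P = e" "P * B = 1\<^sub>m r"
    using split_idempotent[OF ec] by metis
  have PB: "P *\<^sub>v (B *\<^sub>v v) = v" if "v \<in> carrier_vec r" for v
    using assoc_mult_mat_vec[OF BP(2,1) that] BP(4) that by simp
  have BPv: "B *\<^sub>v (P *\<^sub>v v) = e *\<^sub>v v" if "v \<in> carrier_vec ?n" for v
    using assoc_mult_mat_vec[OF BP(1,2) that] BP(3) by simp
  have Bv: "B *\<^sub>v v \<in> carrier_vec ?n" if "v \<in> carrier_vec r" for v using BP(1) that by simp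
  have Pv: "P *\<^sub>v v \<in> carrier_vec r" if "v \<in> carrier_vec ?n" for v using BP(2) that by simp
  have eB: "e *\<^sub>v (B *\<^sub>v v) = B *\<^sub>v v" if "v \<in> carrier_vec r" for v
    using BPv[OF Bv[OF that]] PB[OF that] by simp
  have av: "act Z a *\<^sub>v v \<in> carrier_vec ?n" if "a \<in> carrier A" "v \<in> carrier_vec ?n" for a v
    using is_moduleD(1)[OF Z that(1)] that(2) by (rule mult_mat_vec_carrier)
  have ea: "e *\<^sub>v (act Z a *\<^sub>v v) = act Z a *\<^sub>v (e *\<^sub>v v)" if a: "a \<in> carrier A" and v: "v \<in> carrier_vec ?n" for a v
    unfolding ev[OF av[OF a v]] ev[OF v] mod_hom_vec[OF ip(2) Z M a v] mod_hom_vec[OF ip(1) M Z a pv[OF v]]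
      mult_minus_distrib_mat_vec[OF is_moduleD(1)[OF Z a] v iv[OF pv[OF v]]] ..
  \<comment> \<open>The action on the image of \<open>e\<close> in the coordinates given by
    \<open>P\<close> and \<open>B\<close>. Multiplicativity rests on the fact that \<open>B\<close>
    intertwines \<open>act N a\<close> with \<open>act Z a\<close>.\<close>
  define N :: "('a, 'k) fdmod" where "N = \<lparr>vdim = r, act = (\<lambda>a. P * act Z a * B)\<rparr>"
  have vN: "vdim N = r" by (simp add: N_def)
  have aN: "act N a \<in> carrier_mat r r" if "a \<in> carrier A" for a
    using BP(1,2) is_moduleD(1)[OF Z that] by (simp add: N_def)
  have aNv: "act N a *\<^sub>v v = P *\<^sub>v (act Z a *\<^sub>v (B *\<^sub>v v))" if a: "a \<in> carrier A" and v: "v \<in> carrier_vec r" for a v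
    using assoc_mult_mat_vec[OF mult_carrier_mat[OF BP(2) is_moduleD(1)[OF Z a]] BP(1) v]
      assoc_mult_mat_vec[OF BP(2) is_moduleD(1)[OF Z a] Bv[OF v]] by (simp add: N_def)
  have BaN: "B *\<^sub>v (act N a *\<^sub>v v) = act Z a *\<^sub>v (B *\<^sub>v v)" if a: "a \<in> carrier A" and v: "v \<in> carrier_vec r" for a v
    unfolding aNv[OF a v] BPv[OF av[OF a Bv[OF v]]] ea[OF a Bv[OF v]] eB[OF v] ..
  have aNc: "act N a *\<^sub>v v \<in> carrier_vec r" if "a \<in> carrier A" "v \<in> carrier_vec r" for a v
    using aN[OF that(1)] that(2) by (rule mult_mat_vec_carrier)
  have Binj: "v = w" if "v \<in> carrier_vec r" "w \<in> carrier_vec r" "B *\<^sub>v v = B *\<^sub>v w" for v w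
    using PB that by metis
  have N: "is_module A N"
    unfolding is_module_def vN
  proof (intro conjI ballI allI aN)
    fix a b assume a: "a \<in> carrier A" and b: "b \<in> carrier A"
    show "act N (a \<oplus>\<^bsub>A\<^esub> b) = act N a + act N b"
    proof (rule mat_eqI_vec[OF aN[OF cl(3)[OF a b]]])
      show "act N a + act N b \<in> carrier_mat r r" using aN[OF a] aN[OF b] by simp
      fix v :: "'k vec" assume v: "v \<in> carrier_vec r"
      show "act N (a \<oplus>\<^bsub>A\<^esub> b) *\<^sub>v v = (act N a + act N b) *\<^sub>v v"
        unfolding aNv[OF cl(3)[OF a b] v] is_moduleD(2)[OF Z a b]
          add_mult_distrib_mat_vec[OF is_moduleD(1)[OF Z a] is_moduleD(1)[OF Z b] Bv[OF v]]
          mult_add_distrib_mat_vec[OF BP(2) av[OF a Bv[OF v]] av[OF b Bv[OF v]]]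
          add_mult_distrib_mat_vec[OF aN[OF a] aN[OF b] v] aNv[OF a v] aNv[OF b v] ..
    qed
    show "act N (a \<otimes>\<^bsub>A\<^esub> b) = act N a * act N b"
    proof (rule mat_eqI_vec[OF aN[OF cl(4)[OF a b]]])
      show "act N a * act N b \<in> carrier_mat r r" using aN[OF a] aN[OF b] by simp
      fix v :: "'k vec" assume v: "v \<in> carrier_vec r"
      show "act N (a \<otimes>\<^bsub>A\<^esub> b) *\<^sub>v v = (act N a * act N b) *\<^sub>v v"
        unfolding assoc_mult_mat_vec[OF aN[OF a] aN[OF b] v] aNv[OF a aNc[OF b v]] BaN[OF b v]
          aNv[OF cl(4)[OF a b] v] is_moduleD(4)[OF Z a b]
          assoc_mult_mat_vec[OF is_moduleD(1)[OF Z a] is_moduleD(1)[OF Z b] Bv[OF v]] ..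
    qed
  next
    fix c a assume a: "a \<in> carrier A"
    show "act N (c \<odot>\<^bsub>A\<^esub> a) = c \<cdot>\<^sub>m act N a"
      using is_moduleD(3)[OF Z a] BP(1,2) is_moduleD(1)[OF Z a]
      by (simp add: N_def mult_smult_distrib[OF BP(2) is_moduleD(1)[OF Z a]]
          mult_smult_assoc_mat[OF mult_carrier_mat[OF BP(2) is_moduleD(1)[OF Z a]] BP(1)])
  next
    show "act N \<one>\<^bsub>A\<^esub> = 1\<^sub>m r"
      using is_moduleD(5)[OF Z cl(1)] BP by (simp add: N_def)
  qed
  let ?f = "hstack i B" and ?g = "vstack p P"
  have fc: "?f \<in> carrier_mat ?n (?m + r)" and gc: "?g \<in> carrier_mat (?m + r) ?n"
    using hstack_carrier[OF i BP(1)] vstack_carrier[OF p BP(2)] by auto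
  note fv = hstack_mult_vec[OF i BP(1)] and gv = vstack_mult_vec[OF p BP(2)]
  have pB: "p *\<^sub>v (B *\<^sub>v y) = 0\<^sub>v ?m" if "y \<in> carrier_vec r" for y
    using pe[OF Bv[OF that]] eB[OF that] by simp
  have Pi: "P *\<^sub>v (i *\<^sub>v x) = 0\<^sub>v r" if x: "x \<in> carrier_vec ?m" for x
  proof (rule Binj[OF Pv[OF iv[OF x]] zero_carrier_vec])
    show "B *\<^sub>v (P *\<^sub>v (i *\<^sub>v x)) = B *\<^sub>v 0\<^sub>v r"
      unfolding BPv[OF iv[OF x]] ev[OF iv[OF x]] pi[OF x] mult_mat_vec_zero[OF BP(1)] using iv[OF x] by simp
  qed
  have gf: "?g * ?f = 1\<^sub>m (?m + r)"
  proof (rule mat_eqI_append[OF mult_carrier_mat[OF gc fc] one_carrier_mat])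
    fix x y :: "'k vec" assume x: "x \<in> carrier_vec ?m" and y: "y \<in> carrier_vec r"
    have s: "i *\<^sub>v x + B *\<^sub>v y \<in> carrier_vec ?n" using iv[OF x] Bv[OF y] by simp
    have "?g * ?f *\<^sub>v (x @\<^sub>v y) = ?g *\<^sub>v (?f *\<^sub>v (x @\<^sub>v y))"
      by (rule assoc_mult_mat_vec[OF gc fc]) (use x y in simp)
    also have "\<dots> = x @\<^sub>v y"
      unfolding fv[OF x y] gv[OF s] mult_add_distrib_mat_vec[OF p iv[OF x] Bv[OF y]]
        mult_add_distrib_mat_vec[OF BP(2) iv[OF x] Bv[OF y]] pi[OF x] pB[OF y] Pi[OF x] PB[OF y]
      using x y by simp
    finally show "?g * ?f *\<^sub>v (x @\<^sub>v y) = 1\<^sub>m (?m + r) *\<^sub>v (x @\<^sub>v y)" using x y by simp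
  qed
  have av': "w + (v - w) = v" if "w \<in> carrier_vec ?n" "v \<in> carrier_vec ?n" for v w :: "'k vec"
    using that by (intro eq_vecI) auto
  have fg: "?f * ?g = 1\<^sub>m ?n"
  proof (rule mat_eqI_vec[OF mult_carrier_mat[OF fc gc] one_carrier_mat])
    fix v :: "'k vec" assume v: "v \<in> carrier_vec ?n"
    have "?f * ?g *\<^sub>v v = i *\<^sub>v (p *\<^sub>v v) + e *\<^sub>v v"
      unfolding assoc_mult_mat_vec[OF fc gc v] gv[OF v] fv[OF pv[OF v] Pv[OF v]] BPv[OF v] ..
    also have "\<dots> = v" unfolding ev[OF v] by (rule av'[OF iv[OF pv[OF v]] v])
    finally show "?f * ?g *\<^sub>v v = 1\<^sub>m ?n *\<^sub>v v" using v by simp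
  qed
  note MN = is_module_mod_sum[OF M N]
  have fh: "?f \<in> mod_hom A (mod_sum M N) Z"
  proof (rule mod_homI[OF _ MN Z])
    show "?f \<in> carrier_mat ?n (vdim (mod_sum M N))" using fc by (simp add: vN)
    fix a and v :: "'k vec" assume a: "a \<in> carrier A" and "v \<in> carrier_vec (vdim (mod_sum M N))"
    then have "v \<in> carrier_vec (?m + r)" by (simp add: vN)
    then obtain x y where v: "x \<in> carrier_vec ?m" "y \<in> carrier_vec r" "v = x @\<^sub>v y" by (rule vec_append_cases)
    have ax: "act M a *\<^sub>v x \<in> carrier_vec ?m" using is_moduleD(1)[OF M a] v(1) by (rule mult_mat_vec_carrier)
    show "?f *\<^sub>v (act (mod_sum M N) a *\<^sub>v v) = act Z a *\<^sub>v (?f *\<^sub>v v)"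
      unfolding v(3) mod_sum_simps diag_sum_mult_vec[OF is_moduleD(1)[OF M a] aN[OF a] v(1,2)]
        fv[OF ax aNc[OF a v(2)]] fv[OF v(1,2)] BaN[OF a v(2)] mod_hom_vec[OF ip(1) M Z a v(1)]
        mult_add_distrib_mat_vec[OF is_moduleD(1)[OF Z a] iv[OF v(1)] Bv[OF v(2)]] ..
  qed
  have gh: "?g \<in> mod_hom A Z (mod_sum M N)"
  proof (rule mod_homI[OF _ Z MN])
    show "?g \<in> carrier_mat (vdim (mod_sum M N)) ?n" using gc by (simp add: vN)
    fix a and v :: "'k vec" assume a: "a \<in> carrier A" and v: "v \<in> carrier_vec ?n"
    have "P *\<^sub>v (act Z a *\<^sub>v v) = act N a *\<^sub>v (P *\<^sub>v v)"
    proof (rule Binj[OF Pv[OF av[OF a v]] aNc[OF a Pv[OF v]]])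
      show "B *\<^sub>v (P *\<^sub>v (act Z a *\<^sub>v v)) = B *\<^sub>v (act N a *\<^sub>v (P *\<^sub>v v))"
        unfolding BPv[OF av[OF a v]] BaN[OF a Pv[OF v]] BPv[OF v] ea[OF a v] ..
    qed
    then show "?g *\<^sub>v (act Z a *\<^sub>v v) = act (mod_sum M N) a *\<^sub>v (?g *\<^sub>v v)"
      unfolding gv[OF av[OF a v]] gv[OF v] mod_sum_simps
        diag_sum_mult_vec[OF is_moduleD(1)[OF M a] aN[OF a] pv[OF v] Pv[OF v]]
        mod_hom_vec[OF ip(2) Z M a v] by simp
  qed
  have "isomorphic (mod_cat A) (mod_sum M N) Z"
    unfolding isomorphic_def is_iso_def mod_cat_simps
    using fh gh fg gf by (auto simp: vN intro!: exI[of _ ?f] bexI[of _ ?g])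
  then show ?thesis using M Z N by (auto simp: summand_of_def)
qed

lemma mod_sum_biproduct:
  fixes M N :: "('a, 'k :: field) fdmod"
  assumes M: "is_module A M" and N: "is_module A N"
  obtains i j p q where "i \<in> mod_hom A M (mod_sum M N)" "j \<in> mod_hom A N (mod_sum M N)"
    "p \<in> mod_hom A (mod_sum M N) M" "q \<in> mod_hom A (mod_sum M N) N"
    "p * i = 1\<^sub>m (vdim M)" "q * j = 1\<^sub>m (vdim N)" "i * p + j * q = 1\<^sub>m (vdim M + vdim N)"
proof -
  let ?m = "vdim M" and ?n = "vdim N"
  note MN = is_module_mod_sum[OF M N]
  define i :: "'k mat" where "i = vstack (1\<^sub>m ?m) (0\<^sub>m ?n ?m)"
  define j :: "'k mat" where "j = vstack (0\<^sub>m ?m ?n) (1\<^sub>m ?n)"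
  define p :: "'k mat" where "p = hstack (1\<^sub>m ?m) (0\<^sub>m ?m ?n)"
  define q :: "'k mat" where "q = hstack (0\<^sub>m ?n ?m) (1\<^sub>m ?n)"
  have c: "i \<in> carrier_mat (?m + ?n) ?m" "j \<in> carrier_mat (?m + ?n) ?n"
    "p \<in> carrier_mat ?m (?m + ?n)" "q \<in> carrier_mat ?n (?m + ?n)"
    unfolding i_def j_def p_def q_def by (intro vstack_carrier hstack_carrier one_carrier_mat zero_carrier_mat)+
  have iv: "i *\<^sub>v x = x @\<^sub>v 0\<^sub>v ?n" if "x \<in> carrier_vec ?m" for x
    using vstack_mult_vec[OF one_carrier_mat zero_carrier_mat that] that by (simp add: i_def zero_mat_mult_vec)
  have jv: "j *\<^sub>v x = 0\<^sub>v ?m @\<^sub>v x" if "x \<in> carrier_vec ?n" for x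
    using vstack_mult_vec[OF zero_carrier_mat one_carrier_mat that] that by (simp add: j_def zero_mat_mult_vec)
  have pv: "p *\<^sub>v (x @\<^sub>v y) = x" if "x \<in> carrier_vec ?m" "y \<in> carrier_vec ?n" for x y
    using hstack_mult_vec[OF one_carrier_mat zero_carrier_mat that] that by (simp add: p_def zero_mat_mult_vec)
  have qv: "q *\<^sub>v (x @\<^sub>v y) = y" if "x \<in> carrier_vec ?m" "y \<in> carrier_vec ?n" for x y
    using hstack_mult_vec[OF zero_carrier_mat one_carrier_mat that] that by (simp add: q_def zero_mat_mult_vec)
  note aM = is_moduleD(1)[OF M] and aN = is_moduleD(1)[OF N]
  note aMv = mult_mat_vec_carrier[OF aM] and aNv = mult_mat_vec_carrier[OF aN]
  note sv = diag_sum_mult_vec[OF aM aN]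
  have "i \<in> mod_hom A M (mod_sum M N)"
  proof (rule mod_homI[OF _ M MN])
    fix a and x :: "'k vec" assume a: "a \<in> carrier A" and x: "x \<in> carrier_vec ?m"
    show "i *\<^sub>v (act M a *\<^sub>v x) = act (mod_sum M N) a *\<^sub>v (i *\<^sub>v x)"
      unfolding iv[OF x] iv[OF aMv[OF a x]] mod_sum_simps sv[OF a a x zero_carrier_vec] mult_mat_vec_zero[OF aN[OF a]] ..
  qed (use c in simp)
  moreover have "j \<in> mod_hom A N (mod_sum M N)"
  proof (rule mod_homI[OF _ N MN])
    fix a and x :: "'k vec" assume a: "a \<in> carrier A" and x: "x \<in> carrier_vec ?n"
    show "j *\<^sub>v (act N a *\<^sub>v x) = act (mod_sum M N) a *\<^sub>v (j *\<^sub>v x)"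
      unfolding jv[OF x] jv[OF aNv[OF a x]] mod_sum_simps sv[OF a a zero_carrier_vec x] mult_mat_vec_zero[OF aM[OF a]] ..
  qed (use c in simp)
  moreover have "p \<in> mod_hom A (mod_sum M N) M"
  proof (rule mod_homI[OF _ MN M])
    fix a and v :: "'k vec" assume a: "a \<in> carrier A" and "v \<in> carrier_vec (vdim (mod_sum M N))"
    then have "v \<in> carrier_vec (?m + ?n)" by simp
    then obtain x y where v: "x \<in> carrier_vec ?m" "y \<in> carrier_vec ?n" "v = x @\<^sub>v y" by (rule vec_append_cases)
    show "p *\<^sub>v (act (mod_sum M N) a *\<^sub>v v) = act M a *\<^sub>v (p *\<^sub>v v)"
      unfolding v(3) mod_sum_simps sv[OF a a v(1,2)] pv[OF v(1,2)] pv[OF aMv[OF a v(1)] aNv[OF a v(2)]] ..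
  qed (use c in simp)
  moreover have "q \<in> mod_hom A (mod_sum M N) N"
  proof (rule mod_homI[OF _ MN N])
    fix a and v :: "'k vec" assume a: "a \<in> carrier A" and "v \<in> carrier_vec (vdim (mod_sum M N))"
    then have "v \<in> carrier_vec (?m + ?n)" by simp
    then obtain x y where v: "x \<in> carrier_vec ?m" "y \<in> carrier_vec ?n" "v = x @\<^sub>v y" by (rule vec_append_cases)
    show "q *\<^sub>v (act (mod_sum M N) a *\<^sub>v v) = act N a *\<^sub>v (q *\<^sub>v v)"
      unfolding v(3) mod_sum_simps sv[OF a a v(1,2)] qv[OF v(1,2)] qv[OF aMv[OF a v(1)] aNv[OF a v(2)]] ..
  qed (use c in simp)
  moreover have "p * i = 1\<^sub>m ?m"
  proof (rule mat_eqI_vec[OF mult_carrier_mat[OF c(3,1)] one_carrier_mat])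
    fix x :: "'k vec" assume x: "x \<in> carrier_vec ?m"
    show "p * i *\<^sub>v x = 1\<^sub>m ?m *\<^sub>v x"
      unfolding assoc_mult_mat_vec[OF c(3,1) x] iv[OF x] pv[OF x zero_carrier_vec] using x by simp
  qed
  moreover have "q * j = 1\<^sub>m ?n"
  proof (rule mat_eqI_vec[OF mult_carrier_mat[OF c(4,2)] one_carrier_mat])
    fix x :: "'k vec" assume x: "x \<in> carrier_vec ?n"
    show "q * j *\<^sub>v x = 1\<^sub>m ?n *\<^sub>v x"
      unfolding assoc_mult_mat_vec[OF c(4,2) x] jv[OF x] qv[OF zero_carrier_vec x] using x by simp
  qed
  moreover have "i * p + j * q = 1\<^sub>m (?m + ?n)"
  proof (rule mat_eqI_append)
    note ip = mult_carrier_mat[OF c(1,3)] and jq = mult_carrier_mat[OF c(2,4)]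
    show "i * p + j * q \<in> carrier_mat (?m + ?n) (?m + ?n)" using ip jq by simp
    fix x y :: "'k vec" assume x: "x \<in> carrier_vec ?m" and y: "y \<in> carrier_vec ?n"
    have xy: "x @\<^sub>v y \<in> carrier_vec (?m + ?n)" using x y by simp
    have "(i * p + j * q) *\<^sub>v (x @\<^sub>v y) = (x @\<^sub>v 0\<^sub>v ?n) + (0\<^sub>v ?m @\<^sub>v y)"
      unfolding add_mult_distrib_mat_vec[OF ip jq xy] assoc_mult_mat_vec[OF c(1,3) xy]
        assoc_mult_mat_vec[OF c(2,4) xy] pv[OF x y] qv[OF x y] iv[OF x] jv[OF y] ..
    also have "\<dots> = x @\<^sub>v y" using x y by (intro eq_vecI) auto
    finally show "(i * p + j * q) *\<^sub>v (x @\<^sub>v y) = 1\<^sub>m (?m + ?n) *\<^sub>v (x @\<^sub>v y)" using xy by simp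
  qed simp
  ultimately show ?thesis by (rule that)
qed

lemma retract_of_mod_sum:
  fixes M N :: "('a, 'k :: field) fdmod"
  assumes "is_module A M" "is_module A N"
  shows "retract_of A M (mod_sum M N)" "retract_of A N (mod_sum M N)"
proof -
  obtain i j p q where "i \<in> mod_hom A M (mod_sum M N)" "j \<in> mod_hom A N (mod_sum M N)"
    "p \<in> mod_hom A (mod_sum M N) M" "q \<in> mod_hom A (mod_sum M N) N"
    "p * i = 1\<^sub>m (vdim M)" "q * j = 1\<^sub>m (vdim N)"
    using mod_sum_biproduct[OF assms] .
  then show "retract_of A M (mod_sum M N)" "retract_of A N (mod_sum M N)"
    unfolding retract_of_def by blast+
qed

lemma retract_of_iso:
  assumes "is_iso (mod_cat A) M N f"
  shows "retract_of A M N"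
  using assms by (auto simp: is_iso_def retract_of_def)

text \<open>Accounts for empty intervals, whose module is zero.\<close>

lemma retract_of_zero_dim:
  fixes M N :: "('a, 'k :: field) fdmod"
  assumes M: "is_module A M" and N: "is_module A N" and "vdim M = 0"
  shows "retract_of A M N"
proof -
  have "0\<^sub>m (vdim N) 0 \<in> mod_hom A M N" "0\<^sub>m 0 (vdim N) \<in> mod_hom A N M"
    using assms(3) carrier_matD[OF is_moduleD(1)[OF M]] carrier_matD[OF is_moduleD(1)[OF N]]
    by (auto simp: mod_hom_def intro!: eq_matI)
  moreover have "0\<^sub>m 0 (vdim N) * 0\<^sub>m (vdim N) 0 = (1\<^sub>m (vdim M) :: 'k mat)"
    using assms(3) by (auto intro!: eq_matI)
  ultimately show ?thesis unfolding retract_of_def by blast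
qed

text \<open>A retract of a direct sum whose endomorphisms are scalars is a retract of one of the
  terms, because \<open>1\<close> is not a sum of two zeros: no Krull-Schmidt theorem is needed.\<close>

lemma brick_retract_mod_sum:
  fixes M N K :: "('a, 'k :: field) fdmod"
  assumes K: "is_module A K" and M: "is_module A M" and N: "is_module A N"
    and brick: "\<And>f. f \<in> mod_hom A K K \<Longrightarrow> \<exists>c. f = c \<cdot>\<^sub>m 1\<^sub>m (vdim K)" and "vdim K \<noteq> 0"
    and r: "retract_of A K (mod_sum M N)"
  shows "retract_of A K M \<or> retract_of A K N"
proof -
  let ?k = "vdim K"
  obtain i j p q where b: "i \<in> mod_hom A M (mod_sum M N)" "j \<in> mod_hom A N (mod_sum M N)"
    "p \<in> mod_hom A (mod_sum M N) M" "q \<in> mod_hom A (mod_sum M N) N"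
    "p * i = 1\<^sub>m (vdim M)" "q * j = 1\<^sub>m (vdim N)" "i * p + j * q = 1\<^sub>m (vdim M + vdim N)"
    using mod_sum_biproduct[OF M N] .
  obtain u v where uv: "u \<in> mod_hom A K (mod_sum M N)" "v \<in> mod_hom A (mod_sum M N) K" "v * u = 1\<^sub>m ?k"
    using r by (auto simp: retract_of_def)
  note MN = is_module_mod_sum[OF M N]
  have h: "p * u \<in> mod_hom A K M" "q * u \<in> mod_hom A K N" "v * i \<in> mod_hom A M K" "v * j \<in> mod_hom A N K"
    by (rule mod_hom_comp[OF uv(1) b(3) K MN M] mod_hom_comp[OF uv(1) b(4) K MN N]
        mod_hom_comp[OF b(1) uv(2) M MN K] mod_hom_comp[OF b(2) uv(2) N MN K])+
  have uc: "u \<in> carrier_mat (vdim M + vdim N) ?k" and vc: "v \<in> carrier_mat ?k (vdim M + vdim N)"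
    using uv mod_hom_carrier by fastforce+
  have ic: "i \<in> carrier_mat (vdim M + vdim N) (vdim M)" and jc: "j \<in> carrier_mat (vdim M + vdim N) (vdim N)"
    and pc: "p \<in> carrier_mat (vdim M) (vdim M + vdim N)" and qc: "q \<in> carrier_mat (vdim N) (vdim M + vdim N)"
    using b(1-4)[THEN mod_hom_carrier] by simp_all
  obtain c where c: "(v * i) * (p * u) = c \<cdot>\<^sub>m 1\<^sub>m ?k" using brick[OF mod_hom_comp[OF h(1,3) K M K]] by blast
  obtain d where d: "(v * j) * (q * u) = d \<cdot>\<^sub>m 1\<^sub>m ?k" using brick[OF mod_hom_comp[OF h(2,4) K N K]] by blast
  have "(v * i) * (p * u) = v * ((i * p) * u)"
    using assoc_mult_mat[OF vc ic mult_carrier_mat[OF pc uc]] assoc_mult_mat[OF ic pc uc] by simp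
  moreover have "(v * j) * (q * u) = v * ((j * q) * u)"
    using assoc_mult_mat[OF vc jc mult_carrier_mat[OF qc uc]] assoc_mult_mat[OF jc qc uc] by simp
  moreover have "v * ((i * p + j * q) * u) = v * ((i * p) * u) + v * ((j * q) * u)"
    using add_mult_distrib_mat[OF mult_carrier_mat[OF ic pc] mult_carrier_mat[OF jc qc] uc]
      mult_add_distrib_mat[OF vc mult_carrier_mat[OF mult_carrier_mat[OF ic pc] uc] mult_carrier_mat[OF mult_carrier_mat[OF jc qc] uc]]
    by simp
  \<comment> \<open>The composites through the two summands are scalars and add up to the identity;
    one diagonal entry then gives \<open>c + d = 1\<close>.\<close>
  ultimately have "c \<cdot>\<^sub>m 1\<^sub>m ?k + d \<cdot>\<^sub>m 1\<^sub>m ?k = 1\<^sub>m ?k"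
    unfolding b(7) using c d uv(3) uc vc by simp
  then have "(c \<cdot>\<^sub>m 1\<^sub>m ?k + d \<cdot>\<^sub>m 1\<^sub>m ?k) $$ (0, 0) = (1\<^sub>m ?k :: 'k mat) $$ (0, 0)" by simp
  then have cd: "c + d = 1" using \<open>vdim K \<noteq> 0\<close> by simp
  have scale: "retract_of A K W" if W: "is_module A W" and f: "f \<in> mod_hom A K W" and g: "g \<in> mod_hom A W K"
    and gf: "g * f = e \<cdot>\<^sub>m 1\<^sub>m ?k" and e: "e \<noteq> 0" for W f g e
  proof -
    have fc: "f \<in> carrier_mat (vdim W) ?k" and gc: "g \<in> carrier_mat ?k (vdim W)"
      using f g mod_hom_carrier by auto
    let ?g = "inverse e \<cdot>\<^sub>m g"
    have "?g \<in> mod_hom A W K"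
      using g gc is_moduleD(1)[OF W] is_moduleD(1)[OF K] mult_smult_assoc_mat[OF gc is_moduleD(1)[OF W]]
        mult_smult_distrib[OF is_moduleD(1)[OF K] gc]
      by (simp add: mod_hom_def)
    moreover have "?g * f = 1\<^sub>m ?k"
      unfolding mult_smult_assoc_mat[OF gc fc] gf using e by (intro eq_matI) auto
    ultimately show ?thesis using f unfolding retract_of_def by blast
  qed
  show ?thesis
  proof (cases "c = 0")
    case True
    then show ?thesis using scale[OF N h(2,4) d] cd by simp
  qed (use scale[OF M h(1,3) c] in blast)
qed

lemma finsum_of_mod_cat: "finsum_of (mod_cat A) Ms = foldr mod_sum Ms zero_mod"
  by (simp add: finsum_of_def)

lemma is_module_finsum: "(\<And>M. M \<in> set Ms \<Longrightarrow> is_module A M) \<Longrightarrow> is_module A (foldr mod_sum Ms zero_mod)"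
  by (induction Ms) (auto simp: is_module_zero is_module_mod_sum)

lemma retract_of_finsum:
  assumes "\<And>M. M \<in> set Ms \<Longrightarrow> is_module A M" "M \<in> set Ms"
  shows "retract_of A M (foldr mod_sum Ms zero_mod)"
  using assms
proof (induction Ms)
  case (Cons K Ms)
  note m = is_module_finsum[of Ms A]
  show ?case
  proof (cases "M = K")
    case True
    then show ?thesis using retract_of_mod_sum(1)[of A K] Cons.prems m by simp
  next
    case False
    then have "retract_of A M (foldr mod_sum Ms zero_mod)" using Cons by simp
    then show ?thesis
      using retract_of_trans[of A M "foldr mod_sum Ms zero_mod" "mod_sum K (foldr mod_sum Ms zero_mod)"]
        retract_of_mod_sum(2)[of A K "foldr mod_sum Ms zero_mod"] is_module_mod_sum[of A K] Cons.prems m by simp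
  qed
qed simp

text \<open>Peels off one copy of \<open>Z\<close> at a time. In the base case the identity of a
  nonzero module would factor through the zero module.\<close>

lemma brick_retract_power:
  fixes Z K :: "('a, 'k :: field) fdmod"
  assumes K: "is_module A K" and Z: "is_module A Z"
    and brick: "\<And>f. f \<in> mod_hom A K K \<Longrightarrow> \<exists>c. f = c \<cdot>\<^sub>m 1\<^sub>m (vdim K)" and k: "vdim K \<noteq> 0"
    and "retract_of A K (foldr mod_sum (replicate r Z) zero_mod)"
  shows "retract_of A K Z"
  using assms(5)
proof (induction r)
  case 0
  then obtain i p :: "'k mat" where ip: "i \<in> carrier_mat 0 (vdim K)" "p \<in> carrier_mat (vdim K) 0" "p * i = 1\<^sub>m (vdim K)"
    by (auto simp: retract_of_def mod_hom_def)
  have "(p * i) $$ (0, 0) = 0" using ip(1,2) k by (simp add: scalar_prod_def)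
  then show ?case using ip(3) k by simp
next
  case (Suc r)
  have "is_module A (foldr mod_sum (replicate r Z) zero_mod)" by (rule is_module_finsum) (use Z in auto)
  then show ?case using brick_retract_mod_sum[OF K Z _ brick k] Suc by auto
qed

text \<open>Being a representation generator only places \<open>K\<close> in some power of
  \<open>Z\<close>, whereas the triangle asks for summands of \<open>Z\<close> itself; a brick
  descends to a single copy.\<close>

lemma brick_retract_generator:
  fixes Z K :: "('a, 'k :: field) fdmod"
  assumes Z: "rep_generator A Z" and K: "is_module A K"
    and brick: "\<And>f. f \<in> mod_hom A K K \<Longrightarrow> \<exists>c. f = c \<cdot>\<^sub>m 1\<^sub>m (vdim K)" and k: "vdim K \<noteq> 0"
  shows "retract_of A K Z"
proof -
  have Zm: "is_module A Z" using Z by (simp add: rep_generator_def)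
  have "K \<in> add_closure (mod_cat A) Z" using Z K by (auto simp: rep_generator_def)
  then obtain r where "summand_of (mod_cat A) K (foldr mod_sum (replicate r Z) zero_mod)"
    by (auto simp: add_closure_def finsum_of_mod_cat)
  then obtain K' f where K': "is_module A K'" and f: "is_iso (mod_cat A) (mod_sum K K') (foldr mod_sum (replicate r Z) zero_mod) f"
    and P: "is_module A (foldr mod_sum (replicate r Z) zero_mod)"
    by (auto simp: summand_of_def isomorphic_def)
  have "retract_of A K (foldr mod_sum (replicate r Z) zero_mod)"
    by (rule retract_of_trans[OF K is_module_mod_sum[OF K K'] P retract_of_mod_sum(1)[OF K K'] retract_of_iso[OF f]])
  then show ?thesis using brick_retract_power[of A K Z r] K Zm brick k by blast
qed

section \<open>Free covers\<close>

text \<open>A tuple \<open>F\<close> of elements of the algebra stands for the element \<open>\<Sum>s. F s \<otimes> e\<^sub>s\<close> of the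
  free module on a basis of \<open>M\<close>, and \<open>cover M\<close> is the multiplication map to \<open>M\<close>.\<close>

definition cover :: "('a, 'k :: field) fdmod \<Rightarrow> (nat \<Rightarrow> 'a) \<Rightarrow> 'k vec" where
  "cover M F = vec (vdim M) (\<lambda>t. \<Sum>s<vdim M. act M (F s) $$ (t, s))"

lemma cover_carrier [simp]: "cover M F \<in> carrier_vec (vdim M)"
  by (simp add: cover_def)

lemma cover_add:
  assumes M: "is_module A M" and "\<And>s. F s \<in> carrier A" "\<And>s. G s \<in> carrier A"
  shows "cover M (\<lambda>s. F s \<oplus>\<^bsub>A\<^esub> G s) = cover M F + cover M G"
proof (rule eq_vecI)
  fix t assume "t < dim_vec (cover M F + cover M G)"
  then have t: "t < vdim M" by (simp add: cover_def)
  have "act M (F s \<oplus>\<^bsub>A\<^esub> G s) $$ (t, s) = act M (F s) $$ (t, s) + act M (G s) $$ (t, s)"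
    if "s < vdim M" for s
    using is_moduleD(2)[OF M assms(2,3)] carrier_matD[OF is_moduleD(1)[OF M assms(3)]] t that by simp
  then show "cover M (\<lambda>s. F s \<oplus>\<^bsub>A\<^esub> G s) $ t = (cover M F + cover M G) $ t"
    using t by (simp add: cover_def sum.distrib)
qed (simp add: cover_def)

lemma cover_smult:
  assumes M: "is_module A M" and "\<And>s. F s \<in> carrier A"
  shows "cover M (\<lambda>s. c \<odot>\<^bsub>A\<^esub> F s) = c \<cdot>\<^sub>v cover M F"
proof (rule eq_vecI)
  fix t assume "t < dim_vec (c \<cdot>\<^sub>v cover M F)"
  then have t: "t < vdim M" by (simp add: cover_def)
  have "act M (c \<odot>\<^bsub>A\<^esub> F s) $$ (t, s) = c * act M (F s) $$ (t, s)" if "s < vdim M" for s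
    using is_moduleD(3)[OF M assms(2)] carrier_matD[OF is_moduleD(1)[OF M assms(2)]] t that by simp
  then show "cover M (\<lambda>s. c \<odot>\<^bsub>A\<^esub> F s) $ t = (c \<cdot>\<^sub>v cover M F) $ t"
    using t by (simp add: cover_def sum_distrib_left)
qed (simp add: cover_def)

lemma cover_mult:
  assumes M: "is_module A M" and F: "\<And>s. F s \<in> carrier A" and a: "a \<in> carrier A"
  shows "cover M (\<lambda>s. a \<otimes>\<^bsub>A\<^esub> F s) = act M a *\<^sub>v cover M F"
proof (rule eq_vecI)
  note ca = carrier_matD[OF is_moduleD(1)[OF M a]] and cF = carrier_matD[OF is_moduleD(1)[OF M F]]
  fix t assume "t < dim_vec (act M a *\<^sub>v cover M F)"
  then have t: "t < vdim M" using ca by simp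
  have "cover M (\<lambda>s. a \<otimes>\<^bsub>A\<^esub> F s) $ t = (\<Sum>s<vdim M. \<Sum>u = 0..<vdim M. act M a $$ (t, u) * act M (F s) $$ (u, s))"
    using t ca cF is_moduleD(4)[OF M a F] by (simp add: cover_def scalar_prod_def)
  also have "\<dots> = (\<Sum>u = 0..<vdim M. \<Sum>s<vdim M. act M a $$ (t, u) * act M (F s) $$ (u, s))"
    by (rule sum.swap)
  also have "\<dots> = (act M a *\<^sub>v cover M F) $ t"
    using t ca by (simp add: cover_def scalar_prod_def sum_distrib_left)
  finally show "cover M (\<lambda>s. a \<otimes>\<^bsub>A\<^esub> F s) $ t = (act M a *\<^sub>v cover M F) $ t" .
qed (use carrier_matD[OF is_moduleD(1)[OF M a]] in \<open>simp add: cover_def\<close>)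

lemma cover_cong: "(\<And>s. s < vdim M \<Longrightarrow> F s = G s) \<Longrightarrow> cover M F = cover M G"
  by (simp add: cover_def)

text \<open>The linear section that sends \<open>v\<close> to
  \<open>\<Sum>s. v $ s \<otimes> e\<^sub>s\<close>. It need not be compatible with the action,
  which does no harm because only single vectors are lifted.\<close>

lemma cover_lift:
  assumes M: "is_module A M" and one: "\<one>\<^bsub>A\<^esub> \<in> carrier A" and v: "v \<in> carrier_vec (vdim M)"
  shows "cover M (\<lambda>s. (v $ s) \<odot>\<^bsub>A\<^esub> \<one>\<^bsub>A\<^esub>) = v"
proof (rule eq_vecI)
  fix t assume "t < dim_vec v"
  then have t: "t < vdim M" using v by simp
  have "act M ((v $ s) \<odot>\<^bsub>A\<^esub> \<one>\<^bsub>A\<^esub>) $$ (t, s) = (if s = t then v $ s else 0)" if "s < vdim M" for s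
    using t that unfolding is_moduleD(3)[OF M one] is_moduleD(5)[OF M one] by simp
  then have "cover M (\<lambda>s. (v $ s) \<odot>\<^bsub>A\<^esub> \<one>\<^bsub>A\<^esub>) $ t = (\<Sum>s<vdim M. if s = t then v $ s else 0)"
    using t by (simp add: cover_def)
  then show "cover M (\<lambda>s. (v $ s) \<odot>\<^bsub>A\<^esub> \<one>\<^bsub>A\<^esub>) $ t = v $ t" using t by simp
qed (use v in \<open>simp add: cover_def\<close>)

section \<open>Skew-gentle algebras and their normalization\<close>

locale skew_gentle_data =
  fixes m :: "nat list" and R :: "(nat \<times> nat) rel" and A H :: "('k :: field, nat \<Rightarrow> 'k bmat) module"
  assumes datum: "skew_gentle_datum m R" and A_eq: "A = skew_gentle m R" and H_eq: "H = normalization m R"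
begin

text \<open>Rows are nested triples that are mostly handled as a whole; the rule would break every
  quantifier over them into coordinates.\<close>

declare split_paired_All [simp del]

text \<open>The triple \<open>(i, (j, a))\<close> is place \<open>a\<close> of block
  \<open>j\<close> in factor \<open>i\<close>. In this way an element of \<open>H\<close> becomes a
  single block diagonal matrix, whose entries are given by \<open>entry\<close>.\<close>

definition rows :: "(nat \<times> nat \<times> nat) set" where
  "rows = Sigma {1..length m} (labels_at m R)"

definition entry :: "(nat \<Rightarrow> 'k bmat) \<Rightarrow> nat \<times> nat \<times> nat \<Rightarrow> nat \<times> nat \<times> nat \<Rightarrow> 'k" where
  "entry X p q = (if fst p = fst q then X (fst p) (snd p) (snd q) else 0)"

abbreviation level :: "nat \<times> nat \<times> nat \<Rightarrow> nat" where "level p \<equiv> fst (snd p)"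

abbreviation height :: "nat \<Rightarrow> nat" where "height i \<equiv> m ! (i - 1)"

lemma finite_labels_at: "finite (labels_at m R i)"
proof -
  have "labels_at m R i \<subseteq> {1..height i} \<times> {..<2}"
    by (auto simp: labels_at_def labels_def block_size_def split: if_splits)
  then show ?thesis by (rule finite_subset) simp
qed

lemma finite_rows: "finite rows"
  by (simp add: rows_def finite_labels_at)

lemma rows_iff: "(i, p) \<in> rows \<longleftrightarrow> 1 \<le> i \<and> i \<le> length m \<and> p \<in> labels_at m R i"
  by (auto simp: rows_def)

lemma H_ops:
  "X \<otimes>\<^bsub>H\<^esub> Y = (\<lambda>i p q. \<Sum>r\<in>labels_at m R i. X i p r * Y i r q)"
  "\<one>\<^bsub>H\<^esub> = (\<lambda>i p q. if (i, p) \<in> rows \<and> p = q then 1 else 0)"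
  "X \<oplus>\<^bsub>H\<^esub> Y = (\<lambda>i p q. X i p q + Y i p q)" "c \<odot>\<^bsub>H\<^esub> X = (\<lambda>i p q. c * X i p q)"
  by (auto simp: H_eq normalization_def rows_iff fun_eq_iff)

lemma A_ops:
  "X \<otimes>\<^bsub>A\<^esub> Y = X \<otimes>\<^bsub>H\<^esub> Y" "\<one>\<^bsub>A\<^esub> = \<one>\<^bsub>H\<^esub>" "X \<oplus>\<^bsub>A\<^esub> Y = X \<oplus>\<^bsub>H\<^esub> Y" "c \<odot>\<^bsub>A\<^esub> X = c \<odot>\<^bsub>H\<^esub> X"
  by (simp_all add: H_eq A_eq skew_gentle_def)

lemma carrier_H:
  "X \<in> carrier H \<longleftrightarrow> (\<forall>i p q. X i p q \<noteq> 0 \<longrightarrow> (i, p) \<in> rows \<and> (i, q) \<in> rows \<and> fst q \<le> fst p)"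
proof
  assume X: "X \<in> carrier H"
  show "\<forall>i p q. X i p q \<noteq> 0 \<longrightarrow> (i, p) \<in> rows \<and> (i, q) \<in> rows \<and> fst q \<le> fst p"
  proof (intro allI impI)
    fix i p q assume n: "X i p q \<noteq> 0"
    have "\<forall>i. if 1 \<le> i \<and> i \<le> length m then X i \<in> lower_block (height i) (Sig R i) else X i = (\<lambda>p q. 0)"
      using X unfolding H_eq normalization_def by simp
    then have *: "if 1 \<le> i \<and> i \<le> length m then X i \<in> lower_block (height i) (Sig R i) else X i = (\<lambda>p q. 0)"
      by (rule spec)
    then have i: "1 \<le> i \<and> i \<le> length m" using n by (auto split: if_splits)
    then have "X i \<in> lower_block (height i) (Sig R i)" using * by simp
    then show "(i, p) \<in> rows \<and> (i, q) \<in> rows \<and> fst q \<le> fst p"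
      using n i by (auto simp: lower_block_def rows_iff labels_at_def)
  qed
next
  assume X: "\<forall>i p q. X i p q \<noteq> 0 \<longrightarrow> (i, p) \<in> rows \<and> (i, q) \<in> rows \<and> fst q \<le> fst p"
  have "\<forall>i. if 1 \<le> i \<and> i \<le> length m then X i \<in> lower_block (height i) (Sig R i) else X i = (\<lambda>p q. 0)"
    using X by (auto simp: lower_block_def rows_iff labels_at_def fun_eq_iff)
  then show "X \<in> carrier H" unfolding H_eq normalization_def by simp
qed

definition glued :: "(nat \<Rightarrow> 'k bmat) \<Rightarrow> bool" where
  "glued X \<longleftrightarrow> (\<forall>i j k l. ((i, j), (k, l)) \<in> R \<and> (i, j) \<noteq> (k, l) \<longrightarrow>
       (\<forall>a b. X i (j, a) (j, b) = X k (l, a) (l, b))) \<and>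
     (\<forall>i j. ((i, j), (i, j)) \<in> R \<longrightarrow> (\<forall>a b. a \<noteq> b \<longrightarrow> X i (j, a) (j, b) = 0))"

lemma carrier_A: "X \<in> carrier A \<longleftrightarrow> X \<in> carrier H \<and> glued X"
  by (auto simp: A_eq H_eq skew_gentle_def glued_def)

lemma carrier_A_H: "X \<in> carrier A \<Longrightarrow> X \<in> carrier H"
  by (simp add: carrier_A)

text \<open>A position has at most one partner, so two distinct related positions are not related to
  themselves; both blocks therefore have size 1.\<close>

lemma glued_rows:
  assumes "((i, j), (k, l)) \<in> R" "(i, j) \<noteq> (k, l)"
  shows "(i, (j, a)) \<in> rows \<longleftrightarrow> (k, (l, a)) \<in> rows"
proof -
  have d: "R \<subseteq> positions m \<times> positions m" "Relation.sym R"
    "\<And>\<gamma> \<delta> \<delta>'. (\<gamma>, \<delta>) \<in> R \<Longrightarrow> (\<gamma>, \<delta>') \<in> R \<Longrightarrow> \<delta> = \<delta>'"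
    using datum by (auto simp: skew_gentle_datum_def)
  have "((k, l), (i, j)) \<in> R" using d(2) assms(1) by (meson symD)
  then have "((i, j), (i, j)) \<notin> R" "((k, l), (k, l)) \<notin> R" using d(3) assms by blast+
  moreover have "(i, j) \<in> positions m" "(k, l) \<in> positions m" using d(1) assms(1) by auto
  ultimately show ?thesis
    by (auto simp: rows_iff labels_at_def labels_def block_size_def Sig_def positions_def)
qed

lemma special_or_single:
  assumes "(i, (j, a)) \<in> rows" "(i, (j, b)) \<in> rows" "a \<noteq> b"
  shows "((i, j), (i, j)) \<in> R"
  using assms by (auto simp: rows_iff labels_at_def labels_def block_size_def Sig_def split: if_splits)

text \<open>For lower triangular matrices, a path from level \<open>j\<close> to level
  \<open>j\<close> stays at level \<open>j\<close>, which has at most the places 0 and 1. The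
  conditions that cut out \<open>A\<close> can thus be checked on diagonal blocks alone. If the
  block has size 1, the second term is zero.\<close>

lemma H_mult_diag:
  assumes X: "X \<in> carrier H" and Y: "Y \<in> carrier H"
  shows "(X \<otimes>\<^bsub>H\<^esub> Y) i (j, a) (j, b) = X i (j, a) (j, 0) * Y i (j, 0) (j, b) + X i (j, a) (j, 1) * Y i (j, 1) (j, b)"
proof -
  have nz: "r \<in> labels_at m R i \<and> r \<in> {(j, 0), (j, 1)}" if "X i (j, a) r * Y i r (j, b) \<noteq> 0" for r
  proof -
    have "(i, r) \<in> rows" "fst r = j"
      using that X[unfolded carrier_H, rule_format, of i "(j, a)" r] Y[unfolded carrier_H, rule_format, of i r "(j, b)"]
      by auto
    then show ?thesis by (cases r) (auto simp: rows_iff labels_at_def labels_def block_size_def split: if_splits)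
  qed
  have "(X \<otimes>\<^bsub>H\<^esub> Y) i (j, a) (j, b) = (\<Sum>r\<in>{(j, 0), (j, 1)}. X i (j, a) r * Y i r (j, b))"
    unfolding H_ops
  proof (rule sum.mono_neutral_cong)
    show "X i (j, a) r * Y i r (j, b) = 0" if "r \<in> labels_at m R i - {(j, 0), (j, 1)}" for r
      using nz[of r] that by blast
    show "X i (j, a) r * Y i r (j, b) = 0" if "r \<in> {(j, 0), (j, 1)} - labels_at m R i" for r
      using nz[of r] that by blast
  qed (simp_all add: finite_labels_at)
  then show ?thesis by simp
qed

lemma H_closed:
  "\<one>\<^bsub>H\<^esub> \<in> carrier H" "X \<in> carrier H \<Longrightarrow> c \<odot>\<^bsub>H\<^esub> X \<in> carrier H"
  "X \<in> carrier H \<Longrightarrow> Y \<in> carrier H \<Longrightarrow> X \<oplus>\<^bsub>H\<^esub> Y \<in> carrier H"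
  "X \<in> carrier H \<Longrightarrow> Y \<in> carrier H \<Longrightarrow> X \<otimes>\<^bsub>H\<^esub> Y \<in> carrier H"
proof -
  show "\<one>\<^bsub>H\<^esub> \<in> carrier H" by (auto simp: carrier_H H_ops split: if_splits)
  show "c \<odot>\<^bsub>H\<^esub> X \<in> carrier H" if "X \<in> carrier H" using that by (auto simp: carrier_H H_ops)
  show "X \<oplus>\<^bsub>H\<^esub> Y \<in> carrier H" if "X \<in> carrier H" "Y \<in> carrier H"
    using that unfolding carrier_H H_ops by (metis add.left_neutral)
  show "X \<otimes>\<^bsub>H\<^esub> Y \<in> carrier H" if X: "X \<in> carrier H" and Y: "Y \<in> carrier H"
    unfolding carrier_H
  proof (intro allI impI)
    fix i p q assume "(X \<otimes>\<^bsub>H\<^esub> Y) i p q \<noteq> 0"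
    then have "(\<Sum>r\<in>labels_at m R i. X i p r * Y i r q) \<noteq> 0" unfolding H_ops .
    then obtain r where "X i p r * Y i r q \<noteq> 0" by (rule sum.not_neutral_contains_not_neutral)
    then have "X i p r \<noteq> 0" "Y i r q \<noteq> 0" by auto
    then show "(i, p) \<in> rows \<and> (i, q) \<in> rows \<and> fst q \<le> fst p"
      using X Y unfolding carrier_H by (meson order_trans)
  qed
qed

lemma A_closed:
  "\<one>\<^bsub>A\<^esub> \<in> carrier A" "X \<in> carrier A \<Longrightarrow> c \<odot>\<^bsub>A\<^esub> X \<in> carrier A"
  "X \<in> carrier A \<Longrightarrow> Y \<in> carrier A \<Longrightarrow> X \<oplus>\<^bsub>A\<^esub> Y \<in> carrier A"
  "X \<in> carrier A \<Longrightarrow> Y \<in> carrier A \<Longrightarrow> X \<otimes>\<^bsub>A\<^esub> Y \<in> carrier A"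
proof -
  have "glued \<one>\<^bsub>H\<^esub>" unfolding glued_def H_ops using glued_rows by auto
  then show "\<one>\<^bsub>A\<^esub> \<in> carrier A" using H_closed(1) by (simp add: carrier_A A_ops)
  show "c \<odot>\<^bsub>A\<^esub> X \<in> carrier A" if "X \<in> carrier A"
    using that H_closed(2) by (simp add: carrier_A A_ops) (simp add: H_ops glued_def)
  show "X \<oplus>\<^bsub>A\<^esub> Y \<in> carrier A" if "X \<in> carrier A" "Y \<in> carrier A"
    using that H_closed(3) by (simp add: carrier_A A_ops) (simp add: H_ops glued_def)
  show "X \<otimes>\<^bsub>A\<^esub> Y \<in> carrier A" if "X \<in> carrier A" "Y \<in> carrier A"
  proof -
    have h: "X \<in> carrier H" "Y \<in> carrier H" "glued X" "glued Y" using that by (auto simp: carrier_A)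
    have "glued (X \<otimes>\<^bsub>H\<^esub> Y)"
      unfolding glued_def H_mult_diag[OF h(1,2)]
    proof (intro conjI allI impI)
      fix i j k l a b assume "((i, j), (k, l)) \<in> R \<and> (i, j) \<noteq> (k, l)"
      then show "X i (j, a) (j, 0) * Y i (j, 0) (j, b) + X i (j, a) (j, 1) * Y i (j, 1) (j, b)
          = X k (l, a) (l, 0) * Y k (l, 0) (l, b) + X k (l, a) (l, 1) * Y k (l, 1) (l, b)"
        using h(3,4) unfolding glued_def by metis
    next
      fix i j and a b :: nat assume r: "((i, j), (i, j)) \<in> R" and "a \<noteq> b"
      then have z: "X i (j, a) (j, c) * Y i (j, c) (j, b) = 0" for c
        using h(3,4) unfolding glued_def by (cases "a = c") auto
      show "X i (j, a) (j, 0) * Y i (j, 0) (j, b) + X i (j, a) (j, 1) * Y i (j, 1) (j, b) = 0"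
        unfolding z by simp
    qed
    then show ?thesis using H_closed(4)[OF h(1,2)] by (simp add: carrier_A A_ops)
  qed
qed

lemma sum_rows:
  assumes "1 \<le> i" "i \<le> length m"
  shows "(\<Sum>r\<in>rows. if i = fst r then f (snd r) else 0) = (\<Sum>s\<in>labels_at m R i. f s)"
proof -
  have "(\<Sum>r\<in>rows. if i = fst r then f (snd r) else 0)
      = (\<Sum>i'\<in>{1..length m}. \<Sum>s\<in>labels_at m R i'. if i = i' then f s else 0)"
    unfolding rows_def by (subst sum.Sigma) (auto simp: finite_labels_at split_beta)
  also have "\<dots> = (\<Sum>i'\<in>{1..length m}. if i' = i then \<Sum>s\<in>labels_at m R i'. f s else 0)"
    by (intro sum.cong) auto
  also have "\<dots> = (\<Sum>s\<in>labels_at m R i. f s)" using assms by simp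
  finally show ?thesis .
qed

lemma entry_mult:
  assumes "p \<in> rows"
  shows "entry (X \<otimes>\<^bsub>H\<^esub> Y) p q = (\<Sum>r\<in>rows. entry X p r * entry Y r q)"
proof -
  obtain i p' where p: "p = (i, p')" by (cases p)
  obtain k q' where q: "q = (k, q')" by (cases q)
  have i: "1 \<le> i" "i \<le> length m" using assms p by (auto simp: rows_iff)
  have "(\<Sum>r\<in>rows. entry X p r * entry Y r q)
      = (\<Sum>r\<in>rows. if i = fst r then X i p' (snd r) * (if i = k then Y i (snd r) q' else 0) else 0)"
    by (intro sum.cong) (auto simp: entry_def p q)
  also have "\<dots> = (\<Sum>s\<in>labels_at m R i. X i p' s * (if i = k then Y i s q' else 0))"
    by (rule sum_rows[OF i])
  also have "\<dots> = entry (X \<otimes>\<^bsub>H\<^esub> Y) p q" by (auto simp: entry_def p q H_ops)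
  finally show ?thesis by simp
qed

lemma tri_rep_sub:
  assumes B: "carrier B \<subseteq> carrier H" "\<one>\<^bsub>B\<^esub> = \<one>\<^bsub>H\<^esub>" "\<And>X Y. X \<oplus>\<^bsub>B\<^esub> Y = X \<oplus>\<^bsub>H\<^esub> Y"
      "\<And>X Y. X \<otimes>\<^bsub>B\<^esub> Y = X \<otimes>\<^bsub>H\<^esub> Y" "\<And>c X. c \<odot>\<^bsub>B\<^esub> X = c \<odot>\<^bsub>H\<^esub> X"
    and cl: "\<one>\<^bsub>B\<^esub> \<in> carrier B" "\<And>X c. X \<in> carrier B \<Longrightarrow> c \<odot>\<^bsub>B\<^esub> X \<in> carrier B"
      "\<And>X Y. X \<in> carrier B \<Longrightarrow> Y \<in> carrier B \<Longrightarrow> X \<oplus>\<^bsub>B\<^esub> Y \<in> carrier B"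
      "\<And>X Y. X \<in> carrier B \<Longrightarrow> Y \<in> carrier B \<Longrightarrow> X \<otimes>\<^bsub>B\<^esub> Y \<in> carrier B"
  shows "tri_rep B rows fst level height entry"
proof
  show "1 \<le> level p" "level p \<le> height (fst p)" if "p \<in> rows" for p
    using that by (auto simp: rows_def labels_at_def labels_def)
  show "entry \<one>\<^bsub>B\<^esub> p q = (if p = q then 1 else 0)" if "p \<in> rows" "q \<in> rows" for p q
    using that by (cases p; cases q) (auto simp: entry_def B(2) H_ops)
  show "entry (s \<odot>\<^bsub>B\<^esub> a) p q = s * entry a p q" for a s p q by (simp add: entry_def B(5) H_ops)
  show "entry (a \<oplus>\<^bsub>B\<^esub> b) p q = entry a p q + entry b p q" for a b p q by (simp add: entry_def B(3) H_ops)
  show "entry (a \<otimes>\<^bsub>B\<^esub> b) p q = (\<Sum>r\<in>rows. entry a p r * entry b r q)" if "p \<in> rows" for a b p q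
    unfolding B(4) by (rule entry_mult[OF that])
  show "fst q = fst p \<and> level q \<le> level p" if "a \<in> carrier B" "entry a p q \<noteq> 0" for a p q
    using that B(1) by (auto simp: entry_def carrier_H split: if_splits)
qed (use cl finite_rows in auto)

sublocale HR: tri_rep H rows fst level height entry
  by (rule tri_rep_sub) (use H_closed in auto)

text \<open>The matrix \<open>entry\<close> is the same over \<open>A\<close> as over
  \<open>H\<close>, so \<open>ract\<close>, \<open>Qs\<close>, \<open>ival\<close> and
  \<open>filt\<close> are literally the same objects for both; only the algebra that acts
  changes.\<close>

sublocale AR: tri_rep A rows fst level height entry
  by (rule tri_rep_sub) (use A_closed carrier_A_H A_ops in auto)

lemma is_module_restrict: "is_module H M \<Longrightarrow> is_module A M"
  unfolding is_module_def A_ops using carrier_A_H by auto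

lemma mod_hom_restrict: "f \<in> mod_hom H M N \<Longrightarrow> f \<in> mod_hom A M N"
  unfolding mod_hom_def using carrier_A_H by auto

lemma retract_of_restrict: "retract_of H M N \<Longrightarrow> retract_of A M N"
  unfolding retract_of_def using mod_hom_restrict by blast

lemma mod_real_restrict: "mod_real H \<rho> S U M \<kappa> \<Longrightarrow> mod_real A \<rho> S U M \<kappa>"
  unfolding mod_real_def using is_module_restrict carrier_A_H by blast

lemma retract_of_summand_A:
  "is_module A M \<Longrightarrow> is_module A Z \<Longrightarrow> retract_of A M Z \<Longrightarrow> summand_of (mod_cat A) M Z"
  by (rule retract_of_summand) (use A_closed in auto)

section \<open>Matrix units and interval modules\<close>

definition munit :: "nat \<Rightarrow> nat \<times> nat \<Rightarrow> nat \<times> nat \<Rightarrow> nat \<Rightarrow> 'k bmat" where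
  "munit i p q = (\<lambda>i' p' q'. if i' = i \<and> p' = p \<and> q' = q then 1 else 0)"

lemma munit_H: "(i, p) \<in> rows \<Longrightarrow> (i, q) \<in> rows \<Longrightarrow> fst q \<le> fst p \<Longrightarrow> munit i p q \<in> carrier H"
  by (auto simp: carrier_H munit_def)

text \<open>The gluing conditions concern diagonal blocks only, so every strictly lower matrix unit
  of \<open>H\<close> lies in \<open>A\<close>. This is the form in which the equality of the
  radicals is used.\<close>

lemma munit_A: "(i, p) \<in> rows \<Longrightarrow> (i, q) \<in> rows \<Longrightarrow> fst q < fst p \<Longrightarrow> munit i p q \<in> carrier A"
  by (auto simp: carrier_A munit_H) (auto simp: glued_def munit_def)

lemma row_munit:
  assumes "(i, p) \<in> rows" "(i, q) \<in> rows"
  shows "row (HR.ract (munit i p q) g) r = (if r = (i, p) then row g (i, q) else 0)"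
proof -
  have "(\<Sum>s\<in>rows. fscale (entry (munit i p q) r s) (row g s)) = (\<Sum>s\<in>rows. if s = (i, q) then if r = (i, p) then row g s else 0 else 0)"
    by (intro sum.cong) (auto simp: entry_def munit_def fun_eq_iff prod_eq_iff)
  then show ?thesis using assms finite_rows by (auto simp: HR.row_ract)
qed

definition dirac :: "nat \<times> nat \<times> nat \<Rightarrow> (nat \<times> nat \<times> nat) \<times> unit \<Rightarrow> 'k" where
  "dirac p = (\<lambda>(q, _). if q = p then 1 else 0)"

lemma row_dirac: "row (dirac p) q = (if q = p then (\<lambda>_. 1) else 0)"
  by (auto simp: row_def dirac_def fun_eq_iff)

lemma ival_iff:
  "g \<in> HR.ival i l \<longleftrightarrow> (\<forall>p. g (p, ()) \<noteq> 0 \<longrightarrow> p \<in> rows \<and> fst p = i \<and> l \<le> level p)"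
proof -
  have z: "row g p = 0 \<longleftrightarrow> g (p, ()) = 0" for p by (auto simp: row_def fun_eq_iff)
  show ?thesis
  proof
    assume g: "g \<in> HR.ival i l"
    show "\<forall>p. g (p, ()) \<noteq> 0 \<longrightarrow> p \<in> rows \<and> fst p = i \<and> l \<le> level p"
    proof (intro allI impI)
      fix p assume "g (p, ()) \<noteq> 0"
      then show "p \<in> rows \<and> fst p = i \<and> l \<le> level p"
        using HR.QsD[OF g[unfolded HR.ival_def], of p] z[of p] by (cases "p \<in> rows") (auto split: if_splits)
    qed
  next
    assume g: "\<forall>p. g (p, ()) \<noteq> 0 \<longrightarrow> p \<in> rows \<and> fst p = i \<and> l \<le> level p"
    show "g \<in> HR.ival i l"
      unfolding HR.ival_def
    proof (rule HR.QsI)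
      fix p
      show "row g p \<in> (if fst p = i \<and> l \<le> level p then UNIV else {0})"
        using g[rule_format, of p] z[of p] by (cases "g (p, ()) = 0") auto
      show "row g p = 0" if "p \<notin> rows" using g[rule_format, of p] z[of p] that by blast
    qed
  qed
qed

lemma dirac_ival: "dirac p \<in> HR.ival i l \<longleftrightarrow> p \<in> rows \<and> fst p = i \<and> l \<le> level p"
  by (simp add: ival_iff dirac_def)

lemma ival_span: "HR.ival i l \<subseteq> fvs.span (dirac ` {p \<in> rows. fst p = i \<and> l \<le> level p})"
proof
  fix g assume g: "g \<in> HR.ival i l"
  let ?P = "{p \<in> rows. fst p = i \<and> l \<le> level p}"
  have "g = (\<Sum>p\<in>?P. fscale (g (p, ())) (dirac p))"
  proof (rule ext, clarify)
    fix q and u :: unit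
    have "(\<Sum>p\<in>?P. fscale (g (p, ())) (dirac p)) (q, u) = (\<Sum>p\<in>?P. if p = q then g (p, ()) else 0)"
      unfolding sum_fun_apply by (intro sum.cong) (auto simp: dirac_def)
    then show "g (q, ()) = (\<Sum>p\<in>?P. fscale (g (p, ())) (dirac p)) (q, ())"
      using g finite_rows by (auto simp: ival_iff)
  qed
  moreover have "(\<Sum>p\<in>?P. fscale (g (p, ())) (dirac p)) \<in> fvs.span (dirac ` ?P)"
    by (intro fvs.span_sum fvs.span_scale fvs.span_base) auto
  ultimately show "g \<in> fvs.span (dirac ` ?P)" by metis
qed

text \<open>An interval module is generated by a vector on which a matrix unit acts as the projection,
  so its endomorphisms are scalars.\<close>

lemma ival_brick:
  assumes i: "1 \<le> i" "i \<le> length m" and l: "1 \<le> l" "l \<le> height i" "l < j"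
    and r: "mod_real H HR.ract (HR.ival i l) (HR.ival i j) N \<kappa>"
  shows "vdim N \<noteq> 0" and "f \<in> mod_hom H N N \<Longrightarrow> \<exists>c. f = c \<cdot>\<^sub>m 1\<^sub>m (vdim N)"
proof -
  \<comment> \<open>A row at the lowest level of the interval. Its basis function generates the
    interval, and \<open>l < j\<close> keeps it nonzero in the quotient.\<close>
  define p where "p = (l, 0 :: nat)"
  have pr: "(i, p) \<in> rows" using i l by (auto simp: rows_iff labels_at_def labels_def p_def block_size_def)
  have pS: "dirac (i, p) \<in> HR.ival i l" and pU: "dirac (i, p) \<notin> HR.ival i j"
    using pr l by (auto simp: dirac_ival p_def)
  note c = mod_realD(2)[OF r] and N = mod_realD(1)[OF r]
  have \<kappa>c: "\<kappa> g \<in> carrier_vec (vdim N)" if "g \<in> HR.ival i l" for g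
    using lin_vecD(1)[OF coordsD(4)[OF c] that] .
  show "vdim N \<noteq> 0"
  proof
    assume z: "vdim N = 0"
    then have "\<kappa> (dirac (i, p)) = 0\<^sub>v (vdim N)" using \<kappa>c[OF pS] by (intro eq_vecI) auto
    then show False using coordsD(6)[OF c pS] pU by blast
  qed
  assume f: "f \<in> mod_hom H N N"
  have fc: "f \<in> carrier_mat (vdim N) (vdim N)" using f by (rule mod_hom_carrier)
  have fv: "f *\<^sub>v x \<in> carrier_vec (vdim N)" if "x \<in> carrier_vec (vdim N)" for x using fc that by simp
  have fE: "f *\<^sub>v \<kappa> (HR.ract a g) = act N a *\<^sub>v (f *\<^sub>v \<kappa> g)" if "a \<in> carrier H" "g \<in> HR.ival i l" for a g
    using mod_realD(4)[OF r that] mod_hom_vec[OF f N N that(1) \<kappa>c[OF that(2)]] by simp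
  have Ed: "HR.ract (munit i q p) (dirac (i, p)) = dirac (i, q)" if "(i, q) \<in> rows" for q
    by (rule row_eqI) (simp add: row_munit[OF that pr] row_dirac)
  obtain g where g: "g \<in> HR.ival i l" "\<kappa> g = f *\<^sub>v \<kappa> (dirac (i, p))"
    using coordsD(5)[OF c fv[OF \<kappa>c[OF pS]]] by blast
  define s where "s = g ((i, p), ())"
  have Eg: "HR.ract (munit i p p) g = fscale s (dirac (i, p))"
  proof (rule row_eqI)
    show "row (HR.ract (munit i p p) g) q = row (fscale s (dirac (i, p))) q" for q
      unfolding row_munit[OF pr pr] row_simps row_dirac by (auto simp: s_def row_def fun_eq_iff)
  qed
  have pp: "munit i p p \<in> carrier H" using munit_H[OF pr pr] by simp
  \<comment> \<open>The projection \<open>munit i p p\<close> fixes the generator, so it also fixes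
    the image of the generator under \<open>f\<close>, which is therefore a multiple of it.\<close>
  have f0: "f *\<^sub>v \<kappa> (dirac (i, p)) = s \<cdot>\<^sub>v \<kappa> (dirac (i, p))"
  proof -
    have "f *\<^sub>v \<kappa> (dirac (i, p)) = act N (munit i p p) *\<^sub>v \<kappa> g"
      using fE[OF pp pS] Ed[OF pr] g(2) by simp
    also have "\<dots> = \<kappa> (fscale s (dirac (i, p)))" using mod_realD(4)[OF r pp g(1)] Eg by simp
    also have "\<dots> = s \<cdot>\<^sub>v \<kappa> (dirac (i, p))" by (rule lin_vecD(3)[OF coordsD(4)[OF c] pS])
    finally show ?thesis .
  qed
  \<comment> \<open>The functions on whose classes \<open>f\<close> acts as \<open>s\<close> form a
    subspace. It contains every basis function, since these arise from the generator by matrix units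
    of \<open>H\<close>.\<close>
  define T where "T = {g \<in> HR.ival i l. f *\<^sub>v \<kappa> g = s \<cdot>\<^sub>v \<kappa> g}"
  note S = coordsD(1)[OF c] and lk = coordsD(4)[OF c]
  have "fvs.subspace T"
    unfolding fvs.subspace_def
  proof (intro conjI ballI allI)
    show "0 \<in> T"
      unfolding T_def mem_Collect_eq lin_vec_zero[OF lk S] mult_mat_vec_zero[OF fc]
      using fvs.subspace_0[OF S] by auto
    fix g h assume g: "g \<in> T" and h: "h \<in> T"
    have gS: "g \<in> HR.ival i l" and hS: "h \<in> HR.ival i l" using g h by (auto simp: T_def)
    have "f *\<^sub>v \<kappa> (g + h) = s \<cdot>\<^sub>v \<kappa> (g + h)"
      unfolding lin_vecD(2)[OF lk gS hS] mult_add_distrib_mat_vec[OF fc \<kappa>c[OF gS] \<kappa>c[OF hS]]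
        smult_add_distrib_vec[OF \<kappa>c[OF gS] \<kappa>c[OF hS]] using g h by (simp add: T_def)
    then show "g + h \<in> T" using fvs.subspace_add[OF S gS hS] unfolding T_def by blast
  next
    fix b g assume g: "g \<in> T"
    have gS: "g \<in> HR.ival i l" using g by (auto simp: T_def)
    have "f *\<^sub>v \<kappa> (fscale b g) = s \<cdot>\<^sub>v \<kappa> (fscale b g)"
      unfolding lin_vecD(3)[OF lk gS] mult_mat_vec[OF fc \<kappa>c[OF gS]]
      using g by (simp add: T_def smult_smult_assoc mult.commute)
    then show "fscale b g \<in> T" using fvs.subspace_scale[OF S gS] unfolding T_def by blast
  qed
  moreover have "dirac ` {q \<in> rows. fst q = i \<and> l \<le> level q} \<subseteq> T"
  proof (intro image_subsetI)
    fix q assume "q \<in> {q \<in> rows. fst q = i \<and> l \<le> level q}"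
    then obtain q' where q: "q = (i, q')" "(i, q') \<in> rows" "l \<le> fst q'" by (cases q) auto
    have E: "munit i q' p \<in> carrier H" using munit_H[OF q(2) pr] q(3) by (simp add: p_def)
    have "f *\<^sub>v \<kappa> (dirac q) = act N (munit i q' p) *\<^sub>v (s \<cdot>\<^sub>v \<kappa> (dirac (i, p)))"
      using fE[OF E pS] Ed[OF q(2)] f0 q(1) by simp
    also have "\<dots> = s \<cdot>\<^sub>v \<kappa> (dirac q)"
      unfolding mult_mat_vec[OF is_moduleD(1)[OF N E] \<kappa>c[OF pS]]
      using mod_realD(4)[OF r E pS] Ed[OF q(2)] q(1) by simp
    finally show "dirac q \<in> T" using q by (simp add: T_def dirac_ival)
  qed
  ultimately have "HR.ival i l \<subseteq> T" using ival_span fvs.span_minimal by blast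
  then have eq: "f *\<^sub>v \<kappa> g = s \<cdot>\<^sub>v \<kappa> g" if "g \<in> HR.ival i l" for g using that by (auto simp: T_def)
  have "f = s \<cdot>\<^sub>m 1\<^sub>m (vdim N)"
  proof (rule mat_eqI_coords[OF c fc])
    show "f *\<^sub>v \<kappa> g = (s \<cdot>\<^sub>m 1\<^sub>m (vdim N)) *\<^sub>v \<kappa> g" if "g \<in> HR.ival i l" for g
      using eq[OF that] \<kappa>c[OF that] by (auto intro!: eq_vecI)
  qed simp
  then show "\<exists>c. f = c \<cdot>\<^sub>m 1\<^sub>m (vdim N)" by blast
qed

end

lemma finite_support_span:
  fixes I :: "'x set"
  assumes "finite I"
  shows "{f :: 'x \<Rightarrow> 'k :: field. \<forall>x. x \<notin> I \<longrightarrow> f x = 0} \<subseteq> fvs.span ((\<lambda>x y. if y = x then 1 else 0) ` I)"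
proof
  fix f :: "'x \<Rightarrow> 'k" assume f: "f \<in> {f. \<forall>x. x \<notin> I \<longrightarrow> f x = 0}"
  let ?\<delta> = "\<lambda>x y. if y = x then 1 else 0 :: 'k"
  have "f = (\<Sum>x\<in>I. fscale (f x) (?\<delta> x))"
  proof
    fix y
    have "(\<Sum>x\<in>I. fscale (f x) (?\<delta> x)) y = (\<Sum>x\<in>I. if x = y then f x else 0)"
      unfolding sum_fun_apply by (intro sum.cong) auto
    then show "f y = (\<Sum>x\<in>I. fscale (f x) (?\<delta> x)) y" using f assms by auto
  qed
  moreover have "(\<Sum>x\<in>I. fscale (f x) (?\<delta> x)) \<in> fvs.span (?\<delta> ` I)"
    by (intro fvs.span_sum fvs.span_scale fvs.span_base) auto
  ultimately show "f \<in> fvs.span (?\<delta> ` I)" by metis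
qed

context skew_gentle_data
begin

section \<open>Resolution by submodules of modules over the normalization\<close>

text \<open>A pair \<open>(P, Q)\<close> in the free covers of \<open>X\<^sup>n\<^sup>+\<^sup>1\<close> and \<open>X\<^sup>n\<close> is encoded as a function of a row of \<open>H\<close>
  and an index \<open>(b, s, q)\<close>: the flag \<open>b\<close> is \<open>False\<close> for \<open>P\<close> and \<open>True\<close> for \<open>Q\<close>, \<open>s\<close> is the number
  of the basis vector, and \<open>q\<close> the column.\<close>

type_synonym idx = "bool \<times> nat \<times> nat \<times> nat"

definition el :: "((nat \<times> nat \<times> nat) \<times> idx \<Rightarrow> 'k) \<Rightarrow> bool \<Rightarrow> nat \<Rightarrow> nat \<Rightarrow> 'k bmat" where
  "el g b s = (\<lambda>i p q. g ((i, p), (b, s, q)))"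

definition mkel :: "(nat \<Rightarrow> nat \<Rightarrow> 'k bmat) \<Rightarrow> (nat \<Rightarrow> nat \<Rightarrow> 'k bmat) \<Rightarrow> (nat \<times> nat \<times> nat) \<times> idx \<Rightarrow> 'k" where
  "mkel P Q = (\<lambda>((i, p), (b, s, q)). if b then Q s i p q else P s i p q)"

definition dW :: "(idx \<Rightarrow> 'k) \<Rightarrow> idx \<Rightarrow> 'k" where
  "dW w = (\<lambda>(b, s, q). if b then w (False, s, q) else 0)"

abbreviation dd :: "((nat \<times> nat \<times> nat) \<times> idx \<Rightarrow> 'k) \<Rightarrow> (nat \<times> nat \<times> nat) \<times> idx \<Rightarrow> 'k" where
  "dd \<equiv> HR.rowop (\<lambda>_. dW)"

text \<open>The conditions say \<open>cover P = d (cover Q)\<close>; the differential is \<open>(P, Q) \<mapsto> (0, P)\<close>.\<close>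

definition resol :: "(nat \<Rightarrow> 'k bmat, 'k) cpx \<Rightarrow> int \<Rightarrow> ((nat \<times> nat \<times> nat) \<times> idx \<Rightarrow> 'k) set" where
  "resol X n = {g. (\<forall>b s. el g b s \<in> carrier A) \<and> (\<forall>s. cdim X (n + 1) \<le> s \<longrightarrow> el g False s = 0) \<and>
     (\<forall>s. cdim X n \<le> s \<longrightarrow> el g True s = 0) \<and>
     cover (cterm X (n + 1)) (el g False) = cdiff X n *\<^sub>v cover (cterm X n) (el g True)}"

lemma el_mkel [simp]: "el (mkel P Q) False = P" "el (mkel P Q) True = Q"
  by (auto simp: el_def mkel_def fun_eq_iff)

lemma el_eqI: "(\<And>b s. el g b s = el h b s) \<Longrightarrow> g = h"
  by (auto simp: el_def fun_eq_iff)

lemma el_add: "el (g + h) b s = el g b s \<oplus>\<^bsub>A\<^esub> el h b s"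
  by (simp add: el_def A_ops H_ops)

lemma el_fscale: "el (fscale c g) b s = c \<odot>\<^bsub>A\<^esub> el g b s"
  by (simp add: el_def A_ops H_ops)

lemma el_zero: "el 0 b s = 0"
  by (simp add: el_def fun_eq_iff)

lemma el_diff: "el (g - h) b s = el g b s - el h b s"
  by (simp add: el_def fun_eq_iff)

lemma zero_A: "0 \<in> carrier A"
  by (simp add: carrier_A carrier_H glued_def)

lemma A_ops_zero: "0 \<oplus>\<^bsub>A\<^esub> 0 = 0" "c \<odot>\<^bsub>A\<^esub> 0 = 0" "a \<otimes>\<^bsub>A\<^esub> 0 = 0" "0 \<odot>\<^bsub>A\<^esub> a = 0"
  by (simp_all add: A_ops H_ops fun_eq_iff)

lemma el_ract:
  assumes "a \<in> carrier A"
  shows "el (HR.ract a g) b s = a \<otimes>\<^bsub>A\<^esub> el g b s"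
proof (intro ext)
  fix i p q
  have a: "a i p r = 0" if "(i, p) \<notin> rows" for r
    using assms that by (auto simp: carrier_A carrier_H)
  have "(\<Sum>r\<in>rows. entry a (i, p) r * g (r, (b, s, q)))
      = (\<Sum>r\<in>rows. if i = fst r then a i p (snd r) * g ((i, snd r), (b, s, q)) else 0)"
    by (intro sum.cong) (auto simp: entry_def)
  also have "\<dots> = (\<Sum>r\<in>labels_at m R i. a i p r * g ((i, r), (b, s, q)))" if "(i, p) \<in> rows"
    using that by (intro sum_rows) (auto simp: rows_iff)
  finally show "el (HR.ract a g) b s i p q = (a \<otimes>\<^bsub>A\<^esub> el g b s) i p q"
    using a by (auto simp: el_def HR.ract_def A_ops H_ops)
qed

lemma el_row_support:
  assumes "\<And>b s. el g b s \<in> carrier A" "p \<notin> rows"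
  shows "row g p = 0"
proof
  fix x :: idx
  obtain b s q where x: "x = (b, s, q)" by (cases x)
  have "el g b s \<in> carrier H" using assms(1) carrier_A_H by blast
  then have "el g b s (fst p) (snd p) q = 0" using assms(2) unfolding carrier_H by (metis prod.collapse)
  then show "row g p x = 0 x" by (simp add: row_def el_def x)
qed

text \<open>\<open>rowop\<close> truncates to the index set of rows; elements of \<open>A\<close>
  have no entries outside it, so nothing is lost.\<close>

lemma el_dd:
  assumes "\<And>b s. el g b s \<in> carrier A"
  shows "el (dd g) True s = el g False s" "el (dd g) False s = 0"
proof -
  have "g ((i, p), (b, s, q)) = 0" if "(i, p) \<notin> rows" for i p q and b :: bool and s :: nat
    using el_row_support[of g "(i, p)"] assms that by (auto simp: row_def fun_eq_iff)
  then show "el (dd g) True s = el g False s" "el (dd g) False s = 0"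
    by (auto simp: el_def HR.rowop_def dW_def row_def fun_eq_iff)
qed

lemma lin_dW: "lin dW"
  by (auto simp: lin_def dW_def fun_eq_iff)

lemma dW_dW: "dW (dW w) = 0"
  by (auto simp: dW_def fun_eq_iff)

lemma resolD:
  assumes "g \<in> resol X n"
  shows "el g b s \<in> carrier A" "cdim X (n + 1) \<le> s \<Longrightarrow> el g False s = 0" "cdim X n \<le> s \<Longrightarrow> el g True s = 0"
    "cover (cterm X (n + 1)) (el g False) = cdiff X n *\<^sub>v cover (cterm X n) (el g True)"
    "p \<notin> rows \<Longrightarrow> row g p = 0"
  using assms el_row_support by (auto simp: resol_def)

lemma resolI:
  assumes "\<And>b s. el g b s \<in> carrier A" "\<And>s. cdim X (n + 1) \<le> s \<Longrightarrow> el g False s = 0"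
    "\<And>s. cdim X n \<le> s \<Longrightarrow> el g True s = 0"
    "cover (cterm X (n + 1)) (el g False) = cdiff X n *\<^sub>v cover (cterm X n) (el g True)"
  shows "g \<in> resol X n"
  using assms by (simp add: resol_def)

lemma cover_zero:
  assumes M: "is_module A M"
  shows "cover M (\<lambda>s. 0) = 0\<^sub>v (vdim M)"
proof -
  have "cover M (\<lambda>s. 0 \<odot>\<^bsub>A\<^esub> 0) = 0 \<cdot>\<^sub>v cover M (\<lambda>s. 0)" by (rule cover_smult[OF M zero_A])
  then have "cover M (\<lambda>s. 0) = 0 \<cdot>\<^sub>v cover M (\<lambda>s. 0)" by (simp only: A_ops_zero)
  also have "\<dots> = 0\<^sub>v (vdim M)" by (intro eq_vecI) (simp_all add: cover_def)
  finally show ?thesis .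
qed

context
  fixes X :: "(nat \<Rightarrow> 'k bmat, 'k) cpx"
  assumes X: "bounded_cpx A X"
begin

lemma subspace_resol: "fvs.subspace (resol X n)"
  unfolding fvs.subspace_def
proof (intro conjI ballI allI)
  note m = cterm_module[OF X]
  show "0 \<in> resol X n"
  proof (rule resolI)
    have "el 0 b = (\<lambda>s. 0)" for b by (rule ext) (rule el_zero)
    then show "cover (cterm X (n + 1)) (el 0 False) = cdiff X n *\<^sub>v cover (cterm X n) (el 0 True)"
      by (simp only: cover_zero[OF m] mult_mat_vec_zero[OF cdiff_carrier[OF X]])
  qed (simp_all only: el_zero zero_A)
  fix g h assume g: "g \<in> resol X n" and h: "h \<in> resol X n"
  have cc: "cover (cterm X k) (el (g + h) b) = cover (cterm X k) (el g b) + cover (cterm X k) (el h b)" for k b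
  proof -
    have "el (g + h) b = (\<lambda>s. el g b s \<oplus>\<^bsub>A\<^esub> el h b s)" by (rule ext) (rule el_add)
    then show ?thesis using cover_add[OF m, of "el g b" "el h b"] resolD(1)[OF g] resolD(1)[OF h] by simp
  qed
  show "g + h \<in> resol X n"
  proof (rule resolI)
    show "cover (cterm X (n + 1)) (el (g + h) False) = cdiff X n *\<^sub>v cover (cterm X n) (el (g + h) True)"
      unfolding cc resolD(4)[OF g] resolD(4)[OF h]
      by (rule mult_add_distrib_mat_vec[symmetric, OF cdiff_carrier[OF X] cover_carrier cover_carrier])
  qed (use resolD(1-3)[OF g] resolD(1-3)[OF h] in \<open>simp_all add: el_add A_closed A_ops_zero\<close>)
next
  note m = cterm_module[OF X]
  fix c g assume g: "g \<in> resol X n"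
  have cc: "cover (cterm X k) (el (fscale c g) b) = c \<cdot>\<^sub>v cover (cterm X k) (el g b)" for k b
  proof -
    have "el (fscale c g) b = (\<lambda>s. c \<odot>\<^bsub>A\<^esub> el g b s)" by (rule ext) (rule el_fscale)
    then show ?thesis using cover_smult[OF m, of "el g b"] resolD(1)[OF g] by simp
  qed
  show "fscale c g \<in> resol X n"
  proof (rule resolI)
    show "cover (cterm X (n + 1)) (el (fscale c g) False) = cdiff X n *\<^sub>v cover (cterm X n) (el (fscale c g) True)"
      unfolding cc resolD(4)[OF g]
      by (rule mult_mat_vec[symmetric, OF cdiff_carrier[OF X] cover_carrier])
  qed (use resolD(1-3)[OF g] in \<open>simp_all add: el_fscale A_closed A_ops_zero\<close>)
qed

lemma cover_ract:
  assumes a: "a \<in> carrier A" and g: "\<And>b s. el g b s \<in> carrier A"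
  shows "cover (cterm X k) (el (HR.ract a g) b) = act (cterm X k) a *\<^sub>v cover (cterm X k) (el g b)"
proof -
  have "el (HR.ract a g) b = (\<lambda>s. a \<otimes>\<^bsub>A\<^esub> el g b s)" by (rule ext) (rule el_ract[OF a])
  then show ?thesis using cover_mult[OF cterm_module[OF X], of "el g b" a] g a by simp
qed

lemma resol_ract:
  assumes a: "a \<in> carrier A" and g: "g \<in> resol X n"
  shows "HR.ract a g \<in> resol X n"
proof (rule resolI)
  have "cdiff X n \<in> mod_hom A (cterm X n) (cterm X (n + 1))" using X by (simp add: bounded_cpx_def)
  from mod_hom_vec[OF this cterm_module[OF X] cterm_module[OF X] a cover_carrier]
  show "cover (cterm X (n + 1)) (el (HR.ract a g) False) = cdiff X n *\<^sub>v cover (cterm X n) (el (HR.ract a g) True)"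
    unfolding cover_ract[OF a resolD(1)[OF g]] resolD(4)[OF g] by simp
qed (use resolD(1-3)[OF g] a in \<open>simp_all add: el_ract A_closed A_ops_zero\<close>)

lemma resol_dd:
  assumes g: "g \<in> resol X n"
  shows "dd g \<in> resol X (n + 1)"
proof (rule resolI)
  note e = el_dd[OF resolD(1)[OF g]]
  have t: "el (dd g) True = el g False" "el (dd g) False = (\<lambda>s. 0)" using e by auto
  show "el (dd g) b s \<in> carrier A" for b s
    using e resolD(1)[OF g] zero_A by (cases b) simp_all
  show "cover (cterm X (n + 1 + 1)) (el (dd g) False) = cdiff X (n + 1) *\<^sub>v cover (cterm X (n + 1)) (el (dd g) True)"
    unfolding t resolD(4)[OF g] cover_zero[OF cterm_module[OF X]] cdiff_cdiff[OF X cover_carrier]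
    by (simp add: add.assoc)
  show "el (dd g) True s = 0" if "cdim X (n + 1) \<le> s" for s using e(1) resolD(2)[OF g that] by simp
  show "el (dd g) False s = 0" for s by (rule e(2))
qed

lemma dd_dd: "dd (dd g) = 0"
  by (rule row_eqI) (simp add: HR.row_rowop dW_dW linD(3)[OF lin_dW])

lemma resol_support:
  assumes g: "g \<in> resol X n" and nz: "g (p, (b, s, q)) \<noteq> 0"
  shows "p \<in> rows \<and> s < max (cdim X n) (cdim X (n + 1)) \<and> q \<in> snd ` rows"
proof -
  have e: "el g b s (fst p) (snd p) q \<noteq> 0" using nz by (simp add: el_def)
  have "el g b s \<in> carrier H" using resolD(1)[OF g] carrier_A_H by blast
  then have "(fst p, snd p) \<in> rows" "(fst p, q) \<in> rows" using e unfolding carrier_H by blast+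
  moreover have "s < max (cdim X n) (cdim X (n + 1))"
  proof (rule ccontr)
    assume "\<not> s < max (cdim X n) (cdim X (n + 1))"
    then have "el g b s = 0" using resolD(2,3)[OF g, of s] by (cases b) auto
    then show False using e by simp
  qed
  ultimately show ?thesis by force
qed

lemma resol_bounded: "\<exists>c. \<forall>n. c < \<bar>n\<bar> \<longrightarrow> cdim X n = 0 \<and> cdim X (n + 1) = 0"
proof -
  obtain b where "\<forall>n. \<bar>n\<bar> > b \<longrightarrow> cdim X n = 0" using X by (auto simp: bounded_cpx_def)
  then show ?thesis by (intro exI[of _ "b + 1"]) auto
qed

lemma resol_trivial:
  assumes "cdim X n = 0" "cdim X (n + 1) = 0"
  shows "resol X n = {0}"
proof
  show "resol X n \<subseteq> {0}"
  proof
    fix g assume "g \<in> resol X n"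
    then have "g (p, (b, s, q)) = 0" for p b s q using resol_support[of g n p b s q] assms by auto
    then show "g \<in> {0}" by (auto simp: fun_eq_iff)
  qed
qed (use fvs.subspace_0[OF subspace_resol] in blast)

text \<open>One bound for all degrees, because a filtered complex needs a single finite spanning set
  for all its spaces.\<close>

definition width :: nat where
  "width = (SOME w. \<forall>n. cdim X n \<le> w)"

lemma cdim_le_width: "cdim X n \<le> width"
proof -
  obtain b where b: "\<forall>n. \<bar>n\<bar> > b \<longrightarrow> cdim X n = 0" using X by (auto simp: bounded_cpx_def)
  have "cdim X n \<le> Max (insert 0 (cdim X ` {-b..b}))" for n
  proof (cases "n \<in> {-b..b}")
    case False
    then have "cdim X n = 0" using b by (cases "0 \<le> n") auto
    then show ?thesis by simp
  next
    case True
    then show ?thesis by (intro Max_ge) auto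
  qed
  then have "\<exists>w. \<forall>n. cdim X n \<le> w" by blast
  then have "\<forall>n. cdim X n \<le> width" unfolding width_def by (rule someI_ex)
  then show ?thesis ..
qed

definition idxs :: "idx set" where
  "idxs = UNIV \<times> {..<width} \<times> (snd ` rows)"

definition idx_basis :: "(idx \<Rightarrow> 'k) set" where
  "idx_basis = (\<lambda>x y. if y = x then 1 else 0) ` idxs"

lemma finite_idxs: "finite idxs"
  by (auto simp: idxs_def finite_rows intro!: finite_cartesian_product)

lemma finite_idx_basis: "finite idx_basis"
  by (simp add: idx_basis_def finite_idxs)

lemma row_resol_span:
  assumes "g \<in> resol X n"
  shows "row g p \<in> fvs.span idx_basis"
proof -
  have "row g p x = 0" if "x \<notin> idxs" for x
  proof (rule ccontr)
    obtain b s q where x: "x = (b, s, q)" by (cases x)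
    assume "row g p x \<noteq> 0"
    then have "s < width" "q \<in> snd ` rows"
      using resol_support[OF assms, of p b s q] cdim_le_width[of n] cdim_le_width[of "n + 1"] by (auto simp: row_def x)
    then show False using that by (auto simp: idxs_def x)
  qed
  then show ?thesis
    unfolding idx_basis_def using subsetD[OF finite_support_span[OF finite_idxs], of "row g p"] by simp
qed

lemma resol_span: "resol X n \<subseteq> fvs.span ((\<lambda>x y. if y = x then 1 else 0) ` (rows \<times> idxs))"
proof -
  have "resol X n \<subseteq> {f. \<forall>x. x \<notin> rows \<times> idxs \<longrightarrow> f x = 0}"
  proof (intro subsetI CollectI allI impI)
    fix g y assume g: "g \<in> resol X n" and y: "y \<notin> rows \<times> idxs"
    obtain p x where "y = (p, x)" by (cases y)
    moreover obtain b s q where "x = (b, s, q)" by (cases x)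
    ultimately have e: "y = (p, b, s, q)" by simp
    have n: "(p, b, s, q) \<notin> rows \<times> idxs" using y e by simp
    show "g y = 0"
      unfolding e
    proof (rule ccontr)
      assume "g (p, b, s, q) \<noteq> 0"
      from resol_support[OF g this] show False
        using n cdim_le_width[of n] cdim_le_width[of "n + 1"] by (auto simp: idxs_def)
    qed
  qed
  moreover have fin: "finite (rows \<times> idxs)" by (simp add: finite_rows finite_idxs)
  ultimately show ?thesis by (rule order_trans[OF _ finite_support_span])
qed

lemma resol_finite_span: "\<exists>F. finite F \<and> (\<forall>n. resol X n \<subseteq> fvs.span F)"
proof (intro exI conjI allI)
  show "resol X n \<subseteq> fvs.span ((\<lambda>x y. if y = x then 1 else 0) ` (rows \<times> idxs))" for n by (rule resol_span)
  show "finite ((\<lambda>x y. if y = x then 1 else 0 :: 'k) ` (rows \<times> idxs))"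
    by (simp add: finite_rows finite_idxs)
qed

lemma resol_finite_span_at: "\<exists>F. finite F \<and> resol X n \<subseteq> fvs.span F"
  using resol_finite_span by meson

lemma lin_action_resol: "lin_action A HR.ract (resol X n)"
  by (rule AR.lin_action_ract[OF resol_ract resolD(5)])

lemma subspace_zero: "fvs.subspace {0}"
  by (rule fvs.subspace_single_0)

lemma ract_zero: "HR.ract a 0 = 0"
  by (rule linD(3)[OF HR.lin_ract])

lemma lin_dd: "lin dd"
  by (rule HR.lin_rowop[OF lin_dW])

lemma dd_ract: "a \<in> carrier A \<Longrightarrow> dd (HR.ract a g) = HR.ract a (dd g)"
  by (rule AR.rowop_ract[OF lin_dW])

lemma resol_cpx_exists: "\<exists>Y \<kappa>. cpx_real A HR.ract dd (resol X) (\<lambda>_. {0}) Y \<kappa>"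
proof -
  obtain c where c: "\<forall>n. c < \<bar>n\<bar> \<longrightarrow> cdim X n = 0 \<and> cdim X (n + 1) = 0" using resol_bounded by blast
  show ?thesis
  proof (rule cpx_real_exists[where b = c])
    show "{0} \<subseteq> resol X n" for n using fvs.subspace_0[OF subspace_resol] by blast
    show "HR.ract a v \<in> {0}" if "v \<in> {0}" for a v using that ract_zero by blast
    show "dd v \<in> {0}" if "v \<in> {0}" for v using that linD(3)[OF lin_dd] by blast
    show "dd (dd v) \<in> {0}" for v using dd_dd by blast
    show "resol X n = {0}" if "c < \<bar>n\<bar>" for n using c that resol_trivial by blast
  qed (rule subspace_resol subspace_zero resol_finite_span_at lin_action_resol lin_dd resol_dd dd_ract; assumption)+
qed

text \<open>A cocycle has the form \<open>(0, Q)\<close>; if \<open>cover Q = d x\<close>, it is the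
  differential of \<open>(Q, lift x)\<close>. Conversely, a cocycle \<open>x\<close> of
  \<open>X\<close> is the image of \<open>(0, lift x)\<close>.\<close>

lemma resol_quasi_iso:
  assumes r: "cpx_real A HR.ract dd (resol X) (\<lambda>_. {0}) Y \<kappa>"
  shows "\<exists>e. quasi_iso A Y X e"
proof -
  note m = cterm_module[OF X]
  let ?h = "\<lambda>n g. cover (cterm X n) (el g True)"
  have Y: "bounded_cpx A Y" by (rule cpx_realD(1)[OF r])
  have "\<exists>F. chain_map A Y X F \<and> (\<forall>n. \<forall>g\<in>resol X n. F n *\<^sub>v \<kappa> n g = ?h n g)"
  proof (rule cpx_real_map[OF r X])
    show "lin_vec (resol X n) (cdim X n) (?h n)" for n
      unfolding lin_vec_def
    proof (intro conjI ballI allI cover_carrier)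
      fix g h assume g: "g \<in> resol X n" and h: "h \<in> resol X n"
      have "el (g + h) True = (\<lambda>s. el g True s \<oplus>\<^bsub>A\<^esub> el h True s)" by (rule ext) (rule el_add)
      then show "?h n (g + h) = ?h n g + ?h n h"
        using cover_add[OF m, of "el g True" "el h True"] resolD(1)[OF g] resolD(1)[OF h] by simp
    next
      fix c g assume g: "g \<in> resol X n"
      have "el (fscale c g) True = (\<lambda>s. c \<odot>\<^bsub>A\<^esub> el g True s)" by (rule ext) (rule el_fscale)
      then show "?h n (fscale c g) = c \<cdot>\<^sub>v ?h n g"
        using cover_smult[OF m, of "el g True"] resolD(1)[OF g] by simp
    qed
    show "?h n v = 0\<^sub>v (cdim X n)" if "v \<in> {0}" for n v
    proof -
      have v: "v = 0" using that by simp
      have "el v True = (\<lambda>s. 0)" unfolding v by (rule ext) (rule el_zero)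
      then show ?thesis using cover_zero[OF m] by simp
    qed
    show "?h n (HR.ract a g) = act (cterm X n) a *\<^sub>v ?h n g" if "a \<in> carrier A" "g \<in> resol X n" for n a g
      by (rule cover_ract[OF that(1) resolD(1)[OF that(2)]])
    show "?h (n + 1) (dd g) = cdiff X n *\<^sub>v ?h n g" if g: "g \<in> resol X n" for n g
    proof -
      have "el (dd g) True = el g False" using el_dd(1)[OF resolD(1)[OF g]] by auto
      then show ?thesis using resolD(4)[OF g] by simp
    qed
  qed
  then obtain e where e: "chain_map A Y X e" "\<And>n g. g \<in> resol X n \<Longrightarrow> e n *\<^sub>v \<kappa> n g = ?h n g" by blast
  \<comment> \<open>The section of the cover, cut off at the dimension: tuples are indexed by all of
    \<open>nat\<close>, and \<open>resol\<close> requires them to vanish beyond it.\<close>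
  define lift where "lift v s = (if s < dim_vec v then (v $ s) \<odot>\<^bsub>A\<^esub> \<one>\<^bsub>A\<^esub> else 0)" for v :: "'k vec" and s
  have liftA: "lift v s \<in> carrier A" for v s by (simp add: lift_def A_closed zero_A)
  have lift_big: "lift v s = 0" if "v \<in> carrier_vec k" "k \<le> s" for v k s using that by (simp add: lift_def)
  have cov: "cover (cterm X n) (lift v) = v" if v: "v \<in> carrier_vec (cdim X n)" for n v
  proof -
    have "cover (cterm X n) (lift v) = cover (cterm X n) (\<lambda>s. (v $ s) \<odot>\<^bsub>A\<^esub> \<one>\<^bsub>A\<^esub>)"
      using v by (intro cover_cong) (simp add: lift_def)
    then show ?thesis using cover_lift[OF m A_closed(1) v] by simp
  qed
  have "quasi_iso A Y X e"
  proof (rule quasi_isoI[OF Y X e(1)])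
    fix n y assume y: "y \<in> cocycles Y n" and ey: "e n *\<^sub>v y \<in> coboundaries X n"
    obtain g where g: "g \<in> resol X n" "\<kappa> n g = y" by (rule cpx_real_surj[OF r cocyclesD[OF y]])
    have dg: "dd g = 0" using cpx_real_cocycles[OF r g(1)] g(2) y by simp
    have F0: "el g False s = 0" for s using el_dd(1)[OF resolD(1)[OF g(1)], of s] dg el_zero by metis
    obtain x where x: "x \<in> carrier_vec (cdim X (n - 1))" "?h n g = cdiff X (n - 1) *\<^sub>v x"
      using ey unfolding g(2)[symmetric] e(2)[OF g(1)] by (auto simp: coboundaries_def)
    let ?w = "mkel (el g True) (lift x)"
    have w: "?w \<in> resol X (n - 1)"
    proof (rule resolI)
      show "el ?w b s \<in> carrier A" for b s using resolD(1)[OF g(1)] liftA by (cases b) simp_all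
      show "el ?w False s = 0" if "cdim X (n - 1 + 1) \<le> s" for s using that resolD(3)[OF g(1)] by simp
      show "el ?w True s = 0" if "cdim X (n - 1) \<le> s" for s using lift_big[OF x(1) that] by simp
      show "cover (cterm X (n - 1 + 1)) (el ?w False) = cdiff X (n - 1) *\<^sub>v cover (cterm X (n - 1)) (el ?w True)"
        using x(2) cov[OF x(1)] by simp
    qed
    have "g - dd ?w = 0"
    proof (rule el_eqI)
      fix b s
      have "el (dd ?w) b s = el g b s"
        using el_dd[OF resolD(1)[OF w], of s] F0 by (cases b) simp_all
      then show "el (g - dd ?w) b s = el 0 b s" unfolding el_diff el_zero by simp
    qed
    then have "\<exists>w\<in>resol X (n - 1). g - dd w \<in> {0}" using w by blast
    then show "y \<in> coboundaries Y n" using cpx_real_coboundaries[OF r g(1)] g(2) by simp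
  next
    fix n x assume x: "x \<in> cocycles X n"
    note xc = cocyclesD[OF x]
    let ?g = "mkel (\<lambda>s. 0) (lift x)"
    have g: "?g \<in> resol X n"
    proof (rule resolI)
      show "el ?g b s \<in> carrier A" for b s using zero_A liftA by (cases b) simp_all
      show "el ?g True s = 0" if "cdim X n \<le> s" for s using lift_big[OF xc that] by simp
      show "cover (cterm X (n + 1)) (el ?g False) = cdiff X n *\<^sub>v cover (cterm X n) (el ?g True)"
        using x cov[OF xc] cover_zero[OF m] by (simp add: cocycles_def)
    qed simp
    have "dd ?g = 0"
    proof (rule el_eqI)
      fix b s
      show "el (dd ?g) b s = el 0 b s"
        using el_dd[OF resolD(1)[OF g], of s] el_zero by (cases b) simp_all
    qed
    then have "\<kappa> n ?g \<in> cocycles Y n" using cpx_real_cocycles[OF r g] by simp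
    moreover have "e n *\<^sub>v \<kappa> n ?g = x" using e(2)[OF g] cov[OF xc] by simp
    moreover have "x - x \<in> coboundaries X n" using zero_coboundaries[OF X, of n] xc by simp
    ultimately show "\<exists>y\<in>cocycles Y n. e n *\<^sub>v y - x \<in> coboundaries X n" by metis
  qed
  then show ?thesis by blast
qed

text \<open>The radical of the resolution is an \<open>H\<close>-submodule of the ambient function space: it
  consists of the functions whose row \<open>(i, (j, a))\<close> lies in the span of the rows of level below \<open>j\<close>.\<close>

definition rad :: "nat \<Rightarrow> nat \<Rightarrow> int \<Rightarrow> (idx \<Rightarrow> 'k) set" where
  "rad i j n = fvs.span {row g (i, r) | g r. g \<in> resol X n \<and> (i, r) \<in> rows \<and> fst r < j}"

abbreviation rads :: "int \<Rightarrow> ((nat \<times> nat \<times> nat) \<times> idx \<Rightarrow> 'k) set" where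
  "rads n \<equiv> HR.Qs (\<lambda>i j. rad i j n)"

lemma subspace_rad: "fvs.subspace (rad i j n)"
  by (simp add: rad_def fvs.subspace_span)

lemma rad_mono: "j \<le> j' \<Longrightarrow> rad i j n \<subseteq> rad i j' n"
  unfolding rad_def by (intro fvs.span_mono) force

lemma rad_zero: "rad i 0 n = {0}"
  by (simp add: rad_def)

lemma rads_zero: "HR.Qs (\<lambda>i j. rad i 0 n) = {0}"
proof
  show "HR.Qs (\<lambda>i j. rad i 0 n) \<subseteq> {0}"
  proof
    fix g assume g: "g \<in> HR.Qs (\<lambda>i j. rad i 0 n)"
    have "g = 0"
    proof (rule row_eqI)
      fix p show "row g p = row 0 p"
        using HR.QsD[OF g, of p] by (cases "p \<in> rows") (auto simp: rad_zero)
    qed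
    then show "g \<in> {0}" by simp
  qed
  show "{0} \<subseteq> HR.Qs (\<lambda>i j. rad i 0 n)" by (auto intro!: HR.QsI simp: rad_zero)
qed

text \<open>The differential acts inside each row and preserves \<open>resol\<close>, hence maps
  generators of \<open>rad\<close> to generators in the next degree.\<close>

lemma filt_rad: "\<exists>b. HR.filt rad dW idx_basis b"
proof -
  obtain c where c: "\<forall>n. c < \<bar>n\<bar> \<longrightarrow> cdim X n = 0 \<and> cdim X (n + 1) = 0" using resol_bounded by blast
  have dr: "dW w \<in> rad i j (n + 1)" if "w \<in> rad i j n" for i j n w
    using that unfolding rad_def
  proof (induction rule: fvs.span_induct_alt)
    case base
    show ?case unfolding linD(3)[OF lin_dW] by (rule fvs.span_zero)
  next
    case (step c w v)
    then obtain g r where g: "w = row g (i, r)" "g \<in> resol X n" "(i, r) \<in> rows" "fst r < j" by blast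
    have "dW w = row (dd g) (i, r)" using g by (simp add: HR.row_rowop)
    then have "dW w \<in> fvs.span {row g (i, r) | g r. g \<in> resol X (n + 1) \<and> (i, r) \<in> rows \<and> fst r < j}"
      using g resol_dd[OF g(2)] by (intro fvs.span_base) blast
    then show ?case
      unfolding linD(1,2)[OF lin_dW] using step.IH by (intro fvs.span_add fvs.span_scale)
  qed
  have "HR.filt rad dW idx_basis c"
    unfolding HR.filt_def
  proof (intro conjI allI impI ballI lin_dW dW_dW finite_idx_basis subspace_rad rad_mono dr)
    show "rad i j n \<subseteq> fvs.span idx_basis" for i j n
      unfolding rad_def
    proof (rule fvs.span_minimal[OF _ fvs.subspace_span])
      show "{row g (i, r) | g r. g \<in> resol X n \<and> (i, r) \<in> rows \<and> fst r < j} \<subseteq> fvs.span idx_basis"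
      proof
        fix w assume "w \<in> {row g (i, r) | g r. g \<in> resol X n \<and> (i, r) \<in> rows \<and> fst r < j}"
        then obtain g r where "w = row g (i, r)" "g \<in> resol X n" by blast
        then show "w \<in> fvs.span idx_basis" using row_resol_span by simp
      qed
    qed
    show "rad i (height i) n = rad i 0 n" if "c < \<bar>n\<bar>" for i n
    proof -
      have t: "resol X n = {0}" using c that resol_trivial by blast
      have "rad i (height i) n \<subseteq> {0}"
        unfolding rad_def t by (intro fvs.span_minimal subspace_zero) auto
      moreover have "0 \<in> rad i (height i) n" by (rule fvs.subspace_0[OF subspace_rad])
      ultimately show ?thesis unfolding rad_zero by (intro equalityI) simp_all
    qed
  qed
  then show ?thesis by blast
qed

text \<open>A row of level below \<open>j\<close> is carried to a row of level \<open>j\<close> by a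
  strictly lower matrix unit, which belongs to \<open>A\<close>. As \<open>resol\<close> is an
  \<open>A\<close>-module, each row of an element of \<open>rads\<close> can be placed in it
  separately.\<close>

lemma rads_subset: "rads n \<subseteq> resol X n"
proof
  fix g assume g: "g \<in> rads n"
  define sg :: "nat \<times> nat \<times> nat \<Rightarrow> (idx \<Rightarrow> 'k) \<Rightarrow> (nat \<times> nat \<times> nat) \<times> idx \<Rightarrow> 'k" where
    "sg p w = (\<lambda>(q, x). if q = p then w x else 0)" for p w
  have row_sg: "row (sg p w) q = (if q = p then w else 0)" for p q w
    by (auto simp: sg_def row_def fun_eq_iff)
  have sg: "sg (i, p) w \<in> resol X n" if p: "(i, p) \<in> rows" and w: "w \<in> rad i (fst p) n" for i p w
    using w unfolding rad_def
  proof (induction rule: fvs.span_induct_alt)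
    case base
    have z: "sg (i, p) 0 = 0" by (rule row_eqI) (simp add: row_sg)
    show ?case unfolding z by (rule fvs.subspace_0[OF subspace_resol])
  next
    case (step c w v)
    then obtain h r where h: "w = row h (i, r)" "h \<in> resol X n" "(i, r) \<in> rows" "fst r < fst p" by blast
    have "sg (i, p) w = HR.ract (munit i p r) h"
      by (rule row_eqI) (simp add: row_sg row_munit[OF p h(3)] h(1))
    then have m: "sg (i, p) w \<in> resol X n" using resol_ract[OF munit_A[OF p h(3,4)] h(2)] by simp
    have e: "sg (i, p) (fscale c w + v) = fscale c (sg (i, p) w) + sg (i, p) v"
      by (rule row_eqI) (auto simp: row_sg fun_eq_iff)
    show ?case unfolding e
      by (intro fvs.subspace_add[OF subspace_resol] fvs.subspace_scale[OF subspace_resol] m step.IH)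
  qed
  have "g = (\<Sum>p\<in>rows. sg p (row g p))"
  proof (rule row_eqI)
    fix q
    have "(\<Sum>p\<in>rows. row (sg p (row g p)) q) = (\<Sum>p\<in>rows. if p = q then row g p else 0)"
      by (intro sum.cong) (auto simp: row_sg)
    also have "\<dots> = row g q" using finite_rows HR.QsD(2)[OF g, of q] by simp
    finally show "row g q = row (\<Sum>p\<in>rows. sg p (row g p)) q" by (simp add: row_sum)
  qed
  moreover have "(\<Sum>p\<in>rows. sg p (row g p)) \<in> resol X n"
  proof (rule fvs.subspace_sum[OF subspace_resol])
    fix p assume "p \<in> rows"
    then show "sg p (row g p) \<in> resol X n"
      using sg[of "fst p" "snd p" "row g p"] HR.QsD(1)[OF g, of p] by simp
  qed
  ultimately show "g \<in> resol X n" by metis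
qed

lemma subspace_rads: "fvs.subspace (rads n)"
  by (rule HR.subspace_Qs[OF subspace_rad])

text \<open>All of \<open>H\<close> acts: \<open>rad i j\<close> depends on the factor and the level
  but not on the place within a block, so full diagonal blocks preserve it too.\<close>

lemma rads_ract: "a \<in> carrier H \<Longrightarrow> g \<in> rads n \<Longrightarrow> HR.ract a g \<in> rads n"
  by (rule HR.Qs_ract[OF subspace_rad rad_mono])

lemma rads_dd: "g \<in> rads n \<Longrightarrow> dd g \<in> rads (n + 1)"
proof (rule HR.QsI)
  fix p assume g: "g \<in> rads n" and p: "p \<in> rows"
  obtain b where b: "HR.filt rad dW idx_basis b" using filt_rad by blast
  show "row (dd g) p \<in> rad (fst p) (level p) (n + 1)"
    using HR.filtD(6)[OF b HR.QsD(1)[OF g p]] p by (simp add: HR.row_rowop)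
qed (simp add: HR.row_rowop)

lemma resol_quotient_exists: "\<exists>S \<kappa>. cpx_real A HR.ract dd (resol X) rads S \<kappa>"
proof -
  obtain c where c: "\<forall>n. c < \<bar>n\<bar> \<longrightarrow> cdim X n = 0 \<and> cdim X (n + 1) = 0" using resol_bounded by blast
  show ?thesis
  proof (rule cpx_real_exists[where b = c])
    show "HR.ract a v \<in> rads n" if "a \<in> carrier A" "v \<in> rads n" for a v n
      using rads_ract carrier_A_H that by blast
    show "dd v \<in> rads (n + 1)" if "v \<in> rads n" for v n by (rule rads_dd[OF that])
    show "dd (dd v) \<in> rads (n + 2)" for v n
      unfolding dd_dd by (rule fvs.subspace_0[OF subspace_rads])
    show "resol X n = rads n" if "c < \<bar>n\<bar>" for n
    proof (rule equalityI)
      have "resol X n = {0}" using c that resol_trivial by blast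
      then show "resol X n \<subseteq> rads n" using fvs.subspace_0[OF subspace_rads[of n]] by simp
    qed (rule rads_subset)
  qed (rule subspace_resol subspace_rads rads_subset resol_finite_span_at lin_action_resol lin_dd resol_dd dd_ract; assumption)+
qed

text \<open>The triangle of \<open>0 \<rightarrow> rad \<rightarrow> resol \<rightarrow> resol / rad \<rightarrow> 0\<close>, with \<open>resol\<close> replaced by \<open>X\<close>.\<close>

lemma resol_triangle:
  assumes U: "cpx_real A HR.ract dd rads (\<lambda>_. {0}) Y1 \<kappa>1" and S: "cpx_real A HR.ract dd (resol X) rads S \<kappa>S"
  shows "\<exists>Y2 u v w. derived_tri A Y1 X Y2 u v w \<and> qeq A Y2 S"
proof -
  obtain Y \<kappa> where r: "cpx_real A HR.ract dd (resol X) (\<lambda>_. {0}) Y \<kappa>" using resol_cpx_exists by blast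
  obtain e where e: "quasi_iso A Y X e" using resol_quasi_iso[OF r] by blast
  note bU = cpx_realD(1)[OF U] and bY = cpx_realD(1)[OF r] and bS = cpx_realD(1)[OF S]
  note cU = cpx_realD(3)[OF U] and cY = cpx_realD(3)[OF r] and cS = cpx_realD(3)[OF S]
  have sub: "v \<in> resol X n" if "v \<in> rads n" for v n using rads_subset that by blast
  have "\<exists>f. chain_map A Y1 Y f \<and> (\<forall>n. \<forall>g\<in>rads n. f n *\<^sub>v \<kappa>1 n g = \<kappa> n g)"
  proof (rule cpx_real_map[OF U bY])
    show "lin_vec (rads n) (cdim Y n) (\<kappa> n)" for n
      using coordsD(4)[OF cY] rads_subset unfolding lin_vec_def by blast
    show "\<kappa> n v = 0\<^sub>v (cdim Y n)" if "v \<in> {0}" for n v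
      using that lin_vec_zero[OF coordsD(4,1)[OF cY]] by blast
    show "\<kappa> n (HR.ract a v) = act (cterm Y n) a *\<^sub>v \<kappa> n v" if "a \<in> carrier A" "v \<in> rads n" for n a v
      using mod_realD(4)[OF cpx_realD(2)[OF r]] that sub by blast
    show "\<kappa> (n + 1) (dd v) = cdiff Y n *\<^sub>v \<kappa> n v" if "v \<in> rads n" for n v
      using cpx_realD(5)[OF r] that sub by blast
  qed
  then obtain f where f: "chain_map A Y1 Y f" "\<And>n g. g \<in> rads n \<Longrightarrow> f n *\<^sub>v \<kappa>1 n g = \<kappa> n g" by blast
  have "\<exists>q. chain_map A Y S q \<and> (\<forall>n. \<forall>g\<in>resol X n. q n *\<^sub>v \<kappa> n g = \<kappa>S n g)"
  proof (rule cpx_real_map[OF r bS coordsD(4)[OF cS]])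
    show "\<kappa>S n v = 0\<^sub>v (cdim S n)" if "v \<in> {0}" for n v
      using that lin_vec_zero[OF coordsD(4,1)[OF cS]] by blast
  qed (use mod_realD(4)[OF cpx_realD(2)[OF S]] cpx_realD(5)[OF S] in blast)+
  then obtain q where q: "chain_map A Y S q" "\<And>n g. g \<in> resol X n \<Longrightarrow> q n *\<^sub>v \<kappa> n g = \<kappa>S n g" by blast
  have "quasi_iso A (cone Y1 f Y) S (\<lambda>n. drop_mat (cdim Y1 (n + 1)) (q n))"
  proof (rule cone_exact_quasi_iso[OF bU bY bS f(1) q(1)])
    fix n and x x' :: "'k vec" assume x: "x \<in> carrier_vec (cdim Y1 n)" "x' \<in> carrier_vec (cdim Y1 n)" and eq: "f n *\<^sub>v x = f n *\<^sub>v x'"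
    obtain g where g: "g \<in> rads n" "\<kappa>1 n g = x" by (rule cpx_real_surj[OF U x(1)])
    obtain g' where g': "g' \<in> rads n" "\<kappa>1 n g' = x'" by (rule cpx_real_surj[OF U x(2)])
    have "\<kappa> n g = \<kappa> n g'" using eq f(2) g g' by metis
    then have "g - g' \<in> {0}" using coords_eq_iff[OF cY sub[OF g(1)] sub[OF g'(1)]] by blast
    then show "x = x'" using coords_eq_iff[OF cU g(1) g'(1)] g(2) g'(2) by blast
  next
    fix n and s :: "'k vec" assume s: "s \<in> carrier_vec (cdim S n)"
    obtain g where g: "g \<in> resol X n" "\<kappa>S n g = s" by (rule cpx_real_surj[OF S s])
    then show "\<exists>y\<in>carrier_vec (cdim Y n). q n *\<^sub>v y = s"
      using q(2)[OF g(1)] cpx_real_carrier[OF r g(1)] by blast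
  next
    fix n and x :: "'k vec" assume x: "x \<in> carrier_vec (cdim Y1 n)"
    obtain g where g: "g \<in> rads n" "\<kappa>1 n g = x" by (rule cpx_real_surj[OF U x])
    have "q n *\<^sub>v (f n *\<^sub>v x) = \<kappa>S n g" using f(2)[OF g(1)] g(2) q(2)[OF sub[OF g(1)]] by simp
    then show "q n *\<^sub>v (f n *\<^sub>v x) = 0\<^sub>v (cdim S n)" using coordsD(6)[OF cS sub[OF g(1)]] g(1) by simp
  next
    fix n and y :: "'k vec" assume y: "y \<in> carrier_vec (cdim Y n)" and qy: "q n *\<^sub>v y = 0\<^sub>v (cdim S n)"
    obtain g where g: "g \<in> resol X n" "\<kappa> n g = y" by (rule cpx_real_surj[OF r y])
    have "\<kappa>S n g = 0\<^sub>v (cdim S n)" using q(2)[OF g(1)] g(2) qy by simp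
    then have "g \<in> rads n" using coordsD(6)[OF cS g(1)] by blast
    then show "\<exists>x\<in>carrier_vec (cdim Y1 n). f n *\<^sub>v x = y"
      using f(2)[of g n] g(2) cpx_real_carrier[OF U, of g n] by blast
  qed
  then have "qeq A (cone Y1 f Y) S" by (rule qeq_quasi_iso[OF bounded_cone[OF bU bY f(1)] bS])
  moreover have "\<exists>u v w. derived_tri A Y1 X (cone Y1 f Y) u v w"
    by (rule derived_tri_cone[OF bU bY X f(1) e])
  ultimately show ?thesis by blast
qed

end

end

lemma subspace_lin_image:
  assumes "lin f" "fvs.subspace S"
  shows "fvs.subspace (f ` S)"
  unfolding fvs.subspace_def
proof (intro conjI ballI allI)
  show "0 \<in> f ` S" using linD(3)[OF assms(1)] fvs.subspace_0[OF assms(2)] by (rule image_eqI[OF HOL.sym])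
next
  fix v w assume "v \<in> f ` S" "w \<in> f ` S"
  then obtain x y where xy: "x \<in> S" "y \<in> S" "v = f x" "w = f y" by blast
  show "v + w \<in> f ` S"
    unfolding xy(3,4) linD(1)[OF assms(1), symmetric] using fvs.subspace_add[OF assms(2) xy(1,2)] by (rule imageI)
next
  fix c v assume "v \<in> f ` S"
  then obtain x where x: "x \<in> S" "v = f x" by blast
  show "fscale c v \<in> f ` S"
    unfolding x(2) linD(2)[OF assms(1), symmetric] using fvs.subspace_scale[OF assms(2) x(1)] by (rule imageI)
qed

context skew_gentle_data
begin

section \<open>The semisimple part\<close>

text \<open>A block with two places occurs only at a self-related position, and there the definition
  of \<open>A\<close> forces it to be diagonal.\<close>

lemma A_offdiag:
  assumes X: "X \<in> carrier A" and "a \<noteq> b"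
  shows "X i (j, a) (j, b) = 0"
proof (rule ccontr)
  assume n: "X i (j, a) (j, b) \<noteq> 0"
  then have "(i, (j, a)) \<in> rows" "(i, (j, b)) \<in> rows"
    using X unfolding carrier_A carrier_H by blast+
  then have "((i, j), (i, j)) \<in> R" using special_or_single assms(2) by blast
  then show False using X n assms(2) unfolding carrier_A glued_def by blast
qed

lemma A_entry_same_level:
  assumes "a \<in> carrier A" "entry a p q \<noteq> 0" "level p = level q"
  shows "p = q"
proof -
  obtain i j b where p: "p = (i, j, b)" by (cases p)
  obtain k l c where q: "q = (k, l, c)" by (cases q)
  have "a i (j, b) (j, c) \<noteq> 0" "i = k" "l = j" using assms(2,3) by (auto simp: entry_def p q split: if_splits)
  then show ?thesis using A_offdiag[OF assms(1), of b c i j] by (auto simp: p q)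
qed

text \<open>Only \<open>r = p\<close> survives in the product: triangularity forces \<open>r\<close>
  to the level of \<open>p\<close>, and within a level \<open>A\<close> is diagonal. Diagonal
  entries are therefore characters.\<close>

lemma entry_diag_mult:
  assumes X: "X \<in> carrier A" and Y: "Y \<in> carrier A" and p: "p \<in> rows"
  shows "entry (X \<otimes>\<^bsub>A\<^esub> Y) p p = entry X p p * entry Y p p"
proof -
  define c where "c = entry X p p * entry Y p p"
  have e: "entry X p r * entry Y r p = (if r = p then c else 0)" for r
  proof (cases "entry X p r * entry Y r p = 0")
    case False
    then have "level r \<le> level p" "level p \<le> level r"
      using X Y by (auto simp: entry_def carrier_A carrier_H split: if_splits)
    then have "p = r" using A_entry_same_level[OF X, of p r] False by simp
    then show ?thesis by (simp add: c_def)
  qed (auto simp: c_def)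
  show ?thesis unfolding A_ops entry_mult[OF p] e c_def[symmetric] using p finite_rows by simp
qed

text \<open>The characters of \<open>A\<close> are its diagonal entries; rows with the same character are
  exactly those identified by the gluing.\<close>

definition cls :: "nat \<times> nat \<times> nat \<Rightarrow> (nat \<times> nat \<times> nat) set" where
  "cls p = {q \<in> rows. \<forall>a\<in>carrier A. entry a p p = entry a q q}"

text \<open>On \<open>A\<close> every representative of the class gives the same value;
  \<open>SOME\<close> fixes one, so that the character is attached to the class.\<close>

definition chr :: "(nat \<Rightarrow> 'k bmat) \<Rightarrow> (nat \<times> nat \<times> nat) set \<Rightarrow> 'k" where
  "chr a \<gamma> = (let p = SOME p. p \<in> \<gamma> in entry a p p)"

definition chi :: "(nat \<Rightarrow> 'k bmat) \<Rightarrow> (nat \<times> nat \<times> nat) set \<Rightarrow> (nat \<times> nat \<times> nat) set \<Rightarrow> 'k" where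
  "chi a \<gamma> \<delta> = (if \<gamma> = \<delta> then chr a \<gamma> else 0)"

definition row_classes :: "(nat \<times> nat \<times> nat) set set" where
  "row_classes = cls ` rows"

lemma finite_row_classes: "finite row_classes"
  by (simp add: row_classes_def finite_rows)

lemma cls_in_row_classes: "p \<in> rows \<Longrightarrow> cls p \<in> row_classes"
  by (simp add: row_classes_def)

lemma class_rows: "\<gamma> \<in> row_classes \<Longrightarrow> p \<in> \<gamma> \<Longrightarrow> p \<in> rows"
  by (auto simp: cls_def row_classes_def)

lemma class_eq: "\<gamma> \<in> row_classes \<Longrightarrow> p \<in> \<gamma> \<Longrightarrow> \<gamma> = cls p"
  by (auto simp: cls_def row_classes_def)

lemma cls_self: "p \<in> rows \<Longrightarrow> p \<in> cls p"
  by (simp add: cls_def)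

lemma chr_eq:
  assumes "a \<in> carrier A" "\<gamma> \<in> row_classes" "p \<in> \<gamma>"
  shows "chr a \<gamma> = entry a p p"
proof -
  define q where "q = (SOME q. q \<in> \<gamma>)"
  have "q \<in> \<gamma>" unfolding q_def using assms(3) by (rule someI)
  then have "q \<in> cls p" using class_eq[OF assms(2,3)] by simp
  then show ?thesis using assms(1) by (simp add: chr_def cls_def q_def[symmetric])
qed

lemma class_nonempty: "\<gamma> \<in> row_classes \<Longrightarrow> \<exists>p. p \<in> \<gamma> \<and> p \<in> rows"
  using cls_self unfolding row_classes_def by blast

text \<open>The semisimple quotient of \<open>A\<close>, as diagonal matrices of characters. Each
  class is its own component with the single level 1, so a filtered complex amounts to one complex
  of vector spaces, level 1 modulo level 0, for each character.\<close>

sublocale CR: tri_rep A row_classes "\<lambda>\<gamma>. \<gamma>" "\<lambda>_. 1" "\<lambda>_. 1" chi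
proof
  show "finite row_classes" by (rule finite_row_classes)
  fix \<gamma> \<delta> assume g: "\<gamma> \<in> row_classes"
  obtain p where p: "p \<in> \<gamma>" "p \<in> rows" using class_nonempty[OF g] by blast
  show "chi \<one>\<^bsub>A\<^esub> \<gamma> \<delta> = (if \<gamma> = \<delta> then 1 else 0)"
    using chr_eq[OF A_closed(1) g p(1)] AR.\<tau>_one[OF p(2) p(2)] by (auto simp: chi_def)
  show "chi (s \<odot>\<^bsub>A\<^esub> a) \<gamma> \<delta> = s * chi a \<gamma> \<delta>" if "a \<in> carrier A" for a s
    using chr_eq[OF A_closed(2)[OF that] g p(1)] chr_eq[OF that g p(1)] AR.\<tau>_smult[OF that p(2) p(2)]
    by (auto simp: chi_def)
  show "chi (a \<oplus>\<^bsub>A\<^esub> b) \<gamma> \<delta> = chi a \<gamma> \<delta> + chi b \<gamma> \<delta>" if "a \<in> carrier A" "b \<in> carrier A" for a b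
    using chr_eq[OF A_closed(3)[OF that] g p(1)] chr_eq[OF that(1) g p(1)] chr_eq[OF that(2) g p(1)]
      AR.\<tau>_add[OF that p(2) p(2)]
    by (auto simp: chi_def)
  show "chi (a \<otimes>\<^bsub>A\<^esub> b) \<gamma> \<delta> = (\<Sum>r\<in>row_classes. chi a \<gamma> r * chi b r \<delta>)" if "a \<in> carrier A" "b \<in> carrier A" for a b
  proof -
    have "(\<Sum>r\<in>row_classes. chi a \<gamma> r * chi b r \<delta>) = (\<Sum>r\<in>row_classes. if r = \<gamma> then chi a \<gamma> \<gamma> * chi b \<gamma> \<delta> else 0)"
      by (intro sum.cong) (auto simp: chi_def)
    also have "\<dots> = chi a \<gamma> \<gamma> * chi b \<gamma> \<delta>" using g finite_row_classes by simp
    finally show ?thesis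
      using chr_eq[OF A_closed(4)[OF that] g p(1)] chr_eq[OF that(1) g p(1)] chr_eq[OF that(2) g p(1)]
        entry_diag_mult[OF that p(2)] by (auto simp: chi_def)
  qed
  show "\<delta> = \<gamma> \<and> (1 :: nat) \<le> 1" if "chi a \<gamma> \<delta> \<noteq> 0" for a using that by (auto simp: chi_def split: if_splits)
qed (simp_all add: A_closed)

section \<open>Idempotents of the classes\<close>

definition res :: "(nat \<times> nat \<times> nat) set \<Rightarrow> ((nat \<times> nat \<times> nat) \<times> 'x \<Rightarrow> 'k) \<Rightarrow> (nat \<times> nat \<times> nat) \<times> 'x \<Rightarrow> 'k" where
  "res \<gamma> g = (\<lambda>(p, x). if p \<in> \<gamma> then g (p, x) else 0)"

definition eunit :: "(nat \<times> nat \<times> nat) set \<Rightarrow> nat \<Rightarrow> 'k bmat" where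
  "eunit \<gamma> = (\<lambda>i p q. if p = q \<and> (i, p) \<in> \<gamma> then 1 else 0)"

lemma row_res: "row (res \<gamma> g) p = (if p \<in> \<gamma> then row g p else 0)"
  by (auto simp: row_def res_def fun_eq_iff)

lemma lin_res: "lin (res \<gamma>)"
  by (auto simp: lin_def res_def fun_eq_iff)

text \<open>Glued positions have equal diagonal entries on all of \<open>A\<close>, so a class
  contains both or neither of two glued rows; its idempotent therefore satisfies the gluing
  conditions.\<close>

lemma eunit_A:
  assumes g: "\<gamma> \<in> row_classes"
  shows "eunit \<gamma> \<in> carrier A"
proof -
  obtain r where r: "\<gamma> = cls r" using g unfolding row_classes_def by blast
  have "(i, (j, a)) \<in> \<gamma> \<longleftrightarrow> (k, (l, a)) \<in> \<gamma>" if R: "((i, j), (k, l)) \<in> R" "(i, j) \<noteq> (k, l)" for i j k l a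
  proof -
    have "entry x (i, (j, a)) (i, (j, a)) = entry x (k, (l, a)) (k, (l, a))" if "x \<in> carrier A" for x
      using that R by (simp add: entry_def carrier_A glued_def)
    then show ?thesis using glued_rows[OF R] unfolding r cls_def by auto
  qed
  moreover have "eunit \<gamma> \<in> carrier H" using class_rows[OF g] by (auto simp: carrier_H eunit_def)
  ultimately show ?thesis unfolding carrier_A glued_def eunit_def by auto
qed

text \<open>Restriction to a class is multiplication by an idempotent of \<open>A\<close>, and
  therefore preserves \<open>resol\<close> and \<open>rads\<close>.\<close>

lemma res_eq_ract:
  assumes g: "\<gamma> \<in> row_classes"
  shows "res \<gamma> y = HR.ract (eunit \<gamma>) y"
proof (rule row_eqI)
  fix p
  have "(\<Sum>q\<in>rows. fscale (entry (eunit \<gamma>) p q) (row y q)) = (\<Sum>q\<in>rows. if q = p then if p \<in> \<gamma> then row y q else 0 else 0)"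
    by (intro sum.cong) (auto simp: entry_def eunit_def fun_eq_iff prod_eq_iff)
  then show "row (res \<gamma> y) p = row (HR.ract (eunit \<gamma>) y) p"
    using finite_rows class_rows[OF g, of p] by (cases "p \<in> \<gamma>") (simp_all add: HR.row_ract row_res)
qed

lemma res_res:
  assumes "\<gamma> \<in> row_classes" "\<delta> \<in> row_classes"
  shows "res \<gamma> (res \<delta> y) = (if \<gamma> = \<delta> then res \<delta> y else 0)"
proof (rule row_eqI)
  show "row (res \<gamma> (res \<delta> y)) p = row (if \<gamma> = \<delta> then res \<delta> y else 0) p" for p
    using class_eq[OF assms(1), of p] class_eq[OF assms(2), of p] by (auto simp: row_res)
qed

lemma sum_res:
  assumes "\<And>p. p \<notin> rows \<Longrightarrow> row y p = 0"
  shows "(\<Sum>\<gamma>\<in>row_classes. res \<gamma> y) = y"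
proof (rule row_eqI)
  fix p
  have "(\<Sum>\<gamma>\<in>row_classes. row (res \<gamma> y) p) = (\<Sum>\<gamma>\<in>row_classes. if \<gamma> = cls p then row y p else 0)"
  proof (rule sum.cong[OF HOL.refl])
    fix \<gamma> assume g: "\<gamma> \<in> row_classes"
    show "row (res \<gamma> y) p = (if \<gamma> = cls p then row y p else 0)"
    proof (cases "p \<in> \<gamma>")
      case True
      have "\<gamma> = cls p" by (rule class_eq[OF g True])
      then show ?thesis using True by (simp add: row_res)
    next
      case False
      have "row y p = 0" if "\<gamma> = cls p" using False that cls_self[of p] assms[of p] by blast
      then show ?thesis using False by (auto simp: row_res)
    qed
  qed
  also have "\<dots> = row y p"
  proof (cases "p \<in> rows")
    case True
    then show ?thesis using finite_row_classes cls_in_row_classes[OF True] by simp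
  next
    case False
    show ?thesis unfolding assms[OF False] by simp
  qed
  finally show "row (\<Sum>\<gamma>\<in>row_classes. res \<gamma> y) p = row y p" by (simp add: row_sum)
qed

definition cdirac :: "(nat \<times> nat \<times> nat) set \<Rightarrow> (nat \<times> nat \<times> nat) set \<times> unit \<Rightarrow> 'k" where
  "cdirac \<gamma> = (\<lambda>(\<delta>, _). if \<delta> = \<gamma> then 1 else 0)"

lemma cival_iff:
  assumes "\<gamma> \<in> row_classes"
  shows "G \<in> CR.ival \<gamma> l \<longleftrightarrow> (if l \<le> 1 then \<exists>s. G = fscale s (cdirac \<gamma>) else G = 0)"
proof -
  have z: "row G \<delta> = 0 \<longleftrightarrow> G (\<delta>, ()) = 0" for \<delta> by (auto simp: row_def fun_eq_iff)
  have "G \<in> CR.ival \<gamma> l \<longleftrightarrow> (\<forall>\<delta>. G (\<delta>, ()) \<noteq> 0 \<longrightarrow> \<delta> = \<gamma> \<and> l \<le> 1)"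
  proof
    assume G: "G \<in> CR.ival \<gamma> l"
    show "\<forall>\<delta>. G (\<delta>, ()) \<noteq> 0 \<longrightarrow> \<delta> = \<gamma> \<and> l \<le> 1"
    proof (intro allI impI)
      fix \<delta> assume "G (\<delta>, ()) \<noteq> 0"
      then show "\<delta> = \<gamma> \<and> l \<le> 1"
        using CR.QsD[OF G[unfolded CR.ival_def], of \<delta>] z[of \<delta>] by (cases "\<delta> \<in> row_classes") (auto split: if_splits)
    qed
  next
    assume G: "\<forall>\<delta>. G (\<delta>, ()) \<noteq> 0 \<longrightarrow> \<delta> = \<gamma> \<and> l \<le> 1"
    show "G \<in> CR.ival \<gamma> l"
      unfolding CR.ival_def
    proof (rule CR.QsI)
      fix \<delta>
      show "row G \<delta> \<in> (if \<delta> = \<gamma> \<and> l \<le> 1 then UNIV else {0})"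
        using G[rule_format, of \<delta>] z[of \<delta>] by (cases "G (\<delta>, ()) = 0") auto
      show "row G \<delta> = 0" if "\<delta> \<notin> row_classes" using G[rule_format, of \<delta>] z[of \<delta>] that assms by blast
    qed
  qed
  also have "\<dots> \<longleftrightarrow> (if l \<le> 1 then \<exists>s. G = fscale s (cdirac \<gamma>) else G = 0)"
  proof (cases "l \<le> 1")
    case True
    have 1: "G = fscale (G (\<gamma>, ())) (cdirac \<gamma>)" if "\<forall>\<delta>. G (\<delta>, ()) \<noteq> 0 \<longrightarrow> \<delta> = \<gamma> \<and> l \<le> 1"
    proof (rule ext)
      fix z :: "(nat \<times> nat \<times> nat) set \<times> unit"
      obtain \<delta> where z: "z = (\<delta>, ())" by (cases z) auto
      show "G z = fscale (G (\<gamma>, ())) (cdirac \<gamma>) z"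
        using that[rule_format, of \<delta>] unfolding z by (cases "\<delta> = \<gamma>") (auto simp: cdirac_def)
    qed
    have 2: "\<delta> = \<gamma>" if e: "G = fscale s (cdirac \<gamma>)" and n: "G (\<delta>, ()) \<noteq> 0" for s \<delta>
      using n unfolding e by (auto simp: cdirac_def split: if_splits)
    show ?thesis unfolding if_P[OF True]
    proof
      assume "\<forall>\<delta>. G (\<delta>, ()) \<noteq> 0 \<longrightarrow> \<delta> = \<gamma> \<and> l \<le> 1"
      then show "\<exists>s. G = fscale s (cdirac \<gamma>)" by (intro exI[of _ "G (\<gamma>, ())"] 1)
    next
      assume "\<exists>s. G = fscale s (cdirac \<gamma>)"
      then show "\<forall>\<delta>. G (\<delta>, ()) \<noteq> 0 \<longrightarrow> \<delta> = \<gamma> \<and> l \<le> 1" using 2 True by blast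
    qed
  next
    case False
    then show ?thesis by (auto simp: fun_eq_iff)
  qed
  finally show ?thesis .
qed

text \<open>The simple \<open>H\<close>-module \<open>K\<close> at the level of \<open>r\<close> has
  dimension 1 or 2, and \<open>A\<close> acts on it by diagonal matrices. The basis vector of row
  \<open>r\<close> spans a copy of the simple \<open>A\<close>-module, and the coordinate of row
  \<open>r\<close> is a retraction onto it.\<close>

lemma simple_retract:
  assumes r: "r \<in> rows" and N: "mod_real A CR.ract (CR.ival (cls r) 1) (CR.ival (cls r) 2) N \<kappa>"
    and K: "mod_real A HR.ract (HR.ival (fst r) (level r)) (HR.ival (fst r) (Suc (level r))) K \<kappa>'"
  shows "retract_of A N K"
proof -
  let ?\<gamma> = "cls r" and ?S = "CR.ival (cls r) 1" and ?T = "HR.ival (fst r) (level r)"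
  have g: "?\<gamma> \<in> row_classes" using r by (rule cls_in_row_classes)
  note cN = mod_realD(2)[OF N] and cK = mod_realD(2)[OF K]
  have linK: "lin_vec ?T (vdim K) \<kappa>'" and linN: "lin_vec ?S (vdim N) \<kappa>" using coordsD(4) cN cK by auto
  have dr: "fscale s (dirac r) \<in> ?T" for s
    using r by (auto simp: ival_iff dirac_def)
  have dc: "fscale s (cdirac ?\<gamma>) \<in> ?S" for s using cival_iff[OF g] by auto
  have chr: "chr a ?\<gamma> = entry a r r" if "a \<in> carrier A" for a
    by (rule chr_eq[OF that g cls_self[OF r]])
  have functional: "lin (\<lambda>G. fscale (G z) v)" for z :: 'y and v :: "'z \<Rightarrow> 'k"
    by (auto simp: lin_def fun_eq_iff algebra_simps)
  have "\<exists>I\<in>mod_hom A N K. \<forall>G\<in>?S. I *\<^sub>v \<kappa> G = \<kappa>' (fscale (G (?\<gamma>, ())) (dirac r))"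
  proof (rule mod_real_hom[OF N mod_realD(1)[OF K]])
    show "lin_vec ?S (vdim K) (\<lambda>G. \<kappa>' (fscale (G (?\<gamma>, ())) (dirac r)))"
      by (rule lin_vec_comp_lin[OF linK functional dr])
    show "\<kappa>' (fscale (G (?\<gamma>, ())) (dirac r)) = 0\<^sub>v (vdim K)" if "G \<in> CR.ival ?\<gamma> 2" for G
    proof -
      have "G = 0" using that cival_iff[OF g, of G 2] by simp
      then have "fscale (G (?\<gamma>, ())) (dirac r) = 0" by (auto simp: fun_eq_iff)
      then show ?thesis using lin_vec_zero[OF linK coordsD(1)[OF cK]] by metis
    qed
    fix a G assume a: "a \<in> carrier A" and G: "G \<in> ?S"
    let ?s = "G (?\<gamma>, ())"
    have "CR.ract a G (?\<gamma>, ()) = (\<Sum>\<delta>\<in>row_classes. if \<delta> = ?\<gamma> then chr a ?\<gamma> * ?s else 0)"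
      using g unfolding CR.ract_def by (auto simp: chi_def intro!: sum.cong)
    then have e: "CR.ract a G (?\<gamma>, ()) = entry a r r * ?s"
      using g finite_row_classes chr[OF a] by simp
    \<comment> \<open>Apart from row \<open>r\<close> itself, \<open>a\<close> sends the basis
      function of \<open>r\<close> only to rows of strictly higher level, since entries of
      \<open>A\<close> within one level are diagonal.\<close>
    have "fscale (entry a r r * ?s) (dirac r) - HR.ract a (fscale ?s (dirac r)) \<in> HR.ival (fst r) (Suc (level r))"
      unfolding ival_iff
    proof (intro allI impI)
      fix p assume nz: "(fscale (entry a r r * ?s) (dirac r) - HR.ract a (fscale ?s (dirac r))) (p, ()) \<noteq> 0"
      have "HR.ract a (fscale ?s (dirac r)) (p, ()) = (if p \<in> rows then entry a p r * ?s else 0)"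
      proof -
        have "(\<Sum>q\<in>rows. entry a p q * (?s * dirac r (q, ()))) = (\<Sum>q\<in>rows. if q = r then entry a p r * ?s else 0)"
          by (intro sum.cong) (auto simp: dirac_def)
        then show ?thesis using r finite_rows by (simp add: HR.ract_def)
      qed
      then have d: "(if p = r then entry a r r * ?s else 0) - (if p \<in> rows then entry a p r * ?s else 0) \<noteq> 0"
        using nz by (simp add: dirac_def split: if_splits)
      have "p \<noteq> r" using d r by auto
      then have p: "p \<in> rows" "entry a p r \<noteq> 0" using d by (auto split: if_splits)
      then have "fst p = fst r" "level r \<le> level p" using AR.\<tau>_tri[OF a p(1) r] by auto
      moreover have "level p \<noteq> level r" using A_entry_same_level[OF a p(2)] \<open>p \<noteq> r\<close> by blast
      ultimately show "p \<in> rows \<and> fst p = fst r \<and> Suc (level r) \<le> level p" using p by simp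
    qed
    then have "\<kappa>' (fscale (entry a r r * ?s) (dirac r)) = \<kappa>' (HR.ract a (fscale ?s (dirac r)))"
      using coords_eq_iff[OF cK dr mod_realD(3)[OF K a dr]] by blast
    then show "\<kappa>' (fscale (CR.ract a G (?\<gamma>, ())) (dirac r)) = act K a *\<^sub>v \<kappa>' (fscale ?s (dirac r))"
      unfolding e using mod_realD(4)[OF K a dr] by simp
  qed
  then obtain I where I: "I \<in> mod_hom A N K" "\<And>G. G \<in> ?S \<Longrightarrow> I *\<^sub>v \<kappa> G = \<kappa>' (fscale (G (?\<gamma>, ())) (dirac r))" by blast
  have "\<exists>P\<in>mod_hom A K N. \<forall>h\<in>?T. P *\<^sub>v \<kappa>' h = \<kappa> (fscale (h (r, ())) (cdirac ?\<gamma>))"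
  proof (rule mod_real_hom[OF K mod_realD(1)[OF N]])
    show "lin_vec ?T (vdim N) (\<lambda>h. \<kappa> (fscale (h (r, ())) (cdirac ?\<gamma>)))"
      by (rule lin_vec_comp_lin[OF linN functional dc])
    show "\<kappa> (fscale (h (r, ())) (cdirac ?\<gamma>)) = 0\<^sub>v (vdim N)" if "h \<in> HR.ival (fst r) (Suc (level r))" for h
    proof -
      have "h (r, ()) = 0" using that[unfolded ival_iff, rule_format, of r] by auto
      then have "fscale (h (r, ())) (cdirac ?\<gamma>) = 0" by (auto simp: fun_eq_iff)
      then show ?thesis using lin_vec_zero[OF linN coordsD(1)[OF cN]] by metis
    qed
    fix a h assume a: "a \<in> carrier A" and h: "h \<in> ?T"
    \<comment> \<open>Only \<open>q = r\<close> contributes: \<open>h\<close> is supported at levels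
      not below that of \<open>r\<close>, whereas a nonzero \<open>entry a r q\<close> requires a
      level not above it.\<close>
    have "entry a r q * h (q, ()) = (if q = r then entry a r r * h (r, ()) else 0)" if q: "q \<in> rows" for q
    proof (cases "entry a r q * h (q, ()) = 0")
      case False
      then have "level q \<le> level r" "level r \<le> level q"
        using AR.\<tau>_tri[OF a r q] h[unfolded ival_iff, rule_format, of q] by auto
      then have "r = q" using A_entry_same_level[OF a, of r q] False by simp
      then show ?thesis by simp
    qed auto
    then have "(\<Sum>q\<in>rows. entry a r q * h (q, ())) = (\<Sum>q\<in>rows. if q = r then entry a r r * h (r, ()) else 0)"
      by (intro sum.cong) auto
    then have e: "HR.ract a h (r, ()) = entry a r r * h (r, ())" using r finite_rows by (simp add: HR.ract_def)
    have "CR.ract a (fscale (h (r, ())) (cdirac ?\<gamma>)) = fscale (entry a r r * h (r, ())) (cdirac ?\<gamma>)"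
    proof (rule ext, clarify)
      fix \<delta>
      have "(\<Sum>\<eta>\<in>row_classes. chi a \<delta> \<eta> * (h (r, ()) * cdirac ?\<gamma> (\<eta>, ())))
          = (\<Sum>\<eta>\<in>row_classes. if \<eta> = ?\<gamma> then chi a \<delta> ?\<gamma> * h (r, ()) else 0)"
        by (intro sum.cong) (auto simp: cdirac_def)
      then show "CR.ract a (fscale (h (r, ())) (cdirac ?\<gamma>)) (\<delta>, ()) = fscale (entry a r r * h (r, ())) (cdirac ?\<gamma>) (\<delta>, ())"
        using g finite_row_classes chr[OF a] by (auto simp: CR.ract_def cdirac_def chi_def)
    qed
    then show "\<kappa> (fscale (HR.ract a h (r, ())) (cdirac ?\<gamma>)) = act N a *\<^sub>v \<kappa> (fscale (h (r, ())) (cdirac ?\<gamma>))"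
      unfolding e using mod_realD(4)[OF N a dc, of "h (r, ())"] by simp
  qed
  then obtain P where P: "P \<in> mod_hom A K N" "\<And>h. h \<in> ?T \<Longrightarrow> P *\<^sub>v \<kappa>' h = \<kappa> (fscale (h (r, ())) (cdirac ?\<gamma>))" by blast
  note Ic = mod_hom_carrier[OF I(1)] and Pc = mod_hom_carrier[OF P(1)]
  have "P * I = 1\<^sub>m (vdim N)"
  proof (rule mat_eqI_coords[OF cN mult_carrier_mat[OF Pc Ic] one_carrier_mat])
    fix G assume G: "G \<in> ?S"
    have \<kappa>c: "\<kappa> G \<in> carrier_vec (vdim N)" using lin_vecD(1)[OF linN G] .
    obtain s where s: "G = fscale s (cdirac ?\<gamma>)" using G cival_iff[OF g, of G 1] by auto
    have "P * I *\<^sub>v \<kappa> G = \<kappa> (fscale (fscale (G (?\<gamma>, ())) (dirac r) (r, ())) (cdirac ?\<gamma>))"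
      using assoc_mult_mat_vec[OF Pc Ic \<kappa>c] I(2)[OF G] P(2)[OF dr] by simp
    also have "fscale (fscale (G (?\<gamma>, ())) (dirac r) (r, ())) (cdirac ?\<gamma>) = G"
      unfolding s by (auto simp: dirac_def cdirac_def fun_eq_iff)
    finally show "P * I *\<^sub>v \<kappa> G = 1\<^sub>m (vdim N) *\<^sub>v \<kappa> G" using \<kappa>c by simp
  qed
  then show ?thesis unfolding retract_of_def using I(1) P(1) by blast
qed

context
  fixes X :: "(nat \<Rightarrow> 'k bmat, 'k) cpx"
  assumes X: "bounded_cpx A X"
begin

text \<open>A strictly lower entry brings in rows of lower level, and these span \<open>rad\<close>.
  The matrices \<open>b\<close> are arbitrary, so no membership in \<open>A\<close> has to be shown
  when this is applied.\<close>

lemma strict_ract_rads: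
  assumes b: "\<And>i p q. b i p q \<noteq> 0 \<Longrightarrow> fst q < fst p" and y: "y \<in> resol X n"
  shows "HR.ract b y \<in> rads X n"
proof (rule HR.QsI)
  fix p assume p: "p \<in> rows"
  obtain i p' where ip: "p = (i, p')" by (cases p)
  have "(\<Sum>q\<in>rows. fscale (entry b p q) (row y q)) \<in> rad X i (fst p') n"
  proof (rule fvs.subspace_sum[OF subspace_rad[OF X]])
    fix q assume q: "q \<in> rows"
    obtain k q' where kq: "q = (k, q')" by (cases q)
    show "fscale (entry b p q) (row y q) \<in> rad X i (fst p') n"
    proof (cases "entry b p q = 0")
      case True
      show ?thesis unfolding True fscale_zero by (rule fvs.subspace_0[OF subspace_rad[OF X]])
    next
      case False
      then have "k = i" "fst q' < fst p'" using b by (auto simp: entry_def ip kq split: if_splits)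
      then have "row y q \<in> rad X i (fst p') n"
        unfolding rad_def[OF X] using y q kq by (intro fvs.span_base) blast
      then show ?thesis by (rule fvs.subspace_scale[OF subspace_rad[OF X]])
    qed
  qed
  then show "row (HR.ract b y) p \<in> rad X (fst p) (level p) n" using p by (simp add: HR.row_ract ip)
qed (simp add: HR.row_ract)

text \<open>This is why the quotient by \<open>rads\<close> is a complex over the semisimple
  quotient of \<open>A\<close>: on the rows of one class every element acts by a scalar.\<close>

lemma ract_res_rads:
  assumes a: "a \<in> carrier A" and g: "\<gamma> \<in> row_classes" and y: "y \<in> resol X n"
  shows "HR.ract a (res \<gamma> y) - fscale (chr a \<gamma>) (res \<gamma> y) \<in> rads X n"
proof -
  \<comment> \<open>\<open>b\<close> stands for \<open>a - chr a \<gamma>\<close> times the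
    idempotent of the class. Its diagonal vanishes, and within a level \<open>A\<close> has no other
    entries, so \<open>b\<close> is strictly lower.\<close>
  define b where "b = (\<lambda>i p q. if (i, q) \<in> \<gamma> then a i p q - (if p = q then chr a \<gamma> else 0) else 0)"
  have "fst q < fst p" if nz: "b i p q \<noteq> 0" for i p q
  proof -
    have q: "(i, q) \<in> \<gamma>" using nz by (auto simp: b_def split: if_splits)
    have ne: "p \<noteq> q" using nz chr_eq[OF a g q] by (auto simp: b_def entry_def q)
    then have e: "entry a (i, p) (i, q) \<noteq> 0" using nz q by (auto simp: b_def entry_def)
    then have "fst q \<le> fst p" using a by (simp add: entry_def carrier_A carrier_H)
    moreover have "fst q \<noteq> fst p" using A_entry_same_level[OF a e] ne by auto
    ultimately show ?thesis by simp
  qed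
  then have "HR.ract b y \<in> rads X n" using y by (rule strict_ract_rads)
  moreover have "HR.ract b y = HR.ract a (res \<gamma> y) - fscale (chr a \<gamma>) (res \<gamma> y)"
  proof (rule ext, clarify)
    fix p x
    have t: "entry b p q * y (q, x) = entry a p q * res \<gamma> y (q, x) - (if q = p then chr a \<gamma> * res \<gamma> y (p, x) else 0)" for q
    proof (cases "q = p")
      case False
      then have "fst p = fst q \<Longrightarrow> snd p \<noteq> snd q" by (auto simp: prod_eq_iff)
      then show ?thesis using False by (auto simp: entry_def b_def res_def)
    qed (auto simp: entry_def b_def res_def algebra_simps)
    have "(\<Sum>q\<in>rows. entry b p q * y (q, x))
        = (\<Sum>q\<in>rows. entry a p q * res \<gamma> y (q, x)) - (if p \<in> rows then chr a \<gamma> * res \<gamma> y (p, x) else 0)"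
      unfolding t sum_subtractf using finite_rows by simp
    moreover have "res \<gamma> y (p, x) = 0" if "p \<notin> rows" using class_rows[OF g, of p] that by (auto simp: res_def)
    ultimately show "HR.ract b y (p, x) = (HR.ract a (res \<gamma> y) - fscale (chr a \<gamma>) (res \<gamma> y)) (p, x)"
      by (auto simp: HR.ract_def)
  qed
  ultimately show ?thesis by simp
qed

lemma res_resol: "\<gamma> \<in> row_classes \<Longrightarrow> y \<in> resol X n \<Longrightarrow> res \<gamma> y \<in> resol X n"
  by (subst res_eq_ract) (auto intro: resol_ract[OF X eunit_A])

lemma res_rads: "\<gamma> \<in> row_classes \<Longrightarrow> y \<in> rads X n \<Longrightarrow> res \<gamma> y \<in> rads X n"
  by (subst res_eq_ract) (auto intro: rads_ract[OF X carrier_A_H[OF eunit_A]])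

lemma dd_res: "dd (res \<gamma> y) = res \<gamma> (dd y)"
  by (rule row_eqI) (simp add: HR.row_rowop row_res linD(3)[OF lin_dW])

text \<open>A two-step filtration for each class: the class component of \<open>rads\<close> at
  level 0, that of \<open>resol\<close> above. The value \<open>{0}\<close> outside
  \<open>row_classes\<close> is there because \<open>filt\<close> speaks of all indices.\<close>

definition layers :: "(nat \<times> nat \<times> nat) set \<Rightarrow> nat \<Rightarrow> int \<Rightarrow> ((nat \<times> nat \<times> nat) \<times> idx \<Rightarrow> 'k) set" where
  "layers \<gamma> r n = (if \<gamma> \<in> row_classes then res \<gamma> ` (if r = 0 then rads X n else resol X n) else {0})"

lemma layersE:
  assumes "v \<in> layers \<gamma> r n"
  obtains y where "y \<in> resol X n" "r = 0 \<Longrightarrow> y \<in> rads X n" "v = res \<gamma> y"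
proof (cases "\<gamma> \<in> row_classes")
  case True
  then show ?thesis using that assms rads_subset[OF X] unfolding layers_def by (auto split: if_splits)
next
  case False
  have "v = res \<gamma> 0" using assms False by (simp add: layers_def linD(3)[OF lin_res])
  then show ?thesis
    using that[OF fvs.subspace_0[OF subspace_resol[OF X]] fvs.subspace_0[OF subspace_rads[OF X]]] by blast
qed

lemma layers_resol:
  assumes "v \<in> layers \<gamma> r n"
  shows "v \<in> resol X n"
proof (cases "\<gamma> \<in> row_classes")
  case True
  obtain y where "y \<in> resol X n" "v = res \<gamma> y" using layersE[OF assms] by metis
  then show ?thesis using res_resol[OF True] by blast
next
  case False
  then have "v = 0" using assms by (simp add: layers_def)
  then show ?thesis using fvs.subspace_0[OF subspace_resol[OF X]] by metis
qed

lemma filt_layers: "\<exists>F b. CR.filt layers dd F b"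
proof -
  obtain F where F: "finite F" "\<And>n. resol X n \<subseteq> fvs.span F" using resol_finite_span[OF X] by blast
  obtain c where c: "\<And>n. c < \<bar>n\<bar> \<Longrightarrow> cdim X n = 0 \<and> cdim X (n + 1) = 0" using resol_bounded[OF X] by blast
  have "CR.filt layers dd F c"
    unfolding CR.filt_def
  proof (intro conjI allI impI ballI)
    fix \<gamma> :: "(nat \<times> nat \<times> nat) set" and r r' :: nat and n :: int
    show "fvs.subspace (layers \<gamma> r n)"
      unfolding layers_def
      using subspace_lin_image[OF lin_res subspace_resol[OF X]] subspace_lin_image[OF lin_res subspace_rads[OF X]]
        fvs.subspace_single_0 by simp
    show "layers \<gamma> r n \<subseteq> fvs.span F" using layers_resol F(2) by blast
    show "dd v \<in> layers \<gamma> r (n + 1)" if v: "v \<in> layers \<gamma> r n" for v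
    proof (cases "\<gamma> \<in> row_classes")
      case True
      obtain y where y: "y \<in> (if r = 0 then rads X n else resol X n)" "v = res \<gamma> y"
        using v True unfolding layers_def by auto
      have "dd y \<in> (if r = 0 then rads X (n + 1) else resol X (n + 1))"
        using y(1) rads_dd[OF X] resol_dd[OF X] by (auto split: if_splits)
      then show ?thesis unfolding y(2) dd_res using True by (simp add: layers_def)
    next
      case False
      then have "v = 0" using v by (simp add: layers_def)
      then show ?thesis using False linD(3)[OF lin_dd[OF X]] by (simp add: layers_def)
    qed
    show "layers \<gamma> r n \<subseteq> layers \<gamma> r' n" if "r \<le> r'"
      using that rads_subset[OF X, of n] unfolding layers_def by auto
    show "layers \<gamma> 1 n = layers \<gamma> 0 n" if "c < \<bar>n\<bar>"
    proof -
      have "resol X n \<subseteq> rads X n"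
        unfolding resol_trivial[OF X conjunct1[OF c[OF that]] conjunct2[OF c[OF that]]]
        using fvs.subspace_0[OF subspace_rads[OF X]] by (simp only: insert_subset empty_subsetI simp_thms)
      then have "rads X n = resol X n" using rads_subset[OF X, of n] by (rule equalityI[rotated])
      then show ?thesis by (simp add: layers_def)
    qed
  qed (simp_all only: lin_dd[OF X] dd_dd[OF X] F(1))
  then show ?thesis by blast
qed

text \<open>Reassembles a family with one member for each class into a function on rows;
  \<open>res\<close> takes it apart again. The family carries the diagonal action of
  \<open>CR\<close>, so the two actions agree only modulo \<open>rads\<close>.\<close>

definition tot :: "((nat \<times> nat \<times> nat) set \<times> (nat \<times> nat \<times> nat) \<times> idx \<Rightarrow> 'k) \<Rightarrow> (nat \<times> nat \<times> nat) \<times> idx \<Rightarrow> 'k" where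
  "tot G = (\<Sum>\<gamma>\<in>row_classes. row G \<gamma>)"

lemma lin_tot: "lin tot"
  by (auto simp: lin_def tot_def fun_eq_iff sum_fun_apply sum.distrib sum_distrib_left)

lemma row_layers:
  assumes G: "G \<in> CR.Qs (\<lambda>c r. layers c r n)" and g: "\<gamma> \<in> row_classes"
  shows "row G \<gamma> \<in> resol X n" "res \<gamma> (row G \<gamma>) = row G \<gamma>"
proof -
  note l = CR.QsD(1)[OF G g]
  show "row G \<gamma> \<in> resol X n" by (rule layers_resol[OF l])
  obtain y where y: "row G \<gamma> = res \<gamma> y" using layersE[OF l] by metis
  show "res \<gamma> (row G \<gamma>) = row G \<gamma>" unfolding y res_res[OF g g] by simp
qed

lemma res_tot:
  assumes G: "G \<in> CR.Qs (\<lambda>c r. layers c r n)" and g: "\<gamma> \<in> row_classes"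
  shows "res \<gamma> (tot G) = row G \<gamma>"
proof -
  have "res \<gamma> (tot G) = (\<Sum>\<delta>\<in>row_classes. res \<gamma> (row G \<delta>))" unfolding tot_def by (rule lin_sum[OF lin_res])
  also have "\<dots> = (\<Sum>\<delta>\<in>row_classes. if \<gamma> = \<delta> then row G \<delta> else 0)"
  proof (rule sum.cong[OF HOL.refl])
    fix \<delta> assume d: "\<delta> \<in> row_classes"
    show "res \<gamma> (row G \<delta>) = (if \<gamma> = \<delta> then row G \<delta> else 0)"
      using res_res[OF g d, of "row G \<delta>"] unfolding row_layers(2)[OF G d] .
  qed
  also have "\<dots> = row G \<gamma>" using g finite_row_classes by simp
  finally show ?thesis .
qed

lemma tot_resol: "G \<in> CR.Qs (\<lambda>c r. layers c r n) \<Longrightarrow> tot G \<in> resol X n"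
  unfolding tot_def by (rule fvs.subspace_sum[OF subspace_resol[OF X] row_layers(1)])

lemma tot_rads_iff:
  assumes G: "G \<in> CR.Qs (\<lambda>c r. layers c r n)"
  shows "tot G \<in> rads X n \<longleftrightarrow> G \<in> CR.Qs (\<lambda>c r. layers c 0 n)"
proof
  assume t: "tot G \<in> rads X n"
  show "G \<in> CR.Qs (\<lambda>c r. layers c 0 n)"
  proof (rule CR.QsI)
    show "row G \<gamma> \<in> layers \<gamma> 0 n" if g: "\<gamma> \<in> row_classes" for \<gamma>
      unfolding res_tot[OF G g, symmetric] layers_def using g t by simp
    show "row G \<gamma> = 0" if g: "\<gamma> \<notin> row_classes" for \<gamma> by (rule CR.QsD(2)[OF G g])
  qed
next
  assume G0: "G \<in> CR.Qs (\<lambda>c r. layers c 0 n)"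
  show "tot G \<in> rads X n"
    unfolding tot_def
  proof (rule fvs.subspace_sum[OF subspace_rads[OF X]])
    fix \<gamma> assume g: "\<gamma> \<in> row_classes"
    obtain y where "y \<in> rads X n" "row G \<gamma> = res \<gamma> y" using layersE[OF CR.QsD(1)[OF G0 g]] by metis
    then show "row G \<gamma> \<in> rads X n" using res_rads[OF g] by simp
  qed
qed

lemma tot_surj:
  assumes y: "y \<in> resol X n"
  shows "\<exists>G\<in>CR.Qs (\<lambda>c r. layers c r n). tot G = y"
proof -
  define G where "G = (\<lambda>(\<gamma>, z). if \<gamma> \<in> row_classes then res \<gamma> y z else 0)"
  have row: "row G \<gamma> = (if \<gamma> \<in> row_classes then res \<gamma> y else 0)" for \<gamma>
    by (auto simp: G_def row_def fun_eq_iff)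
  have "G \<in> CR.Qs (\<lambda>c r. layers c r n)"
    by (rule CR.QsI) (use y in \<open>simp_all add: row layers_def\<close>)
  moreover have "tot G = (\<Sum>\<gamma>\<in>row_classes. res \<gamma> y)" unfolding tot_def by (rule sum.cong) (simp_all add: row)
  ultimately show ?thesis using sum_res[OF resolD(5)[OF y]] by metis
qed

lemma tot_ract:
  assumes a: "a \<in> carrier A" and G: "G \<in> CR.Qs (\<lambda>c r. layers c r n)"
  shows "HR.ract a (tot G) - tot (CR.ract a G) \<in> rads X n"
proof -
  have "row (CR.ract a G) \<gamma> = fscale (chr a \<gamma>) (row G \<gamma>)" if g: "\<gamma> \<in> row_classes" for \<gamma>
  proof -
    have "(\<Sum>\<delta>\<in>row_classes. fscale (chi a \<gamma> \<delta>) (row G \<delta>)) = (\<Sum>\<delta>\<in>row_classes. if \<gamma> = \<delta> then fscale (chr a \<gamma>) (row G \<delta>) else 0)"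
      by (rule sum.cong) (auto simp: chi_def fun_eq_iff)
    then show ?thesis using g finite_row_classes by (simp add: CR.row_ract)
  qed
  then have "tot (CR.ract a G) = (\<Sum>\<gamma>\<in>row_classes. fscale (chr a \<gamma>) (row G \<gamma>))"
    unfolding tot_def by (rule sum.cong[OF HOL.refl])
  moreover have "HR.ract a (tot G) = (\<Sum>\<gamma>\<in>row_classes. HR.ract a (row G \<gamma>))"
    unfolding tot_def by (rule lin_sum[OF HR.lin_ract])
  ultimately have e: "HR.ract a (tot G) - tot (CR.ract a G)
      = (\<Sum>\<gamma>\<in>row_classes. HR.ract a (row G \<gamma>) - fscale (chr a \<gamma>) (row G \<gamma>))"
    by (simp only: sum_subtractf)
  show ?thesis
    unfolding e
  proof (rule fvs.subspace_sum[OF subspace_rads[OF X]])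
    fix \<gamma> assume g: "\<gamma> \<in> row_classes"
    show "HR.ract a (row G \<gamma>) - fscale (chr a \<gamma>) (row G \<gamma>) \<in> rads X n"
      using ract_res_rads[OF a g tot_resol[OF G]] unfolding res_tot[OF G g] .
  qed
qed

lemma tot_dd: "tot (CR.rowop (\<lambda>_. dd) G) = dd (tot G)"
proof -
  have "tot (CR.rowop (\<lambda>_. dd) G) = (\<Sum>\<gamma>\<in>row_classes. dd (row G \<gamma>))"
    unfolding tot_def by (rule sum.cong) (simp_all add: CR.row_rowop)
  also have "\<dots> = dd (tot G)" unfolding tot_def by (rule lin_sum[OF lin_dd[OF X], symmetric])
  finally show ?thesis .
qed

text \<open>The complex \<open>S\<close> itself, with its coordinates composed with
  \<open>tot\<close>, is the filtered complex over the characters. The decomposition theorem then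
  applies without passing to an isomorphic complex.\<close>

lemma fcpx_layers:
  assumes S: "cpx_real A HR.ract dd (resol X) (\<lambda>n. rads X n) S \<kappa>"
  shows "CR.fcpx layers dd S (\<lambda>n G. \<kappa> n (tot G))"
proof -
  obtain F b where f: "CR.filt layers dd F b" using filt_layers by blast
  note fD = CR.filtD[OF f]
  let ?Q = "\<lambda>n. CR.Qs (\<lambda>c r. layers c r n)" and ?W = "\<lambda>n. CR.Qs (\<lambda>c r. layers c 0 n)"
  note c = cpx_realD(3)[OF S]
  have sub: "fvs.subspace (?Q n)" "fvs.subspace (?W n)" for n by (intro CR.subspace_Qs fD(4))+
  have mono: "?W n \<subseteq> ?Q n" for n by (rule CR.Qs_mono) (use fD(7) in blast)
  have act: "CR.ract a G \<in> ?Q n" if "a \<in> carrier A" "G \<in> ?Q n" for a G n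
    by (rule CR.Qs_ract[OF fD(4) _ that]) (use fD(7) in blast)
  have diff: "CR.rowop (\<lambda>_. dd) G \<in> ?Q (n + 1)" if "G \<in> ?Q n" for G n
    by (rule CR.QsI) (use CR.QsD(1)[OF that] fD(6) in \<open>auto simp: CR.row_rowop\<close>)
  show ?thesis
    unfolding CR.fcpx_def cpx_real_def mod_real_def coords_def
  proof (intro conjI allI ballI)
    fix n
    show "is_module A (cterm S n)" by (rule mod_realD(1)[OF cpx_realD(2)[OF S]])
    show "lin_vec (?Q n) (cdim S n) (\<lambda>G. \<kappa> n (tot G))"
      by (rule lin_vec_comp_lin[OF coordsD(4)[OF c] lin_tot tot_resol])
    show "\<exists>G\<in>?Q n. \<kappa> n (tot G) = x" if "x \<in> carrier_vec (cdim S n)" for x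
      using coordsD(5)[OF c that] tot_surj by blast
    show "\<kappa> n (tot G) = 0\<^sub>v (cdim S n) \<longleftrightarrow> G \<in> ?W n" if "G \<in> ?Q n" for G
      using coordsD(6)[OF c tot_resol[OF that]] tot_rads_iff[OF that] by simp
    show "\<kappa> n (tot (CR.ract a G)) = act (cterm S n) a *\<^sub>v \<kappa> n (tot G)" if a: "a \<in> carrier A" and G: "G \<in> ?Q n" for a G
    proof -
      have "\<kappa> n (HR.ract a (tot G)) = \<kappa> n (tot (CR.ract a G))"
        using coords_eq_iff[OF c resol_ract[OF X a tot_resol[OF G]] tot_resol[OF act[OF a G]]] tot_ract[OF a G] by blast
      then show ?thesis using mod_realD(4)[OF cpx_realD(2)[OF S] a tot_resol[OF G]] by simp
    qed
    show "\<kappa> (n + 1) (tot (CR.rowop (\<lambda>_. dd) G)) = cdiff S n *\<^sub>v \<kappa> n (tot G)" if "G \<in> ?Q n" for G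
      unfolding tot_dd by (rule cpx_realD(5)[OF S tot_resol[OF that]])
  qed (fact cpx_realD(1)[OF S] sub mono act diff)+
qed

end

end

context skew_gentle_data
begin

section \<open>The triangle\<close>

text \<open>Isolates what the triangle uses of \<open>Z\<close>. Every representation generator of
  \<open>H\<close> has this property, and so has a finite direct sum of interval modules, which
  supplies the generator for the dimension bound.\<close>

definition has_intervals :: "(nat \<Rightarrow> 'k bmat, 'k) fdmod \<Rightarrow> bool" where
  "has_intervals Z \<longleftrightarrow> is_module A Z \<and>
     (\<forall>i l j. 1 \<le> i \<and> i \<le> length m \<and> 1 \<le> l \<and> l \<le> height i \<and> l \<le> j \<and> j \<le> Suc (height i) \<longrightarrow>
       (\<exists>N \<kappa>. mod_real H HR.ract (HR.ival i l) (HR.ival i j) N \<kappa> \<and> retract_of A N Z))"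

lemma has_intervalsD:
  assumes "has_intervals Z" "1 \<le> i" "i \<le> length m" "1 \<le> l" "l \<le> height i" "l \<le> j" "j \<le> Suc (height i)"
  shows "\<exists>N \<kappa>. mod_real H HR.ract (HR.ival i l) (HR.ival i j) N \<kappa> \<and> retract_of A N Z"
  using assms unfolding has_intervals_def by blast

text \<open>At height 1 there are two intervals to treat: the empty one, with zero module, and the
  full one, whose module is the simple module of the class.\<close>

lemma simple_summand:
  assumes Z: "has_intervals Z" and g: "\<gamma> \<in> row_classes" and l: "1 \<le> l" "l \<le> j" "j \<le> 2" "l \<le> 1"
  shows "\<exists>N \<kappa>. mod_real A CR.ract (CR.ival \<gamma> l) (CR.ival \<gamma> j) N \<kappa> \<and> summand_of (mod_cat A) N Z"
proof -
  have Zm: "is_module A Z" using Z by (simp add: has_intervals_def)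
  obtain N \<kappa> where N: "mod_real A CR.ract (CR.ival \<gamma> l) (CR.ival \<gamma> j) N \<kappa>"
    using CR.ival_module_exists[OF l(2)] by blast
  note Nm = mod_realD(1)[OF N]
  have "l = 1" using l by simp
  have "retract_of A N Z"
  proof (cases "j = 1")
    case True
    have "coords (CR.ival \<gamma> 1) (CR.ival \<gamma> 1) (vdim N) \<kappa>" using mod_realD(2)[OF N] unfolding True \<open>l = 1\<close> .
    then show ?thesis by (rule retract_of_zero_dim[OF Nm Zm coords_trivial])
  next
    case False
    then have "j = 2" using l by simp
    obtain r where r: "r \<in> rows" "\<gamma> = cls r" using g unfolding row_classes_def by blast
    have "1 \<le> fst r \<and> fst r \<le> length m" using r(1) rows_iff[of "fst r" "snd r"] by simp
    then obtain K \<kappa>' where K: "mod_real H HR.ract (HR.ival (fst r) (level r)) (HR.ival (fst r) (Suc (level r))) K \<kappa>'"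
      "retract_of A K Z"
      using has_intervalsD[OF Z, of "fst r" "level r" "Suc (level r)"] HR.lev[OF r(1)] by auto
    note K' = mod_real_restrict[OF K(1)]
    have "retract_of A N K"
      using simple_retract[OF r(1) _ K'] N unfolding \<open>l = 1\<close> \<open>j = 2\<close> r(2) by blast
    then show ?thesis using retract_of_trans[OF Nm mod_realD(1)[OF K'] Zm] K(2) by blast
  qed
  then show ?thesis using N retract_of_summand_A[OF Nm Zm] by blast
qed

lemma triangle:
  assumes X: "bounded_cpx A X" and Z: "has_intervals Z"
  shows "\<exists>X1 X2 u v w. shifted_sum A Z X1 \<and> shifted_sum A Z X2 \<and> derived_tri A X1 X X2 u v w"
proof -
  have Zm: "is_module A Z" using Z by (simp add: has_intervals_def)
  obtain b where f: "HR.filt (rad X) dW (idx_basis X) b" using filt_rad[OF X] by blast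
  \<comment> \<open>The radical is stable under \<open>H\<close>, but its complex is formed directly
    over \<open>A\<close>; the interval modules that split off it are restrictions from
    \<open>H\<close>.\<close>
  obtain Y \<kappa> where Y: "AR.fcpx (rad X) dW Y \<kappa>" using AR.fcpx_exists[OF f] by blast
  have Y1: "shifted_sum A Z Y"
  proof (rule AR.filtered_cpx_shifted_sum[OF _ f Y])
    fix i l j assume i: "i \<in> fst ` rows" and l: "1 \<le> l" "l \<le> height i" "l \<le> j" "j \<le> Suc (height i)"
    have i': "1 \<le> i" "i \<le> length m" using i by (auto simp: rows_def)
    obtain N \<kappa>N where N: "mod_real H HR.ract (HR.ival i l) (HR.ival i j) N \<kappa>N" "retract_of A N Z"
      using has_intervalsD[OF Z i' l] by blast
    note N' = mod_real_restrict[OF N(1)]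
    show "\<exists>N \<kappa>N. mod_real A HR.ract (HR.ival i l) (HR.ival i j) N \<kappa>N \<and> summand_of (mod_cat A) N Z"
      using N' retract_of_summand_A[OF mod_realD(1)[OF N'] Zm N(2)] by blast
  qed
  have Y': "cpx_real A HR.ract dd (\<lambda>n. rads X n) (\<lambda>_. {0}) Y \<kappa>"
    using Y unfolding AR.fcpx_def rads_zero[OF X] .
  obtain S \<kappa>S where S: "cpx_real A HR.ract dd (resol X) (\<lambda>n. rads X n) S \<kappa>S"
    using resol_quotient_exists[OF X] by blast
  obtain F c where F: "CR.filt (layers X) dd F c" using filt_layers[OF X] by blast
  have "shifted_sum A Z S"
    by (rule CR.filtered_cpx_shifted_sum[OF _ F fcpx_layers[OF X S]]) (rule simple_summand[OF Z], auto)
  moreover obtain Y2 u v w where "derived_tri A Y X Y2 u v w" "qeq A Y2 S"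
    using resol_triangle[OF X Y' S] by blast
  ultimately show ?thesis using Y1 shifted_sum_qeq by blast
qed

lemma derived_cat_layer:
  assumes Z: "has_intervals Z"
  shows "Ob (derived_cat A) = layer (derived_cat A) (stalk Z) 2"
proof
  have Zm: "is_module A Z" using Z by (simp add: has_intervals_def)
  show "Ob (derived_cat A) \<subseteq> layer (derived_cat A) (stalk Z) 2"
    using triangle[OF _ Z] tri_layer2[OF _ _ _ _ Zm] unfolding derived_cat_simps by blast
  show "layer (derived_cat A) (stalk Z) 2 \<subseteq> Ob (derived_cat A)"
    using layer_subset_Ob[of A "stalk Z" 1] by (simp add: numeral_2_eq_2)
qed

lemma rep_generator_has_intervals:
  assumes Z: "rep_generator H Z"
  shows "has_intervals Z"
  unfolding has_intervals_def
proof (intro conjI allI impI)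
  have ZH: "is_module H Z" using Z by (simp add: rep_generator_def)
  then show Zm: "is_module A Z" by (rule is_module_restrict)
  fix i l j assume a: "1 \<le> i \<and> i \<le> length m \<and> 1 \<le> l \<and> l \<le> height i \<and> l \<le> j \<and> j \<le> Suc (height i)"
  then obtain N \<kappa> where N: "mod_real H HR.ract (HR.ival i l) (HR.ival i j) N \<kappa>"
    using HR.ival_module_exists by blast
  note Nm = mod_realD(1)[OF N]
  have "retract_of H N Z"
  proof (cases "l = j")
    case True
    have "coords (HR.ival i j) (HR.ival i j) (vdim N) \<kappa>" using mod_realD(2)[OF N] unfolding True .
    then show ?thesis by (rule retract_of_zero_dim[OF Nm ZH coords_trivial])
  next
    case False
    then have l: "1 \<le> i" "i \<le> length m" "1 \<le> l" "l \<le> height i" "l < j" using a by auto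
    show ?thesis by (rule brick_retract_generator[OF Z Nm ival_brick(2)[OF l N] ival_brick(1)[OF l N]])
  qed
  then show "\<exists>N \<kappa>. mod_real H HR.ract (HR.ival i l) (HR.ival i j) N \<kappa> \<and> retract_of A N Z"
    using N retract_of_restrict by blast
qed

text \<open>There are finitely many intervals in the finitely many factors, so the direct sum of all
  interval modules is again a module. The dimension bound needs such a module without being given
  \<open>Z\<close>.\<close>

lemma ex_has_intervals: "\<exists>Z. has_intervals Z"
proof -
  define N where "N i l j = (SOME N. \<exists>\<kappa>. mod_real H HR.ract (HR.ival i l) (HR.ival i j) N \<kappa>)" for i l j
  have N: "\<exists>\<kappa>. mod_real H HR.ract (HR.ival i l) (HR.ival i j) (N i l j) \<kappa>" if "l \<le> j" for i l j
    unfolding N_def by (rule someI_ex) (rule HR.ival_module_exists[OF that])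
  \<comment> \<open>Upper bounds of list ranges are exclusive, and the end \<open>j\<close> may
    exceed the height by one; hence the double \<open>Suc\<close>.\<close>
  define Ns where "Ns = [N i l j. i \<leftarrow> [1..<Suc (length m)], l \<leftarrow> [1..<Suc (height i)], j \<leftarrow> [l..<Suc (Suc (height i))]]"
  have mods: "is_module A M" if M: "M \<in> set Ns" for M
  proof -
    obtain i l j where "M = N i l j" "l \<le> j" using M unfolding Ns_def by auto
    then show ?thesis using N mod_realD(1) is_module_restrict by blast
  qed
  have "has_intervals (foldr mod_sum Ns zero_mod)"
    unfolding has_intervals_def
  proof (intro conjI allI impI)
    show "is_module A (foldr mod_sum Ns zero_mod)" by (rule is_module_finsum[OF mods])
    fix i l j assume a: "1 \<le> i \<and> i \<le> length m \<and> 1 \<le> l \<and> l \<le> height i \<and> l \<le> j \<and> j \<le> Suc (height i)"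
    have "N i l j \<in> (\<Union>i\<in>{1..<Suc (length m)}. \<Union>l\<in>{1..<Suc (height i)}. N i l ` {l..<Suc (Suc (height i))})"
      using a by (intro UN_I[of i] UN_I[of l] imageI) auto
    then have "N i l j \<in> set Ns" unfolding Ns_def by (simp del: upt_Suc)
    then have "retract_of A (N i l j) (foldr mod_sum Ns zero_mod)"
      using retract_of_finsum[of Ns A] mods by blast
    then show "\<exists>K \<kappa>. mod_real H HR.ract (HR.ival i l) (HR.ival i j) K \<kappa> \<and> retract_of A K (foldr mod_sum Ns zero_mod)"
      using N a by blast
  qed
  then show ?thesis by blast
qed

lemma der_dim_le_1: "der_dim A \<le> 1"
proof -
  obtain Z where Z: "has_intervals Z" using ex_has_intervals by blast
  have "stalk Z \<in> Ob (derived_cat A)" using Z by (simp add: has_intervals_def bounded_stalk)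
  \<comment> \<open>\<open>rouquier_dim\<close> assigns \<open>d\<close> to generation in
    \<open>d + 1\<close> layers, so two layers correspond to \<open>d = 1\<close>.\<close>
  moreover have "Ob (derived_cat A) = layer (derived_cat A) (stalk Z) (1 + 1)"
    using derived_cat_layer[OF Z] by (simp only: one_add_one)
  ultimately have "rouquier_dim (derived_cat A) \<le> enat 1"
    unfolding rouquier_dim_def by (intro Inf_lower) blast
  then show ?thesis by (simp add: der_dim_def one_enat_def)
qed

end

theorem theorem3p4:
  fixes m :: "nat list" and R :: "(nat \<times> nat) rel"
    and A H :: "('k :: alg_closed_field, nat \<Rightarrow> 'k bmat) module"
  assumes "skew_gentle_datum m R"
    and "A = skew_gentle m R"
    and "H = normalization m R"
  shows "(\<forall>Z. rep_generator H Z \<longrightarrow>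
            Ob (derived_cat A) = layer (derived_cat A) (stalk Z) 2 \<and>
            (\<forall>X \<in> Ob (derived_cat A).
               \<exists>X1 X2 u v w.
                 sum_of_shifted_summands A Z X1 \<and> sum_of_shifted_summands A Z X2 \<and>
                 Tri (derived_cat A) X1 X X2 u v w)) \<and>
         der_dim A \<le> 1"
proof -
  interpret skew_gentle_data m R A H by unfold_locales (fact assms)+
  show ?thesis
  proof (intro conjI allI impI ballI)
    fix Z assume "rep_generator H Z"
    then have Z: "has_intervals Z" by (rule rep_generator_has_intervals)
    show "Ob (derived_cat A) = layer (derived_cat A) (stalk Z) 2" by (rule derived_cat_layer[OF Z])
    fix X assume "X \<in> Ob (derived_cat A)"
    then have "bounded_cpx A X" by simp
    then show "\<exists>X1 X2 u v w. sum_of_shifted_summands A Z X1 \<and> sum_of_shifted_summands A Z X2 \<and>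
        Tri (derived_cat A) X1 X X2 u v w"
      using triangle[OF _ Z] shifted_sum_sum_of_shifted_summands unfolding derived_cat_simps by blast
  qed (rule der_dim_le_1)
qed

end
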